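(* Let $F:\mathbb{R}^d\times\mathbb{R}\times\mathbb{R}^d\to\mathbb{R}$, $F=F(\mathbf{x},s,\mathbf{p})$, be the function defined in the context, and assume that $F$ is of class $C^2(\mathbb{R}^d\times\mathbb{R}\times\mathbb{R}^d)$. Fix $\epsilon_0>0$ and $\beta>1$, and let $J_{\lambda,\eta}:H^p(\Omega)\to\mathbb{R}$ be the functional defined in the context. Then: 1. For all $\lambda>1$ and $\eta>0$, the functional $J_{\lambda,\eta}$ is Fréchet differentiable, and its derivative is given, for all $v,h\in H^p(\Omega)$, by $$ \begin{aligned} DJ_{\lambda,\eta}(v)h ={}& 2\int_{\Omega}e^{2\lambda r^{-\beta}}\big[-\epsilon_0\Delta v+F(\mathbf{x},v,\nabla v)\big]\big[-\epsilon_0\Delta h+\partial_sF(\mathbf{x},v,\nabla v)h+\nabla_{\mathbf{p}}F(\mathbf{x},v,\nabla v)\cdot\nabla h\big]\,d\mathbf{x}\\ &+2\lambda^4\int_{\partial\Omega}e^{2\lambda r^{-\beta}}\big[vh+\nabla v\cdot\nabla h\big]\,d\sigma(\mathbf{x})+2\eta\langle v,h\rangle_{H^p(\Omega)} . \end{aligned} $$ Here $\partial_sF$ is the partial derivative of $F(\mathbf{x},s,\mathbf{p})$ with respect to $s$ and $\nabla_{\mathbf{p}}F$ is the gradient with respect to $\mathbf{p}$. 2. Let $M>0$ be arbitrarily large. There is a number $\lambda_0>1$, depending only on $\epsilon_0,M,R,d,r,F,\beta$, such that for every $\lambda>\lambda_0$ there is a constant $C>0$, depending only on $\lambda,\beta,R,r,d,M,F,\epsilon_0$,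 such that for all $\eta>0$ and all $u,v\in\overline{B(M)}$, $$ \begin{aligned} J_{\lambda,\eta}(u)-J_{\lambda,\eta}(v)-DJ_{\lambda,\eta}(v)(u-v)\ge{}& C\int_{\Omega}e^{2\lambda r^{-\beta}}\big[|u-v|^2+|\nabla(u-v)|^2\big]\,d\mathbf{x}\\ &+C\int_{\partial\Omega}\lambda^4e^{2\lambda r^{-\beta}}\big(|u-v|^2+|\nabla(u-v)|^2\big)\,d\sigma(\mathbf{x})+\eta\|u-v\|_{H^p(\Omega)}^2 . \end{aligned} $$ 3. For such $\lambda>\lambda_0$ and $\eta>0$, the functional $J_{\lambda,\eta}$ has a unique minimizer in $\overline{B(M)}$.
   Context: Let $d\ge1$, $R>0$, $\Omega=(-R,R)^d$, and let $G$ be a bounded domain compactly contained in $\Omega$. Let $\delta\in(0,1)$ and let $\chi_\delta\in C^\infty(\mathbb{R}^d)$ satisfy, for some constant $c>0$: $\chi_\delta>c$ on $G$, $\chi_\delta\in(\delta,c]$ on $\Omega\setminus G$, and $\chi_\delta=\delta$ on $\mathbb{R}^d\setminus\Omega$. Let $H:\mathbb{R}^d\times\mathbb{R}^d\to\mathbb{R}$ satisfy $|H(\mathbf{x},\mathbf{p})|\le C|\mathbf{p}|^k$ for all $\mathbf{x},\mathbf{p}\in\mathbb{R}^d$, for some constants $C,k>0$, and let $\mu>0$ be fixed (the coefficient of $u$ in the Hamilton-Jacobi equation $\mu u+H(\mathbf{x},\nabla u)=0$ on $\mathbb{R}^d$). Define $$F(\mathbf{x},s,\mathbf{p})=\chi_\delta^{2k}(\mathbf{x})\left[\mu\frac{s}{\chi_\delta(\mathbf{x})}+H\!\left(\mathbf{x},\frac{\chi_\delta(\mathbf{x})\mathbf{p}-s\nabla\chi_\delta(\mathbf{x})}{\chi_\delta^2(\mathbf{x})}\right)\right].$$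 Let $\mathbf{x}_0\in\mathbb{R}^d\setminus\overline\Omega$ and $r=r(\mathbf{x})=|\mathbf{x}-\mathbf{x}_0|$ for $\mathbf{x}\in\overline\Omega$. Let $p>\lceil d/2\rceil+2$, so that the $L^2$-based Sobolev space $H^p(\Omega)$ is continuously embedded into $C^2(\overline\Omega)$. For $M>0$, $B(M)=\{v\in H^p(\Omega):\|v\|_{H^p(\Omega)}<M\}$ and $\overline{B(M)}$ is its closure in $H^p(\Omega)$. For $\epsilon_0>0$ and parameters $\lambda,\beta,\eta>0$ the Carleman weighted mismatch functional is $$J_{\lambda,\eta}(v)=\int_\Omega e^{2\lambda r^{-\beta}}\big|-\epsilon_0\Delta v+F(\mathbf{x},v,\nabla v)\big|^2d\mathbf{x}+\lambda^4\int_{\partial\Omega}e^{2\lambda r^{-\beta}}\big(|v|^2+|\nabla v|^2\big)d\sigma(\mathbf{x})+\eta\|v\|_{H^p(\Omega)}^2,\quad v\in H^p(\Omega),$$ where $d\sigma$ is surface measure on $\partial\Omega$. *)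

theory Defs
  imports "HOL-Analysis.Analysis"
begin

subsection \<open>Classical differentiability classes\<close>

primrec Ck :: "nat \<Rightarrow> ('a::euclidean_space \<Rightarrow> real) \<Rightarrow> bool" where
  "Ck 0 f \<longleftrightarrow> continuous_on UNIV f"
| "Ck (Suc m) f \<longleftrightarrow> (\<forall>x. f differentiable (at x)) \<and>
     (\<forall>b\<in>Basis. Ck m (\<lambda>x. frechet_derivative f (at x) b))"

definition smooth :: "('a::euclidean_space \<Rightarrow> real) \<Rightarrow> bool" where
  "smooth f \<longleftrightarrow> (\<forall>m. Ck m f)"

definition gradient :: "('a::euclidean_space \<Rightarrow> real) \<Rightarrow> 'a \<Rightarrow> 'a" where
  "gradient f x = (THE D. GDERIV f x :> D)"

definition pderivative :: "'n::finite \<Rightarrow> (real^'n \<Rightarrow> real) \<Rightarrow> real^'n \<Rightarrow> real" where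
  "pderivative i f x = frechet_derivative f (at x) (axis i 1)"

text \<open>A multi-index is a function \<open>\<alpha> :: 'n \<Rightarrow> nat\<close>. The classical derivative
  \<open>D\<^sup>\<alpha> f\<close> takes the partial derivatives in an arbitrary order compatible with \<open>\<alpha>\<close>;
  it is only applied to smooth functions, for which the order is immaterial.\<close>

definition mi_order :: "('n::finite \<Rightarrow> nat) \<Rightarrow> nat" where
  "mi_order \<alpha> = (\<Sum>i\<in>UNIV. \<alpha> i)"

definition mi_deriv :: "('n::finite \<Rightarrow> nat) \<Rightarrow> (real^'n \<Rightarrow> real) \<Rightarrow> real^'n \<Rightarrow> real" where
  "mi_deriv \<alpha> f = foldr pderivative (SOME is. \<forall>i. count_list is i = \<alpha> i) f"

subsection \<open>The Sobolev space \<open>H\<^sup>p(\<Omega>)\<close>\<close>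

text \<open>Elements of \<open>H\<^sup>p(\<Omega>)\<close> are represented by functions on the whole space that are to be
  identified when they agree almost everywhere on \<open>\<Omega>\<close>. Every notion below depends only on the
  class of its arguments.\<close>

definition test_function :: "(real^'n::finite) set \<Rightarrow> (real^'n \<Rightarrow> real) \<Rightarrow> bool" where
  "test_function \<Omega> \<phi> \<longleftrightarrow> smooth \<phi> \<and> compact (closure {x. \<phi> x \<noteq> 0}) \<and> closure {x. \<phi> x \<noteq> 0} \<subseteq> \<Omega>"

definition L2_space :: "(real^'n::finite) set \<Rightarrow> (real^'n \<Rightarrow> real) set" where
  "L2_space \<Omega> = {u. u \<in> borel_measurable (lebesgue_on \<Omega>) \<and> integrable (lebesgue_on \<Omega>) (\<lambda>x. (u x)\<^sup>2)}"

definition has_weak_deriv_L2 ::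
  "(real^'n::finite) set \<Rightarrow> ('n \<Rightarrow> nat) \<Rightarrow> (real^'n \<Rightarrow> real) \<Rightarrow> (real^'n \<Rightarrow> real) \<Rightarrow> bool" where
  "has_weak_deriv_L2 \<Omega> \<alpha> u g \<longleftrightarrow> g \<in> L2_space \<Omega> \<and>
     (\<forall>\<phi>. test_function \<Omega> \<phi> \<longrightarrow>
        (LINT x|lebesgue_on \<Omega>. u x * mi_deriv \<alpha> \<phi> x) =
        (- 1) ^ mi_order \<alpha> * (LINT x|lebesgue_on \<Omega>. g x * \<phi> x))"

text \<open>The weak derivative is unique up to null sets of \<open>\<Omega>\<close>; a representative is chosen.\<close>

definition weak_deriv ::
  "(real^'n::finite) set \<Rightarrow> ('n \<Rightarrow> nat) \<Rightarrow> (real^'n \<Rightarrow> real) \<Rightarrow> real^'n \<Rightarrow> real" where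
  "weak_deriv \<Omega> \<alpha> u = (SOME g. has_weak_deriv_L2 \<Omega> \<alpha> u g)"

definition sobolev :: "(real^'n::finite) set \<Rightarrow> nat \<Rightarrow> (real^'n \<Rightarrow> real) set" where
  "sobolev \<Omega> p = {u \<in> L2_space \<Omega>. \<forall>\<alpha>. mi_order \<alpha> \<le> p \<longrightarrow> (\<exists>g. has_weak_deriv_L2 \<Omega> \<alpha> u g)}"

definition sobolev_inner ::
  "(real^'n::finite) set \<Rightarrow> nat \<Rightarrow> (real^'n \<Rightarrow> real) \<Rightarrow> (real^'n \<Rightarrow> real) \<Rightarrow> real" where
  "sobolev_inner \<Omega> p u v =
     (\<Sum>\<alpha> | mi_order \<alpha> \<le> p. LINT x|lebesgue_on \<Omega>. weak_deriv \<Omega> \<alpha> u x * weak_deriv \<Omega> \<alpha> v x)"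

definition sobolev_norm :: "(real^'n::finite) set \<Rightarrow> nat \<Rightarrow> (real^'n \<Rightarrow> real) \<Rightarrow> real" where
  "sobolev_norm \<Omega> p u = sqrt (sobolev_inner \<Omega> p u u)"

definition sobolev_ball :: "(real^'n::finite) set \<Rightarrow> nat \<Rightarrow> real \<Rightarrow> (real^'n \<Rightarrow> real) set" where
  "sobolev_ball \<Omega> p M = {v \<in> sobolev \<Omega> p. sobolev_norm \<Omega> p v < M}"

definition sobolev_closure ::
  "(real^'n::finite) set \<Rightarrow> nat \<Rightarrow> (real^'n \<Rightarrow> real) set \<Rightarrow> (real^'n \<Rightarrow> real) set" where
  "sobolev_closure \<Omega> p S =
     {v \<in> sobolev \<Omega> p. \<forall>e>0. \<exists>w\<in>S. sobolev_norm \<Omega> p (\<lambda>x. v x - w x) < e}"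

text \<open>Frechet derivative at \<open>v\<close> of a functional on \<open>H\<^sup>p(\<Omega>)\<close>: a bounded linear functional \<open>L\<close> with
  remainder \<open>o(\<parallel>h\<parallel>)\<close> (\<open>has_derivative\<close> is not applicable as \<open>H\<^sup>p(\<Omega>)\<close> is not a type).\<close>

definition sobolev_has_derivative ::
  "(real^'n::finite) set \<Rightarrow> nat \<Rightarrow> ((real^'n \<Rightarrow> real) \<Rightarrow> real) \<Rightarrow>
    ((real^'n \<Rightarrow> real) \<Rightarrow> real) \<Rightarrow> (real^'n \<Rightarrow> real) \<Rightarrow> bool" where
  "sobolev_has_derivative \<Omega> p J L v \<longleftrightarrow>
     (\<forall>h\<in>sobolev \<Omega> p. \<forall>k\<in>sobolev \<Omega> p. \<forall>a b. L (\<lambda>x. a * h x + b * k x) = a * L h + b * L k) \<and>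
     (\<exists>K. \<forall>h\<in>sobolev \<Omega> p. \<bar>L h\<bar> \<le> K * sobolev_norm \<Omega> p h) \<and>
     (\<forall>e>0. \<exists>d>0. \<forall>h\<in>sobolev \<Omega> p. sobolev_norm \<Omega> p h < d \<longrightarrow>
        \<bar>J (\<lambda>x. v x + h x) - J v - L h\<bar> \<le> e * sobolev_norm \<Omega> p h)"

definition weak_gradient ::
  "(real^'n::finite) set \<Rightarrow> (real^'n \<Rightarrow> real) \<Rightarrow> real^'n \<Rightarrow> real^'n" where
  "weak_gradient \<Omega> u x = (\<chi> i. weak_deriv \<Omega> (\<lambda>j. if j = i then 1 else 0) u x)"

definition weak_laplacian ::
  "(real^'n::finite) set \<Rightarrow> (real^'n \<Rightarrow> real) \<Rightarrow> real^'n \<Rightarrow> real" where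
  "weak_laplacian \<Omega> u x = (\<Sum>i\<in>UNIV. weak_deriv \<Omega> (\<lambda>j. if j = i then 2 else 0) u x)"

text \<open>Boundary values: when \<open>H\<^sup>p(\<Omega>)\<close> embeds into \<open>C\<^sup>2\<close> of the closure, \<open>u\<close> and its first weak
  derivatives agree almost everywhere with functions continuous up to the boundary; on the closure of
  an open \<open>\<Omega>\<close> these are unique.\<close>

definition cont_rep :: "(real^'n::finite) set \<Rightarrow> (real^'n \<Rightarrow> real) \<Rightarrow> real^'n \<Rightarrow> real" where
  "cont_rep \<Omega> g = (SOME f. continuous_on (closure \<Omega>) f \<and> (AE x in lebesgue_on \<Omega>. f x = g x))"

definition cont_gradient ::
  "(real^'n::finite) set \<Rightarrow> (real^'n \<Rightarrow> real) \<Rightarrow> real^'n \<Rightarrow> real^'n" where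
  "cont_gradient \<Omega> u x = (\<chi> i. cont_rep \<Omega> (weak_deriv \<Omega> (\<lambda>j. if j = i then 1 else 0) u) x)"

subsection \<open>The cube and its surface integral\<close>

definition cube :: "real \<Rightarrow> (real^'n::finite) set" where
  "cube R = {x. \<forall>i. - R < x $ i \<and> x $ i < R}"

text \<open>The boundary of the cube consists, up to sets of surface measure zero, of the faces
  \<open>x\<^sub>i = - R\<close> and \<open>x\<^sub>i = R\<close>, on which surface measure is Lebesgue measure in the remaining
  coordinates (a unit point mass in dimension one).\<close>

definition bdry_integral :: "real \<Rightarrow> (real^'n::finite \<Rightarrow> real) \<Rightarrow> real" where
  "bdry_integral R f = (\<Sum>i\<in>UNIV. \<Sum>t\<in>{- R, R}.
     LINT y:(PiE (UNIV - {i}) (\<lambda>_. {- R..R}))|(PiM (UNIV - {i}) (\<lambda>_. lborel)).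
       f (\<chi> j. if j = i then t else y j))"

subsection \<open>The Carleman weighted functional\<close>

definition hjF :: "real \<Rightarrow> real \<Rightarrow> (real^'n::finite \<Rightarrow> real) \<Rightarrow> (real^'n \<Rightarrow> real^'n \<Rightarrow> real) \<Rightarrow>
    real^'n \<Rightarrow> real \<Rightarrow> real^'n \<Rightarrow> real" where
  "hjF \<mu> k chi H x s q = chi x powr (2 * k) *
     (\<mu> * (s / chi x) + H x ((1 / (chi x)\<^sup>2) *\<^sub>R (chi x *\<^sub>R q - s *\<^sub>R gradient chi x)))"

definition cweight :: "real^'n::finite \<Rightarrow> real \<Rightarrow> real \<Rightarrow> real^'n \<Rightarrow> real" where
  "cweight x0 \<beta> lam x = exp (2 * lam * norm (x - x0) powr (- \<beta>))"

definition carlemanJ :: "real \<Rightarrow> real^'n::finite \<Rightarrow> real \<Rightarrow> real \<Rightarrow>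
    (real^'n \<Rightarrow> real \<Rightarrow> real^'n \<Rightarrow> real) \<Rightarrow> nat \<Rightarrow> real \<Rightarrow> real \<Rightarrow> (real^'n \<Rightarrow> real) \<Rightarrow> real" where
  "carlemanJ R x0 \<epsilon>0 \<beta> F p lam \<eta> v =
     (LINT x|lebesgue_on (cube R). cweight x0 \<beta> lam x *
        \<bar>- \<epsilon>0 * weak_laplacian (cube R) v x + F x (v x) (weak_gradient (cube R) v x)\<bar>\<^sup>2)
     + lam ^ 4 * bdry_integral R (\<lambda>x. cweight x0 \<beta> lam x *
        (\<bar>cont_rep (cube R) v x\<bar>\<^sup>2 + (norm (cont_gradient (cube R) v x))\<^sup>2))
     + \<eta> * (sobolev_norm (cube R) p v)\<^sup>2"

definition carlemanDJ :: "real \<Rightarrow> real^'n::finite \<Rightarrow> real \<Rightarrow> real \<Rightarrow>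
    (real^'n \<Rightarrow> real \<Rightarrow> real^'n \<Rightarrow> real) \<Rightarrow> nat \<Rightarrow> real \<Rightarrow> real \<Rightarrow>
    (real^'n \<Rightarrow> real) \<Rightarrow> (real^'n \<Rightarrow> real) \<Rightarrow> real" where
  "carlemanDJ R x0 \<epsilon>0 \<beta> F p lam \<eta> v h =
     2 * (LINT x|lebesgue_on (cube R). cweight x0 \<beta> lam x *
        (- \<epsilon>0 * weak_laplacian (cube R) v x + F x (v x) (weak_gradient (cube R) v x)) *
        (- \<epsilon>0 * weak_laplacian (cube R) h x
         + deriv (\<lambda>s. F x s (weak_gradient (cube R) v x)) (v x) * h x
         + gradient (\<lambda>q. F x (v x) q) (weak_gradient (cube R) v x) \<bullet> weak_gradient (cube R) h x))
     + 2 * lam ^ 4 * bdry_integral R (\<lambda>x. cweight x0 \<beta> lam x *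
        (cont_rep (cube R) v x * cont_rep (cube R) h x
         + cont_gradient (cube R) v x \<bullet> cont_gradient (cube R) h x))
     + 2 * \<eta> * sobolev_inner (cube R) p v h"

end

theory Submission
  imports Defs "HOL-Library.Multiset"
begin

text \<open>Expanding the square gives
  \<open>J (v + h) - J v - DJ v h = \<integral> W [(lin v h + rem v h)\<^sup>2 + 2 res v \<sqdot> rem v h] + lam\<^sup>4 (boundary term of h) + \<eta> \<parallel>h\<parallel>\<^sup>2\<close>,
  where \<open>W\<close> is the Carleman weight, \<open>res v\<close> the residual of the equation at \<open>v\<close>, \<open>lin v h\<close> its
  linearisation and \<open>rem v h\<close> the second order Taylor remainder of \<open>F\<close>, which is \<open>O(|h|\<^sup>2 + |\<nabla>h|\<^sup>2)\<close>
  because \<open>H\<^sup>p\<close> embeds into \<open>C\<^sup>2\<close>. This is \<open>O(\<parallel>h\<parallel>\<^sup>2)\<close>, hence the derivative. On a ball it is bounded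
  below by \<open>\<epsilon>0\<^sup>2/2 \<integral> W |\<Delta>h|\<^sup>2 - K \<integral> W (|h|\<^sup>2 + |\<nabla>h|\<^sup>2)\<close> plus the boundary term, and the Carleman estimate
  \<open>lam \<integral> W (|h|\<^sup>2 + |\<nabla>h|\<^sup>2) \<le> C \<integral> W |\<Delta>h|\<^sup>2 + C lam\<^sup>3 (boundary term)\<close> absorbs the negative part for large
  \<open>lam\<close>. By the resulting strong convexity minimizing sequences are Cauchy in \<open>H\<^sup>p\<close>.

  The function \<open>chi - \<delta>\<close> is a smooth bump supported on the closed cube and serves as mollifier, which
  transfers the Sobolev and Carleman inequalities from smooth functions to \<open>H\<^sup>p\<close>.\<close>

subsection \<open>Smooth functions and their partial derivatives\<close>

text \<open>Two powers of \<open>lam\<close> decide the proof. In the interior the Carleman estimate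
  gains one factor \<open>lam\<close> over a quadratic error whose constant is fixed by
  \<open>M\<close> through the sup bounds of the embedding, so a large \<open>lam\<close> absorbs
  it. On the boundary the estimate costs \<open>lam\<^sup>3\<close> where the functional has
  \<open>lam\<^sup>4\<close>; the spare factor outweighs the fixed
  \<open>\<epsilon>0\<^sup>2\<close>. The estimate is needed on all of H^p, with no boundary
  condition. Mollifying with a centre \<open>x\<close> near a face would call for values outside the
  cube. Contracting the centre towards the origin avoids this and costs only a power of
  \<open>1 - 2 * \<epsilon>\<close> in each derivative. Interior integrals then converge in L2,
  boundary integrals by the uniform convergence that the embedding provides. \<open>lam0\<close> and
  \<open>C\<close> may depend neither on \<open>p\<close> nor on the penalty weight, so the
  embedding and Carleman constants are fixed before \<open>p\<close> is. Norm convergence of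
  minimizing sequences comes from comparing two near-minimizers with their midpoint, so that no weak
  compactness enters.\<close>

lemma smooth_iff:
  fixes f :: "real^'n::finite \<Rightarrow> real"
  shows "smooth f \<longleftrightarrow> (\<forall>x. f differentiable (at x)) \<and> (\<forall>i. smooth (pderivative i f))"
proof
  assume f: "smooth f"
  have "Ck (Suc m) f" for m
    using f by (simp add: smooth_def del: Ck.simps)
  then show "(\<forall>x. f differentiable (at x)) \<and> (\<forall>i. smooth (pderivative i f))"
    by (auto simp: smooth_def Basis_vec_def pderivative_def [abs_def])
next
  assume f: "(\<forall>x. f differentiable (at x)) \<and> (\<forall>i. smooth (pderivative i f))"
  have "Ck m f" for m
  proof (cases m)
    case 0
    then show ?thesis
      using f by (auto intro!: continuous_at_imp_continuous_on differentiable_imp_continuous_within)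
  next
    case (Suc k)
    have "Ck k (pderivative i f)" for i
      using f by (auto simp: smooth_def)
    then show ?thesis
      using f Suc by (auto simp: Basis_vec_def pderivative_def [abs_def])
  qed
  then show "smooth f"
    by (simp add: smooth_def)
qed

text \<open>\<open>Ck\<close> recurses on the order, so smoothness is the largest class of
  differentiable functions closed under partial derivatives. Exhibiting an invariant class that
  contains \<open>f\<close> replaces every computation of higher derivatives; linear combinations,
  affine substitutions and convolutions are all treated this way.\<close>

lemma smooth_coinduct:
  fixes f :: "real^'n::finite \<Rightarrow> real"
  assumes "f \<in> S"
    and step: "\<And>f x. f \<in> S \<Longrightarrow> f differentiable (at x)" "\<And>f i. f \<in> S \<Longrightarrow> pderivative i f \<in> S"
  shows "smooth f"
proof -
  have "Ck m f" if "f \<in> S" for m f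
    using that
  proof (induction m arbitrary: f)
    case 0
    then show ?case
      using step(1) by (auto intro!: continuous_at_imp_continuous_on differentiable_imp_continuous_within)
  next
    case (Suc m)
    have "Ck m (pderivative i f)" for i
      using Suc step(2) by blast
    then show ?case
      using Suc.prems step(1) by (auto simp: Basis_vec_def pderivative_def [abs_def])
  qed
  then show ?thesis
    using assms(1) by (simp add: smooth_def)
qed

lemma smooth_pderivative: "smooth f \<Longrightarrow> smooth (pderivative i f)"
  using smooth_iff by blast

lemma smooth_foldr: "smooth f \<Longrightarrow> smooth (foldr pderivative ks f)"
  by (induction "ks") (auto intro: smooth_pderivative)

lemma smooth_continuous: "smooth f \<Longrightarrow> continuous_on S f"
  by (metis Ck.simps(1) continuous_on_subset smooth_def subset_UNIV)

lemma pderivative_eqI: "(f has_derivative D) (at x) \<Longrightarrow> pderivative i f x = D (axis i 1)"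
  by (metis frechet_derivative_at pderivative_def)

lemma differentiable_has_derivative_pderivative:
  fixes f :: "real^'n::finite \<Rightarrow> real"
  assumes "f differentiable (at x)"
  shows "(f has_derivative (\<lambda>h. \<Sum>i\<in>UNIV. h $ i * pderivative i f x)) (at x)"
proof -
  let ?D = "frechet_derivative f (at x)"
  have D: "(f has_derivative ?D) (at x)"
    using assms frechet_derivative_works by blast
  then have lin: "linear ?D"
    using has_derivative_linear by blast
  have "?D h = (\<Sum>i\<in>UNIV. h $ i * pderivative i f x)" for h
  proof -
    have "?D h = ?D (\<Sum>i\<in>UNIV. h $ i *\<^sub>R axis i 1)"
      using basis_expansion[of h] by (simp add: scalar_mult_eq_scaleR)
    also have "\<dots> = (\<Sum>i\<in>UNIV. h $ i * pderivative i f x)"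
      by (simp add: linear_sum[OF lin] linear_cmul[OF lin] pderivative_def)
    finally show ?thesis .
  qed
  then have "?D = (\<lambda>h. \<Sum>i\<in>UNIV. h $ i * pderivative i f x)"
    by blast
  with D show ?thesis
    by simp
qed

lemma smooth_has_derivative:
  "smooth f \<Longrightarrow> (f has_derivative (\<lambda>h. \<Sum>i\<in>UNIV. h $ i * pderivative i f x)) (at x)"
  using smooth_iff differentiable_has_derivative_pderivative by blast

lemma smooth_line_derivative:
  assumes "smooth f"
  shows "((\<lambda>t. f (a + t *\<^sub>R v)) has_real_derivative
    (\<Sum>i\<in>UNIV. v $ i * pderivative i f (a + t *\<^sub>R v))) (at t within S)"
proof -
  have "((\<lambda>t. a + t *\<^sub>R v) has_derivative (\<lambda>s. s *\<^sub>R v)) (at t)"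
    by (auto intro!: derivative_eq_intros)
  from diff_chain_at[OF this smooth_has_derivative[OF assms]]
  have "((\<lambda>t. f (a + t *\<^sub>R v)) has_derivative
      (\<lambda>s. \<Sum>i\<in>UNIV. (s *\<^sub>R v) $ i * pderivative i f (a + t *\<^sub>R v))) (at t)"
    by (simp only: o_def)
  also have "(\<lambda>s. \<Sum>i\<in>UNIV. (s *\<^sub>R v) $ i * pderivative i f (a + t *\<^sub>R v))
      = (*) (\<Sum>i\<in>UNIV. v $ i * pderivative i f (a + t *\<^sub>R v))"
    by (rule ext) (simp add: sum_distrib_left mult_ac)
  finally show ?thesis
    unfolding has_field_derivative_def by (rule has_derivative_at_withinI)
qed

lemma smooth_axis_derivative:
  assumes "smooth f"
  shows "((\<lambda>t. f (a + t *\<^sub>R axis i 1)) has_real_derivative pderivative i f (a + t *\<^sub>R axis i 1)) (at t within S)"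
proof -
  have "(\<Sum>k\<in>UNIV. axis i 1 $ k * pderivative k f x) = pderivative i f x" for x
    by (subst sum.remove[of _ i]) (auto simp: axis_def intro!: sum.neutral)
  then show ?thesis
    using smooth_line_derivative[OF assms, of a "axis i 1" t S] by simp
qed

section \<open>Symmetry of mixed derivatives and multi-indices\<close>

text \<open>The second difference is symmetric in \<open>i\<close> and \<open>j\<close>, so the
  lemma used in both orders evaluates one number by either mixed derivative. The mean value theorem
  is applied in direction \<open>i\<close> to a difference in direction \<open>j\<close>, then in
  direction \<open>j\<close>.\<close>

lemma second_difference_mvt:
  fixes f :: "real^'n::finite \<Rightarrow> real"
  assumes "smooth f" "h > 0"
  shows "\<exists>y. norm (y - x) \<le> 2 * h \<and>
    f (x + h *\<^sub>R axis i 1 + h *\<^sub>R axis j 1) - f (x + h *\<^sub>R axis i 1) - f (x + h *\<^sub>R axis j 1) + f x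
      = h\<^sup>2 * pderivative j (pderivative i f) y"
proof -
  define u where "u s = f ((x + h *\<^sub>R axis j 1) + s *\<^sub>R axis i 1) - f (x + s *\<^sub>R axis i 1)" for s
  define u' where "u' s = pderivative i f ((x + h *\<^sub>R axis j 1) + s *\<^sub>R axis i 1) - pderivative i f (x + s *\<^sub>R axis i 1)" for s
  have "(u has_real_derivative u' s) (at s)" for s
    unfolding u_def u'_def
    by (intro derivative_intros smooth_axis_derivative assms)
  from MVT2[OF \<open>h > 0\<close> this] obtain s where s: "0 < s" "s < h" "u h - u 0 = h * u' s"
    by auto
  have "((\<lambda>t. pderivative i f ((x + s *\<^sub>R axis i 1) + t *\<^sub>R axis j 1)) has_real_derivative
     pderivative j (pderivative i f) ((x + s *\<^sub>R axis i 1) + t *\<^sub>R axis j 1)) (at t)" for t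
    by (intro smooth_axis_derivative smooth_pderivative assms)
  from MVT2[OF \<open>h > 0\<close> this] obtain t where t: "0 < t" "t < h"
    "u' s = h * pderivative j (pderivative i f) ((x + s *\<^sub>R axis i 1) + t *\<^sub>R axis j 1)"
    by (auto simp: u'_def algebra_simps)
  define y where "y = (x + s *\<^sub>R axis i 1) + t *\<^sub>R axis j (1::real)"
  have "norm (y - x) \<le> norm (s *\<^sub>R axis i (1::real) :: real^'n) + norm (t *\<^sub>R axis j (1::real) :: real^'n)"
    unfolding y_def by (metis (no_types, lifting) add.assoc add_diff_cancel_left' norm_triangle_ineq)
  also have "\<dots> \<le> 2 * h"
    using s t by (simp add: norm_axis_1)
  finally have 1: "norm (y - x) \<le> 2 * h" .
  have "f (x + h *\<^sub>R axis i 1 + h *\<^sub>R axis j 1) - f (x + h *\<^sub>R axis i 1) - f (x + h *\<^sub>R axis j 1) + f x = u h - u 0"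
    by (simp add: u_def algebra_simps)
  also have "\<dots> = h\<^sup>2 * pderivative j (pderivative i f) y"
    using s t by (simp add: y_def power2_eq_square)
  finally show ?thesis
    using 1 by blast
qed

lemma pderivative_commute:
  fixes f :: "real^'n::finite \<Rightarrow> real"
  assumes f: "smooth f"
  shows "pderivative i (pderivative j f) = pderivative j (pderivative i f)"
proof
  fix x
  let ?A = "pderivative i (pderivative j f)" and ?B = "pderivative j (pderivative i f)"
  have cA: "isCont ?A x" and cB: "isCont ?B x"
    using smooth_continuous[of ?A UNIV] smooth_continuous[of ?B UNIV] f
    by (auto intro!: smooth_pderivative simp: continuous_on_eq_continuous_at)
  show "?A x = ?B x"
  proof (rule ccontr)
    assume ne: "?A x \<noteq> ?B x"
    \<comment> \<open>Half the gap: the \<open>e\<close>-neighbourhoods of the two values at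
      \<open>x\<close> are disjoint, while \<open>?B y\<close> and \<open>?A z\<close> turn out to
      be one number that would lie in both.\<close>
    define e where "e = \<bar>?A x - ?B x\<bar> / 2"
    have "e > 0" using ne by (simp add: e_def)
    obtain d1 where d1: "d1 > 0" "\<And>y. dist y x < d1 \<Longrightarrow> dist (?A y) (?A x) < e"
      using cA \<open>e > 0\<close> by (metis continuous_at_eps_delta)
    obtain d2 where d2: "d2 > 0" "\<And>y. dist y x < d2 \<Longrightarrow> dist (?B y) (?B x) < e"
      using cB \<open>e > 0\<close> by (metis continuous_at_eps_delta)
    define h where "h = min d1 d2 / 4"
    have h: "h > 0" "2 * h < d1" "2 * h < d2"
      using d1 d2 by (auto simp: h_def min_def)
    obtain y where y: "norm (y - x) \<le> 2 * h"
      "f (x + h *\<^sub>R axis i 1 + h *\<^sub>R axis j 1) - f (x + h *\<^sub>R axis i 1) - f (x + h *\<^sub>R axis j 1) + f x = h\<^sup>2 * ?B y"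
      using second_difference_mvt[OF f h(1)] by blast
    obtain z where z: "norm (z - x) \<le> 2 * h"
      "f (x + h *\<^sub>R axis j 1 + h *\<^sub>R axis i 1) - f (x + h *\<^sub>R axis j 1) - f (x + h *\<^sub>R axis i 1) + f x = h\<^sup>2 * ?A z"
      using second_difference_mvt[OF f h(1)] by blast
    have "h\<^sup>2 * ?B y = h\<^sup>2 * ?A z"
      using y(2) z(2) by (simp add: algebra_simps)
    then have "?B y = ?A z"
      using h(1) by simp
    moreover have "dist (?B y) (?B x) < e" "dist (?A z) (?A x) < e"
      using d1(2)[of z] d2(2)[of y] y(1) z(1) h by (auto simp: dist_norm)
    ultimately show False
      unfolding e_def dist_real_def by (auto simp: abs_if split: if_splits)
  qed
qed

lemma foldr_pderivative_remove1:
  assumes "smooth f" "i \<in> set ks"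
  shows "foldr pderivative ks f = pderivative i (foldr pderivative (remove1 i ks) f)"
  using assms(2)
proof (induction "ks")
  case (Cons j js)
  then show ?case
    by (auto simp: pderivative_commute[OF smooth_foldr[OF assms(1)], of i j])
qed simp

text \<open>Schwarz's theorem for iterated derivatives; it makes the arbitrary order of
  differentiation chosen in \<open>mi_deriv\<close> immaterial.\<close>

lemma foldr_pderivative_mset_cong:
  assumes "smooth f" "mset ks = mset js"
  shows "foldr pderivative ks f = foldr pderivative js f"
  using assms(2)
proof (induction "ks" arbitrary: js)
  case (Cons i ks)
  have "i \<in> set js"
    using Cons.prems by (metis list.set_intros(1) set_mset_mset)
  moreover have "foldr pderivative ks f = foldr pderivative (remove1 i js) f"
    using Cons.prems by (intro Cons.IH) (simp flip: Cons.prems)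
  ultimately show ?case
    by (simp add: foldr_pderivative_remove1[OF assms(1), of i js])
qed simp

lemma ex_list_count:
  fixes \<alpha> :: "'n::finite \<Rightarrow> nat"
  shows "\<exists>ks. \<forall>i. count_list ks i = \<alpha> i"
proof -
  obtain "ks" where "mset ks = Abs_multiset \<alpha>"
    using ex_mset by blast
  then have "count (mset ks) i = \<alpha> i" for i
    by simp
  then show ?thesis
    by (metis count_mset count_list_eq_length_filter)
qed

text \<open>Names the list hidden behind \<open>SOME\<close> in \<open>mi_deriv\<close>, so that its
  counts and its length can be spoken of.\<close>

definition mi_list :: "('n::finite \<Rightarrow> nat) \<Rightarrow> 'n list" where
  "mi_list \<alpha> = (SOME ks. \<forall>i. count_list ks i = \<alpha> i)"

lemma count_mi_list: "count_list (mi_list \<alpha>) i = \<alpha> i"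
  unfolding mi_list_def using someI_ex[OF ex_list_count[of \<alpha>]] by blast

lemma length_mi_list: "length (mi_list \<alpha>) = mi_order \<alpha>"
proof -
  have "mi_order \<alpha> = (\<Sum>i\<in>UNIV. count_list (mi_list \<alpha>) i)"
    by (simp add: mi_order_def count_mi_list)
  also have "\<dots> = length (mi_list \<alpha>)"
    using sum_count_set[of "mi_list \<alpha>" UNIV] by simp
  finally show ?thesis by simp
qed

lemma mi_deriv_mi_list: "mi_deriv \<alpha> f = foldr pderivative (mi_list \<alpha>) f"
  by (simp add: mi_deriv_def mi_list_def)

lemma mi_deriv_eq_foldr:
  assumes "smooth f" "\<And>i. count_list ks i = \<alpha> i"
  shows "mi_deriv \<alpha> f = foldr pderivative ks f"
proof -
  have "mset (mi_list \<alpha>) = mset ks"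
    by (rule multiset_eqI) (metis assms(2) count_mi_list count_mset count_list_eq_length_filter)
  then show ?thesis
    using foldr_pderivative_mset_cong[OF assms(1)] mi_deriv_mi_list by metis
qed

lemma smooth_mi_deriv: "smooth f \<Longrightarrow> smooth (mi_deriv \<alpha> f)"
  by (simp add: mi_deriv_mi_list smooth_foldr)

lemma pderivative_mi_deriv:
  "smooth f \<Longrightarrow> pderivative i (mi_deriv \<alpha> f) = mi_deriv (\<alpha>(i := Suc (\<alpha> i))) f"
  by (subst mi_deriv_eq_foldr[of f "i # mi_list \<alpha>"]) (auto simp: count_mi_list mi_deriv_mi_list)

lemma mi_order_upd: "mi_order (\<alpha>(i := Suc (\<alpha> i))) = Suc (mi_order \<alpha>)"
proof -
  have "mi_order (\<alpha>(i := Suc (\<alpha> i))) = Suc (\<alpha> i) + (\<Sum>k\<in>UNIV - {i}. \<alpha> k)"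
    unfolding mi_order_def by (subst sum.remove[of _ i]) auto
  also have "\<dots> = Suc (mi_order \<alpha>)"
    unfolding mi_order_def by (subst (2) sum.remove[of _ i]) auto
  finally show ?thesis .
qed

lemma mi_deriv_zero:
  fixes f :: "real^'n::finite \<Rightarrow> real"
  shows "mi_deriv (\<lambda>_. 0) f = f"
proof -
  have "mi_list (\<lambda>_::'n. 0) = []"
    by (metis length_mi_list length_0_conv mi_order_def sum.neutral_const)
  then show ?thesis
    by (simp add: mi_deriv_mi_list)
qed

lemma mi_deriv_one: "smooth f \<Longrightarrow> mi_deriv (\<lambda>j. if j = i then 1 else 0) f = pderivative i f"
  by (subst mi_deriv_eq_foldr[of f "[i]"]) auto

lemma mi_deriv_two:
  "smooth f \<Longrightarrow> mi_deriv (\<lambda>j. if j = i then 2 else 0) f = pderivative i (pderivative i f)"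
  by (subst mi_deriv_eq_foldr[of f "[i, i]"]) auto

lemma mi_order_zero [simp]: "mi_order (\<lambda>_. 0) = 0"
  and mi_order_single [simp]: "mi_order (\<lambda>j. if j = i then k else 0) = k"
  by (simp_all add: mi_order_def)

lemma finite_mi_order_le [simp]: "finite {\<alpha> :: 'n::finite \<Rightarrow> nat. mi_order \<alpha> \<le> p}"
proof (rule finite_subset)
  show "{\<alpha> :: 'n \<Rightarrow> nat. mi_order \<alpha> \<le> p} \<subseteq> {\<alpha>. \<forall>i. \<alpha> i \<in> {..p}}"
    by (auto simp: mi_order_def) (meson finite_class.finite_UNIV iso_tuple_UNIV_I le_trans member_le_sum zero_le)
  have "{\<alpha> :: 'n \<Rightarrow> nat. \<forall>i. \<alpha> i \<in> {..p}} = PiE UNIV (\<lambda>_. {..p})"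
    by (auto simp: PiE_def extensional_def)
  then show "finite {\<alpha> :: 'n \<Rightarrow> nat. \<forall>i. \<alpha> i \<in> {..p}}"
    by (simp add: finite_PiE)
qed

lemma sum_axis: "(\<Sum>k\<in>UNIV. axis i (1::real) $ k * c k) = c i"
  by (subst sum.remove[of _ i]) (auto simp: axis_def intro!: sum.neutral)

lemma lincomb_derivative:
  fixes f g :: "real^'n::finite \<Rightarrow> real"
  assumes "smooth f" "smooth g"
  shows "((\<lambda>x. a * f x + b * g x) has_derivative
    (\<lambda>h. a * (\<Sum>i\<in>UNIV. h $ i * pderivative i f x) + b * (\<Sum>i\<in>UNIV. h $ i * pderivative i g x))) (at x)"
  by (intro has_derivative_add has_derivative_mult_right smooth_has_derivative assms)

lemma pderivative_lincomb:
  fixes f g :: "real^'n::finite \<Rightarrow> real"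
  assumes "smooth f" "smooth g"
  shows "pderivative i (\<lambda>x. a * f x + b * g x) = (\<lambda>x. a * pderivative i f x + b * pderivative i g x)"
proof
  fix x
  show "pderivative i (\<lambda>x. a * f x + b * g x) x = a * pderivative i f x + b * pderivative i g x"
    using pderivative_eqI[OF lincomb_derivative[OF assms], of i a b x] by (simp only: sum_axis)
qed

lemma smooth_lincomb:
  fixes f g :: "real^'n::finite \<Rightarrow> real"
  assumes "smooth f" "smooth g"
  shows "smooth (\<lambda>x. a * f x + b * g x)"
proof (rule smooth_coinduct)
  let ?S = "{h. \<exists>f g. smooth f \<and> smooth g \<and> h = (\<lambda>x::real^'n. a * f x + b * g x)}"
  show "(\<lambda>x. a * f x + b * g x) \<in> ?S"
    using assms by blast
  show "h differentiable (at x)" if "h \<in> ?S" for h x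
    using that by (auto intro: differentiableI[OF lincomb_derivative])
  show "pderivative i h \<in> ?S" if "h \<in> ?S" for h i
  proof -
    from that obtain f g where "smooth f" "smooth g" "h = (\<lambda>x. a * f x + b * g x)"
      by auto
    then show ?thesis
      unfolding mem_Collect_eq
      by (intro exI[of _ "pderivative i f"] exI[of _ "pderivative i g"]) (simp add: pderivative_lincomb smooth_pderivative)
  qed
qed

lemma foldr_pderivative_lincomb:
  fixes f g :: "real^'n::finite \<Rightarrow> real"
  assumes "smooth f" "smooth g"
  shows "foldr pderivative ks (\<lambda>x. a * f x + b * g x)
    = (\<lambda>x. a * foldr pderivative ks f x + b * foldr pderivative ks g x)"
  by (induction "ks") (simp_all add: pderivative_lincomb smooth_foldr assms)

lemma mi_deriv_diff:
  fixes f g :: "real^'n::finite \<Rightarrow> real"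
  assumes "smooth f" "smooth g"
  shows "smooth (\<lambda>x. f x - g x)" "mi_deriv \<alpha> (\<lambda>x. f x - g x) = (\<lambda>x. mi_deriv \<alpha> f x - mi_deriv \<alpha> g x)"
  using smooth_lincomb[OF assms, of 1 "-1"] foldr_pderivative_lincomb[OF assms, of _ 1 "-1"]
  by (simp_all add: mi_deriv_mi_list)

lemma affine_derivative:
  fixes f :: "real^'n::finite \<Rightarrow> real"
  assumes "smooth f"
  shows "((\<lambda>x. f (\<theta> *\<^sub>R x + b)) has_derivative (\<lambda>h. \<theta> * (\<Sum>i\<in>UNIV. h $ i * pderivative i f (\<theta> *\<^sub>R x + b)))) (at x)"
proof -
  have "((\<lambda>x. \<theta> *\<^sub>R x + b) has_derivative (\<lambda>h. \<theta> *\<^sub>R h)) (at x)"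
    by (auto intro!: derivative_eq_intros)
  from diff_chain_at[OF this smooth_has_derivative[OF assms]] show ?thesis
    by (simp add: o_def sum_distrib_left mult.assoc)
qed

lemma pderivative_affine:
  fixes f :: "real^'n::finite \<Rightarrow> real"
  assumes "smooth f"
  shows "pderivative i (\<lambda>x. k * f (\<theta> *\<^sub>R x + b)) = (\<lambda>x. (k * \<theta>) * pderivative i f (\<theta> *\<^sub>R x + b))"
proof
  fix x
  have "((\<lambda>x. k * f (\<theta> *\<^sub>R x + b)) has_derivative (\<lambda>h. k * (\<theta> * (\<Sum>i\<in>UNIV. h $ i * pderivative i f (\<theta> *\<^sub>R x + b))))) (at x)"
    by (intro derivative_intros affine_derivative assms)
  from pderivative_eqI[OF this] show "pderivative i (\<lambda>x. k * f (\<theta> *\<^sub>R x + b)) x = (k * \<theta>) * pderivative i f (\<theta> *\<^sub>R x + b)"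
    by (simp add: sum_axis)
qed

lemma smooth_affine:
  fixes f :: "real^'n::finite \<Rightarrow> real"
  assumes "smooth f"
  shows "smooth (\<lambda>x. k * f (\<theta> *\<^sub>R x + b))"
proof (rule smooth_coinduct)
  \<comment> \<open>The factor \<open>k\<close> varies over the set because each partial derivative
    contributes a \<open>\<theta>\<close>; the inner affine map stays fixed.\<close>
  let ?S = "{h. \<exists>f k. smooth f \<and> h = (\<lambda>x::real^'n. k * f (\<theta> *\<^sub>R x + b))}"
  show "(\<lambda>x. k * f (\<theta> *\<^sub>R x + b)) \<in> ?S"
    using assms by blast
  show "h differentiable (at x)" if "h \<in> ?S" for h x
    using that by (auto intro: differentiableI[OF has_derivative_mult_right[OF affine_derivative]])
  show "pderivative i h \<in> ?S" if "h \<in> ?S" for h i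
  proof -
    from that obtain f k where "smooth f" "h = (\<lambda>x. k * f (\<theta> *\<^sub>R x + b))"
      by auto
    then show ?thesis
      by (auto simp: pderivative_affine intro!: exI[of _ "pderivative i f"] exI[of _ "k * \<theta>"] smooth_pderivative)
  qed
qed

lemma foldr_pderivative_affine:
  fixes f :: "real^'n::finite \<Rightarrow> real"
  assumes "smooth f"
  shows "foldr pderivative ks (\<lambda>x. f (\<theta> *\<^sub>R x + b)) = (\<lambda>x. \<theta> ^ length ks * foldr pderivative ks f (\<theta> *\<^sub>R x + b))"
  by (induction "ks") (simp_all add: pderivative_affine smooth_foldr assms mult_ac)

subsection \<open>Square integrable functions\<close>

text \<open>\<open>L2_space\<close> over an arbitrary measure, so that the Hilbert space facts are
  not tied to the cube.\<close>

definition L2fun :: "'a measure \<Rightarrow> ('a \<Rightarrow> real) \<Rightarrow> bool" where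
  "L2fun M f \<longleftrightarrow> f \<in> borel_measurable M \<and> integrable M (\<lambda>x. (f x)\<^sup>2)"

lemma L2_space_iff: "u \<in> L2_space \<Omega> \<longleftrightarrow> L2fun (lebesgue_on \<Omega>) u"
  by (simp add: L2_space_def L2fun_def)

lemma L2funD:
  assumes "L2fun M f"
  shows "f \<in> borel_measurable M" "integrable M (\<lambda>x. (f x)\<^sup>2)"
  using assms by (simp_all add: L2fun_def)

lemma L2fun_mult_integrable:
  assumes "L2fun M f" "L2fun M g"
  shows "integrable M (\<lambda>x. f x * g x)"
proof (rule Bochner_Integration.integrable_bound)
  show "integrable M (\<lambda>x. (f x)\<^sup>2 + (g x)\<^sup>2)"
    using assms by (auto simp: L2fun_def)
  show "(\<lambda>x. f x * g x) \<in> borel_measurable M"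
    using assms by (auto simp: L2fun_def)
  have "\<bar>f x * g x\<bar> \<le> (f x)\<^sup>2 + (g x)\<^sup>2" for x
  proof -
    have "2 * \<bar>f x\<bar> * \<bar>g x\<bar> \<le> (f x)\<^sup>2 + (g x)\<^sup>2"
      using sum_squares_bound[of "\<bar>f x\<bar>" "\<bar>g x\<bar>"] by simp
    moreover have "0 \<le> \<bar>f x\<bar> * \<bar>g x\<bar>"
      by simp
    ultimately show ?thesis
      unfolding abs_mult by linarith
  qed
  then show "AE x in M. norm (f x * g x) \<le> norm ((f x)\<^sup>2 + (g x)\<^sup>2)"
    by simp
qed

lemma L2fun_lincomb:
  assumes "L2fun M f" "L2fun M g"
  shows "L2fun M (\<lambda>x. a * f x + b * g x)"
proof -
  have "integrable M (\<lambda>x. a\<^sup>2 * (f x)\<^sup>2 + 2 * a * b * (f x * g x) + b\<^sup>2 * (g x)\<^sup>2)"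
    using assms L2fun_mult_integrable[OF assms] by (auto simp: L2fun_def)
  also have "(\<lambda>x. a\<^sup>2 * (f x)\<^sup>2 + 2 * a * b * (f x * g x) + b\<^sup>2 * (g x)\<^sup>2) = (\<lambda>x. (a * f x + b * g x)\<^sup>2)"
    by (auto simp: power2_eq_square algebra_simps)
  finally show ?thesis
    using assms by (auto simp: L2fun_def)
qed

lemma L2fun_add: "L2fun M f \<Longrightarrow> L2fun M g \<Longrightarrow> L2fun M (\<lambda>x. f x + g x)"
  and L2fun_diff: "L2fun M f \<Longrightarrow> L2fun M g \<Longrightarrow> L2fun M (\<lambda>x. f x - g x)"
  and L2fun_cmult: "L2fun M f \<Longrightarrow> L2fun M (\<lambda>x. a * f x)"
  using L2fun_lincomb[of M f g 1 1] L2fun_lincomb[of M f g 1 "-1"] L2fun_lincomb[of M f f a 0] by simp_all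

lemma L2fun_zero: "L2fun M (\<lambda>_. 0)"
  by (simp add: L2fun_def)

lemma L2fun_sum: "finite I \<Longrightarrow> (\<And>i. i \<in> I \<Longrightarrow> L2fun M (f i)) \<Longrightarrow> L2fun M (\<lambda>x. \<Sum>i\<in>I. f i x)"
  by (induction I rule: finite_induct) (auto intro: L2fun_zero L2fun_add)

lemma L2fun_bounded:
  assumes "finite_measure M" "f \<in> borel_measurable M" "AE x in M. \<bar>f x\<bar> \<le> B"
  shows "L2fun M f"
proof -
  interpret finite_measure M by fact
  have "integrable M (\<lambda>x. (f x)\<^sup>2)"
  proof (rule integrable_const_bound)
    show "AE x in M. norm ((f x)\<^sup>2) \<le> B\<^sup>2"
      using assms(3) by eventually_elim (simp add: abs_le_square_iff[symmetric])
  qed (use assms in auto)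
  then show ?thesis
    using assms by (simp add: L2fun_def)
qed

lemma L2fun_mult_bounded:
  assumes "L2fun M f" "g \<in> borel_measurable M" "AE x in M. \<bar>g x\<bar> \<le> B"
  shows "L2fun M (\<lambda>x. g x * f x)"
proof -
  have "integrable M (\<lambda>x. (g x * f x)\<^sup>2)"
  proof (rule Bochner_Integration.integrable_bound)
    show "integrable M (\<lambda>x. B\<^sup>2 * (f x)\<^sup>2)"
      using assms by (auto simp: L2fun_def)
    show "AE x in M. norm ((g x * f x)\<^sup>2) \<le> norm (B\<^sup>2 * (f x)\<^sup>2)"
      using assms(3) by eventually_elim (simp add: abs_le_square_iff[symmetric] power_mult_distrib mult_right_mono)
  qed (use assms in \<open>auto simp: L2fun_def\<close>)
  then show ?thesis
    using assms by (auto simp: L2fun_def)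
qed

text \<open>Evaluate at the minimizer \<open>t = - B / C\<close>; if \<open>C = 0\<close> the
  polynomial is affine and bounded below only when \<open>B = 0\<close>. Serves both Cauchy-Schwarz
  inequalities, for integrals and for the Sobolev inner product.\<close>

lemma discriminant_bound:
  fixes A B C :: real
  assumes "\<And>t. 0 \<le> A + 2 * t * B + t\<^sup>2 * C" "C \<ge> 0"
  shows "B\<^sup>2 \<le> A * C"
proof (cases "C = 0")
  case True
  have "B = 0"
  proof (rule ccontr)
    assume "B \<noteq> 0"
    show False
    proof -
      \<comment> \<open>This \<open>t\<close> makes the affine polynomial take the value -1.\<close>
      have "2 * (- (A + 1) / (2 * B)) * B = - (A + 1)"
        using \<open>B \<noteq> 0\<close> by simp
      then show False
        using assms(1)[of "- (A + 1) / (2 * B)"] True by simp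
    qed
  qed
  then show ?thesis
    using True by simp
next
  case False
  then have "C > 0" using assms(2) by simp
  have "0 \<le> C * (A + 2 * (- B / C) * B + (- B / C)\<^sup>2 * C)"
    using assms(1)[of "- B / C"] \<open>C > 0\<close> by (intro mult_nonneg_nonneg) auto
  also have "\<dots> = A * C - B\<^sup>2"
    using \<open>C > 0\<close> by (simp add: field_simps power2_eq_square)
  finally show ?thesis by simp
qed

lemma L2_Cauchy_Schwarz:
  assumes "L2fun M f" "L2fun M g"
  shows "(LINT x|M. f x * g x)\<^sup>2 \<le> (LINT x|M. (f x)\<^sup>2) * (LINT x|M. (g x)\<^sup>2)"
proof (rule discriminant_bound)
  fix t
  note i = L2fun_mult_integrable[OF assms] L2funD(2)[OF assms(1)] L2funD(2)[OF assms(2)]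
  have "0 \<le> (LINT x|M. (f x + t * g x)\<^sup>2)"
    by (rule integral_nonneg_AE) simp
  also have "\<dots> = (LINT x|M. (f x)\<^sup>2 + 2 * t * (f x * g x) + t\<^sup>2 * (g x)\<^sup>2)"
    by (intro arg_cong[where f="integral\<^sup>L M"]) (auto simp: power2_eq_square algebra_simps)
  also have "\<dots> = (LINT x|M. (f x)\<^sup>2) + 2 * t * (LINT x|M. f x * g x) + t\<^sup>2 * (LINT x|M. (g x)\<^sup>2)"
    using i by simp
  finally show "0 \<le> \<dots>" .
qed simp

lemma L2_abs_Cauchy_Schwarz:
  assumes "L2fun M f" "L2fun M g"
  shows "\<bar>LINT x|M. f x * g x\<bar> \<le> sqrt (LINT x|M. (f x)\<^sup>2) * sqrt (LINT x|M. (g x)\<^sup>2)"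
  using real_sqrt_le_mono[OF L2_Cauchy_Schwarz[OF assms]] by (simp add: real_sqrt_mult)

lemma L2fun_abs: "L2fun M f \<Longrightarrow> L2fun M (\<lambda>x. \<bar>f x\<bar>)"
  by (auto simp: L2fun_def)

text \<open>Pairing with the constant 1. On a finite measure this hands L2 questions over to the L1
  theorems on subsequences that converge almost everywhere.\<close>

lemma L1_le_L2:
  assumes "finite_measure M" "L2fun M f"
  shows "integrable M f" "(LINT x|M. \<bar>f x\<bar>) \<le> sqrt (LINT x|M. (f x)\<^sup>2) * sqrt (measure M (space M))"
proof -
  have 1: "L2fun M (\<lambda>_. 1)"
    using assms(1) by (intro L2fun_bounded[of _ _ 1]) auto
  show "integrable M f"
    using L2fun_mult_integrable[OF assms(2) 1] by simp
  show "(LINT x|M. \<bar>f x\<bar>) \<le> sqrt (LINT x|M. (f x)\<^sup>2) * sqrt (measure M (space M))"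
    using L2_abs_Cauchy_Schwarz[OF L2fun_abs[OF assms(2)] 1] by simp
qed

section \<open>Convergence and completeness in L2\<close>

definition L2conv :: "'a measure \<Rightarrow> (nat \<Rightarrow> 'a \<Rightarrow> real) \<Rightarrow> ('a \<Rightarrow> real) \<Rightarrow> bool" where
  "L2conv M f g \<longleftrightarrow> (\<forall>n. L2fun M (f n)) \<and> L2fun M g \<and> (\<lambda>n. LINT x|M. (f n x - g x)\<^sup>2) \<longlonglongrightarrow> 0"

lemma L2convD:
  assumes "L2conv M f g"
  shows "L2fun M (f n)" "L2fun M g" "(\<lambda>n. LINT x|M. (f n x - g x)\<^sup>2) \<longlonglongrightarrow> 0"
  using assms by (auto simp: L2conv_def)

lemma L2conv_AE_subseq:
  assumes "finite_measure M" "L2conv M f g"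
  shows "\<exists>r. strict_mono r \<and> (AE x in M. (\<lambda>n. f (r n) x) \<longlonglongrightarrow> g x)"
proof -
  note L = L2convD[OF assms(2)]
  have "(\<lambda>n. LINT x|M. norm (f n x - g x)) \<longlonglongrightarrow> 0"
  proof (rule tendsto_sandwich[of "\<lambda>_. 0"])
    show "\<forall>\<^sub>F n in sequentially. 0 \<le> (LINT x|M. norm (f n x - g x))"
      by simp
    show "\<forall>\<^sub>F n in sequentially. (LINT x|M. norm (f n x - g x)) \<le> sqrt (LINT x|M. (f n x - g x)\<^sup>2) * sqrt (measure M (space M))"
      using L1_le_L2(2)[OF assms(1) L2fun_diff[OF L(1,2)]] by simp
    show "(\<lambda>n. sqrt (LINT x|M. (f n x - g x)\<^sup>2) * sqrt (measure M (space M))) \<longlonglongrightarrow> 0"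
      using tendsto_mult_right[OF tendsto_real_sqrt[OF L(3)], of "sqrt (measure M (space M))"] by simp
  qed simp
  then obtain r where r: "strict_mono r" "AE x in M. (\<lambda>n. f (r n) x - g x) \<longlonglongrightarrow> 0"
    using tendsto_L1_AE_subseq[of M "\<lambda>n x. f n x - g x"] L1_le_L2(1)[OF assms(1) L2fun_diff[OF L(1,2)]] by blast
  have "AE x in M. (\<lambda>n. f (r n) x) \<longlonglongrightarrow> g x"
    using r(2) by eventually_elim (simp add: Lim_null[symmetric])
  then show ?thesis
    using r(1) by blast
qed

lemma L2conv_AE_eq:
  assumes "finite_measure M" "L2conv M f g" "AE x in M. (\<lambda>n. f n x) \<longlonglongrightarrow> h x"
  shows "AE x in M. h x = g x"
proof -
  obtain r where r: "strict_mono r" "AE x in M. (\<lambda>n. f (r n) x) \<longlonglongrightarrow> g x"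
    using L2conv_AE_subseq[OF assms(1,2)] by blast
  show ?thesis
    using r(2) assms(3)
  proof eventually_elim
    case (elim x)
    then show ?case
      using LIMSEQ_unique LIMSEQ_subseq_LIMSEQ[OF elim(2) r(1)] by (auto simp: o_def)
  qed
qed

text \<open>Transfers pointwise bounds of mollifications to the weak derivative they approximate.
  The bounds vary with \<open>n\<close>, since they will be norms of the mollifications.\<close>

lemma L2conv_AE_le:
  assumes "finite_measure M" "L2conv M f g" "\<And>n. AE x in M. \<bar>f n x\<bar> \<le> B n" "B \<longlonglongrightarrow> b"
  shows "AE x in M. \<bar>g x\<bar> \<le> b"
proof -
  obtain r where r: "strict_mono r" "AE x in M. (\<lambda>n. f (r n) x) \<longlonglongrightarrow> g x"
    using L2conv_AE_subseq[OF assms(1,2)] by blast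
  have "AE x in M. \<forall>n. \<bar>f n x\<bar> \<le> B n"
    using assms(3) by (simp add: AE_all_countable)
  then show ?thesis
    using r(2)
  proof eventually_elim
    case (elim x)
    have "(\<lambda>n. \<bar>f (r n) x\<bar>) \<longlonglongrightarrow> \<bar>g x\<bar>"
      using elim(2) by (rule tendsto_rabs)
    moreover have "(\<lambda>n. B (r n)) \<longlonglongrightarrow> b"
      using LIMSEQ_subseq_LIMSEQ[OF assms(4) r(1)] by (simp add: o_def)
    ultimately show ?case
      using elim(1) by (intro LIMSEQ_le) auto
  qed
qed

lemma L2_norm_triangle:
  assumes "L2fun M f" "L2fun M g"
  shows "sqrt (LINT x|M. (f x + g x)\<^sup>2) \<le> sqrt (LINT x|M. (f x)\<^sup>2) + sqrt (LINT x|M. (g x)\<^sup>2)"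
proof (rule real_le_lsqrt)
  note i = L2fun_mult_integrable[OF assms] L2funD(2)[OF assms(1)] L2funD(2)[OF assms(2)]
  have "(LINT x|M. (f x + g x)\<^sup>2) = (LINT x|M. (f x)\<^sup>2 + 2 * (f x * g x) + (g x)\<^sup>2)"
    by (intro arg_cong[where f="integral\<^sup>L M"]) (auto simp: power2_eq_square algebra_simps)
  also have "\<dots> = (LINT x|M. (f x)\<^sup>2) + 2 * (LINT x|M. f x * g x) + (LINT x|M. (g x)\<^sup>2)"
    using i by simp
  also have "\<dots> \<le> (LINT x|M. (f x)\<^sup>2) + 2 * (sqrt (LINT x|M. (f x)\<^sup>2) * sqrt (LINT x|M. (g x)\<^sup>2)) + (LINT x|M. (g x)\<^sup>2)"
    using L2_abs_Cauchy_Schwarz[OF assms] by (intro add_mono mult_left_mono) auto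
  also have "\<dots> = (sqrt (LINT x|M. (f x)\<^sup>2) + sqrt (LINT x|M. (g x)\<^sup>2))\<^sup>2"
    by (simp add: power2_sum)
  finally show "(LINT x|M. (f x + g x)\<^sup>2) \<le> (sqrt (LINT x|M. (f x)\<^sup>2) + sqrt (LINT x|M. (g x)\<^sup>2))\<^sup>2" .
qed (simp_all add: integral_nonneg_AE)

lemma L2conv_square:
  assumes "L2conv M f g"
  shows "(\<lambda>n. LINT x|M. (f n x)\<^sup>2) \<longlonglongrightarrow> (LINT x|M. (g x)\<^sup>2)"
proof -
  note L = L2convD[OF assms]
  let ?N = "\<lambda>h. sqrt (LINT x|M. (h x)\<^sup>2)"
  have le: "\<bar>?N (f n) - ?N g\<bar> \<le> ?N (\<lambda>x. f n x - g x)" for n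
  proof -
    have "?N (f n) \<le> ?N (\<lambda>x. f n x - g x) + ?N g"
      using L2_norm_triangle[OF L2fun_diff[OF L(1)[of n] L(2)] L(2)] by simp
    moreover have "?N g \<le> ?N (\<lambda>x. f n x - g x) + ?N (f n)"
      using L2_norm_triangle[OF L2fun_diff[OF L(2) L(1)[of n]] L(1)[of n]] by (simp add: power2_commute)
    ultimately show ?thesis by simp
  qed
  have "(\<lambda>n. ?N (\<lambda>x. f n x - g x)) \<longlonglongrightarrow> 0"
    using tendsto_real_sqrt[OF L(3)] by simp
  then have "(\<lambda>n. ?N (f n) - ?N g) \<longlonglongrightarrow> 0"
    using Lim_null_comparison[of "\<lambda>n. ?N (f n) - ?N g" "\<lambda>n. ?N (\<lambda>x. f n x - g x)"] le by simp
  then have "(\<lambda>n. ?N (f n)) \<longlonglongrightarrow> ?N g"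
    using Lim_null by blast
  from tendsto_power[OF this, of 2] show ?thesis
    by (simp add: integral_nonneg_AE)
qed

lemma L2conv_add:
  assumes "L2conv M f g" "L2conv M f' g'"
  shows "L2conv M (\<lambda>n x. f n x + f' n x) (\<lambda>x. g x + g' x)"
proof -
  note L = L2convD[OF assms(1)] and L' = L2convD[OF assms(2)]
  have "(\<lambda>n. LINT x|M. ((f n x + f' n x) - (g x + g' x))\<^sup>2) \<longlonglongrightarrow> 0"
  proof (rule tendsto_sandwich[of "\<lambda>_. 0"])
    show "(\<lambda>n. 2 * (LINT x|M. (f n x - g x)\<^sup>2) + 2 * (LINT x|M. (f' n x - g' x)\<^sup>2)) \<longlonglongrightarrow> 0"
      using tendsto_add[OF tendsto_mult_left[OF L(3), of 2] tendsto_mult_left[OF L'(3), of 2]] by simp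
    have "(LINT x|M. ((f n x + f' n x) - (g x + g' x))\<^sup>2) \<le> 2 * (LINT x|M. (f n x - g x)\<^sup>2) + 2 * (LINT x|M. (f' n x - g' x)\<^sup>2)" for n
    proof -
      note i = L2funD(2)[OF L2fun_diff[OF L(1,2)], of n] L2funD(2)[OF L2fun_diff[OF L'(1,2)], of n]
        L2funD(2)[OF L2fun_diff[OF L2fun_add[OF L(1) L'(1)] L2fun_add[OF L(2) L'(2)]], of n n]
      have "(LINT x|M. ((f n x + f' n x) - (g x + g' x))\<^sup>2) \<le> (LINT x|M. 2 * (f n x - g x)\<^sup>2 + 2 * (f' n x - g' x)\<^sup>2)"
      proof (rule integral_mono)
        fix x
        have "((f n x + f' n x) - (g x + g' x))\<^sup>2 + ((f n x - g x) - (f' n x - g' x))\<^sup>2 = 2 * (f n x - g x)\<^sup>2 + 2 * (f' n x - g' x)\<^sup>2"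
          by (simp add: power2_eq_square algebra_simps)
        then show "((f n x + f' n x) - (g x + g' x))\<^sup>2 \<le> 2 * (f n x - g x)\<^sup>2 + 2 * (f' n x - g' x)\<^sup>2"
          by (smt (verit) zero_le_power2)
      qed (use i in auto)
      then show ?thesis
        using i by simp
    qed
    then show "\<forall>\<^sub>F n in sequentially. (LINT x|M. ((f n x + f' n x) - (g x + g' x))\<^sup>2) \<le> 2 * (LINT x|M. (f n x - g x)\<^sup>2) + 2 * (LINT x|M. (f' n x - g' x)\<^sup>2)"
      by simp
  qed (simp_all add: integral_nonneg_AE)
  then show ?thesis
    using L2fun_add[OF L(1) L'(1)] L2fun_add[OF L(2) L'(2)] by (simp add: L2conv_def)
qed

lemma L2conv_const: "L2fun M g \<Longrightarrow> L2conv M (\<lambda>_. g) g"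
  by (simp add: L2conv_def)

lemma L2conv_sum:
  assumes "finite I" "\<And>i. i \<in> I \<Longrightarrow> L2conv M (f i) (g i)"
  shows "L2conv M (\<lambda>n x. \<Sum>i\<in>I. f i n x) (\<lambda>x. \<Sum>i\<in>I. g i x)"
  using assms by (induction I rule: finite_induct) (auto intro: L2conv_add L2conv_const[OF L2fun_zero])

lemma L2conv_mult_bounded:
  assumes "L2conv M f g" "w \<in> borel_measurable M" "AE x in M. \<bar>w x\<bar> \<le> B"
  shows "L2conv M (\<lambda>n x. w x * f n x) (\<lambda>x. w x * g x)"
proof -
  note L = L2convD[OF assms(1)]
  have "(\<lambda>n. LINT x|M. (w x * f n x - w x * g x)\<^sup>2) \<longlonglongrightarrow> 0"
  proof (rule tendsto_sandwich[of "\<lambda>_. 0"])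
    show "(\<lambda>n. B\<^sup>2 * (LINT x|M. (f n x - g x)\<^sup>2)) \<longlonglongrightarrow> 0"
      using tendsto_mult_left[OF L(3), of "B\<^sup>2"] by simp
    have "(LINT x|M. (w x * f n x - w x * g x)\<^sup>2) \<le> B\<^sup>2 * (LINT x|M. (f n x - g x)\<^sup>2)" for n
    proof -
      note d = L2fun_diff[OF L(1,2), of n]
      have "(LINT x|M. (w x * f n x - w x * g x)\<^sup>2) \<le> (LINT x|M. B\<^sup>2 * (f n x - g x)\<^sup>2)"
      proof (rule integral_mono_AE)
        show "integrable M (\<lambda>x. (w x * f n x - w x * g x)\<^sup>2)"
          using L2funD(2)[OF L2fun_mult_bounded[OF d assms(2,3)]] by (simp add: right_diff_distrib)
        show "AE x in M. (w x * f n x - w x * g x)\<^sup>2 \<le> B\<^sup>2 * (f n x - g x)\<^sup>2"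
          using assms(3) by eventually_elim
            (simp add: abs_le_square_iff[symmetric] power_mult_distrib mult_right_mono flip: right_diff_distrib)
      qed (use L2funD(2)[OF d] in auto)
      then show ?thesis by simp
    qed
    then show "\<forall>\<^sub>F n in sequentially. (LINT x|M. (w x * f n x - w x * g x)\<^sup>2) \<le> B\<^sup>2 * (LINT x|M. (f n x - g x)\<^sup>2)"
      by simp
  qed (simp_all add: integral_nonneg_AE)
  then show ?thesis
    using L2fun_mult_bounded[OF _ assms(2,3)] L by (simp add: L2conv_def)
qed

lemma L2conv_integral_mult:
  assumes "L2conv M f g" "L2fun M h"
  shows "(\<lambda>n. LINT x|M. f n x * h x) \<longlonglongrightarrow> (LINT x|M. g x * h x)"
proof -
  note L = L2convD[OF assms(1)]
  have "(\<lambda>n. (LINT x|M. f n x * h x) - (LINT x|M. g x * h x)) \<longlonglongrightarrow> 0"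
  proof (rule Lim_null_comparison)
    show "(\<lambda>n. sqrt (LINT x|M. (f n x - g x)\<^sup>2) * sqrt (LINT x|M. (h x)\<^sup>2)) \<longlonglongrightarrow> 0"
      using tendsto_mult_right[OF tendsto_real_sqrt[OF L(3)]] by simp
    have "(LINT x|M. f n x * h x) - (LINT x|M. g x * h x) = (LINT x|M. (f n x - g x) * h x)" for n
      using L2fun_mult_integrable[OF L(1) assms(2)] L2fun_mult_integrable[OF L(2) assms(2)]
      by (simp add: left_diff_distrib)
    then show "\<forall>\<^sub>F n in sequentially. norm ((LINT x|M. f n x * h x) - (LINT x|M. g x * h x))
        \<le> sqrt (LINT x|M. (f n x - g x)\<^sup>2) * sqrt (LINT x|M. (h x)\<^sup>2)"
      using L2_abs_Cauchy_Schwarz[OF L2fun_diff[OF L(1,2)] assms(2)] by simp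
  qed
  then show ?thesis
    using Lim_null by blast
qed

text \<open>Riesz-Fischer by way of L1: a subsequence is Cauchy almost everywhere, its pointwise
  limit is the candidate, and Fatou's lemma turns the Cauchy estimate into L2 convergence of the
  whole sequence.\<close>

lemma L2_complete:
  assumes fin: "finite_measure M" and L: "\<And>n. L2fun M (f n)"
    and C: "\<And>e. e > 0 \<Longrightarrow> \<exists>N. \<forall>i\<ge>N. \<forall>j\<ge>N. (LINT x|M. (f i x - f j x)\<^sup>2) < e"
  shows "\<exists>g. L2conv M f g"
proof -
  interpret finite_measure M by fact
  let ?m = "measure M (space M)"
  have "\<exists>N. \<forall>i\<ge>N. \<forall>j\<ge>N. (LINT x|M. norm (f i x - f j x)) < e" if "e > 0" for e
  proof -
    have pos: "0 < (e / (sqrt ?m + 1))\<^sup>2"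
      using that by (intro zero_less_power divide_pos_pos add_nonneg_pos) auto
    obtain N where N: "\<forall>i\<ge>N. \<forall>j\<ge>N. (LINT x|M. (f i x - f j x)\<^sup>2) < (e / (sqrt ?m + 1))\<^sup>2"
      using C[OF pos] by blast
    have "(LINT x|M. norm (f i x - f j x)) < e" if "i \<ge> N" "j \<ge> N" for i j
    proof -
      have "sqrt (LINT x|M. (f i x - f j x)\<^sup>2) < e / (sqrt ?m + 1)"
        using real_sqrt_less_mono[of "LINT x|M. (f i x - f j x)\<^sup>2" "(e / (sqrt ?m + 1))\<^sup>2"] N that \<open>e > 0\<close>
        by (simp add: add_nonneg_pos)
      then have "sqrt (LINT x|M. (f i x - f j x)\<^sup>2) * (sqrt ?m + 1) < e"
        by (simp add: pos_less_divide_eq add_nonneg_pos)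
      moreover have "(LINT x|M. norm (f i x - f j x)) \<le> sqrt (LINT x|M. (f i x - f j x)\<^sup>2) * sqrt ?m"
        using L1_le_L2(2)[OF fin L2fun_diff[OF L L]] by simp
      moreover have "sqrt (LINT x|M. (f i x - f j x)\<^sup>2) * sqrt ?m \<le> sqrt (LINT x|M. (f i x - f j x)\<^sup>2) * (sqrt ?m + 1)"
        by (intro mult_left_mono) (auto simp: integral_nonneg_AE)
      ultimately show ?thesis by linarith
    qed
    then show ?thesis by blast
  qed
  from cauchy_L1_AE_cauchy_subseq[OF L1_le_L2(1)[OF fin L] this]
  obtain r where r: "strict_mono r" "AE x in M. Cauchy (\<lambda>i. f (r i) x)"
    by blast
  define g where "g x = lim (\<lambda>i. f (r i) x)" for x
  have [measurable]: "f n \<in> borel_measurable M" for n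
    using L by (simp add: L2fun_def)
  have gm [measurable]: "g \<in> borel_measurable M"
    unfolding g_def by measurable
  have lim: "AE x in M. (\<lambda>i. f (r i) x) \<longlonglongrightarrow> g x"
    using r(2) by eventually_elim (simp add: g_def Cauchy_convergent_iff convergent_LIMSEQ_iff)
  \<comment> \<open>Fatou along the subsequence \<open>r\<close>; as \<open>r i \<ge> i\<close>, the
    Cauchy bound is available for all \<open>i \<ge> N\<close>.\<close>
  have fatou: "(\<integral>\<^sup>+x. ennreal ((f n x - g x)\<^sup>2) \<partial>M) \<le> ennreal e" if "\<forall>i\<ge>N. \<forall>j\<ge>N. (LINT x|M. (f i x - f j x)\<^sup>2) < e" "n \<ge> N" for n N e
  proof -
    have "(\<integral>\<^sup>+x. ennreal ((f n x - g x)\<^sup>2) \<partial>M) = (\<integral>\<^sup>+x. liminf (\<lambda>i. ennreal ((f n x - f (r i) x)\<^sup>2)) \<partial>M)"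
    proof (rule nn_integral_cong_AE)
      show "AE x in M. ennreal ((f n x - g x)\<^sup>2) = liminf (\<lambda>i. ennreal ((f n x - f (r i) x)\<^sup>2))"
        using lim
      proof eventually_elim
        case (elim x)
        then have "(\<lambda>i. ennreal ((f n x - f (r i) x)\<^sup>2)) \<longlonglongrightarrow> ennreal ((f n x - g x)\<^sup>2)"
          by (intro tendsto_intros) auto
        then show ?case
          by (intro lim_imp_Liminf[symmetric]) simp_all
      qed
    qed
    also have "\<dots> \<le> liminf (\<lambda>i. \<integral>\<^sup>+x. ennreal ((f n x - f (r i) x)\<^sup>2) \<partial>M)"
      by (rule nn_integral_liminf) simp
    also have "\<dots> \<le> liminf (\<lambda>i. ennreal e)"
    proof (rule Liminf_mono)
      have "(\<integral>\<^sup>+x. ennreal ((f n x - f (r i) x)\<^sup>2) \<partial>M) \<le> ennreal e" if "i \<ge> N" for i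
      proof -
        have "r i \<ge> N"
          using that seq_suble[OF r(1), of i] by simp
        then have "(LINT x|M. (f n x - f (r i) x)\<^sup>2) \<le> e"
          using \<open>n \<ge> N\<close> \<open>\<forall>i\<ge>N. \<forall>j\<ge>N. (LINT x|M. (f i x - f j x)\<^sup>2) < e\<close> by (meson less_imp_le)
        then show ?thesis
          using nn_integral_eq_integral[OF L2funD(2)[OF L2fun_diff[OF L L]], of n "r i"] by (simp add: ennreal_leI)
      qed
      then show "\<forall>\<^sub>F i in sequentially. (\<integral>\<^sup>+x. ennreal ((f n x - f (r i) x)\<^sup>2) \<partial>M) \<le> ennreal e"
        by (auto simp: eventually_sequentially)
    qed
    finally show ?thesis
      by (simp add: Liminf_const)
  qed
  obtain N0 where N0: "\<forall>i\<ge>N0. \<forall>j\<ge>N0. (LINT x|M. (f i x - f j x)\<^sup>2) < 1"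
    using C[of 1] by auto
  have "(\<integral>\<^sup>+x. ennreal ((f N0 x - g x)\<^sup>2) \<partial>M) < \<infinity>"
    using le_less_trans[OF fatou[OF N0 order_refl] ennreal_less_top] by simp
  then have "L2fun M (\<lambda>x. f N0 x - g x)"
    by (simp add: L2fun_def integrable_iff_bounded)
  from L2fun_diff[OF L[of N0] this] have g: "L2fun M g"
    by simp
  have "(\<lambda>n. LINT x|M. (f n x - g x)\<^sup>2) \<longlonglongrightarrow> 0"
  proof (rule LIMSEQ_I)
    fix e :: real assume "e > 0"
    then obtain N where N: "\<forall>i\<ge>N. \<forall>j\<ge>N. (LINT x|M. (f i x - f j x)\<^sup>2) < e / 2"
      using C[of "e / 2"] by auto
    have "norm ((LINT x|M. (f n x - g x)\<^sup>2) - 0) < e" if "n \<ge> N" for n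
    proof -
      have "ennreal (LINT x|M. (f n x - g x)\<^sup>2) \<le> ennreal (e / 2)"
        using fatou[OF N that] nn_integral_eq_integral[OF L2funD(2)[OF L2fun_diff[OF L g]], of n] by simp
      then have "(LINT x|M. (f n x - g x)\<^sup>2) \<le> e / 2"
        using \<open>e > 0\<close> by (simp add: ennreal_le_iff)
      then show ?thesis
        using \<open>e > 0\<close> by (simp add: integral_nonneg_AE)
    qed
    then show "\<exists>N. \<forall>n\<ge>N. norm ((LINT x|M. (f n x - g x)\<^sup>2) - 0) < e"
      by blast
  qed
  then show ?thesis
    using L g by (auto simp: L2conv_def)
qed

subsection \<open>The cube\<close>

abbreviation ccube :: "real \<Rightarrow> (real^'n::finite) set" where
  "ccube R \<equiv> cbox (\<chi> i. - R) (\<chi> i. R)"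

lemma mem_ccube: "x \<in> ccube R \<longleftrightarrow> (\<forall>i. \<bar>x $ i\<bar> \<le> R)"
  by (auto simp: mem_box_cart abs_le_iff) (metis minus_le_iff)+

lemma mem_cube: "x \<in> cube R \<longleftrightarrow> (\<forall>i. \<bar>x $ i\<bar> < R)"
  by (auto simp: cube_def abs_less_iff) (metis minus_less_iff)+

lemma cube_eq_box: "cube R = box (\<chi> i. - R) (\<chi> i. R)"
  by (auto simp: cube_def mem_box_cart)

lemma open_cube [simp]: "open (cube R)"
  by (simp add: cube_eq_box open_box)

lemma cube_subset_ccube: "cube R \<subseteq> ccube R"
  by (simp add: cube_eq_box box_subset_cbox)

lemma closure_cube:
  assumes "R > 0"
  shows "closure (cube R) = (ccube R :: (real^'n::finite) set)"
proof -
  have "(0::real^'n) \<in> box (\<chi> i. - R) (\<chi> i. R)"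
    using assms by (simp add: mem_box_cart)
  then show ?thesis
    unfolding cube_eq_box by (intro closure_box) auto
qed

lemma lmeasurable_cube [simp]: "cube R \<in> lmeasurable"
  by (simp add: cube_eq_box)

lemma sets_cube [simp]: "cube R \<in> sets lebesgue" "cube R \<in> sets borel"
  using lmeasurable_cube by (auto simp: cube_eq_box)

lemma norm_ccube:
  fixes x :: "real^'n::finite"
  assumes "x \<in> ccube R"
  shows "norm x \<le> real CARD('n) * R"
proof -
  have "norm x \<le> (\<Sum>i\<in>UNIV. \<bar>x $ i\<bar>)"
    by (rule norm_le_l1_cart)
  also have "\<dots> \<le> (\<Sum>i\<in>(UNIV :: 'n set). R)"
    using assms by (intro sum_mono) (simp add: mem_ccube)
  finally show ?thesis by simp
qed

abbreviation (input) cubeM :: "real \<Rightarrow> (real^'n::finite) measure" where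
  "cubeM R \<equiv> lebesgue_on (cube R)"

lemma finite_cubeM [simp]: "finite_measure (cubeM R)"
  by (simp add: finite_measure_lebesgue_on)

lemma AE_cubeM: "(AE x in cubeM R. P x) \<longleftrightarrow> (AE x in lebesgue. x \<in> cube R \<longrightarrow> P x)"
  by (subst AE_restrict_space_iff) auto

lemma AE_cubeM_ball: "(\<And>x. x \<in> cube R \<Longrightarrow> P x) \<Longrightarrow> AE x in cubeM R. P x"
  by (rule AE_I2) simp

lemma borel_measurable_cubeM:
  "f \<in> borel_measurable borel \<Longrightarrow> f \<in> borel_measurable (cubeM R)"
  by (intro measurable_restrict_space1 measurable_completion) simp

lemma continuous_cubeM:
  fixes f :: "real^'n::finite \<Rightarrow> 'b::euclidean_space"
  shows "continuous_on (cube R) f \<Longrightarrow> f \<in> borel_measurable (cubeM R)"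
  by (simp add: continuous_imp_measurable_on_sets_lebesgue)

lemma id_cubeM: "(\<lambda>x. x) \<in> measurable (cubeM R) borel"
  by (rule borel_measurable_cubeM) simp

lemma continuous_bounded_ccube:
  fixes f :: "real^'n::finite \<Rightarrow> 'b::real_normed_vector"
  assumes "continuous_on (ccube R) f"
  shows "\<exists>B\<ge>0. \<forall>x\<in>ccube R. norm (f x) \<le> B"
proof -
  have "bounded (f ` ccube R)"
    by (intro compact_imp_bounded compact_continuous_image assms compact_cbox)
  then show ?thesis
    unfolding bounded_iff by (metis (no_types, lifting) ball_imageD dual_order.trans imageI linorder_le_cases norm_ge_zero order_refl)
qed

lemma continuous_L2fun:
  fixes f :: "real^'n::finite \<Rightarrow> real"
  assumes "continuous_on (ccube R) f"
  shows "L2fun (cubeM R) f"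
proof -
  obtain B where "\<forall>x\<in>ccube R. norm (f x) \<le> B"
    using continuous_bounded_ccube[OF assms] by blast
  then have B: "\<bar>f x\<bar> \<le> B" if "x \<in> cube R" for x
    using that cube_subset_ccube by fastforce
  show ?thesis
    by (rule L2fun_bounded[where B=B])
      (auto intro!: continuous_cubeM AE_cubeM_ball B continuous_on_subset[OF assms cube_subset_ccube])
qed

text \<open>Change of variables for the mollifier kernel and for the contraction towards a point in
  the Sobolev inequality. With nonnegative integrals neither side needs an integrability
  argument.\<close>

lemma nn_integral_lborel_affine:
  fixes f :: "'a::euclidean_space \<Rightarrow> ennreal"
  assumes [measurable]: "f \<in> borel_measurable borel" and "c \<noteq> 0"
  shows "(\<integral>\<^sup>+x. f (t + c *\<^sub>R x) \<partial>lborel) = ennreal (1 / \<bar>c\<bar> ^ DIM('a)) * (\<integral>\<^sup>+x. f x \<partial>lborel)"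
proof -
  have "(\<integral>\<^sup>+x. f x \<partial>lborel) = (\<integral>\<^sup>+x. f x \<partial>density (distr lborel borel (\<lambda>x. t + c *\<^sub>R x)) (\<lambda>_. \<bar>c\<bar>^DIM('a)))"
    using lborel_affine[OF assms(2), of t] by simp
  also have "\<dots> = (\<integral>\<^sup>+x. ennreal (\<bar>c\<bar>^DIM('a)) * f (t + c *\<^sub>R x) \<partial>lborel)"
    by (subst nn_integral_density) (auto simp: nn_integral_distr)
  also have "\<dots> = ennreal (\<bar>c\<bar>^DIM('a)) * (\<integral>\<^sup>+x. f (t + c *\<^sub>R x) \<partial>lborel)"
    by (rule nn_integral_cmult) simp
  finally have "ennreal (1 / \<bar>c\<bar> ^ DIM('a)) * (\<integral>\<^sup>+x. f x \<partial>lborel)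
    = (ennreal (1 / \<bar>c\<bar> ^ DIM('a)) * ennreal (\<bar>c\<bar>^DIM('a))) * (\<integral>\<^sup>+x. f (t + c *\<^sub>R x) \<partial>lborel)"
    by (simp add: mult.assoc)
  also have "ennreal (1 / \<bar>c\<bar> ^ DIM('a)) * ennreal (\<bar>c\<bar>^DIM('a)) = 1"
    using assms(2) by (simp flip: ennreal_mult)
  finally show ?thesis by simp
qed

lemma nn_integral_cubeM:
  fixes f :: "real^'n::finite \<Rightarrow> ennreal"
  assumes [measurable]: "f \<in> borel_measurable borel"
  shows "(\<integral>\<^sup>+x. f x \<partial>cubeM R) = (\<integral>\<^sup>+x. f x * indicator (cube R) x \<partial>lborel)"
proof -
  have "(\<integral>\<^sup>+x. f x \<partial>cubeM R) = (\<integral>\<^sup>+x. f x * indicator (cube R) x \<partial>lebesgue)"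
    by (rule nn_integral_restrict_space) simp
  also have "\<dots> = (\<integral>\<^sup>+x. f x * indicator (cube R) x \<partial>lborel)"
    by (rule nn_integral_completion)
  finally show ?thesis .
qed

lemma quadratic_has_derivative:
  fixes f :: "'a::real_normed_vector \<Rightarrow> real"
  assumes "bounded_linear D" "\<And>h. \<bar>f (x + h) - f x - D h\<bar> \<le> K * (norm h)\<^sup>2"
  shows "(f has_derivative D) (at x)"
  unfolding has_derivative_at
proof
  show "bounded_linear D" by fact
  show "(\<lambda>h. norm (f (x + h) - f x - D h) / norm h) \<midarrow>0\<rightarrow> 0"
  proof (rule Lim_null_comparison)
    show "\<forall>\<^sub>F h in at 0. norm (norm (f (x + h) - f x - D h) / norm h) \<le> K * norm h"
      unfolding eventually_at_filter
      using assms(2) by (auto simp: divide_le_eq power2_eq_square mult.assoc intro!: always_eventually)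
    show "(\<lambda>h. K * norm h) \<midarrow>0\<rightarrow> 0"
      by (auto intro!: tendsto_eq_intros)
  qed
qed

subsection \<open>Convolution and mollification up to the boundary\<close>

text \<open>Phrased with an arbitrary compact set rather than the closure of the support, so that
  partial derivatives inherit it with the same set.\<close>

definition csupp :: "(real^'n::finite \<Rightarrow> real) \<Rightarrow> bool" where
  "csupp \<psi> \<longleftrightarrow> (\<exists>S. compact S \<and> (\<forall>x. x \<notin> S \<longrightarrow> \<psi> x = 0))"

lemma pderivative_outside:
  fixes \<psi> :: "real^'n::finite \<Rightarrow> real"
  assumes "closed S" "\<And>x. x \<notin> S \<Longrightarrow> \<psi> x = 0" "x \<notin> S"
  shows "pderivative i \<psi> x = 0"
proof -
  have "(\<psi> has_derivative (\<lambda>_. 0)) (at x)"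
    by (rule has_derivative_transform_within_open[of "\<lambda>_. 0" _ _ UNIV "- S"]) (use assms in auto)
  then show ?thesis
    using pderivative_eqI by fastforce
qed

lemma csupp_pderivative: "csupp \<psi> \<Longrightarrow> csupp (pderivative i \<psi>)"
  unfolding csupp_def by (meson compact_imp_closed pderivative_outside)

lemma csupp_bounded:
  assumes "csupp \<psi>" "continuous_on UNIV \<psi>"
  shows "\<exists>B\<ge>0. \<forall>x. \<bar>\<psi> x\<bar> \<le> B"
proof -
  obtain S where S: "compact S" "\<And>x. x \<notin> S \<Longrightarrow> \<psi> x = 0"
    using assms(1) by (auto simp: csupp_def)
  have "bounded (\<psi> ` S)"
    by (intro compact_imp_bounded compact_continuous_image continuous_on_subset[OF assms(2)] S) auto
  then obtain B where "\<And>x. x \<in> S \<Longrightarrow> \<bar>\<psi> x\<bar> \<le> B"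
    unfolding bounded_iff by auto
  then have "\<bar>\<psi> x\<bar> \<le> max B 0" for x
    using S(2)[of x] by (cases "x \<in> S") (auto simp: le_max_iff_disj)
  then show ?thesis
    by (intro exI[of _ "max B 0"]) auto
qed

text \<open>The second derivatives are continuous with compact support, hence globally bounded, so
  \<open>K\<close> is uniform in \<open>z\<close>. This uniformity is what later permits
  differentiation under the integral sign.\<close>

lemma csupp_taylor:
  fixes \<psi> :: "real^'n::finite \<Rightarrow> real"
  assumes "csupp \<psi>" and sm: "smooth \<psi>"
  shows "\<exists>K\<ge>0. \<forall>z h. \<bar>\<psi> (z + h) - \<psi> z - (\<Sum>i\<in>UNIV. h $ i * pderivative i \<psi> z)\<bar> \<le> K * (norm h)\<^sup>2"
proof -
  have "\<forall>i j. \<exists>B\<ge>0. \<forall>x. \<bar>pderivative j (pderivative i \<psi>) x\<bar> \<le> B"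
    by (intro allI csupp_bounded csupp_pderivative smooth_continuous smooth_pderivative assms)
  then obtain B where B: "\<And>i j. B i j \<ge> 0" "\<And>i j x. \<bar>pderivative j (pderivative i \<psi>) x\<bar> \<le> B i j"
    by metis
  define K where "K = (\<Sum>i\<in>UNIV. \<Sum>j\<in>UNIV. B i j)"
  have "K \<ge> 0"
    unfolding K_def using B by (intro sum_nonneg) auto
  moreover have "\<bar>\<psi> (z + h) - \<psi> z - (\<Sum>i\<in>UNIV. h $ i * pderivative i \<psi> z)\<bar> \<le> K * (norm h)\<^sup>2" for z h
  proof -
    define P where "P t = (\<Sum>i\<in>UNIV. h $ i * pderivative i \<psi> (z + t *\<^sub>R h))" for t
    define Q where "Q t = (\<Sum>i\<in>UNIV. h $ i * (\<Sum>j\<in>UNIV. h $ j * pderivative j (pderivative i \<psi>) (z + t *\<^sub>R h)))" for t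
    have 1: "((\<lambda>t. \<psi> (z + t *\<^sub>R h)) has_real_derivative P t) (at t)" for t
      unfolding P_def by (rule smooth_line_derivative[OF sm])
    have 2: "(P has_real_derivative Q t) (at t)" for t
      unfolding P_def Q_def
      by (intro DERIV_sum DERIV_cmult smooth_line_derivative smooth_pderivative sm)
    \<comment> \<open>The mean value theorem twice: for the function on \<open>{0..1}\<close>, then
      for its derivative \<open>P\<close> on \<open>{0..s}\<close>.\<close>
    obtain s where s: "0 < s" "s < 1" "\<psi> (z + h) - \<psi> z = P s"
      using MVT2[OF zero_less_one 1] by auto
    obtain s' where s': "P s - P 0 = s * Q s'"
      using MVT2[OF s(1) 2] by auto
    have "\<bar>Q s'\<bar> \<le> (\<Sum>i\<in>UNIV. \<bar>h $ i\<bar> * (\<Sum>j\<in>UNIV. \<bar>h $ j\<bar> * B i j))"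
      unfolding Q_def
      by (rule order_trans[OF sum_abs], rule sum_mono, unfold abs_mult, rule mult_left_mono,
          rule order_trans[OF sum_abs], rule sum_mono, unfold abs_mult, rule mult_left_mono) (use B in auto)
    also have "\<dots> \<le> (\<Sum>i\<in>UNIV. norm h * (\<Sum>j\<in>UNIV. norm h * B i j))"
      by (intro sum_mono mult_mono sum_nonneg mult_nonneg_nonneg component_le_norm_cart B order_refl) auto
    also have "\<dots> = K * (norm h)\<^sup>2"
      by (simp add: K_def sum_distrib_left sum_distrib_right power2_eq_square mult_ac)
    finally have Q: "\<bar>Q s'\<bar> \<le> K * (norm h)\<^sup>2" .
    have "\<bar>s * Q s'\<bar> \<le> 1 * \<bar>Q s'\<bar>"
      unfolding abs_mult using s by (intro mult_right_mono) auto
    then have "\<bar>P s - P 0\<bar> \<le> K * (norm h)\<^sup>2"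
      using s' Q by simp
    then show ?thesis
      using s(3) by (simp add: P_def)
  qed
  ultimately show ?thesis by blast
qed

lemma integrable_mult_bounded_continuous:
  fixes \<psi> :: "real^'n::finite \<Rightarrow> real"
  assumes M: "(\<lambda>y. y) \<in> measurable M borel" and g: "integrable M g"
    and c: "continuous_on UNIV \<psi>" and B: "\<And>x. \<bar>\<psi> x\<bar> \<le> B"
  shows "integrable M (\<lambda>y. \<psi> (z - b *\<^sub>R y) * g y)"
proof (rule Bochner_Integration.integrable_bound)
  show "integrable M (\<lambda>y. B * g y)"
    using g by simp
  have "(\<lambda>y. \<psi> (z - b *\<^sub>R y)) \<in> borel_measurable borel"
    by (intro borel_measurable_continuous_onI continuous_on_compose2[OF c] continuous_intros) auto
  from measurable_compose[OF M this] show "(\<lambda>y. \<psi> (z - b *\<^sub>R y) * g y) \<in> borel_measurable M"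
    using borel_measurable_integrable[OF g] by (intro borel_measurable_times)
  show "AE y in M. norm (\<psi> (z - b *\<^sub>R y) * g y) \<le> norm (B * g y)"
    using order_trans[OF B abs_ge_self] by (auto simp: abs_mult intro!: mult_right_mono)
qed

text \<open>Separate scales for \<open>x\<close> and \<open>y\<close>, because the mollifier below
  is centred at a contracted \<open>x\<close>.\<close>

definition conv :: "(real^'n::finite) measure \<Rightarrow> (real^'n \<Rightarrow> real) \<Rightarrow> real \<Rightarrow> real \<Rightarrow> (real^'n \<Rightarrow> real) \<Rightarrow> real^'n \<Rightarrow> real" where
  "conv M \<psi> a b g x = (LINT y|M. \<psi> (a *\<^sub>R x - b *\<^sub>R y) * g y)"

text \<open>Differentiation under the integral: the Taylor remainder of \<open>\<psi>\<close> is at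
  most \<open>K * a\<^sup>2 * (norm h)\<^sup>2\<close> for every \<open>y\<close>, and integrating
  it against \<open>|g|\<close> keeps it quadratic in \<open>h\<close>.\<close>

lemma conv_has_derivative:
  fixes \<psi> :: "real^'n::finite \<Rightarrow> real"
  assumes M: "(\<lambda>y. y) \<in> measurable M borel" and g: "integrable M g"
    and sm: "smooth \<psi>" and cs: "csupp \<psi>"
  shows "(conv M \<psi> a b g has_derivative (\<lambda>h. \<Sum>i\<in>UNIV. h $ i * (a * conv M (pderivative i \<psi>) a b g x))) (at x)"
proof -
  obtain K where K: "K \<ge> 0" "\<And>z h. \<bar>\<psi> (z + h) - \<psi> z - (\<Sum>i\<in>UNIV. h $ i * pderivative i \<psi> z)\<bar> \<le> K * (norm h)\<^sup>2"
    using csupp_taylor[OF cs sm] by blast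
  have int: "integrable M (\<lambda>y. \<phi> (z - b *\<^sub>R y) * g y)" if "smooth \<phi>" "csupp \<phi>" for \<phi> :: "real^'n \<Rightarrow> real" and z
  proof -
    obtain B where "\<And>x. \<bar>\<phi> x\<bar> \<le> B"
      using csupp_bounded[OF \<open>csupp \<phi>\<close> smooth_continuous[OF \<open>smooth \<phi>\<close>]] by blast
    then show ?thesis
      by (intro integrable_mult_bounded_continuous[OF M g smooth_continuous[OF \<open>smooth \<phi>\<close>]])
  qed
  note int1 = int[OF sm cs] and int2 = int[OF smooth_pderivative[OF sm] csupp_pderivative[OF cs]]
  show ?thesis
  proof (rule quadratic_has_derivative)
    show "bounded_linear (\<lambda>h::real^'n. \<Sum>i\<in>UNIV. h $ i * (a * conv M (pderivative i \<psi>) a b g x))"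
      by (intro bounded_linear_sum bounded_linear_mult_left[THEN bounded_linear_compose] bounded_linear_vec_nth)
    fix h :: "real^'n"
    let ?r = "\<lambda>y. \<psi> (a *\<^sub>R (x + h) - b *\<^sub>R y) - \<psi> (a *\<^sub>R x - b *\<^sub>R y) - (\<Sum>i\<in>UNIV. (a *\<^sub>R h) $ i * pderivative i \<psi> (a *\<^sub>R x - b *\<^sub>R y))"
    have eq: "?r y * g y = \<psi> (a *\<^sub>R (x + h) - b *\<^sub>R y) * g y - \<psi> (a *\<^sub>R x - b *\<^sub>R y) * g y
        - (\<Sum>i\<in>UNIV. (h $ i * a) * (pderivative i \<psi> (a *\<^sub>R x - b *\<^sub>R y) * g y))" for y
    proof -
      have "(\<Sum>i\<in>UNIV. (a *\<^sub>R h) $ i * pderivative i \<psi> (a *\<^sub>R x - b *\<^sub>R y)) * g y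
          = (\<Sum>i\<in>UNIV. (h $ i * a) * (pderivative i \<psi> (a *\<^sub>R x - b *\<^sub>R y) * g y))"
        by (simp add: sum_distrib_left mult_ac)
      then show ?thesis
        by (simp only: left_diff_distrib)
    qed
    have ir: "integrable M (\<lambda>y. ?r y * g y)"
      unfolding eq by (intro Bochner_Integration.integrable_diff Bochner_Integration.integrable_sum integrable_mult_right int1 int2)
    have eq2: "conv M \<psi> a b g (x + h) - conv M \<psi> a b g x - (\<Sum>i\<in>UNIV. h $ i * (a * conv M (pderivative i \<psi>) a b g x))
        = (LINT y|M. ?r y * g y)"
      unfolding eq conv_def using int1 int2 by (simp add: mult.assoc)
    have "\<bar>LINT y|M. ?r y * g y\<bar> \<le> (LINT y|M. \<bar>?r y * g y\<bar>)"
      by (rule integral_abs_bound)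
    also have "\<dots> \<le> (LINT y|M. (K * a\<^sup>2 * (norm h)\<^sup>2) * \<bar>g y\<bar>)"
    proof (rule integral_mono)
      fix y
      have "\<bar>?r y\<bar> \<le> K * (norm (a *\<^sub>R h))\<^sup>2"
        using K(2)[of "a *\<^sub>R x - b *\<^sub>R y" "a *\<^sub>R h"] by (simp add: algebra_simps)
      then show "\<bar>?r y * g y\<bar> \<le> (K * a\<^sup>2 * (norm h)\<^sup>2) * \<bar>g y\<bar>"
        unfolding abs_mult by (intro mult_right_mono) (auto simp: power_mult_distrib mult.assoc)
    qed (use ir g in auto)
    also have "\<dots> = (K * a\<^sup>2 * (LINT y|M. \<bar>g y\<bar>)) * (norm h)\<^sup>2"
      by simp
    finally show "\<bar>conv M \<psi> a b g (x + h) - conv M \<psi> a b g x - (\<Sum>i\<in>UNIV. h $ i * (a * conv M (pderivative i \<psi>) a b g x))\<bar>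
      \<le> (K * a\<^sup>2 * (LINT y|M. \<bar>g y\<bar>)) * (norm h)\<^sup>2"
      unfolding eq2 .
  qed
qed

lemma pderivative_conv:
  fixes \<psi> :: "real^'n::finite \<Rightarrow> real"
  assumes "(\<lambda>y. y) \<in> measurable M borel" "integrable M g" "smooth \<psi>" "csupp \<psi>"
  shows "pderivative i (\<lambda>x. k * conv M \<psi> a b g x) = (\<lambda>x. (k * a) * conv M (pderivative i \<psi>) a b g x)"
proof
  fix x
  show "pderivative i (\<lambda>x. k * conv M \<psi> a b g x) x = (k * a) * conv M (pderivative i \<psi>) a b g x"
    using pderivative_eqI[OF has_derivative_mult_right[OF conv_has_derivative[OF assms]], of i k a b x]
    by (simp only: sum_axis mult.assoc)
qed

lemma smooth_conv:
  fixes \<psi> :: "real^'n::finite \<Rightarrow> real"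
  assumes M: "(\<lambda>y. y) \<in> measurable M borel" "integrable M g" and "smooth \<psi>" "csupp \<psi>"
  shows "smooth (\<lambda>x. k * conv M \<psi> a b g x)"
proof (rule smooth_coinduct)
  let ?S = "{h. \<exists>\<psi> k. smooth \<psi> \<and> csupp \<psi> \<and> h = (\<lambda>x. k * conv M \<psi> a b g x)}"
  show "(\<lambda>x. k * conv M \<psi> a b g x) \<in> ?S"
    using assms by blast
  show "h differentiable (at x)" if "h \<in> ?S" for h x
    using that by (auto intro: differentiableI[OF has_derivative_mult_right[OF conv_has_derivative[OF M]]])
  show "pderivative i h \<in> ?S" if "h \<in> ?S" for h i
  proof -
    from that obtain \<psi> k where "smooth \<psi>" "csupp \<psi>" "h = (\<lambda>x. k * conv M \<psi> a b g x)"
      by auto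
    then show ?thesis
      unfolding mem_Collect_eq
      by (intro exI[of _ "pderivative i \<psi>"] exI[of _ "k * a"])
        (simp add: pderivative_conv[OF M] smooth_pderivative csupp_pderivative)
  qed
qed

lemma csupp_foldr: "csupp \<psi> \<Longrightarrow> csupp (foldr pderivative ks \<psi>)"
  by (induction ks) (auto intro: csupp_pderivative)

lemma mi_deriv_conv:
  fixes \<psi> :: "real^'n::finite \<Rightarrow> real"
  assumes "(\<lambda>y. y) \<in> measurable M borel" "integrable M g" "smooth \<psi>" "csupp \<psi>"
  shows "mi_deriv \<alpha> (\<lambda>x. k * conv M \<psi> a b g x) = (\<lambda>x. k * a ^ mi_order \<alpha> * conv M (mi_deriv \<alpha> \<psi>) a b g x)"
proof -
  have "foldr pderivative ks (\<lambda>x. k * conv M \<psi> a b g x)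
      = (\<lambda>x. k * a ^ length ks * conv M (foldr pderivative ks \<psi>) a b g x)" for ks
  proof (induction ks)
    case (Cons i ks)
    have "foldr pderivative (i # ks) (\<lambda>x. k * conv M \<psi> a b g x)
        = pderivative i (\<lambda>x. (k * a ^ length ks) * conv M (foldr pderivative ks \<psi>) a b g x)"
      by (simp only: foldr_Cons o_apply Cons.IH)
    also have "\<dots> = (\<lambda>x. (k * a ^ length ks * a) * conv M (pderivative i (foldr pderivative ks \<psi>)) a b g x)"
      by (rule pderivative_conv[OF assms(1,2) smooth_foldr[OF assms(3)] csupp_foldr[OF assms(4)]])
    also have "k * a ^ length ks * a = k * a ^ length (i # ks)"
      by simp
    finally show ?case
      by (simp only: foldr_Cons o_apply)
  qed simp
  then show ?thesis
    by (simp add: mi_deriv_mi_list length_mi_list)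
qed

text \<open>Truncate \<open>g\<close>, then approximate the truncation almost everywhere by
  continuous functions. These are truncated at the same level, so dominated convergence applies on
  the finite measure of the cube.\<close>

lemma L2_continuous_dense:
  fixes g :: "real^'n::finite \<Rightarrow> real"
  assumes g: "L2fun (cubeM R) g" and "e > 0"
  shows "\<exists>c. continuous_on UNIV c \<and> L2fun (cubeM R) c \<and> (LINT x|cubeM R. (g x - c x)\<^sup>2) < e"
proof -
  let ?M = "cubeM R :: (real^'n) measure"
  interpret finite_measure ?M by simp
  define cl where "cl B t = max (- B) (min B t)" for B t :: real
  have cl_le: "\<bar>cl B t\<bar> \<le> B" if "B \<ge> 0" for B t
    using that by (auto simp: cl_def)
  have [measurable]: "g \<in> borel_measurable ?M"
    using g by (simp add: L2fun_def)
  have "(\<lambda>n. LINT x|?M. (g x - cl (real n) (g x))\<^sup>2) \<longlonglongrightarrow> (LINT x|?M. 0)"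
  proof (rule integral_dominated_convergence[where w="\<lambda>x. (g x)\<^sup>2"])
    show "AE x in ?M. (\<lambda>n. (g x - cl (real n) (g x))\<^sup>2) \<longlonglongrightarrow> 0"
    proof (rule AE_I2)
      fix x
      obtain N :: nat where "\<bar>g x\<bar> \<le> N"
        using real_arch_simple by blast
      then have "\<forall>n\<ge>N. (g x - cl (real n) (g x))\<^sup>2 = 0"
        by (auto simp: cl_def)
      then show "(\<lambda>n. (g x - cl (real n) (g x))\<^sup>2) \<longlonglongrightarrow> 0"
        by (intro tendsto_eventually) (auto simp: eventually_sequentially)
    qed
    show "AE x in ?M. norm ((g x - cl (real n) (g x))\<^sup>2) \<le> (g x)\<^sup>2" for n
      by (rule AE_I2) (auto simp: cl_def abs_le_square_iff[symmetric])
    show "integrable ?M (\<lambda>x. (g x)\<^sup>2)"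
      using g by (simp add: L2fun_def)
  qed (auto simp: cl_def)
  then obtain n where n: "(LINT x|?M. (g x - cl (real n) (g x))\<^sup>2) < e / 4"
    using \<open>e > 0\<close> by (auto dest!: LIMSEQ_D[where r="e/4"])
  let ?g = "\<lambda>x. cl (real n) (g x)"
  have gm: "?g \<in> borel_measurable ?M"
    by (auto simp: cl_def)
  then have "?g measurable_on cube R"
    by (simp add: measurable_on_iff_borel_measurable)
  \<comment> \<open>\<open>measurable_on\<close> supplies continuous functions that converge off a
    negligible set.\<close>
  then obtain N h where N: "negligible N" and h: "\<And>k. continuous_on UNIV (h k)"
    and lim: "\<And>x. x \<notin> N \<Longrightarrow> (\<lambda>k. h k x) \<longlonglongrightarrow> (if x \<in> cube R then ?g x else 0)"
    unfolding measurable_on_def by blast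
  have hc: "continuous_on UNIV (\<lambda>x. cl (real n) (h k x))" for k
    unfolding cl_def by (intro continuous_intros h)
  have hm [measurable]: "(\<lambda>x. cl (real n) (h k x)) \<in> borel_measurable ?M" for k
    by (intro borel_measurable_cubeM borel_measurable_continuous_onI hc)
  have "(\<lambda>k. LINT x|?M. (?g x - cl (real n) (h k x))\<^sup>2) \<longlonglongrightarrow> (LINT x|?M. 0)"
  proof (rule integral_dominated_convergence[where w="\<lambda>x. (2 * real n)\<^sup>2"])
    have "AE x in lebesgue. x \<notin> N"
      using N by (simp add: negligible_iff_null_sets AE_not_in)
    then show "AE x in ?M. (\<lambda>k. (?g x - cl (real n) (h k x))\<^sup>2) \<longlonglongrightarrow> 0"
      unfolding AE_cubeM
    proof eventually_elim
      case (elim x)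
      show ?case
      proof
        assume x: "x \<in> cube R"
        have "(\<lambda>k. (?g x - cl (real n) (h k x))\<^sup>2) \<longlonglongrightarrow> (?g x - cl (real n) (?g x))\<^sup>2"
          using lim[OF elim] x unfolding cl_def by (intro tendsto_intros) simp
        then show "(\<lambda>k. (?g x - cl (real n) (h k x))\<^sup>2) \<longlonglongrightarrow> 0"
          by (simp add: cl_def)
      qed
    qed
    show "AE x in ?M. norm ((?g x - cl (real n) (h k x))\<^sup>2) \<le> (2 * real n)\<^sup>2" for k
    proof (rule AE_I2)
      fix x
      have "\<bar>?g x - cl (real n) (h k x)\<bar> \<le> \<bar>2 * real n\<bar>"
        using cl_le[of "real n" "g x"] cl_le[of "real n" "h k x"] by simp
      then show "norm ((?g x - cl (real n) (h k x))\<^sup>2) \<le> (2 * real n)\<^sup>2"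
        unfolding abs_le_square_iff by simp
    qed
  qed (use gm hm in auto)
  then obtain k where k: "(LINT x|?M. (?g x - cl (real n) (h k x))\<^sup>2) < e / 4"
    using \<open>e > 0\<close> by (auto dest!: LIMSEQ_D[where r="e/4"])
  let ?c = "\<lambda>x. cl (real n) (h k x)"
  have L1: "L2fun ?M ?g" "L2fun ?M ?c"
    by (auto intro!: L2fun_bounded[of _ _ "real n"] cl_le simp: gm hm)
  note L = L2fun_diff[OF g L1(1)] L2fun_diff[OF L1]
  let ?N = "\<lambda>h. sqrt (LINT x|?M. (h x)\<^sup>2)"
  \<comment> \<open>Both squared distances are below \<open>e / 4\<close>, so the two norms sum to
    less than \<open>sqrt e\<close>.\<close>
  have s: "sqrt (e / 4) = sqrt e / 2"
    by (simp add: real_sqrt_divide)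
  have "?N (\<lambda>x. g x - ?c x) \<le> ?N (\<lambda>x. g x - ?g x) + ?N (\<lambda>x. ?g x - ?c x)"
    using L2_norm_triangle[OF L] by simp
  also have "\<dots> < sqrt e / 2 + sqrt e / 2"
    using real_sqrt_less_mono[OF n] real_sqrt_less_mono[OF k] unfolding s by (rule add_strict_mono)
  finally have "(LINT x|?M. (g x - ?c x)\<^sup>2) < e"
    by simp
  then show ?thesis
    using hc L1(2) by blast
qed

lemma ennreal_mult3:
  "0 \<le> a \<Longrightarrow> 0 \<le> b \<Longrightarrow> 0 \<le> c \<Longrightarrow> ennreal a * (ennreal b * ennreal c) = ennreal (a * (b * c))"
  by (simp add: ennreal_mult)

section \<open>The contracted mollifier\<close>

text \<open>Positivity in the open cube gives the bump a positive mass for normalization; vanishing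
  outside it localizes the kernel.\<close>

locale smooth_bump =
  fixes \<eta> :: "real^'n::finite \<Rightarrow> real" and R :: real
  assumes R: "R > 0" and sm: "smooth \<eta>"
    and pos: "\<And>x. x \<in> cube R \<Longrightarrow> \<eta> x > 0" and zero: "\<And>x. x \<notin> cube R \<Longrightarrow> \<eta> x = 0"
begin

lemma nonneg: "\<eta> x \<ge> 0"
  using pos[of x] zero[of x] by (cases "x \<in> cube R") auto

lemma continuous: "continuous_on S \<eta>"
  by (rule smooth_continuous[OF sm])

lemma csupp: "csupp \<eta>"
  unfolding csupp_def
  by (rule exI[of _ "ccube R"]) (use cube_subset_ccube zero in auto)

lemma meas [measurable]: "\<eta> \<in> borel_measurable borel"
  by (rule borel_measurable_continuous_onI[OF continuous])

lemma bounded: "\<exists>B\<ge>0. \<forall>x. \<bar>\<eta> x\<bar> \<le> B"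
  by (rule csupp_bounded[OF csupp continuous])

definition mass :: real where
  "mass = enn2real (\<integral>\<^sup>+x. ennreal (\<eta> x) \<partial>lborel)"

lemma mass: "(\<integral>\<^sup>+x. ennreal (\<eta> x) \<partial>lborel) = ennreal mass" "mass > 0"
proof -
  obtain B where B: "B \<ge> 0" "\<And>x. \<bar>\<eta> x\<bar> \<le> B"
    using bounded by blast
  have "(\<integral>\<^sup>+x. ennreal (\<eta> x) \<partial>lborel) \<le> (\<integral>\<^sup>+x. ennreal B * indicator (ccube R :: (real^'n) set) x \<partial>lborel)"
  proof (rule nn_integral_mono)
    fix x
    show "ennreal (\<eta> x) \<le> ennreal B * indicator (ccube R) x"
      using B(2)[of x] zero[of x] cube_subset_ccube[of R] by (cases "x \<in> cube R") (auto intro!: ennreal_leI)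
  qed
  also have "\<dots> < \<infinity>"
    using emeasure_lborel_cbox_finite[of "(\<chi> i. - R)::real^'n" "\<chi> i. R"]
    by (simp add: nn_integral_cmult ennreal_mult_less_top)
  finally have fin: "(\<integral>\<^sup>+x. ennreal (\<eta> x) \<partial>lborel) < \<infinity>" .
  then show 1: "(\<integral>\<^sup>+x. ennreal (\<eta> x) \<partial>lborel) = ennreal mass"
    by (simp add: mass_def less_top)
  have "(\<integral>\<^sup>+x. ennreal (\<eta> x) \<partial>lborel) \<noteq> 0"
  proof
    assume "(\<integral>\<^sup>+x. ennreal (\<eta> x) \<partial>lborel) = 0"
    then have "AE x in lborel. ennreal (\<eta> x) = 0"
      by (subst (asm) nn_integral_0_iff_AE) auto
    then have "AE x::real^'n in lborel. x \<notin> cube R"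
      by eventually_elim (use pos in force)
    then have "AE x::real^'n in lebesgue. x \<notin> cube R"
      by (rule AE_completion)
    then have "negligible (cube R :: (real^'n) set)"
      by (simp add: negligible_iff_null_sets AE_iff_null_sets)
    moreover have "(0 :: real^'n) \<in> cube R"
      using R by (simp add: mem_cube)
    ultimately show False
      using open_not_negligible[OF open_cube] by blast
  qed
  then show "mass > 0"
    by (metis 1 ennreal_eq_0_iff linorder_not_le)
qed

text \<open>A mollifier centred at \<open>(1 - 2\<epsilon>) x\<close> instead of \<open>x\<close>: for every \<open>x\<close> in the closed cube the support
  in \<open>y\<close> is a compact subset of the open cube, so that weak derivatives may be tested with it up to
  the boundary.\<close>

definition kernel :: "real \<Rightarrow> real^'n \<Rightarrow> real^'n \<Rightarrow> real" where
  "kernel \<epsilon> x y = 1 / (\<epsilon> ^ CARD('n) * mass) * \<eta> (((1 - 2 * \<epsilon>) / \<epsilon>) *\<^sub>R x - (1 / \<epsilon>) *\<^sub>R y)"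

definition moll :: "real \<Rightarrow> (real^'n \<Rightarrow> real) \<Rightarrow> real^'n \<Rightarrow> real" where
  "moll \<epsilon> g x = 1 / (\<epsilon> ^ CARD('n) * mass) * conv (cubeM R) \<eta> ((1 - 2 * \<epsilon>) / \<epsilon>) (1 / \<epsilon>) g x"

context
  fixes \<epsilon> :: real
  assumes \<epsilon>: "0 < \<epsilon>" "\<epsilon> \<le> 1/4"
begin

lemma kernel_nonneg: "kernel \<epsilon> x y \<ge> 0"
  using \<epsilon> mass nonneg by (simp add: kernel_def)

text \<open>The argument of \<open>\<eta>\<close> lies in the closed cube only if \<open>y\<close>
  is within \<open>\<epsilon> * R\<close> of \<open>(1 - 2 * \<epsilon>) *\<^sub>R x\<close> in each
  coordinate. Of the room \<open>2 * \<epsilon> * R\<close> gained by the contraction, half is spent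
  on this and half remains as distance to the boundary.\<close>

lemma kernel_support_scaled:
  fixes x y :: "real^'n"
  assumes "x \<in> ccube R" "((1 - 2 * \<epsilon>) / \<epsilon>) *\<^sub>R x - (1 / \<epsilon>) *\<^sub>R y \<in> ccube R"
  shows "y \<in> ccube ((1 - \<epsilon>) * R)" "norm (x - y) \<le> 3 * \<epsilon> * (real CARD('n) * R)"
proof -
  have key: "\<bar>(1 - 2 * \<epsilon>) * x $ i - y $ i\<bar> \<le> \<epsilon> * R" for i
  proof -
    have "\<bar>((1 - 2 * \<epsilon>) / \<epsilon>) * x $ i - (1 / \<epsilon>) * y $ i\<bar> \<le> R"
      using assms(2) unfolding mem_ccube by auto
    then have "\<epsilon> * \<bar>((1 - 2 * \<epsilon>) / \<epsilon>) * x $ i - (1 / \<epsilon>) * y $ i\<bar> \<le> \<epsilon> * R"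
      using \<epsilon> by (intro mult_left_mono) auto
    also have "\<epsilon> * \<bar>((1 - 2 * \<epsilon>) / \<epsilon>) * x $ i - (1 / \<epsilon>) * y $ i\<bar> = \<bar>\<epsilon> * (((1 - 2 * \<epsilon>) / \<epsilon>) * x $ i - (1 / \<epsilon>) * y $ i)\<bar>"
      using \<epsilon> by (simp add: abs_mult)
    also have "\<epsilon> * (((1 - 2 * \<epsilon>) / \<epsilon>) * x $ i - (1 / \<epsilon>) * y $ i) = (1 - 2 * \<epsilon>) * x $ i - y $ i"
      using \<epsilon> by (simp add: field_simps)
    finally show ?thesis .
  qed
  have xi: "\<bar>x $ i\<bar> \<le> R" for i
    using assms(1) by (simp add: mem_ccube)
  have 1: "\<bar>(1 - 2 * \<epsilon>) * x $ i\<bar> \<le> (1 - 2 * \<epsilon>) * R" for i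
    unfolding abs_mult using \<epsilon> xi by (intro mult_mono) auto
  have "\<bar>y $ i\<bar> \<le> (1 - 2 * \<epsilon>) * R + \<epsilon> * R" for i
    using key[of i] 1[of i] by linarith
  then show "y \<in> ccube ((1 - \<epsilon>) * R)"
    unfolding mem_ccube by (simp add: algebra_simps)
  have 2: "\<bar>2 * \<epsilon> * x $ i\<bar> \<le> 2 * \<epsilon> * R" for i
    unfolding abs_mult using \<epsilon> xi by (intro mult_mono) auto
  have 3: "x $ i - y $ i = ((1 - 2 * \<epsilon>) * x $ i - y $ i) + 2 * \<epsilon> * x $ i" for i
    by (simp add: algebra_simps)
  have "\<bar>x $ i - y $ i\<bar> \<le> \<epsilon> * R + 2 * \<epsilon> * R" for i
    using key[of i] 2[of i] unfolding 3 by linarith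
  then have "x - y \<in> ccube (3 * \<epsilon> * R)"
    unfolding mem_ccube by (simp add: algebra_simps)
  from norm_ccube[OF this] show "norm (x - y) \<le> 3 * \<epsilon> * (real CARD('n) * R)"
    by (simp add: mult_ac)
qed

lemma kernel_support:
  assumes "x \<in> ccube R" "kernel \<epsilon> x y \<noteq> 0"
  shows "y \<in> cube R" "norm (x - y) \<le> 3 * \<epsilon> * (real CARD('n) * R)"
proof -
  have "((1 - 2 * \<epsilon>) / \<epsilon>) *\<^sub>R x - (1 / \<epsilon>) *\<^sub>R y \<in> ccube R"
    using assms(2) zero cube_subset_ccube by (fastforce simp: kernel_def)
  note s = kernel_support_scaled[OF assms(1) this]
  show "norm (x - y) \<le> 3 * \<epsilon> * (real CARD('n) * R)" by (rule s)
  have "(1 - \<epsilon>) * R < R"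
    using \<epsilon> R by (simp add: algebra_simps)
  then show "y \<in> cube R"
    using s(1) le_less_trans by (auto simp: mem_ccube mem_cube)
qed

text \<open>Joint measurability for Tonelli. It goes through the Borel sets of the product, where
  continuity of the kernel suffices.\<close>

lemma kernel_meas [measurable]:
  "(\<lambda>(x, y). kernel \<epsilon> x y) \<in> borel_measurable (cubeM R \<Otimes>\<^sub>M cubeM R)"
proof -
  have 1: "(\<lambda>p. (fst p, snd p)) \<in> measurable (cubeM R \<Otimes>\<^sub>M cubeM R) (borel \<Otimes>\<^sub>M borel :: ((real^'n) \<times> (real^'n)) measure)"
    by (intro measurable_Pair measurable_compose[OF measurable_fst id_cubeM] measurable_compose[OF measurable_snd id_cubeM])
  have "(\<lambda>p. kernel \<epsilon> (fst p) (snd p)) \<in> borel_measurable borel"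
    unfolding kernel_def
    by (intro borel_measurable_continuous_onI continuous_intros continuous_on_compose2[OF continuous[of UNIV]]) auto
  from measurable_compose[OF 1[unfolded borel_prod] this] show ?thesis
    by (simp add: split_def)
qed

lemma kernel_cont: "continuous_on S (kernel \<epsilon> x)" "continuous_on S (\<lambda>x. kernel \<epsilon> x y)"
  unfolding kernel_def
  by (intro continuous_intros continuous_on_compose2[OF continuous[of UNIV]]; auto)+

lemma nn_integral_kernel_y:
  "(\<integral>\<^sup>+y. ennreal (kernel \<epsilon> x y) \<partial>lborel) = 1"
proof -
  let ?k = "1 / (\<epsilon> ^ CARD('n) * mass)"
  have "(\<integral>\<^sup>+y. ennreal (kernel \<epsilon> x y) \<partial>lborel)
     = (\<integral>\<^sup>+y. ennreal ?k * ennreal (\<eta> (((1 - 2 * \<epsilon>) / \<epsilon>) *\<^sub>R x + (- 1 / \<epsilon>) *\<^sub>R y)) \<partial>lborel)"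
    unfolding kernel_def using \<epsilon> mass nonneg by (subst ennreal_mult) auto
  also have "\<dots> = ennreal ?k * (\<integral>\<^sup>+y. ennreal (\<eta> (((1 - 2 * \<epsilon>) / \<epsilon>) *\<^sub>R x + (- 1 / \<epsilon>) *\<^sub>R y)) \<partial>lborel)"
    by (rule nn_integral_cmult) simp
  also have "\<dots> = ennreal ?k * (ennreal (1 / \<bar>- 1 / \<epsilon>\<bar> ^ CARD('n)) * ennreal mass)"
    using nn_integral_lborel_affine[of "\<lambda>y. ennreal (\<eta> y)" "- 1 / \<epsilon>" "((1 - 2 * \<epsilon>) / \<epsilon>) *\<^sub>R x"] \<epsilon> mass(1) by simp
  also have "\<dots> = ennreal (?k * ((1 / \<bar>- 1 / \<epsilon>\<bar> ^ CARD('n)) * mass))"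
    using \<epsilon> mass(2) by (intro ennreal_mult3) auto
  also have "?k * ((1 / \<bar>- 1 / \<epsilon>\<bar> ^ CARD('n)) * mass) = 1"
    using \<epsilon> mass(2) by (simp add: field_simps power_divide)
  finally show ?thesis by simp
qed

text \<open>After normalization the contraction leaves the factor
  \<open>(1 / (1 - 2 * \<epsilon>)) ^ CARD('n)\<close>, and \<open>\<epsilon> \<le> 1/4\<close>.
  With the unit integral in \<open>y\<close> this supplies the two bounds of Schur's test.\<close>

lemma nn_integral_kernel_x:
  "(\<integral>\<^sup>+x. ennreal (kernel \<epsilon> x y) \<partial>lborel) \<le> ennreal (2 ^ CARD('n))"
proof -
  let ?k = "1 / (\<epsilon> ^ CARD('n) * mass)" and ?a = "(1 - 2 * \<epsilon>) / \<epsilon>"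
  have a: "?a > 0" using \<epsilon> by simp
  have "(\<integral>\<^sup>+x. ennreal (kernel \<epsilon> x y) \<partial>lborel)
     = (\<integral>\<^sup>+x. ennreal ?k * ennreal (\<eta> (- ((1 / \<epsilon>) *\<^sub>R y) + ?a *\<^sub>R x)) \<partial>lborel)"
    unfolding kernel_def using \<epsilon> mass nonneg by (subst ennreal_mult) (auto simp: algebra_simps)
  also have "\<dots> = ennreal ?k * (\<integral>\<^sup>+x. ennreal (\<eta> (- ((1 / \<epsilon>) *\<^sub>R y) + ?a *\<^sub>R x)) \<partial>lborel)"
    by (rule nn_integral_cmult) simp
  also have "\<dots> = ennreal ?k * (ennreal (1 / \<bar>?a\<bar> ^ CARD('n)) * ennreal mass)"
    using a \<epsilon> by (subst nn_integral_lborel_affine[of "\<lambda>y. ennreal (\<eta> y)"]) (simp_all add: mass(1))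
  also have "\<dots> = ennreal (?k * ((1 / \<bar>?a\<bar> ^ CARD('n)) * mass))"
    using \<epsilon> mass(2) by (intro ennreal_mult3) auto
  also have "?k * ((1 / \<bar>?a\<bar> ^ CARD('n)) * mass) = (1 / (1 - 2 * \<epsilon>)) ^ CARD('n)"
    using \<epsilon> mass(2) by (simp add: field_simps power_divide)
  also have "ennreal \<dots> \<le> ennreal (2 ^ CARD('n))"
    using \<epsilon> by (intro ennreal_leI power_mono) (auto simp: field_simps)
  finally show ?thesis .
qed

text \<open>For \<open>x\<close> in the closed cube the whole support in \<open>y\<close> lies
  inside the open cube, so restricting the integral loses no mass.\<close>

lemma integral_kernel:
  "integrable (cubeM R) (kernel \<epsilon> x)" "(LINT y|cubeM R. kernel \<epsilon> x y) \<le> 1"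
  "x \<in> ccube R \<Longrightarrow> (LINT y|cubeM R. kernel \<epsilon> x y) = 1"
proof -
  have m: "kernel \<epsilon> x \<in> borel_measurable borel"
    by (rule borel_measurable_continuous_onI[OF kernel_cont(1)])
  have m': "kernel \<epsilon> x \<in> borel_measurable (cubeM R)"
    by (rule borel_measurable_cubeM[OF m])
  have nn: "(\<integral>\<^sup>+y. ennreal (kernel \<epsilon> x y) \<partial>cubeM R) = (\<integral>\<^sup>+y. ennreal (kernel \<epsilon> x y) * indicator (cube R) y \<partial>lborel)"
    using m by (intro nn_integral_cubeM) simp
  also have "\<dots> \<le> (\<integral>\<^sup>+y. ennreal (kernel \<epsilon> x y) \<partial>lborel)"
    by (intro nn_integral_mono) (auto simp: indicator_def)
  finally have le: "(\<integral>\<^sup>+y. ennreal (kernel \<epsilon> x y) \<partial>cubeM R) \<le> 1"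
    by (simp add: nn_integral_kernel_y)
  show i: "integrable (cubeM R) (kernel \<epsilon> x)"
    using le m' le_less_trans[OF le] by (intro integrableI_nonneg) (auto simp: kernel_nonneg)
  note eq = nn_integral_eq_integral[OF i]
  show "(LINT y|cubeM R. kernel \<epsilon> x y) \<le> 1"
    using le eq by (simp add: kernel_nonneg)
  assume x: "x \<in> ccube R"
  have "(\<integral>\<^sup>+y. ennreal (kernel \<epsilon> x y) * indicator (cube R) y \<partial>lborel) = (\<integral>\<^sup>+y. ennreal (kernel \<epsilon> x y) \<partial>lborel)"
  proof (rule nn_integral_cong)
    fix y
    show "ennreal (kernel \<epsilon> x y) * indicator (cube R) y = ennreal (kernel \<epsilon> x y)"
      using kernel_support(1)[OF x, of y] by (cases "kernel \<epsilon> x y = 0") auto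
  qed
  then have "ennreal (LINT y|cubeM R. kernel \<epsilon> x y) = 1"
    using nn eq by (simp add: kernel_nonneg nn_integral_kernel_y)
  then show "(LINT y|cubeM R. kernel \<epsilon> x y) = 1"
    by simp
qed

lemma kernel_bounded: "\<exists>B\<ge>0. \<forall>x y. kernel \<epsilon> x y \<le> B"
proof -
  obtain B where B: "B \<ge> 0" "\<And>x. \<bar>\<eta> x\<bar> \<le> B"
    using bounded by blast
  have "kernel \<epsilon> x y \<le> 1 / (\<epsilon> ^ CARD('n) * mass) * B" for x y
    unfolding kernel_def using order_trans[OF abs_ge_self B(2)] \<epsilon> mass by (intro mult_left_mono) auto
  then show ?thesis
    using B \<epsilon> mass(2) by (intro exI[of _ "1 / (\<epsilon> ^ CARD('n) * mass) * B"]) auto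
qed

lemma kernel_mult_integrable:
  assumes "integrable (cubeM R) g"
  shows "integrable (cubeM R) (\<lambda>y. kernel \<epsilon> x y * g y)"
proof -
  obtain B where B: "B \<ge> 0" "\<And>x y. kernel \<epsilon> x y \<le> B"
    using kernel_bounded by blast
  have "kernel \<epsilon> x \<in> borel_measurable (cubeM R)"
    by (intro borel_measurable_cubeM borel_measurable_continuous_onI[OF kernel_cont(1)])
  then show ?thesis
    using B kernel_nonneg assms
    by (intro Bochner_Integration.integrable_bound[OF integrable_mult_right[OF assms, of B]])
      (auto simp: abs_mult intro!: mult_right_mono)
qed

lemma moll_eq: "moll \<epsilon> g x = (LINT y|cubeM R. kernel \<epsilon> x y * g y)"
  by (simp add: moll_def conv_def kernel_def mult.assoc)

lemma moll_diff:
  assumes "integrable (cubeM R) f" "integrable (cubeM R) g"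
  shows "moll \<epsilon> (\<lambda>x. f x - g x) x = moll \<epsilon> f x - moll \<epsilon> g x"
  unfolding moll_eq using assms kernel_mult_integrable by (simp add: right_diff_distrib)

lemma smooth_moll: "integrable (cubeM R) g \<Longrightarrow> smooth (moll \<epsilon> g)"
  unfolding moll_def [abs_def] by (rule smooth_conv[OF id_cubeM _ sm csupp])

text \<open>Cauchy-Schwarz with the kernel split into two factors
  \<open>sqrt (kernel \<epsilon> x y)\<close>; the kernel itself integrates to at most 1.\<close>

lemma moll_square_le:
  assumes g: "L2fun (cubeM R) g"
  shows "(moll \<epsilon> g x)\<^sup>2 \<le> (LINT y|cubeM R. kernel \<epsilon> x y * (g y)\<^sup>2)"
proof -
  obtain B where B: "B \<ge> 0" "\<And>x y. kernel \<epsilon> x y \<le> B"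
    using kernel_bounded by blast
  have m: "(\<lambda>y. sqrt (kernel \<epsilon> x y)) \<in> borel_measurable (cubeM R)"
    by (intro borel_measurable_cubeM borel_measurable_continuous_onI continuous_intros kernel_cont(1))
  have b: "\<bar>sqrt (kernel \<epsilon> x y)\<bar> \<le> sqrt B" for y
    using B kernel_nonneg by simp
  have L1: "L2fun (cubeM R) (\<lambda>y. sqrt (kernel \<epsilon> x y))"
    by (rule L2fun_bounded[where B="sqrt B"]) (auto simp: m b)
  have L2: "L2fun (cubeM R) (\<lambda>y. sqrt (kernel \<epsilon> x y) * g y)"
    by (rule L2fun_mult_bounded[OF g m]) (auto intro!: AE_I2 b)
  have e1: "sqrt (kernel \<epsilon> x y) * (sqrt (kernel \<epsilon> x y) * g y) = kernel \<epsilon> x y * g y"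
    "(sqrt (kernel \<epsilon> x y))\<^sup>2 = kernel \<epsilon> x y" "(sqrt (kernel \<epsilon> x y) * g y)\<^sup>2 = kernel \<epsilon> x y * (g y)\<^sup>2" for y
    using kernel_nonneg[of x y] by (auto simp: power_mult_distrib simp flip: mult.assoc)
  have "(moll \<epsilon> g x)\<^sup>2 \<le> (LINT y|cubeM R. kernel \<epsilon> x y) * (LINT y|cubeM R. kernel \<epsilon> x y * (g y)\<^sup>2)"
    using L2_Cauchy_Schwarz[OF L1 L2] by (simp add: e1 moll_eq)
  also have "\<dots> \<le> 1 * (LINT y|cubeM R. kernel \<epsilon> x y * (g y)\<^sup>2)"
    by (intro mult_right_mono integral_kernel(2) integral_nonneg_AE) (auto simp: kernel_nonneg)
  finally show ?thesis by simp
qed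

text \<open>Schur's test: integrate \<open>moll_square_le\<close> over \<open>x\<close>, exchange
  the order by Tonelli and use the bound in \<open>x\<close>. Nonnegative integrals give
  integrability along the way, and the bound does not depend on \<open>\<epsilon>\<close>.\<close>

lemma moll_L2_bound:
  assumes g: "L2fun (cubeM R) g"
  shows "L2fun (cubeM R) (moll \<epsilon> g)" "(LINT x|cubeM R. (moll \<epsilon> g x)\<^sup>2) \<le> 2 ^ CARD('n) * (LINT x|cubeM R. (g x)\<^sup>2)"
proof -
  interpret M: finite_measure "cubeM R :: (real^'n) measure" by simp
  interpret pair_sigma_finite "cubeM R :: (real^'n) measure" "cubeM R :: (real^'n) measure" ..
  have [measurable]: "g \<in> borel_measurable (cubeM R)" and gi: "integrable (cubeM R) (\<lambda>x. (g x)\<^sup>2)"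
    using g by (auto simp: L2fun_def)
  have gI: "integrable (cubeM R) g"
    by (rule L1_le_L2(1)[OF _ g]) simp
  have mm: "moll \<epsilon> g \<in> borel_measurable (cubeM R)"
    by (intro continuous_cubeM smooth_continuous smooth_moll gI)
  have "(\<integral>\<^sup>+x. ennreal ((moll \<epsilon> g x)\<^sup>2) \<partial>cubeM R) \<le> (\<integral>\<^sup>+x. (\<integral>\<^sup>+y. ennreal (kernel \<epsilon> x y * (g y)\<^sup>2) \<partial>cubeM R) \<partial>cubeM R)"
  proof (rule nn_integral_mono)
    fix x
    have "(\<integral>\<^sup>+y. ennreal (kernel \<epsilon> x y * (g y)\<^sup>2) \<partial>cubeM R) = ennreal (LINT y|cubeM R. kernel \<epsilon> x y * (g y)\<^sup>2)"
      by (intro nn_integral_eq_integral kernel_mult_integrable gi) (auto simp: kernel_nonneg)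
    then show "ennreal ((moll \<epsilon> g x)\<^sup>2) \<le> (\<integral>\<^sup>+y. ennreal (kernel \<epsilon> x y * (g y)\<^sup>2) \<partial>cubeM R)"
      using moll_square_le[OF g] by (simp add: ennreal_leI)
  qed
  also have "\<dots> = (\<integral>\<^sup>+y. (\<integral>\<^sup>+x. ennreal (kernel \<epsilon> x y * (g y)\<^sup>2) \<partial>cubeM R) \<partial>cubeM R)"
    by (rule Fubini') measurable
  also have "\<dots> \<le> (\<integral>\<^sup>+y. ennreal (2 ^ CARD('n)) * ennreal ((g y)\<^sup>2) \<partial>cubeM R)"
  proof (rule nn_integral_mono)
    fix y
    have m: "(\<lambda>x. kernel \<epsilon> x y) \<in> borel_measurable borel"
      by (rule borel_measurable_continuous_onI[OF kernel_cont(2)])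
    have "(\<integral>\<^sup>+x. ennreal (kernel \<epsilon> x y * (g y)\<^sup>2) \<partial>cubeM R) = (\<integral>\<^sup>+x. ennreal (kernel \<epsilon> x y) \<partial>cubeM R) * ennreal ((g y)\<^sup>2)"
      using borel_measurable_cubeM[OF m] by (simp add: ennreal_mult kernel_nonneg nn_integral_multc)
    also have "(\<integral>\<^sup>+x. ennreal (kernel \<epsilon> x y) \<partial>cubeM R) \<le> (\<integral>\<^sup>+x. ennreal (kernel \<epsilon> x y) \<partial>lborel)"
      using m by (subst nn_integral_cubeM) (auto intro!: nn_integral_mono simp: indicator_def)
    also have "\<dots> \<le> ennreal (2 ^ CARD('n))"
      by (rule nn_integral_kernel_x)
    finally show "(\<integral>\<^sup>+x. ennreal (kernel \<epsilon> x y * (g y)\<^sup>2) \<partial>cubeM R) \<le> ennreal (2 ^ CARD('n)) * ennreal ((g y)\<^sup>2)"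
      by (simp add: mult_right_mono)
  qed
  also have "\<dots> = ennreal (2 ^ CARD('n) * (LINT x|cubeM R. (g x)\<^sup>2))"
    using gi by (simp add: nn_integral_cmult nn_integral_eq_integral ennreal_mult)
  finally have le: "(\<integral>\<^sup>+x. ennreal ((moll \<epsilon> g x)\<^sup>2) \<partial>cubeM R) \<le> ennreal (2 ^ CARD('n) * (LINT x|cubeM R. (g x)\<^sup>2))" .
  then have "integrable (cubeM R) (\<lambda>x. (moll \<epsilon> g x)\<^sup>2)"
    using mm le_less_trans[OF le] by (intro integrableI_nonneg) auto
  then show "L2fun (cubeM R) (moll \<epsilon> g)"
    using mm by (simp add: L2fun_def)
  show "(LINT x|cubeM R. (moll \<epsilon> g x)\<^sup>2) \<le> 2 ^ CARD('n) * (LINT x|cubeM R. (g x)\<^sup>2)"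
    using le mm by (intro integral_real_bounded) (auto simp: integral_nonneg_AE)
qed

end

text \<open>A kernel of unit mass averages \<open>c\<close> over points at distance of order
  \<open>\<epsilon>\<close>, so uniform continuity on the closed cube is enough.\<close>

lemma moll_uniform:
  assumes c: "continuous_on UNIV c" and "e > 0"
  shows "\<exists>\<epsilon>0>0. \<forall>\<epsilon>. 0 < \<epsilon> \<longrightarrow> \<epsilon> \<le> 1/4 \<longrightarrow> \<epsilon> < \<epsilon>0 \<longrightarrow> (\<forall>x\<in>cube R. \<bar>moll \<epsilon> c x - c x\<bar> \<le> e)"
proof -
  have "uniformly_continuous_on (ccube R) c"
    by (intro compact_uniformly_continuous continuous_on_subset[OF c]) auto
  then obtain d where d: "d > 0" "\<And>x y. x \<in> ccube R \<Longrightarrow> y \<in> ccube R \<Longrightarrow> dist y x < d \<Longrightarrow> dist (c y) (c x) < e"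
    unfolding uniformly_continuous_on_def using \<open>e > 0\<close> by metis
  define \<epsilon>0 where "\<epsilon>0 = d / (3 * (real CARD('n) * R))"
  have "\<epsilon>0 > 0" using d R by (simp add: \<epsilon>0_def)
  moreover have "\<bar>moll \<epsilon> c x - c x\<bar> \<le> e" if \<epsilon>: "0 < \<epsilon>" "\<epsilon> \<le> 1/4" "\<epsilon> < \<epsilon>0" and x: "x \<in> cube R" for \<epsilon> x
  proof -
    note k = integral_kernel[OF \<epsilon>(1,2)]
    have x': "x \<in> ccube R" using x cube_subset_ccube by blast
    have "L2fun (cubeM R) c"
      by (rule continuous_L2fun[OF continuous_on_subset[OF c]]) simp
    then have ci: "integrable (cubeM R) c"
      using L1_le_L2(1)[of "cubeM R" c] by simp
    note ki = kernel_mult_integrable[OF \<epsilon>(1,2) ci, of x]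
    have i: "integrable (cubeM R) (\<lambda>y. kernel \<epsilon> x y * (c y - c x))"
      unfolding right_diff_distrib using ki k(1) by auto
    have "moll \<epsilon> c x - c x = (LINT y|cubeM R. kernel \<epsilon> x y * c y) - (LINT y|cubeM R. kernel \<epsilon> x y * c x)"
      using k(3)[OF x'] by (simp add: moll_eq[OF \<epsilon>(1,2)])
    also have "\<dots> = (LINT y|cubeM R. kernel \<epsilon> x y * (c y - c x))"
      unfolding right_diff_distrib using ki k(1) by (subst Bochner_Integration.integral_diff) auto
    finally have eq: "moll \<epsilon> c x - c x = (LINT y|cubeM R. kernel \<epsilon> x y * (c y - c x))" .
    have "\<bar>LINT y|cubeM R. kernel \<epsilon> x y * (c y - c x)\<bar> \<le> (LINT y|cubeM R. \<bar>kernel \<epsilon> x y * (c y - c x)\<bar>)"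
      by (rule integral_abs_bound)
    also have "\<dots> \<le> (LINT y|cubeM R. kernel \<epsilon> x y * e)"
    proof (rule integral_mono)
      fix y :: "real^'n" assume "y \<in> space (cubeM R)"
      then have y: "y \<in> ccube R" using cube_subset_ccube[of R] by auto
      show "\<bar>kernel \<epsilon> x y * (c y - c x)\<bar> \<le> kernel \<epsilon> x y * e"
      proof (cases "kernel \<epsilon> x y = 0")
        case False
        have "norm (x - y) \<le> 3 * \<epsilon> * (real CARD('n) * R)"
          by (rule kernel_support(2)[OF \<epsilon>(1,2) x' False])
        also have "\<dots> < d"
          using \<epsilon>(3) R by (simp add: \<epsilon>0_def field_simps)
        finally have "dist (c y) (c x) < e"
          using d(2)[OF x' y] by (simp add: dist_norm norm_minus_commute)
        then show ?thesis
          using kernel_nonneg[OF \<epsilon>(1,2), of x y] by (auto simp: abs_mult dist_real_def intro!: mult_left_mono)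
      qed simp
    qed (use i k(1) in auto)
    also have "\<dots> = e"
      using k(3)[OF x'] by simp
    finally show ?thesis
      unfolding eq .
  qed
  ultimately show ?thesis by blast
qed

text \<open>The shift by 4 keeps the parameter at most \<open>1/4\<close> for every
  \<open>n\<close>.\<close>

definition mollseq :: "nat \<Rightarrow> (real^'n \<Rightarrow> real) \<Rightarrow> real^'n \<Rightarrow> real" where
  "mollseq n = moll (1 / real (n + 4))"

lemma eps_seq: "0 < 1 / real (n + 4)" "1 / real (n + 4) \<le> 1/4"
  by (auto simp: field_simps)

text \<open>The operators are bounded on L2 uniformly in the parameter and converge on the dense set
  of continuous functions, hence everywhere.\<close>

lemma mollseq_L2conv:
  assumes g: "L2fun (cubeM R) g"
  shows "L2conv (cubeM R) (\<lambda>n. mollseq n g) g"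
proof -
  let ?M = "cubeM R :: (real^'n) measure"
  let ?N = "\<lambda>h. sqrt (LINT x|?M. (h x)\<^sup>2)"
  note L = moll_L2_bound(1)[OF eps_seq, folded mollseq_def]
  note le = moll_L2_bound(2)[OF eps_seq, folded mollseq_def]
  define A where "A = sqrt (2 ^ CARD('n))"
  define m where "m = sqrt (measure ?M (space ?M))"
  have m: "m \<ge> 0" and A: "A \<ge> 0" by (auto simp: m_def A_def)
  have I: "L2fun ?M f \<Longrightarrow> integrable ?M f" for f
    by (rule L1_le_L2(1)) simp_all
  have "(\<lambda>n. ?N (\<lambda>x. mollseq n g x - g x)) \<longlonglongrightarrow> 0"
  proof (rule LIMSEQ_I)
    fix e :: real assume "e > 0"
    \<comment> \<open>\<open>A\<close> is the operator bound and \<open>m\<close> the root of the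
      volume: the errors sum to less than \<open>(A + 1) * e1 + e2 * m\<close>, which is at most
      \<open>e / 2 + e / 4\<close>. The added 1 in each denominator rules out division by
      zero.\<close>
    define e1 where "e1 = e / (2 * (A + 1))"
    define e2 where "e2 = e / (4 * (m + 1))"
    have e1: "e1 > 0" and e2: "e2 > 0" using \<open>e > 0\<close> m A by (auto simp: e1_def e2_def)
    obtain c where c: "continuous_on UNIV c" "L2fun ?M c" "(LINT x|?M. (g x - c x)\<^sup>2) < e1\<^sup>2"
      using L2_continuous_dense[OF g, of "e1\<^sup>2"] e1 by auto
    obtain \<epsilon>0 where \<epsilon>0: "\<epsilon>0 > 0" "\<And>\<epsilon> x. 0 < \<epsilon> \<Longrightarrow> \<epsilon> \<le> 1/4 \<Longrightarrow> \<epsilon> < \<epsilon>0 \<Longrightarrow> x \<in> cube R \<Longrightarrow> \<bar>moll \<epsilon> c x - c x\<bar> \<le> e2"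
      using moll_uniform[OF c(1) e2] by blast
    obtain N :: nat where N: "N > 1 / \<epsilon>0"
      using reals_Archimedean2 by blast
    have d: "?N (\<lambda>x. g x - c x) < e1"
      using real_sqrt_less_mono[OF c(3)] e1 by simp
    have "norm (?N (\<lambda>x. mollseq n g x - g x) - 0) < e" if "n \<ge> N" for n
    proof -
      have "1 / real (n + 4) < \<epsilon>0"
      proof -
        have "1 / \<epsilon>0 < real (n + 4)"
          using N that by linarith
        then show ?thesis
          using \<epsilon>0(1) by (simp add: field_simps)
      qed
      then have u: "\<bar>mollseq n c x - c x\<bar> \<le> e2" if "x \<in> cube R" for x
        using \<epsilon>0(2)[OF eps_seq _ that] by (simp add: mollseq_def)
      have t1: "?N (\<lambda>x. mollseq n g x - mollseq n c x) \<le> A * e1"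
      proof -
        have "(\<lambda>x. mollseq n g x - mollseq n c x) = mollseq n (\<lambda>x. g x - c x)"
          unfolding mollseq_def using moll_diff[OF eps_seq I[OF g] I[OF c(2)]] by (auto simp: fun_eq_iff)
        then have "?N (\<lambda>x. mollseq n g x - mollseq n c x) \<le> A * ?N (\<lambda>x. g x - c x)"
          using real_sqrt_le_mono[OF le[OF L2fun_diff[OF g c(2)], of n]] by (simp add: real_sqrt_mult A_def fun_eq_iff)
        also have "\<dots> \<le> A * e1"
          using d A by (intro mult_left_mono) auto
        finally show ?thesis .
      qed
      have t2: "?N (\<lambda>x. mollseq n c x - c x) \<le> e2 * m"
      proof -
        interpret finite_measure ?M by simp
        have "(LINT x|?M. (mollseq n c x - c x)\<^sup>2) \<le> (LINT x|?M. e2\<^sup>2)"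
        proof (rule integral_mono)
          show "(mollseq n c x - c x)\<^sup>2 \<le> e2\<^sup>2" if "x \<in> space ?M" for x
            using u[of x] that e2 by (simp add: abs_le_square_iff[symmetric])
        qed (use L2funD(2)[OF L2fun_diff[OF L[OF c(2)] c(2)]] in auto)
        also have "\<dots> = (e2 * m)\<^sup>2"
          by (simp add: m_def power_mult_distrib)
        finally show ?thesis
          using e2 m by (intro real_le_lsqrt) (auto simp: integral_nonneg_AE)
      qed
      have "?N (\<lambda>x. mollseq n g x - g x) \<le> ?N (\<lambda>x. mollseq n g x - c x) + ?N (\<lambda>x. c x - g x)"
        using L2_norm_triangle[OF L2fun_diff[OF L[OF g] c(2)] L2fun_diff[OF c(2) g], of n] by simp
      also have "?N (\<lambda>x. mollseq n g x - c x) \<le> ?N (\<lambda>x. mollseq n g x - mollseq n c x) + ?N (\<lambda>x. mollseq n c x - c x)"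
        using L2_norm_triangle[OF L2fun_diff[OF L[OF g] L[OF c(2)]] L2fun_diff[OF L[OF c(2)] c(2)], of n n n] by simp
      also have "?N (\<lambda>x. c x - g x) = ?N (\<lambda>x. g x - c x)"
        by (simp add: power2_commute)
      finally have "?N (\<lambda>x. mollseq n g x - g x) < (A + 1) * e1 + e2 * m"
        using t1 t2 d by (simp add: algebra_simps)
      also have "(A + 1) * e1 = e / 2"
        using A by (simp add: e1_def field_simps)
      also have "e2 * m \<le> e2 * (m + 1)"
        using e2 by simp
      also have "e2 * (m + 1) = e / 4"
        using m by (simp add: e2_def field_simps)
      finally show ?thesis
        using \<open>e > 0\<close> by (simp add: integral_nonneg_AE)
    qed
    then show "\<exists>N. \<forall>n\<ge>N. norm (?N (\<lambda>x. mollseq n g x - g x) - 0) < e"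
      by blast
  qed
  from tendsto_power[OF this, of 2] show ?thesis
    using g L by (simp add: L2conv_def integral_nonneg_AE)
qed

end

subsection \<open>Weak derivatives and the Hilbert space structure\<close>

lemma L2fun_cong: "(\<And>x. x \<in> space M \<Longrightarrow> f x = g x) \<Longrightarrow> L2fun M f \<longleftrightarrow> L2fun M g"
  unfolding L2fun_def by (intro conj_cong measurable_cong Bochner_Integration.integrable_cong) auto

lemma L2conv_cong:
  assumes "L2conv M f g" "\<And>n x. x \<in> space M \<Longrightarrow> f' n x = f n x"
  shows "L2conv M f' g"
proof -
  have "L2fun M (f' n)" for n
    using L2fun_cong[of M "f' n" "f n"] assms by (auto simp: L2conv_def)
  moreover have "(LINT x|M. (f' n x - g x)\<^sup>2) = (LINT x|M. (f n x - g x)\<^sup>2)" for n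
    by (rule Bochner_Integration.integral_cong) (auto simp: assms(2))
  ultimately show ?thesis
    using assms(1) by (simp add: L2conv_def)
qed

text \<open>Made for the power of \<open>1 - 2 * \<epsilon>\<close> by which the derivative of a
  mollification differs from the mollified derivative.\<close>

lemma L2conv_scaled:
  assumes "L2conv M f g" "c \<longlonglongrightarrow> (1::real)"
  shows "L2conv M (\<lambda>n x. c n * f n x) g"
proof -
  note L = L2convD[OF assms(1)]
  let ?N = "\<lambda>h. sqrt (LINT x|M. (h x)\<^sup>2)"
  have le: "?N (\<lambda>x. c n * f n x - g x) \<le> \<bar>c n\<bar> * ?N (\<lambda>x. f n x - g x) + \<bar>c n - 1\<bar> * ?N g" for n
  proof -
    have "?N (\<lambda>x. c n * (f n x - g x) + (c n - 1) * g x) \<le> ?N (\<lambda>x. c n * (f n x - g x)) + ?N (\<lambda>x. (c n - 1) * g x)"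
      by (rule L2_norm_triangle[OF L2fun_cmult[OF L2fun_diff[OF L(1,2)]] L2fun_cmult[OF L(2)]])
    moreover have "c n * (f n x - g x) + (c n - 1) * g x = c n * f n x - g x" for x
      by (simp add: algebra_simps)
    moreover have "?N (\<lambda>x. a * h x) = \<bar>a\<bar> * ?N h" for a h
      by (simp add: power_mult_distrib real_sqrt_mult)
    ultimately show ?thesis
      by (simp only:)
  qed
  have lim: "(\<lambda>n. \<bar>c n\<bar> * ?N (\<lambda>x. f n x - g x) + \<bar>c n - 1\<bar> * ?N g) \<longlonglongrightarrow> \<bar>1\<bar> * sqrt 0 + \<bar>1 - 1\<bar> * ?N g"
    by (intro tendsto_intros L assms(2))
  have "(\<lambda>n. ?N (\<lambda>x. c n * f n x - g x)) \<longlonglongrightarrow> 0"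
  proof (rule tendsto_sandwich[of "\<lambda>_. 0"])
    show "(\<lambda>n. \<bar>c n\<bar> * ?N (\<lambda>x. f n x - g x) + \<bar>c n - 1\<bar> * ?N g) \<longlonglongrightarrow> 0"
      using lim by simp
    show "\<forall>\<^sub>F n in sequentially. ?N (\<lambda>x. c n * f n x - g x) \<le> \<bar>c n\<bar> * ?N (\<lambda>x. f n x - g x) + \<bar>c n - 1\<bar> * ?N g"
      using le by (rule always_eventually[OF allI])
  qed (auto simp: integral_nonneg_AE)
  from tendsto_power[OF this, of 2] show ?thesis
    using L2fun_cmult[OF L(1)] L(2) by (simp add: L2conv_def integral_nonneg_AE)
qed

lemma test_function_L2fun:
  fixes \<phi> :: "real^'n::finite \<Rightarrow> real"
  assumes "test_function (cube R) \<phi>"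
  shows "L2fun (cubeM R) \<phi>" "L2fun (cubeM R) (mi_deriv \<alpha> \<phi>)"
  using assms by (auto simp: test_function_def intro!: continuous_L2fun smooth_continuous smooth_mi_deriv)

lemma has_weak_deriv_L2D:
  assumes "has_weak_deriv_L2 (cube R) \<alpha> u g"
  shows "L2fun (cubeM R) g"
    "test_function (cube R) \<phi> \<Longrightarrow> (LINT x|cubeM R. u x * mi_deriv \<alpha> \<phi> x) = (- 1) ^ mi_order \<alpha> * (LINT x|cubeM R. g x * \<phi> x)"
  using assms by (auto simp: has_weak_deriv_L2_def L2_space_iff)

lemma has_weak_deriv_L2_lincomb:
  fixes u v :: "real^'n::finite \<Rightarrow> real"
  assumes u: "L2fun (cubeM R) u" "has_weak_deriv_L2 (cube R) \<alpha> u g"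
    and v: "L2fun (cubeM R) v" "has_weak_deriv_L2 (cube R) \<alpha> v h"
  shows "has_weak_deriv_L2 (cube R) \<alpha> (\<lambda>x. a * u x + b * v x) (\<lambda>x. a * g x + b * h x)"
  unfolding has_weak_deriv_L2_def L2_space_iff
proof (intro conjI allI impI)
  note g = has_weak_deriv_L2D[OF u(2)] and h = has_weak_deriv_L2D[OF v(2)]
  show "L2fun (cubeM R) (\<lambda>x. a * g x + b * h x)"
    by (rule L2fun_lincomb[OF g(1) h(1)])
  fix \<phi> :: "real^'n \<Rightarrow> real" assume t: "test_function (cube R) \<phi>"
  note t' = test_function_L2fun[OF t]
  have split: "(LINT x|cubeM R. (a * f x + b * k x) * \<psi> x) = a * (LINT x|cubeM R. f x * \<psi> x) + b * (LINT x|cubeM R. k x * \<psi> x)"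
    if "L2fun (cubeM R) f" "L2fun (cubeM R) k" "L2fun (cubeM R) \<psi>" for f k \<psi> :: "real^'n \<Rightarrow> real"
  proof -
    have "(LINT x|cubeM R. (a * f x + b * k x) * \<psi> x) = (LINT x|cubeM R. a * (f x * \<psi> x) + b * (k x * \<psi> x))"
      by (simp add: algebra_simps)
    then show ?thesis
      using L2fun_mult_integrable[OF that(1,3)] L2fun_mult_integrable[OF that(2,3)] by simp
  qed
  show "(LINT x|cubeM R. (a * u x + b * v x) * mi_deriv \<alpha> \<phi> x)
      = (- 1) ^ mi_order \<alpha> * (LINT x|cubeM R. (a * g x + b * h x) * \<phi> x)"
    unfolding split[OF u(1) v(1) t'(2)] split[OF g(1) h(1) t'(1)] g(2)[OF t] h(2)[OF t]
    by (simp add: algebra_simps)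
qed

lemma has_weak_deriv_L2_zero:
  fixes u :: "real^'n::finite \<Rightarrow> real"
  assumes "L2fun (cubeM R) u"
  shows "has_weak_deriv_L2 (cube R) (\<lambda>_. 0) u u"
  using assms by (simp add: has_weak_deriv_L2_def L2_space_iff mi_deriv_zero)

text \<open>Weak differentiation is a closed operator: for a fixed test function both sides of the
  defining identity are continuous in L2. This is what completeness of the Sobolev space rests
  on.\<close>

lemma has_weak_deriv_L2_limit:
  fixes u :: "nat \<Rightarrow> real^'n::finite \<Rightarrow> real"
  assumes "\<And>n. has_weak_deriv_L2 (cube R) \<alpha> (u n) (g n)" "L2conv (cubeM R) u u'" "L2conv (cubeM R) g g'"
  shows "has_weak_deriv_L2 (cube R) \<alpha> u' g'"
  unfolding has_weak_deriv_L2_def L2_space_iff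
proof (intro conjI allI impI)
  show "L2fun (cubeM R) g'"
    by (rule L2convD(2)[OF assms(3)])
  fix \<phi> :: "real^'n \<Rightarrow> real" assume t: "test_function (cube R) \<phi>"
  note t' = test_function_L2fun[OF t]
  have "(\<lambda>n. LINT x|cubeM R. u n x * mi_deriv \<alpha> \<phi> x) \<longlonglongrightarrow> (LINT x|cubeM R. u' x * mi_deriv \<alpha> \<phi> x)"
    by (rule L2conv_integral_mult[OF assms(2) t'(2)])
  moreover have "(\<lambda>n. (- 1) ^ mi_order \<alpha> * (LINT x|cubeM R. g n x * \<phi> x)) \<longlonglongrightarrow> (- 1) ^ mi_order \<alpha> * (LINT x|cubeM R. g' x * \<phi> x)"
    by (intro tendsto_mult_left L2conv_integral_mult[OF assms(3) t'(1)])
  ultimately show "(LINT x|cubeM R. u' x * mi_deriv \<alpha> \<phi> x) = (- 1) ^ mi_order \<alpha> * (LINT x|cubeM R. g' x * \<phi> x)"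
    unfolding has_weak_deriv_L2D(2)[OF assms(1) t] by (rule LIMSEQ_unique)
qed

lemma sobolevD:
  assumes "u \<in> sobolev (cube R) p"
  shows "L2fun (cubeM R) u"
    "mi_order \<alpha> \<le> p \<Longrightarrow> has_weak_deriv_L2 (cube R) \<alpha> u (weak_deriv (cube R) \<alpha> u)"
    "mi_order \<alpha> \<le> p \<Longrightarrow> L2fun (cubeM R) (weak_deriv (cube R) \<alpha> u)"
proof -
  show "L2fun (cubeM R) u"
    using assms by (simp add: sobolev_def L2_space_iff)
  assume "mi_order \<alpha> \<le> p"
  then have "\<exists>g. has_weak_deriv_L2 (cube R) \<alpha> u g"
    using assms by (simp add: sobolev_def)
  then show w: "has_weak_deriv_L2 (cube R) \<alpha> u (weak_deriv (cube R) \<alpha> u)"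
    unfolding weak_deriv_def by (rule someI_ex)
  show "L2fun (cubeM R) (weak_deriv (cube R) \<alpha> u)"
    by (rule has_weak_deriv_L2D(1)[OF w])
qed

lemma sobolev_lincomb:
  assumes "u \<in> sobolev (cube R) p" "v \<in> sobolev (cube R) p"
  shows "(\<lambda>x. a * u x + b * v x) \<in> sobolev (cube R) p"
  using has_weak_deriv_L2_lincomb[OF sobolevD(1,2)[OF assms(1)] sobolevD(1,2)[OF assms(2)]] sobolevD(1)[OF assms(1)] sobolevD(1)[OF assms(2)]
  by (auto simp: sobolev_def L2_space_iff intro!: L2fun_lincomb)

lemma sobolev_add: "u \<in> sobolev (cube R) p \<Longrightarrow> v \<in> sobolev (cube R) p \<Longrightarrow> (\<lambda>x. u x + v x) \<in> sobolev (cube R) p"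
  and sobolev_diff: "u \<in> sobolev (cube R) p \<Longrightarrow> v \<in> sobolev (cube R) p \<Longrightarrow> (\<lambda>x. u x - v x) \<in> sobolev (cube R) p"
  and sobolev_cmult: "u \<in> sobolev (cube R) p \<Longrightarrow> (\<lambda>x. a * u x) \<in> sobolev (cube R) p"
  using sobolev_lincomb[of u R p v 1 1] sobolev_lincomb[of u R p v 1 "-1"] sobolev_lincomb[of u R p u a 0] by simp_all

lemma sobolev_inner_commute: "sobolev_inner \<Omega> p u v = sobolev_inner \<Omega> p v u"
  by (simp add: sobolev_inner_def mult.commute)

lemma sobolev_inner_nonneg: "0 \<le> sobolev_inner \<Omega> p u u"
  unfolding sobolev_inner_def by (intro sum_nonneg integral_nonneg_AE) simp

lemma sobolev_norm_nonneg [simp]: "0 \<le> sobolev_norm \<Omega> p u"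
  by (simp add: sobolev_norm_def sobolev_inner_nonneg)

lemma sobolev_norm_square: "(sobolev_norm \<Omega> p u)\<^sup>2 = sobolev_inner \<Omega> p u u"
  by (simp add: sobolev_norm_def sobolev_inner_nonneg)

lemma sobolev_inner_self: "sobolev_inner \<Omega> p u u = (\<Sum>\<alpha> | mi_order \<alpha> \<le> p. LINT x|lebesgue_on \<Omega>. (weak_deriv \<Omega> \<alpha> u x)\<^sup>2)"
  by (simp add: sobolev_inner_def power2_eq_square)

lemma weak_deriv_norm_le:
  fixes u :: "real^'n::finite \<Rightarrow> real"
  assumes "mi_order \<alpha> \<le> p"
  shows "(LINT x|lebesgue_on \<Omega>. (weak_deriv \<Omega> \<alpha> u x)\<^sup>2) \<le> (sobolev_norm \<Omega> p u)\<^sup>2"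
  unfolding sobolev_norm_square sobolev_inner_self
  by (rule member_le_sum) (use assms in \<open>auto simp: integral_nonneg_AE\<close>)

section \<open>Mollified weak derivatives and the Sobolev Hilbert structure\<close>

context smooth_bump
begin

text \<open>The purpose of the contracted centre: even for \<open>x\<close> on a face the support in
  \<open>y\<close> stays in the smaller cube with parameter
  \<open>(1 - \<epsilon>) * R\<close>.\<close>

lemma test_kernel:
  assumes \<epsilon>: "0 < \<epsilon>" "\<epsilon> \<le> 1/4" and x: "x \<in> ccube R"
  shows "test_function (cube R) (\<lambda>y. \<eta> (((1 - 2 * \<epsilon>) / \<epsilon>) *\<^sub>R x - (1 / \<epsilon>) *\<^sub>R y))"
    (is "test_function _ ?\<phi>")
proof -
  have "smooth ?\<phi>"
    using smooth_affine[OF sm, of 1 "- 1 / \<epsilon>" "((1 - 2 * \<epsilon>) / \<epsilon>) *\<^sub>R x"] by (simp add: algebra_simps)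
  have sub: "{y. ?\<phi> y \<noteq> 0} \<subseteq> ccube ((1 - \<epsilon>) * R)"
  proof
    fix y assume "y \<in> {y. ?\<phi> y \<noteq> 0}"
    then have "((1 - 2 * \<epsilon>) / \<epsilon>) *\<^sub>R x - (1 / \<epsilon>) *\<^sub>R y \<in> ccube R"
      using zero cube_subset_ccube by fastforce
    then show "y \<in> ccube ((1 - \<epsilon>) * R)"
      by (rule kernel_support_scaled(1)[OF \<epsilon> x])
  qed
  then have cl: "closure {y. ?\<phi> y \<noteq> 0} \<subseteq> ccube ((1 - \<epsilon>) * R)"
    by (rule closure_minimal) (rule closed_cbox)
  have "(1 - \<epsilon>) * R < R"
    using \<epsilon> R by (simp add: algebra_simps)
  then have "ccube ((1 - \<epsilon>) * R) \<subseteq> (cube R :: (real^'n) set)"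
    by (simp add: mem_ccube mem_cube subset_iff) (meson le_less_trans)
  moreover have "compact (closure {y. ?\<phi> y \<noteq> 0})"
    using cl by (meson bounded_cbox bounded_subset closed_closure compact_eq_bounded_closed)
  ultimately show ?thesis
    using \<open>smooth ?\<phi>\<close> cl by (auto simp: test_function_def)
qed

text \<open>Both derivatives fall on the same kernel: each order in \<open>x\<close> contributes
  \<open>(1 - 2 * \<epsilon>) / \<epsilon>\<close>, each order in \<open>y\<close> contributes
  \<open>- 1 / \<epsilon>\<close>. Testing the weak derivative with the kernel trades one for the
  other; the signs cancel and the ratio leaves the power of
  \<open>1 - 2 * \<epsilon>\<close>.\<close>

lemma mi_deriv_moll:
  assumes \<epsilon>: "0 < \<epsilon>" "\<epsilon> \<le> 1/4" and x: "x \<in> ccube R"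
    and u: "L2fun (cubeM R) u" and w: "has_weak_deriv_L2 (cube R) \<alpha> u g"
  shows "mi_deriv \<alpha> (moll \<epsilon> u) x = (1 - 2 * \<epsilon>) ^ mi_order \<alpha> * moll \<epsilon> g x"
proof -
  let ?a = "(1 - 2 * \<epsilon>) / \<epsilon>" and ?b = "1 / \<epsilon>" and ?m = "mi_order \<alpha>"
  let ?\<phi> = "\<lambda>y. \<eta> (?a *\<^sub>R x - ?b *\<^sub>R y)"
  let ?k = "1 / (\<epsilon> ^ CARD('n) * mass)"
  have i: "integrable (cubeM R) u"
    by (rule L1_le_L2(1)[OF _ u]) simp
  have "?\<phi> = (\<lambda>y. \<eta> ((- ?b) *\<^sub>R y + ?a *\<^sub>R x))"
    by (simp add: algebra_simps)
  then have d: "mi_deriv \<alpha> ?\<phi> = (\<lambda>y. (- ?b) ^ ?m * mi_deriv \<alpha> \<eta> (?a *\<^sub>R x - ?b *\<^sub>R y))"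
    using foldr_pderivative_affine[OF sm, of "mi_list \<alpha>" "- ?b" "?a *\<^sub>R x"]
    by (simp add: mi_deriv_mi_list length_mi_list algebra_simps)
  have "(LINT y|cubeM R. u y * mi_deriv \<alpha> ?\<phi> y) = (- ?b) ^ ?m * conv (cubeM R) (mi_deriv \<alpha> \<eta>) ?a ?b u x"
    unfolding d conv_def by (subst integral_mult_right_zero[symmetric]) (simp add: mult_ac)
  moreover have "(LINT y|cubeM R. u y * mi_deriv \<alpha> ?\<phi> y) = (- 1) ^ ?m * conv (cubeM R) \<eta> ?a ?b g x"
    using has_weak_deriv_L2D(2)[OF w test_kernel[OF \<epsilon> x]] by (simp add: conv_def mult.commute)
  ultimately have "(- ?b) ^ ?m * conv (cubeM R) (mi_deriv \<alpha> \<eta>) ?a ?b u x = (- 1) ^ ?m * conv (cubeM R) \<eta> ?a ?b g x"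
    by simp
  moreover have "(- ?b) ^ ?m = (- 1) ^ ?m * ?b ^ ?m"
    by (metis mult_minus1 power_mult_distrib)
  ultimately have c: "?b ^ ?m * conv (cubeM R) (mi_deriv \<alpha> \<eta>) ?a ?b u x = conv (cubeM R) \<eta> ?a ?b g x"
    by simp
  have "mi_deriv \<alpha> (moll \<epsilon> u) x = ?k * ?a ^ ?m * conv (cubeM R) (mi_deriv \<alpha> \<eta>) ?a ?b u x"
  proof -
    have "moll \<epsilon> u = (\<lambda>x. ?k * conv (cubeM R) \<eta> ?a ?b u x)"
      by (simp add: moll_def fun_eq_iff)
    then show ?thesis
      by (simp only: mi_deriv_conv[OF id_cubeM i sm csupp])
  qed
  also have "?a ^ ?m = (1 - 2 * \<epsilon>) ^ ?m * ?b ^ ?m"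
    by (simp add: power_divide)
  also have "?k * ((1 - 2 * \<epsilon>) ^ ?m * ?b ^ ?m) * conv (cubeM R) (mi_deriv \<alpha> \<eta>) ?a ?b u x
      = (1 - 2 * \<epsilon>) ^ ?m * (?k * (?b ^ ?m * conv (cubeM R) (mi_deriv \<alpha> \<eta>) ?a ?b u x))"
    by (simp only: mult_ac)
  finally show ?thesis
    unfolding c by (simp only: moll_def[of \<epsilon> g])
qed

lemma smooth_mollseq: "L2fun (cubeM R) u \<Longrightarrow> smooth (mollseq n u)"
  unfolding mollseq_def by (intro smooth_moll eps_seq L1_le_L2(1)) auto

lemma mi_deriv_mollseq_L2conv:
  assumes u: "L2fun (cubeM R) u" and w: "has_weak_deriv_L2 (cube R) \<alpha> u g"
  shows "L2conv (cubeM R) (\<lambda>n. mi_deriv \<alpha> (mollseq n u)) g"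
proof (rule L2conv_cong)
  have "(\<lambda>n. (1 - 2 * (1 / real (n + 4))) ^ mi_order \<alpha>) \<longlonglongrightarrow> (1 - 2 * 0) ^ mi_order \<alpha>"
    by (intro tendsto_intros LIMSEQ_ignore_initial_segment[OF lim_1_over_n])
  then show "L2conv (cubeM R) (\<lambda>n x. (1 - 2 * (1 / real (n + 4))) ^ mi_order \<alpha> * mollseq n g x) g"
    by (intro L2conv_scaled mollseq_L2conv has_weak_deriv_L2D(1)[OF w]) simp
  fix n and x :: "real^'n" assume "x \<in> space (cubeM R)"
  then have "x \<in> ccube R"
    using cube_subset_ccube by auto
  then show "mi_deriv \<alpha> (mollseq n u) x = (1 - 2 * (1 / real (n + 4))) ^ mi_order \<alpha> * mollseq n g x"
    unfolding mollseq_def by (rule mi_deriv_moll[OF eps_seq _ u w])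
qed

text \<open>Each value of a mollification in the cube is, up to normalization, an integral of
  \<open>g\<close> against a test function, hence zero; and the mollifications converge to
  \<open>g\<close>.\<close>

lemma L2_zero_of_test_functions:
  fixes g :: "real^'n \<Rightarrow> real"
  assumes g: "L2fun (cubeM R) g" and z: "\<And>\<phi>. test_function (cube R) \<phi> \<Longrightarrow> (LINT x|cubeM R. g x * \<phi> x) = 0"
  shows "AE x in cubeM R. g x = 0"
proof -
  have "mollseq n g x = 0" if "x \<in> cube R" for n x
  proof -
    have "x \<in> ccube R"
      using that cube_subset_ccube by auto
    from z[OF test_kernel[OF eps_seq this, of n]] show ?thesis
      by (simp add: mollseq_def moll_def conv_def mult.commute)
  qed
  then have "AE x in cubeM R. (\<lambda>n. mollseq n g x) \<longlonglongrightarrow> 0"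
    by (intro AE_cubeM_ball) simp
  from L2conv_AE_eq[OF finite_cubeM mollseq_L2conv[OF g] this] show ?thesis
    by eventually_elim simp
qed

lemma weak_deriv_unique:
  fixes u :: "real^'n \<Rightarrow> real"
  assumes "has_weak_deriv_L2 (cube R) \<alpha> u g" "has_weak_deriv_L2 (cube R) \<alpha> u h"
  shows "AE x in cubeM R. g x = h x"
proof -
  note g = has_weak_deriv_L2D[OF assms(1)] and h = has_weak_deriv_L2D[OF assms(2)]
  have "AE x in cubeM R. g x - h x = 0"
  proof (rule L2_zero_of_test_functions)
    show "L2fun (cubeM R) (\<lambda>x. g x - h x)"
      by (rule L2fun_diff[OF g(1) h(1)])
    fix \<phi> :: "real^'n \<Rightarrow> real" assume t: "test_function (cube R) \<phi>"
    have "(- 1) ^ mi_order \<alpha> * (LINT x|cubeM R. g x * \<phi> x) = (- 1) ^ mi_order \<alpha> * (LINT x|cubeM R. h x * \<phi> x)"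
      using g(2)[OF t] h(2)[OF t] by simp
    then show "(LINT x|cubeM R. (g x - h x) * \<phi> x) = 0"
      using L2fun_mult_integrable[OF g(1) test_function_L2fun(1)[OF t]] L2fun_mult_integrable[OF h(1) test_function_L2fun(1)[OF t]]
      by (simp add: left_diff_distrib)
  qed
  then show ?thesis
    by eventually_elim simp
qed

lemma weak_deriv_AE_eq:
  fixes u :: "real^'n \<Rightarrow> real"
  assumes "has_weak_deriv_L2 (cube R) \<alpha> u g"
  shows "AE x in cubeM R. weak_deriv (cube R) \<alpha> u x = g x"
  by (rule weak_deriv_unique[OF _ assms]) (metis assms someI_ex weak_deriv_def)

lemma weak_deriv_zero:
  fixes u :: "real^'n \<Rightarrow> real"
  assumes "L2fun (cubeM R) u"
  shows "AE x in cubeM R. weak_deriv (cube R) (\<lambda>_. 0) u x = u x"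
  by (rule weak_deriv_AE_eq[OF has_weak_deriv_L2_zero[OF assms]])

lemma weak_deriv_lincomb:
  fixes u v :: "real^'n \<Rightarrow> real"
  assumes "u \<in> sobolev (cube R) p" "v \<in> sobolev (cube R) p" "mi_order \<alpha> \<le> p"
  shows "AE x in cubeM R. weak_deriv (cube R) \<alpha> (\<lambda>x. a * u x + b * v x) x
    = a * weak_deriv (cube R) \<alpha> u x + b * weak_deriv (cube R) \<alpha> v x"
  by (rule weak_deriv_AE_eq[OF has_weak_deriv_L2_lincomb]) (use assms sobolevD in auto)

lemma sobolev_inner_lincomb_left:
  fixes u v w :: "real^'n \<Rightarrow> real"
  assumes u: "u \<in> sobolev (cube R) p" and v: "v \<in> sobolev (cube R) p" and w: "w \<in> sobolev (cube R) p"
  shows "sobolev_inner (cube R) p (\<lambda>x. a * u x + b * v x) w = a * sobolev_inner (cube R) p u w + b * sobolev_inner (cube R) p v w"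
proof -
  have "(LINT x|cubeM R. weak_deriv (cube R) \<alpha> (\<lambda>x. a * u x + b * v x) x * weak_deriv (cube R) \<alpha> w x)
     = a * (LINT x|cubeM R. weak_deriv (cube R) \<alpha> u x * weak_deriv (cube R) \<alpha> w x)
      + b * (LINT x|cubeM R. weak_deriv (cube R) \<alpha> v x * weak_deriv (cube R) \<alpha> w x)" if \<alpha>: "mi_order \<alpha> \<le> p" for \<alpha>
  proof -
    note L = sobolevD(3)[OF u \<alpha>] sobolevD(3)[OF v \<alpha>] sobolevD(3)[OF w \<alpha>] sobolevD(3)[OF sobolev_lincomb[OF u v] \<alpha>, of a b]
    have "(LINT x|cubeM R. weak_deriv (cube R) \<alpha> (\<lambda>x. a * u x + b * v x) x * weak_deriv (cube R) \<alpha> w x)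
        = (LINT x|cubeM R. a * (weak_deriv (cube R) \<alpha> u x * weak_deriv (cube R) \<alpha> w x)
           + b * (weak_deriv (cube R) \<alpha> v x * weak_deriv (cube R) \<alpha> w x))"
    proof (rule integral_cong_AE)
      show "AE x in cubeM R. weak_deriv (cube R) \<alpha> (\<lambda>x. a * u x + b * v x) x * weak_deriv (cube R) \<alpha> w x
         = a * (weak_deriv (cube R) \<alpha> u x * weak_deriv (cube R) \<alpha> w x) + b * (weak_deriv (cube R) \<alpha> v x * weak_deriv (cube R) \<alpha> w x)"
        using weak_deriv_lincomb[OF u v \<alpha>, of a b] by eventually_elim (simp add: algebra_simps)
    qed (use L in \<open>auto simp: L2fun_def\<close>)
    then show ?thesis
      using L2fun_mult_integrable[OF L(1,3)] L2fun_mult_integrable[OF L(2,3)] by simp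
  qed
  then show ?thesis
    by (simp add: sobolev_inner_def sum.distrib sum_distrib_left)
qed

lemma sobolev_inner_lincomb_right:
  fixes u v w :: "real^'n \<Rightarrow> real"
  assumes u: "u \<in> sobolev (cube R) p" and v: "v \<in> sobolev (cube R) p" and w: "w \<in> sobolev (cube R) p"
  shows "sobolev_inner (cube R) p w (\<lambda>x. a * u x + b * v x) = a * sobolev_inner (cube R) p w u + b * sobolev_inner (cube R) p w v"
  using sobolev_inner_lincomb_left[OF assms] by (simp add: sobolev_inner_commute)

lemma sobolev_norm_lincomb_square:
  fixes u v :: "real^'n \<Rightarrow> real"
  assumes u: "u \<in> sobolev (cube R) p" and v: "v \<in> sobolev (cube R) p"
  shows "(sobolev_norm (cube R) p (\<lambda>x. a * u x + b * v x))\<^sup>2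
    = a\<^sup>2 * (sobolev_norm (cube R) p u)\<^sup>2 + 2 * a * b * sobolev_inner (cube R) p u v + b\<^sup>2 * (sobolev_norm (cube R) p v)\<^sup>2"
  unfolding sobolev_norm_square
  by (simp add: sobolev_inner_lincomb_left[OF u v sobolev_lincomb[OF u v]] sobolev_inner_lincomb_right[OF u v u]
      sobolev_inner_lincomb_right[OF u v v] sobolev_inner_commute[of _ _ v u] algebra_simps power2_eq_square)

lemma sobolev_norm_add_square:
  fixes u v :: "real^'n \<Rightarrow> real"
  assumes u: "u \<in> sobolev (cube R) p" and v: "v \<in> sobolev (cube R) p"
  shows "(sobolev_norm (cube R) p (\<lambda>x. u x + v x))\<^sup>2
    = (sobolev_norm (cube R) p u)\<^sup>2 + 2 * sobolev_inner (cube R) p u v + (sobolev_norm (cube R) p v)\<^sup>2"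
  using sobolev_norm_lincomb_square[OF assms, of 1 1] by simp

lemma sobolev_norm_cmult:
  fixes u :: "real^'n \<Rightarrow> real"
  assumes u: "u \<in> sobolev (cube R) p"
  shows "sobolev_norm (cube R) p (\<lambda>x. a * u x) = \<bar>a\<bar> * sobolev_norm (cube R) p u"
proof -
  have "(sobolev_norm (cube R) p (\<lambda>x. a * u x))\<^sup>2 = (\<bar>a\<bar> * sobolev_norm (cube R) p u)\<^sup>2"
    using sobolev_norm_lincomb_square[OF u u, of a 0] by (simp add: power_mult_distrib)
  then show ?thesis
    by (rule power2_eq_imp_eq) auto
qed

lemma sobolev_Cauchy_Schwarz:
  fixes u v :: "real^'n \<Rightarrow> real"
  assumes u: "u \<in> sobolev (cube R) p" and v: "v \<in> sobolev (cube R) p"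
  shows "\<bar>sobolev_inner (cube R) p u v\<bar> \<le> sobolev_norm (cube R) p u * sobolev_norm (cube R) p v"
proof -
  have "(sobolev_inner (cube R) p u v)\<^sup>2 \<le> (sobolev_norm (cube R) p u)\<^sup>2 * (sobolev_norm (cube R) p v)\<^sup>2"
  proof (rule discriminant_bound)
    fix t
    show "0 \<le> (sobolev_norm (cube R) p u)\<^sup>2 + 2 * t * sobolev_inner (cube R) p u v + t\<^sup>2 * (sobolev_norm (cube R) p v)\<^sup>2"
      using zero_le_power2[of "sobolev_norm (cube R) p (\<lambda>x. 1 * u x + t * v x)"]
      unfolding sobolev_norm_lincomb_square[OF u v] by simp
  qed simp
  then show ?thesis
    by (metis abs_le_square_iff abs_mult abs_of_nonneg power_mult_distrib sobolev_norm_nonneg)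
qed

lemma sobolev_norm_triangle:
  fixes u v :: "real^'n \<Rightarrow> real"
  assumes u: "u \<in> sobolev (cube R) p" and v: "v \<in> sobolev (cube R) p"
  shows "sobolev_norm (cube R) p (\<lambda>x. u x + v x) \<le> sobolev_norm (cube R) p u + sobolev_norm (cube R) p v"
proof (rule power2_le_imp_le)
  show "(sobolev_norm (cube R) p (\<lambda>x. u x + v x))\<^sup>2 \<le> (sobolev_norm (cube R) p u + sobolev_norm (cube R) p v)\<^sup>2"
    using sobolev_norm_add_square[OF assms] sobolev_Cauchy_Schwarz[OF assms] by (simp add: power2_sum)
qed simp

lemma sobolev_norm_diff_commute:
  fixes u v :: "real^'n \<Rightarrow> real"
  assumes u: "u \<in> sobolev (cube R) p" and v: "v \<in> sobolev (cube R) p"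
  shows "sobolev_norm (cube R) p (\<lambda>x. u x - v x) = sobolev_norm (cube R) p (\<lambda>x. v x - u x)"
  using sobolev_norm_cmult[OF sobolev_diff[OF u v], of "-1"] by simp

lemma sobolev_norm_AE_zero:
  fixes u :: "real^'n \<Rightarrow> real"
  assumes u: "u \<in> sobolev (cube R) p" and "sobolev_norm (cube R) p u = 0"
  shows "AE x in cubeM R. u x = 0"
proof -
  let ?g = "weak_deriv (cube R) (\<lambda>_. 0) u"
  note L = sobolevD(3)[OF u, of "\<lambda>_. 0", simplified]
  have "(LINT x|cubeM R. (?g x)\<^sup>2) \<le> 0"
    using weak_deriv_norm_le[of "\<lambda>_. 0" p "cube R" u] assms(2) by simp
  then have "(LINT x|cubeM R. (?g x)\<^sup>2) = 0"
    by (intro antisym) (auto simp: integral_nonneg_AE)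
  then have "AE x in cubeM R. (?g x)\<^sup>2 = 0"
    using L by (subst (asm) integral_nonneg_eq_0_iff_AE) (auto simp: L2fun_def)
  then show ?thesis
    using weak_deriv_zero[OF sobolevD(1)[OF u]] by eventually_elim simp
qed

text \<open>Every weak derivative converges in L2. The limit at order zero is the candidate, and
  closedness of weak differentiation identifies the other limits as its derivatives.\<close>

lemma sobolev_complete:
  fixes u :: "nat \<Rightarrow> real^'n \<Rightarrow> real"
  assumes u: "\<And>n. u n \<in> sobolev (cube R) p"
    and C: "\<And>e. e > 0 \<Longrightarrow> \<exists>N. \<forall>i\<ge>N. \<forall>j\<ge>N. sobolev_norm (cube R) p (\<lambda>x. u i x - u j x) < e"
  shows "\<exists>v\<in>sobolev (cube R) p. (\<lambda>n. sobolev_norm (cube R) p (\<lambda>x. u n x - v x)) \<longlonglongrightarrow> 0"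
proof -
  let ?D = "weak_deriv (cube R)"
  have "\<exists>g. L2conv (cubeM R) (\<lambda>n. ?D \<alpha> (u n)) g" if \<alpha>: "mi_order \<alpha> \<le> p" for \<alpha>
  proof (rule L2_complete[OF finite_cubeM])
    show "L2fun (cubeM R) (?D \<alpha> (u n))" for n
      by (rule sobolevD(3)[OF u \<alpha>])
    fix e :: real assume "e > 0"
    then obtain N where N: "\<forall>i\<ge>N. \<forall>j\<ge>N. sobolev_norm (cube R) p (\<lambda>x. u i x - u j x) < sqrt e"
      using C[of "sqrt e"] by auto
    have "(LINT x|cubeM R. (?D \<alpha> (u i) x - ?D \<alpha> (u j) x)\<^sup>2) < e" if "i \<ge> N" "j \<ge> N" for i j
    proof -
      note d = sobolev_diff[OF u u, of i j]
      have "(LINT x|cubeM R. (?D \<alpha> (u i) x - ?D \<alpha> (u j) x)\<^sup>2) = (LINT x|cubeM R. (?D \<alpha> (\<lambda>x. u i x - u j x) x)\<^sup>2)"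
      proof (rule integral_cong_AE)
        show "AE x in cubeM R. (?D \<alpha> (u i) x - ?D \<alpha> (u j) x)\<^sup>2 = (?D \<alpha> (\<lambda>x. u i x - u j x) x)\<^sup>2"
          using weak_deriv_lincomb[OF u[of i] u[of j] \<alpha>, where a=1 and b="-1"] by eventually_elim simp
      qed (use L2funD(1)[OF sobolevD(3)[OF u \<alpha>]] L2funD(1)[OF sobolevD(3)[OF d \<alpha>]] in auto)
      also have "\<dots> \<le> (sobolev_norm (cube R) p (\<lambda>x. u i x - u j x))\<^sup>2"
        by (rule weak_deriv_norm_le[OF \<alpha>])
      also have "\<dots> < (sqrt e)\<^sup>2"
        using N that by (intro power_strict_mono) auto
      finally show ?thesis
        using \<open>e > 0\<close> by simp
    qed
    then show "\<exists>N. \<forall>i\<ge>N. \<forall>j\<ge>N. (LINT x|cubeM R. (?D \<alpha> (u i) x - ?D \<alpha> (u j) x)\<^sup>2) < e"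
      by blast
  qed
  then obtain g where g: "\<And>\<alpha>. mi_order \<alpha> \<le> p \<Longrightarrow> L2conv (cubeM R) (\<lambda>n. ?D \<alpha> (u n)) (g \<alpha>)"
    by metis
  define v where "v = g (\<lambda>_. 0)"
  \<comment> \<open>At order zero \<open>weak_deriv\<close> is a chosen representative that equals
    \<open>u n\<close> only almost everywhere.\<close>
  have conv0: "L2conv (cubeM R) u v"
  proof -
    have c: "L2conv (cubeM R) (\<lambda>n. ?D (\<lambda>_. 0) (u n)) v"
      unfolding v_def by (rule g) simp
    have "(LINT x|cubeM R. (u n x - v x)\<^sup>2) = (LINT x|cubeM R. (?D (\<lambda>_. 0) (u n) x - v x)\<^sup>2)" for n
    proof (rule integral_cong_AE)
      show "AE x in cubeM R. (u n x - v x)\<^sup>2 = (?D (\<lambda>_. 0) (u n) x - v x)\<^sup>2"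
        using weak_deriv_zero[OF sobolevD(1)[OF u[of n]]] by eventually_elim simp
    qed (use L2funD(1)[OF sobolevD(1)[OF u]] L2funD(1)[OF L2convD(1)[OF c]] L2funD(1)[OF L2convD(2)[OF c]] in auto)
    then show ?thesis
      using c sobolevD(1)[OF u] by (simp add: L2conv_def)
  qed
  have hw: "has_weak_deriv_L2 (cube R) \<alpha> v (g \<alpha>)" if "mi_order \<alpha> \<le> p" for \<alpha>
    by (rule has_weak_deriv_L2_limit[OF sobolevD(2)[OF u that] conv0 g[OF that]])
  have v: "v \<in> sobolev (cube R) p"
    using hw L2convD(2)[OF conv0] by (auto simp: sobolev_def L2_space_iff)
  have eq: "(LINT x|cubeM R. (?D \<alpha> (\<lambda>x. u n x - v x) x)\<^sup>2) = (LINT x|cubeM R. (?D \<alpha> (u n) x - g \<alpha> x)\<^sup>2)"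
    if \<alpha>: "mi_order \<alpha> \<le> p" for \<alpha> n
  proof (rule integral_cong_AE)
    show "AE x in cubeM R. (?D \<alpha> (\<lambda>x. u n x - v x) x)\<^sup>2 = (?D \<alpha> (u n) x - g \<alpha> x)\<^sup>2"
      using weak_deriv_lincomb[OF u[of n] v \<alpha>, where a=1 and b="-1"] weak_deriv_AE_eq[OF hw[OF \<alpha>]] by eventually_elim simp
  qed (use L2funD(1)[OF sobolevD(3)[OF u \<alpha>]] L2funD(1)[OF sobolevD(3)[OF sobolev_diff[OF u v] \<alpha>]] L2funD(1)[OF L2convD(2)[OF g[OF \<alpha>]]] in auto)
  have "(\<lambda>n. \<Sum>\<alpha> | mi_order \<alpha> \<le> p. LINT x|cubeM R. (?D \<alpha> (u n) x - g \<alpha> x)\<^sup>2) \<longlonglongrightarrow> (\<Sum>\<alpha>::'n \<Rightarrow> nat | mi_order \<alpha> \<le> p. 0)"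
    by (intro tendsto_sum) (use L2convD(3)[OF g] in auto)
  then have "(\<lambda>n. sobolev_inner (cube R) p (\<lambda>x. u n x - v x) (\<lambda>x. u n x - v x)) \<longlonglongrightarrow> 0"
    unfolding sobolev_inner_self by (simp add: eq)
  from tendsto_real_sqrt[OF this] show ?thesis
    using v by (auto simp: sobolev_norm_def)
qed

end

subsection \<open>The Sobolev embedding\<close>

lemma smooth_const: "smooth (\<lambda>x::real^'n::finite. c)"
proof (rule smooth_coinduct)
  let ?S = "{h. \<exists>c. h = (\<lambda>x::real^'n. c :: real)}"
  show "(\<lambda>x. c) \<in> ?S" by blast
  show "h differentiable (at x)" if "h \<in> ?S" for h x
    using that by auto
  show "pderivative i h \<in> ?S" if "h \<in> ?S" for h i
  proof -
    from that obtain c where "h = (\<lambda>x. c)"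
      by blast
    then have "pderivative i h = (\<lambda>x. 0)"
      using pderivative_eqI[OF has_derivative_const] by blast
    then show ?thesis
      by blast
  qed
qed

text \<open>One induction for both claims, since the derivative formula for the next summand
  requires smoothness of the partial sum.\<close>

lemma smooth_sum_and_pderivative:
  fixes f :: "'i \<Rightarrow> real^'n::finite \<Rightarrow> real"
  assumes "finite I" "\<And>i. i \<in> I \<Longrightarrow> smooth (f i)"
  shows "smooth (\<lambda>x. \<Sum>i\<in>I. c i * f i x) \<and>
    pderivative k (\<lambda>x. \<Sum>i\<in>I. c i * f i x) = (\<lambda>x. \<Sum>i\<in>I. c i * pderivative k (f i) x)"
  using assms
proof (induction I rule: finite_induct)
  case empty
  have "pderivative k (\<lambda>x::real^'n. 0) = (\<lambda>x. 0)"
    using pderivative_eqI[OF has_derivative_const] by blast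
  then show ?case
    by (simp add: smooth_const)
next
  case (insert a I)
  then have *: "smooth (\<lambda>x. \<Sum>i\<in>I. c i * f i x)"
    "pderivative k (\<lambda>x. \<Sum>i\<in>I. c i * f i x) = (\<lambda>x. \<Sum>i\<in>I. c i * pderivative k (f i) x)"
    by auto
  have fa: "smooth (f a)" using insert by auto
  show ?case
    using smooth_lincomb[OF fa *(1), of "c a" 1] pderivative_lincomb[OF fa *(1), of k "c a" 1] insert(1,2) *(2) by simp
qed

lemmas smooth_sum = smooth_sum_and_pderivative[THEN conjunct1] smooth_sum_and_pderivative[THEN conjunct2]

section \<open>Taylor expansion along segments\<close>

definition dirD :: "real^'n::finite \<Rightarrow> (real^'n \<Rightarrow> real) \<Rightarrow> real^'n \<Rightarrow> real" where
  "dirD v f x = (\<Sum>i\<in>UNIV. v $ i * pderivative i f x)"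

lemma smooth_dirD: "smooth f \<Longrightarrow> smooth (dirD v f)"
  unfolding dirD_def [abs_def] by (intro smooth_sum(1) smooth_pderivative) auto

lemma smooth_dirD_funpow: "smooth f \<Longrightarrow> smooth ((dirD v ^^ j) f)"
  by (induction j) (auto intro: smooth_dirD)

lemma dirD_sum:
  fixes f :: "'i \<Rightarrow> real^'n::finite \<Rightarrow> real"
  assumes "finite I" "\<And>i. i \<in> I \<Longrightarrow> smooth (f i)"
  shows "dirD v (\<lambda>x. \<Sum>i\<in>I. c i * f i x) = (\<lambda>x. \<Sum>i\<in>I. c i * dirD v (f i) x)"
proof
  fix x
  have "dirD v (\<lambda>x. \<Sum>i\<in>I. c i * f i x) x = (\<Sum>k\<in>UNIV. v $ k * (\<Sum>i\<in>I. c i * pderivative k (f i) x))"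
    using smooth_sum(2)[of I f _ c] assms by (simp add: dirD_def)
  also have "\<dots> = (\<Sum>k\<in>UNIV. \<Sum>i\<in>I. c i * (v $ k * pderivative k (f i) x))"
    by (simp add: sum_distrib_left mult_ac)
  also have "\<dots> = (\<Sum>i\<in>I. \<Sum>k\<in>UNIV. c i * (v $ k * pderivative k (f i) x))"
    by (rule sum.swap)
  finally show "dirD v (\<lambda>x. \<Sum>i\<in>I. c i * f i x) x = (\<Sum>i\<in>I. c i * dirD v (f i) x)"
    by (simp add: dirD_def sum_distrib_left)
qed

lemma dirD_funpow_sum:
  fixes f :: "'i \<Rightarrow> real^'n::finite \<Rightarrow> real"
  assumes "finite I" "\<And>i. i \<in> I \<Longrightarrow> smooth (f i)"
  shows "(dirD v ^^ j) (\<lambda>x. \<Sum>i\<in>I. c i * f i x) = (\<lambda>x. \<Sum>i\<in>I. c i * (dirD v ^^ j) (f i) x)"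
proof (induction j)
  case (Suc j)
  have "dirD v (\<lambda>x. \<Sum>i\<in>I. c i * (dirD v ^^ j) (f i) x) = (\<lambda>x. \<Sum>i\<in>I. c i * dirD v ((dirD v ^^ j) (f i)) x)"
    by (rule dirD_sum[OF assms(1)]) (rule smooth_dirD_funpow[OF assms(2)])
  then show ?case
    using Suc by simp
qed simp

definition absderivs :: "nat \<Rightarrow> (real^'n::finite \<Rightarrow> real) \<Rightarrow> real^'n \<Rightarrow> real" where
  "absderivs q w z = (\<Sum>\<gamma> | mi_order \<gamma> \<le> q. \<bar>mi_deriv \<gamma> w z\<bar>)"

lemma absderivs_nonneg: "absderivs q w z \<ge> 0"
  by (simp add: absderivs_def sum_nonneg)

lemma absderivs_mono: "q \<le> q' \<Longrightarrow> absderivs q w z \<le> absderivs q' w z"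
  unfolding absderivs_def by (rule sum_mono2) auto

lemma absderivs_continuous: "smooth w \<Longrightarrow> continuous_on S (absderivs q w)"
  unfolding absderivs_def [abs_def]
  by (intro continuous_intros smooth_continuous smooth_mi_deriv)

text \<open>The induction generalizes \<open>\<alpha>\<close> because the innermost derivative is
  expanded first, which raises one entry of the multi-index. Each expansion has
  \<open>CARD('n)\<close> terms with coefficients at most \<open>norm v\<close>.\<close>

lemma dirD_funpow_le:
  fixes w :: "real^'n::finite \<Rightarrow> real"
  assumes w: "smooth w"
  shows "\<bar>(dirD v ^^ j) (mi_deriv \<alpha> w) z\<bar> \<le> (real CARD('n) * norm v) ^ j * absderivs (mi_order \<alpha> + j) w z"
proof (induction j arbitrary: \<alpha>)
  case 0
  then show ?case
    unfolding absderivs_def by (auto intro!: member_le_sum[of \<alpha> _ "\<lambda>\<gamma>. \<bar>mi_deriv \<gamma> w z\<bar>"])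
next
  case (Suc j)
  let ?A = "absderivs (mi_order \<alpha> + Suc j) w z" and ?B = "(real CARD('n) * norm v) ^ j"
  have "dirD v (mi_deriv \<alpha> w) = (\<lambda>x. \<Sum>i\<in>UNIV. v $ i * mi_deriv (\<alpha>(i := Suc (\<alpha> i))) w x)"
    by (simp add: dirD_def [abs_def] pderivative_mi_deriv[OF w])
  then have "(dirD v ^^ Suc j) (mi_deriv \<alpha> w) z = (\<Sum>i\<in>UNIV. v $ i * (dirD v ^^ j) (mi_deriv (\<alpha>(i := Suc (\<alpha> i))) w) z)"
    by (simp only: funpow_Suc_right o_apply) (simp add: dirD_funpow_sum smooth_mi_deriv[OF w])
  also have "\<bar>\<dots>\<bar> \<le> (\<Sum>i\<in>UNIV. \<bar>v $ i * (dirD v ^^ j) (mi_deriv (\<alpha>(i := Suc (\<alpha> i))) w) z\<bar>)"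
    by (rule sum_abs)
  also have "\<dots> \<le> (\<Sum>i\<in>(UNIV::'n set). norm v * (?B * ?A))"
  proof (rule sum_mono)
    fix i
    have "\<bar>(dirD v ^^ j) (mi_deriv (\<alpha>(i := Suc (\<alpha> i))) w) z\<bar> \<le> ?B * ?A"
      using Suc.IH[of "\<alpha>(i := Suc (\<alpha> i))"] by (simp only: mi_order_upd add_Suc add_Suc_right)
    then show "\<bar>v $ i * (dirD v ^^ j) (mi_deriv (\<alpha>(i := Suc (\<alpha> i))) w) z\<bar> \<le> norm v * (?B * ?A)"
      unfolding abs_mult by (intro mult_mono component_le_norm_cart) auto
  qed
  also have "\<dots> = (real CARD('n) * norm v) ^ Suc j * ?A"
    by (simp add: mult_ac)
  finally show ?case .
qed

text \<open>Taylor's formula with integral remainder on the segment from \<open>y\<close> to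
  \<open>x\<close>. Factorials are bounded by 1 and powers of the length by \<open>K\<close>; the
  factor \<open>(1 - t) ^ (m - 1)\<close> is kept, since it has to pay for a Jacobian later.\<close>

lemma taylor_segment_bound:
  fixes w :: "real^'n::finite \<Rightarrow> real"
  assumes w: "smooth w" and m: "m > 0" and q: "mi_order \<alpha> + m \<le> q"
    and K: "\<And>j. j \<le> m \<Longrightarrow> (real CARD('n) * norm (x - y)) ^ j \<le> K"
  shows "\<bar>mi_deriv \<alpha> w x\<bar> \<le> real m * K * absderivs q w y
    + K * integral {0..1} (\<lambda>t. (1 - t) ^ (m - 1) * absderivs q w (y + t *\<^sub>R (x - y)))"
proof -
  define v where "v = x - y"
  define Df where "Df j t = (dirD v ^^ j) (mi_deriv \<alpha> w) (y + t *\<^sub>R v)" for j t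
  have bound: "\<bar>Df j t\<bar> \<le> K * absderivs q w (y + t *\<^sub>R v)" if "j \<le> m" for j t
  proof -
    have "\<bar>Df j t\<bar> \<le> (real CARD('n) * norm v) ^ j * absderivs (mi_order \<alpha> + j) w (y + t *\<^sub>R v)"
      unfolding Df_def by (rule dirD_funpow_le[OF w])
    also have "\<dots> \<le> K * absderivs q w (y + t *\<^sub>R v)"
      using K[OF that] q that by (intro mult_mono absderivs_mono absderivs_nonneg order_trans[OF _ K[OF that]]) (auto simp: v_def)
    finally show ?thesis .
  qed
  have K0: "K \<ge> 0" using K[of 0] by simp
  have der: "(Df j has_vector_derivative Df (Suc j) t) (at t within {0..1})" for j t
  proof -
    have 1: "Df (Suc j) t = (\<Sum>i\<in>UNIV. v $ i * pderivative i ((dirD v ^^ j) (mi_deriv \<alpha> w)) (y + t *\<^sub>R v))"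
      by (simp add: Df_def dirD_def)
    have 2: "Df j = (\<lambda>t. (dirD v ^^ j) (mi_deriv \<alpha> w) (y + t *\<^sub>R v))"
      by (simp add: Df_def fun_eq_iff)
    show ?thesis
      unfolding has_real_derivative_iff_has_vector_derivative[symmetric] 1
      unfolding 2 by (rule smooth_line_derivative[OF smooth_dirD_funpow[OF smooth_mi_deriv[OF w]]])
  qed
  define I where "I t = ((1 - t) ^ (m - 1) / fact (m - 1)) *\<^sub>R Df m t" for t
  have T: "Df 0 1 = (\<Sum>i<m. ((1 - 0) ^ i / fact i) *\<^sub>R Df i 0) + integral {0..1} I"
    "I integrable_on {0..1}"
    using Taylor_integral[of m Df "Df 0" 0 1, OF m refl der] Taylor_integrable[of m Df "Df 0" 0 1, OF m refl der]
    by (auto simp: I_def [abs_def])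
  have "mi_deriv \<alpha> w x = Df 0 1"
    by (simp add: Df_def v_def)
  then have eq: "mi_deriv \<alpha> w x = (\<Sum>i<m. (1 / fact i) * Df i 0) + integral {0..1} I"
    using T(1) by simp
  have 1: "\<bar>\<Sum>i<m. (1 / fact i) * Df i 0\<bar> \<le> real m * K * absderivs q w y"
  proof -
    have "\<bar>\<Sum>i<m. (1 / fact i) * Df i 0\<bar> \<le> (\<Sum>i<m. \<bar>(1 / fact i) * Df i 0\<bar>)"
      by (rule sum_abs)
    also have "\<dots> \<le> (\<Sum>i<m. 1 * (K * absderivs q w y))"
    proof (rule sum_mono)
      fix i assume i: "i \<in> {..<m}"
      have "\<bar>1 / fact i :: real\<bar> \<le> 1"
        by (simp add: fact_ge_1)
      then show "\<bar>(1 / fact i) * Df i 0\<bar> \<le> 1 * (K * absderivs q w y)"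
        unfolding abs_mult using bound[of i 0] i by (intro mult_mono) auto
    qed
    finally show ?thesis by simp
  qed
  have int: "(\<lambda>t. K * ((1 - t) ^ (m - 1) * absderivs q w (y + t *\<^sub>R v))) integrable_on {0..1}"
    by (intro integrable_continuous_interval continuous_intros continuous_on_compose2[OF absderivs_continuous[OF w, of UNIV]]) auto
  have 2: "\<bar>integral {0..1} I\<bar> \<le> integral {0..1} (\<lambda>t. K * ((1 - t) ^ (m - 1) * absderivs q w (y + t *\<^sub>R v)))"
    unfolding real_norm_def[symmetric]
  proof (rule integral_norm_bound_integral[OF T(2) int])
    fix t :: real assume t: "t \<in> {0..1}"
    have f: "\<bar>1 / fact (m - 1) :: real\<bar> \<le> 1"
      by (simp add: fact_ge_1)
    have "norm (I t) = \<bar>1 / fact (m - 1)\<bar> * ((1 - t) ^ (m - 1) * \<bar>Df m t\<bar>)"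
      using t by (simp add: I_def abs_mult)
    also have "\<dots> \<le> 1 * ((1 - t) ^ (m - 1) * (K * absderivs q w (y + t *\<^sub>R v)))"
      using bound[of m t] t f by (intro mult_mono mult_left_mono) auto
    finally show "norm (I t) \<le> K * ((1 - t) ^ (m - 1) * absderivs q w (y + t *\<^sub>R v))"
      by (simp add: mult_ac)
  qed
  show ?thesis
    using 1 2 by (simp add: eq v_def)
qed

text \<open>Kept in the extended nonnegative reals so that it applies before integrability of
  \<open>g\<close> is known; an infinite left side contradicts the finite bound on its
  square.\<close>

lemma nn_sqrt_Cauchy_Schwarz:
  fixes g :: "'a::euclidean_space \<Rightarrow> ennreal"
  assumes [measurable]: "g \<in> borel_measurable borel" "A \<in> sets borel" and I: "I \<ge> 0" "m \<ge> 0"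
    and "(\<integral>\<^sup>+y. (g y)\<^sup>2 * indicator A y \<partial>lborel) \<le> ennreal I" "emeasure lborel A = ennreal m"
  shows "(\<integral>\<^sup>+y. g y * indicator A y \<partial>lborel) \<le> ennreal (sqrt (m * I))"
proof -
  have e1: "indicator A y * (g y * indicator A y) = g y * indicator A y" for y :: 'a
    by (simp add: indicator_def)
  have e2: "(g y * indicator A y)\<^sup>2 = (g y)\<^sup>2 * indicator A y" for y
    by (simp add: indicator_def)
  have e3: "(indicator A y :: ennreal)\<^sup>2 = indicator A y" for y :: 'a
    by (simp add: indicator_def)
  have "(\<integral>\<^sup>+y. indicator A y * (g y * indicator A y) \<partial>lborel)\<^sup>2
      \<le> (\<integral>\<^sup>+y. (indicator A y)\<^sup>2 \<partial>lborel) * (\<integral>\<^sup>+y. (g y * indicator A y)\<^sup>2 \<partial>lborel)"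
    by (rule Cauchy_Schwarz_nn_integral) auto
  also have "\<dots> \<le> ennreal m * ennreal I"
    unfolding e2 e3 using assms by (intro mult_mono) auto
  also have "\<dots> = ennreal ((sqrt (m * I))\<^sup>2)"
    using I by (simp add: ennreal_mult)
  also have "\<dots> = (ennreal (sqrt (m * I)))\<^sup>2"
    using I by (intro ennreal_power[symmetric]) simp
  finally have le: "(\<integral>\<^sup>+y. g y * indicator A y \<partial>lborel)\<^sup>2 \<le> (ennreal (sqrt (m * I)))\<^sup>2"
    unfolding e1 .
  have I0: "0 \<le> m * I" using I by simp
  show ?thesis
  proof (cases "\<integral>\<^sup>+y. g y * indicator A y \<partial>lborel")
    case (real r)
    then have "ennreal (r\<^sup>2) \<le> ennreal ((sqrt (m * I))\<^sup>2)"
      using le I0 by (simp add: ennreal_power)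
    then have "r\<^sup>2 \<le> (sqrt (m * I))\<^sup>2"
      using I0 by (subst (asm) ennreal_le_iff) auto
    then have "r \<le> sqrt (m * I)"
      by (rule power2_le_imp_le) (use I0 in simp)
    then show ?thesis
      using real by (simp add: ennreal_leI)
  next
    case top
    then show ?thesis
      using le I0 unfolding power2_eq_square by (simp add: ennreal_mult[symmetric] top_unique)
  qed
qed

text \<open>\<open>taylor_segment_bound\<close> is integrated over \<open>y\<close> in the cube; its
  left side does not depend on \<open>y\<close> and picks up the volume. Cauchy-Schwarz then brings
  in the L2 norm of \<open>absderivs q w\<close>.\<close>

lemma sobolev_average_bound:
  fixes w :: "real^'n::finite \<Rightarrow> real"
  assumes R: "R > 0" and w: "smooth w" and m: "m > 0" "CARD('n) \<le> 2 * (m - 1)"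
    and q: "mi_order \<alpha> + m \<le> q" and x: "x \<in> ccube R"
    and K: "\<And>y j. y \<in> ccube R \<Longrightarrow> j \<le> m \<Longrightarrow> (real CARD('n) * norm (x - y)) ^ j \<le> K"
  shows "\<bar>mi_deriv \<alpha> w x\<bar> * measure (cubeM R) (cube R :: (real^'n) set)
    \<le> (real m * K + K) * sqrt (measure (cubeM R) (cube R :: (real^'n) set) * (LINT y|cubeM R. (absderivs q w y)\<^sup>2))"
proof -
  define G where "G = absderivs q w"
  define \<mu> where "\<mu> = measure (cubeM R) (cube R :: (real^'n) set)"
  define I where "I = (LINT y|cubeM R. (G y)\<^sup>2)"
  let ?Q = "cube R :: (real^'n) set"
  have [measurable]: "?Q \<in> sets borel"
    by simp
  have Gc: "continuous_on S G" for S
    unfolding G_def by (rule absderivs_continuous[OF w])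
  have Gm [measurable]: "G \<in> borel_measurable borel"
    by (rule borel_measurable_continuous_onI[OF Gc])
  have G0: "G y \<ge> 0" for y
    by (simp add: G_def absderivs_nonneg)
  have K0: "K \<ge> 0"
    using K[OF x, of 0] by simp
  have \<mu>: "emeasure lborel ?Q = ennreal \<mu>" "\<mu> \<ge> 0"
  proof -
    have "emeasure lborel ?Q = emeasure lebesgue ?Q"
      by simp
    also have "\<dots> = ennreal (measure lebesgue ?Q)"
      by (rule emeasure_eq_measure2) (simp add: fmeasurableD)
    finally show "emeasure lborel ?Q = ennreal \<mu>"
      by (simp add: \<mu>_def measure_restrict_space)
  qed (simp add: \<mu>_def)
  have I: "(\<integral>\<^sup>+y. ennreal ((G y)\<^sup>2) * indicator ?Q y \<partial>lborel) = ennreal I" "I \<ge> 0"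
  proof -
    have "(\<integral>\<^sup>+y. ennreal ((G y)\<^sup>2) * indicator ?Q y \<partial>lborel) = (\<integral>\<^sup>+y. ennreal ((G y)\<^sup>2) \<partial>cubeM R)"
      by (subst nn_integral_cubeM) auto
    also have "\<dots> = ennreal I"
      unfolding I_def by (intro nn_integral_eq_integral L2funD(2) continuous_L2fun Gc) auto
    finally show "(\<integral>\<^sup>+y. ennreal ((G y)\<^sup>2) * indicator ?Q y \<partial>lborel) = ennreal I" .
  qed (simp add: I_def integral_nonneg_AE)
  let ?J = "ennreal (sqrt (\<mu> * I))"
  have b1: "(\<integral>\<^sup>+y. ennreal (G y) * indicator ?Q y \<partial>lborel) \<le> ?J"
    by (rule nn_sqrt_Cauchy_Schwarz) (use I \<mu> G0 in \<open>auto simp: ennreal_power\<close>)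
  \<comment> \<open>For fixed \<open>t\<close> the map from \<open>y\<close> to
    \<open>t *\<^sub>R x + (1 - t) *\<^sub>R y\<close> sends the cube into itself with Jacobian
    \<open>(1 - t) ^ CARD('n)\<close>. The squared weight \<open>(1 - t) ^ (2 * (m - 1))\<close>
    compensates its inverse, so the bound is uniform in \<open>t\<close>.\<close>
  have b2: "(\<integral>\<^sup>+y. ennreal ((1 - t) ^ (m - 1) * G (y + t *\<^sub>R (x - y))) * indicator ?Q y \<partial>lborel) \<le> ?J"
    if t: "0 \<le> t" "t < 1" for t
  proof -
    let ?s = "1 - t"
    have s: "0 < ?s" "?s \<le> 1" using t by auto
    have e: "y + t *\<^sub>R (x - y) = t *\<^sub>R x + ?s *\<^sub>R y" for y
      by (simp add: algebra_simps)
    have inQ: "t *\<^sub>R x + ?s *\<^sub>R y \<in> ?Q" if "y \<in> ?Q" for y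
    proof -
      have "\<bar>t * x $ i + ?s * y $ i\<bar> < R" for i
      proof -
        have "\<bar>t * x $ i + ?s * y $ i\<bar> \<le> t * \<bar>x $ i\<bar> + ?s * \<bar>y $ i\<bar>"
          using t by (intro order_trans[OF abs_triangle_ineq]) (simp add: abs_mult)
        also have "\<dots> < t * R + ?s * R"
          using x that s t by (intro add_le_less_mono mult_left_mono mult_strict_left_mono) (auto simp: mem_ccube mem_cube)
        finally show ?thesis by (simp add: algebra_simps)
      qed
      then show ?thesis by (simp add: mem_cube)
    qed
    have "(\<integral>\<^sup>+y. (ennreal (G (t *\<^sub>R x + ?s *\<^sub>R y)))\<^sup>2 * indicator ?Q y \<partial>lborel)
       \<le> (\<integral>\<^sup>+y. ennreal ((G (t *\<^sub>R x + ?s *\<^sub>R y))\<^sup>2) * indicator ?Q (t *\<^sub>R x + ?s *\<^sub>R y) \<partial>lborel)"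
      using inQ G0 by (intro nn_integral_mono) (auto simp: ennreal_power indicator_def)
    also have "\<dots> = ennreal (1 / \<bar>?s\<bar> ^ CARD('n)) * ennreal I"
      using s I by (subst nn_integral_lborel_affine[of "\<lambda>y. ennreal ((G y)\<^sup>2) * indicator ?Q y"]) auto
    also have "\<dots> = ennreal (1 / ?s ^ CARD('n) * I)"
      using s I by (subst ennreal_mult[symmetric]) auto
    finally have "(\<integral>\<^sup>+y. ennreal (G (t *\<^sub>R x + ?s *\<^sub>R y)) * indicator ?Q y \<partial>lborel) \<le> ennreal (sqrt (\<mu> * (1 / ?s ^ CARD('n) * I)))"
      by (intro nn_sqrt_Cauchy_Schwarz) (use s I \<mu> in auto)
    then have "ennreal (?s ^ (m - 1)) * (\<integral>\<^sup>+y. ennreal (G (t *\<^sub>R x + ?s *\<^sub>R y)) * indicator ?Q y \<partial>lborel)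
       \<le> ennreal (?s ^ (m - 1)) * ennreal (sqrt (\<mu> * (1 / ?s ^ CARD('n) * I)))"
      by (rule mult_left_mono) simp
    also have "\<dots> = ennreal (?s ^ (m - 1) * sqrt (\<mu> * (1 / ?s ^ CARD('n) * I)))"
      using s I \<mu> by (simp add: ennreal_mult)
    also have "\<dots> \<le> ?J"
    proof (rule ennreal_leI)
      have "?s ^ (m - 1) * sqrt (\<mu> * (1 / ?s ^ CARD('n) * I)) = sqrt ((?s ^ (m - 1))\<^sup>2 * (\<mu> * (1 / ?s ^ CARD('n) * I)))"
        by (subst real_sqrt_mult[of "(?s ^ (m - 1))\<^sup>2"], subst real_sqrt_abs) (use s in simp)
      also have "(?s ^ (m - 1))\<^sup>2 * (\<mu> * (1 / ?s ^ CARD('n) * I)) = (?s ^ (2 * (m - 1)) / ?s ^ CARD('n)) * (\<mu> * I)"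
        by (simp add: power_mult[symmetric] mult.commute)
      also have "sqrt \<dots> \<le> sqrt (1 * (\<mu> * I))"
      proof (intro real_sqrt_le_mono mult_right_mono)
        show "?s ^ (2 * (m - 1)) / ?s ^ CARD('n) \<le> 1"
          using s m(2) by (simp add: power_decreasing)
      qed (use I \<mu> in auto)
      finally show "?s ^ (m - 1) * sqrt (\<mu> * (1 / ?s ^ CARD('n) * I)) \<le> sqrt (\<mu> * I)"
        by simp
    qed
    also have "ennreal (?s ^ (m - 1)) * (\<integral>\<^sup>+y. ennreal (G (t *\<^sub>R x + ?s *\<^sub>R y)) * indicator ?Q y \<partial>lborel)
       = (\<integral>\<^sup>+y. ennreal (?s ^ (m - 1) * G (y + t *\<^sub>R (x - y))) * indicator ?Q y \<partial>lborel)"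
      unfolding e using s G0 by (subst nn_integral_cmult[symmetric]) (auto simp: ennreal_mult mult.assoc)
    finally show ?thesis .
  qed
  define H where "H y = integral {0..1} (\<lambda>t. (1 - t) ^ (m - 1) * G (y + t *\<^sub>R (x - y)))" for y
  have Hnn: "ennreal (H y) = (\<integral>\<^sup>+t. ennreal ((1 - t) ^ (m - 1) * G (y + t *\<^sub>R (x - y))) * indicator {0..1} t \<partial>lborel)" and H0: "H y \<ge> 0" for y
  proof -
    let ?f = "\<lambda>t. (1 - t) ^ (m - 1) * G (y + t *\<^sub>R (x - y))"
    have c: "continuous_on {0..1} ?f"
      by (intro continuous_intros continuous_on_compose2[OF Gc[of UNIV]]) auto
    have "?f integrable_on {0..1}"
      by (rule integrable_continuous_interval[OF c])
    then have "(?f has_integral H y) {0..1}"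
      unfolding H_def by (rule integrable_integral)
    moreover have "?f \<in> borel_measurable borel"
      by measurable
    ultimately have "(\<integral>\<^sup>+t. ennreal (?f t) * indicator {0..1} t \<partial>lborel) = ennreal (H y)"
      by (intro nn_integral_has_integral_lebesgue'[symmetric, THEN sym]) (auto simp: G0)
    then show "ennreal (H y) = (\<integral>\<^sup>+t. ennreal (?f t) * indicator {0..1} t \<partial>lborel)" ..
    show "H y \<ge> 0"
      unfolding H_def by (rule Henstock_Kurzweil_Integration.integral_nonneg[OF integrable_continuous_interval[OF c]]) (auto simp: G0)
  qed
  have "(\<integral>\<^sup>+y. ennreal (H y) * indicator ?Q y \<partial>lborel)
     = (\<integral>\<^sup>+y. \<integral>\<^sup>+t. ennreal ((1 - t) ^ (m - 1) * G (y + t *\<^sub>R (x - y))) * indicator {0..1} t * indicator ?Q y \<partial>lborel \<partial>lborel)"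
    unfolding Hnn by (intro nn_integral_cong, subst nn_integral_multc) auto
  also have "\<dots> = (\<integral>\<^sup>+t. \<integral>\<^sup>+y. ennreal ((1 - t) ^ (m - 1) * G (y + t *\<^sub>R (x - y))) * indicator {0..1} t * indicator ?Q y \<partial>lborel \<partial>lborel)"
    by (rule lborel_pair.Fubini') measurable
  also have "\<dots> \<le> (\<integral>\<^sup>+t. ?J * indicator {0..1::real} t \<partial>lborel)"
  proof (rule nn_integral_mono_AE)
    have "AE t::real in lborel. t \<noteq> 1"
      by (rule AE_lborel_singleton)
    then show "AE t in lborel. (\<integral>\<^sup>+y. ennreal ((1 - t) ^ (m - 1) * G (y + t *\<^sub>R (x - y))) * indicator {0..1} t * indicator ?Q y \<partial>lborel) \<le> ?J * indicator {0..1} t"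
    proof eventually_elim
      case (elim t)
      show ?case
      proof (cases "t \<in> {0..1}")
        case True
        then have "0 \<le> t" "t < 1" using elim by auto
        from b2[OF this] True show ?thesis by simp
      qed simp
    qed
  qed
  also have "\<dots> = ?J"
    by (simp add: nn_integral_cmult)
  finally have b3: "(\<integral>\<^sup>+y. ennreal (H y) * indicator ?Q y \<partial>lborel) \<le> ?J" .
  have [measurable]: "(\<lambda>y. ennreal (H y)) \<in> borel_measurable borel"
    unfolding Hnn by measurable
  have pt: "ennreal \<bar>mi_deriv \<alpha> w x\<bar> * indicator ?Q y
     \<le> ennreal (real m * K) * (ennreal (G y) * indicator ?Q y) + ennreal K * (ennreal (H y) * indicator ?Q y)" for y
  proof (cases "y \<in> ?Q")
    case True
    then have "y \<in> ccube R" using cube_subset_ccube by blast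
    then have "\<bar>mi_deriv \<alpha> w x\<bar> \<le> real m * K * G y + K * H y"
      unfolding G_def H_def by (intro taylor_segment_bound[OF w m(1) q] K)
    then have "ennreal \<bar>mi_deriv \<alpha> w x\<bar> \<le> ennreal (real m * K * G y + K * H y)"
      by (rule ennreal_leI)
    also have "\<dots> = ennreal (real m * K) * ennreal (G y) + ennreal K * ennreal (H y)"
      using K0 G0 H0 by (simp add: ennreal_plus ennreal_mult)
    finally show ?thesis using True by simp
  qed simp
  have "ennreal (\<bar>mi_deriv \<alpha> w x\<bar> * \<mu>) = (\<integral>\<^sup>+y. ennreal \<bar>mi_deriv \<alpha> w x\<bar> * indicator ?Q y \<partial>lborel)"
    using \<mu> by (simp add: nn_integral_cmult ennreal_mult)
  also have "\<dots> \<le> (\<integral>\<^sup>+y. ennreal (real m * K) * (ennreal (G y) * indicator ?Q y) + ennreal K * (ennreal (H y) * indicator ?Q y) \<partial>lborel)"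
    by (rule nn_integral_mono) (rule pt)
  also have "\<dots> = ennreal (real m * K) * (\<integral>\<^sup>+y. ennreal (G y) * indicator ?Q y \<partial>lborel) + ennreal K * (\<integral>\<^sup>+y. ennreal (H y) * indicator ?Q y \<partial>lborel)"
    by (subst nn_integral_add) (auto simp: nn_integral_cmult)
  also have "\<dots> \<le> ennreal (real m * K) * ?J + ennreal K * ?J"
    by (intro add_mono mult_left_mono b1 b3) auto
  also have "\<dots> = ennreal ((real m * K + K) * sqrt (\<mu> * I))"
    using K0 I \<mu> by (simp add: ennreal_plus ennreal_mult distrib_right)
  finally have "\<bar>mi_deriv \<alpha> w x\<bar> * \<mu> \<le> (real m * K + K) * sqrt (\<mu> * I)"
    using K0 I \<mu> by (subst (asm) ennreal_le_iff) auto
  then show ?thesis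
    by (simp add: \<mu>_def I_def G_def)
qed

lemma sum_squared_le_card:
  fixes a :: "'i \<Rightarrow> real"
  assumes "finite A"
  shows "(\<Sum>i\<in>A. a i)\<^sup>2 \<le> real (card A) * (\<Sum>i\<in>A. (a i)\<^sup>2)"
  using Cauchy_Schwarz_ineq_sum[of "\<lambda>_. 1" a A] by simp

lemma measure_cube_pos:
  assumes "R > 0"
  shows "measure (cubeM R) (cube R :: (real^'n::finite) set) > 0"
proof -
  have "(0 :: real^'n) \<in> cube R"
    using assms by (simp add: mem_cube)
  then have "\<not> negligible (cube R :: (real^'n) set)"
    using open_not_negligible[OF open_cube] by blast
  then have "measure lebesgue (cube R :: (real^'n) set) \<noteq> 0"
    using negligible_iff_measure[of "cube R :: (real^'n) set"] lmeasurable_cube by blast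
  then show ?thesis
    by (simp add: measure_restrict_space zero_less_measure_iff)
qed

text \<open>Averaging the Taylor expansion with centre \<open>y\<close> over the cube; after the substitution
  \<open>y \<mapsto> y + t(x - y)\<close> the remainder carries the factor \<open>(1 - t)\<close> to the power \<open>m - 1 - n/2\<close>,
  which is harmless because \<open>2 (m - 1) \<ge> n\<close>.\<close>

lemma smooth_sobolev_inequality:
  assumes R: "R > 0" and m: "m > 0" "CARD('n) \<le> 2 * (m - 1)"
  shows "\<exists>C>0. \<forall>\<alpha> (w::real^'n::finite \<Rightarrow> real) x. smooth w \<longrightarrow> mi_order \<alpha> + m \<le> q \<longrightarrow> x \<in> ccube R \<longrightarrow>
    \<bar>mi_deriv \<alpha> w x\<bar> \<le> C * sqrt (\<Sum>\<gamma> | mi_order \<gamma> \<le> q. LINT y|cubeM R. (mi_deriv \<gamma> w y)\<^sup>2)"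
proof -
  define V where "V = max 1 (real CARD('n) * (2 * (real CARD('n) * R)))"
  define K where "K = V ^ m"
  define \<mu> where "\<mu> = measure (cubeM R) (cube R :: (real^'n) set)"
  define N where "N = real (card {\<gamma> :: 'n \<Rightarrow> nat. mi_order \<gamma> \<le> q})"
  define C where "C = (real m * K + K) * sqrt (\<mu> * N) / \<mu>"
  have \<mu>: "\<mu> > 0" unfolding \<mu>_def by (rule measure_cube_pos[OF R])
  have V: "V \<ge> 1" by (simp add: V_def)
  have K0: "K \<ge> 0" using V by (simp add: K_def)
  have "\<bar>mi_deriv \<alpha> w x\<bar> \<le> (C + 1) * sqrt (\<Sum>\<gamma> | mi_order \<gamma> \<le> q. LINT y|cubeM R. (mi_deriv \<gamma> w y)\<^sup>2)"
    if w: "smooth w" and q: "mi_order \<alpha> + m \<le> q" and x: "x \<in> ccube R" for \<alpha> and w :: "real^'n \<Rightarrow> real" and x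
  proof -
    let ?S = "\<Sum>\<gamma> | mi_order \<gamma> \<le> q. LINT y|cubeM R. (mi_deriv \<gamma> w y)\<^sup>2"
    let ?I = "LINT y|cubeM R. (absderivs q w y)\<^sup>2"
    have K: "(real CARD('n) * norm (x - y)) ^ j \<le> K" if "y \<in> ccube R" "j \<le> m" for y j
    proof -
      have "norm (x - y) \<le> norm x + norm y"
        by (rule norm_triangle_ineq4)
      then have "real CARD('n) * norm (x - y) \<le> real CARD('n) * (2 * (real CARD('n) * R))"
        using norm_ccube[OF x] norm_ccube[OF that(1)] by (intro mult_left_mono) auto
      also have "\<dots> \<le> V" by (simp add: V_def)
      finally have "(real CARD('n) * norm (x - y)) ^ j \<le> V ^ j"
        by (intro power_mono) auto
      also have "\<dots> \<le> K"
        unfolding K_def using V that(2) by (rule power_increasing[rotated])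
      finally show ?thesis .
    qed
    have L: "L2fun (cubeM R) (mi_deriv \<gamma> w)" "L2fun (cubeM R) (absderivs q w)" for \<gamma>
      by (auto intro!: continuous_L2fun smooth_continuous smooth_mi_deriv absderivs_continuous w)
    have S0: "?S \<ge> 0" by (intro sum_nonneg) (simp add: integral_nonneg_AE)
    have "?I \<le> (LINT y|cubeM R. N * (\<Sum>\<gamma> | mi_order \<gamma> \<le> q. (mi_deriv \<gamma> w y)\<^sup>2))"
    proof (rule integral_mono)
      show "(absderivs q w y)\<^sup>2 \<le> N * (\<Sum>\<gamma> | mi_order \<gamma> \<le> q. (mi_deriv \<gamma> w y)\<^sup>2)" for y
        using sum_squared_le_card[of "{\<gamma>. mi_order \<gamma> \<le> q}" "\<lambda>\<gamma>. \<bar>mi_deriv \<gamma> w y\<bar>"] by (simp add: absderivs_def N_def)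
    qed (use L2funD(2)[OF L(1)] L2funD(2)[OF L(2)] in auto)
    also have "\<dots> = N * ?S"
      using L2funD(2)[OF L(1)] by simp
    finally have I: "?I \<le> N * ?S" .
    have "\<bar>mi_deriv \<alpha> w x\<bar> * \<mu> \<le> (real m * K + K) * sqrt (\<mu> * ?I)"
      unfolding \<mu>_def by (rule sobolev_average_bound[OF R w m q x K])
    also have "\<dots> \<le> (real m * K + K) * sqrt (\<mu> * (N * ?S))"
      using I \<mu> K0 by (intro mult_left_mono real_sqrt_le_mono) auto
    also have "\<dots> = C * sqrt ?S * \<mu>"
      using \<mu> by (simp add: C_def real_sqrt_mult mult_ac)
    finally have "\<bar>mi_deriv \<alpha> w x\<bar> \<le> C * sqrt ?S"
      using \<mu> by simp
    then show ?thesis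
      using S0 by (simp add: distrib_right add_increasing2)
  qed
  moreover have "C + 1 > 0"
    using \<mu> K0 by (simp add: C_def N_def add_nonneg_pos)
  ultimately show ?thesis by blast
qed

text \<open>The smallest order allowed for \<open>p\<close>. The embedding constant is taken at this order, so that it,
  and with it \<open>lam0\<close>, does not depend on \<open>p\<close>.\<close>

definition sob_order :: "'n::finite itself \<Rightarrow> nat" where
  "sob_order _ = (CARD('n) + 1) div 2 + 3"

lemma sob_order_le:
  assumes "int p > \<lceil>real CARD('n::finite) / 2\<rceil> + 2"
  shows "sob_order TYPE('n) \<le> p"
proof -
  have "\<lceil>real CARD('n) / 2\<rceil> = int ((CARD('n) + 1) div 2)"
    by (cases "even CARD('n)") (auto elim!: evenE oddE simp: ceiling_unique field_simps)
  then show ?thesis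
    using assms by (simp add: sob_order_def)
qed

text \<open>With \<open>?m\<close> equal to the dimension halved, rounded up, plus 1, two
  derivatives and \<open>?m\<close> more add up to \<open>sob_order\<close>, and
  \<open>2 * (?m - 1)\<close> is at least the dimension.\<close>

lemma smooth_embedding:
  assumes "R > 0"
  shows "\<exists>C>0. \<forall>\<alpha> w. \<forall>x\<in>(ccube R :: (real^'n::finite) set). smooth w \<longrightarrow> mi_order \<alpha> \<le> 2 \<longrightarrow>
    \<bar>mi_deriv \<alpha> w x\<bar> \<le> C * sqrt (\<Sum>\<gamma> | mi_order \<gamma> \<le> sob_order TYPE('n). LINT y|cubeM R. (mi_deriv \<gamma> w y)\<^sup>2)"
proof -
  let ?m = "(CARD('n) + 1) div 2 + 1"
  have "\<exists>C>0. \<forall>\<alpha> (w::real^'n \<Rightarrow> real) x. smooth w \<longrightarrow> mi_order \<alpha> + ?m \<le> sob_order TYPE('n) \<longrightarrow> x \<in> ccube R \<longrightarrow>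
    \<bar>mi_deriv \<alpha> w x\<bar> \<le> C * sqrt (\<Sum>\<gamma> | mi_order \<gamma> \<le> sob_order TYPE('n). LINT y|cubeM R. (mi_deriv \<gamma> w y)\<^sup>2)"
    by (rule smooth_sobolev_inequality[OF assms]) auto
  then obtain C where C: "C > 0" "\<And>\<alpha> (w::real^'n \<Rightarrow> real) x. smooth w \<Longrightarrow> mi_order \<alpha> + ?m \<le> sob_order TYPE('n) \<Longrightarrow> x \<in> ccube R \<Longrightarrow>
    \<bar>mi_deriv \<alpha> w x\<bar> \<le> C * sqrt (\<Sum>\<gamma> | mi_order \<gamma> \<le> sob_order TYPE('n). LINT y|cubeM R. (mi_deriv \<gamma> w y)\<^sup>2)"
    by blast
  show ?thesis
    by (intro exI[of _ C] conjI allI ballI impI C) (auto simp: sob_order_def)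
qed

text \<open>Chosen as a function of the dimension and \<open>R\<close> alone, ahead of
  \<open>p\<close> and of the bump, so that constants built from it inherit this
  independence.\<close>

definition embedding_const :: "'n::finite itself \<Rightarrow> real \<Rightarrow> real" where
  "embedding_const _ R = (SOME C. C > 0 \<and> (\<forall>\<alpha> w. \<forall>x\<in>(ccube R :: (real^'n) set). smooth w \<longrightarrow> mi_order \<alpha> \<le> 2 \<longrightarrow>
    \<bar>mi_deriv \<alpha> w x\<bar> \<le> C * sqrt (\<Sum>\<gamma> | mi_order \<gamma> \<le> sob_order TYPE('n). LINT y|cubeM R. (mi_deriv \<gamma> w y)\<^sup>2)))"

lemma embedding_const:
  assumes "R > 0"
  shows "embedding_const TYPE('n) R > 0 \<and> (\<forall>\<alpha> w. \<forall>x\<in>(ccube R :: (real^'n::finite) set). smooth w \<longrightarrow> mi_order \<alpha> \<le> 2 \<longrightarrow>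
    \<bar>mi_deriv \<alpha> w x\<bar> \<le> embedding_const TYPE('n) R * sqrt (\<Sum>\<gamma> | mi_order \<gamma> \<le> sob_order TYPE('n). LINT y|cubeM R. (mi_deriv \<gamma> w y)\<^sup>2))"
  unfolding embedding_const_def by (rule someI_ex) (rule smooth_embedding[OF assms])

context smooth_bump
begin

lemma embC_pos: "embedding_const TYPE('n) R > 0"
  and embC: "smooth w \<Longrightarrow> mi_order \<alpha> \<le> 2 \<Longrightarrow> (x :: real^'n) \<in> ccube R \<Longrightarrow>
    \<bar>mi_deriv \<alpha> w x\<bar> \<le> embedding_const TYPE('n) R * sqrt (\<Sum>\<gamma> | mi_order \<gamma> \<le> sob_order TYPE('n). LINT y|cubeM R. (mi_deriv \<gamma> w y)\<^sup>2)"
  using embedding_const[OF R, where 'n='n] by blast+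

text \<open>Inside the cube the set where the functions differ is open and negligible, hence empty;
  density carries equality to the closed cube. It makes the choice in \<open>cont_rep\<close>
  unambiguous there.\<close>

lemma cont_rep_unique:
  fixes f g :: "real^'n \<Rightarrow> real"
  assumes "continuous_on (ccube R) f" "continuous_on (ccube R) g" "AE x in cubeM R. f x = g x" "x \<in> ccube R"
  shows "f x = g x"
proof -
  have cl: "closure (cube R) = (ccube R :: (real^'n) set)"
    by (rule closure_cube[OF R])
  let ?U = "{x \<in> cube R. f x \<noteq> g x}"
  have "open ?U"
  proof -
    have "continuous_on (cube R) (\<lambda>x. f x - g x)"
      by (intro continuous_intros continuous_on_subset[OF assms(1)] continuous_on_subset[OF assms(2)] cube_subset_ccube)
    then have "open (cube R \<inter> (\<lambda>x. f x - g x) -` (- {0}))"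
      by (intro continuous_open_preimage) auto
    moreover have "cube R \<inter> (\<lambda>x. f x - g x) -` (- {0}) = ?U"
      by auto
    ultimately show ?thesis by simp
  qed
  moreover have "negligible ?U"
  proof -
    have "AE x in lebesgue. x \<notin> ?U"
      using assms(3) unfolding AE_cubeM by eventually_elim auto
    moreover have "?U \<in> sets lebesgue"
      using borel_open[OF \<open>open ?U\<close>] by simp
    ultimately show ?thesis
      by (simp add: negligible_iff_null_sets AE_iff_null_sets)
  qed
  ultimately have "?U = {}"
    using open_not_negligible by blast
  then have eq: "f x = g x" if "x \<in> cube R" for x
    using that by blast
  show ?thesis
  proof -
    have 1: "closed {x \<in> ccube R. f x - g x = 0}"
      by (intro continuous_closed_preimage_constant continuous_intros assms closed_cbox)
    have 2: "cube R \<subseteq> {x \<in> ccube R. f x - g x = 0}"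
      using eq cube_subset_ccube by auto
    have "ccube R \<subseteq> {x \<in> ccube R. f x - g x = 0}"
      using closure_minimal[OF 2 1] unfolding cl .
    then show ?thesis
      using assms(4) by auto
  qed
qed

lemma cont_rep_props:
  fixes f g :: "real^'n \<Rightarrow> real"
  assumes "continuous_on (ccube R) f" "AE x in cubeM R. f x = g x"
  shows "continuous_on (ccube R) (cont_rep (cube R) g)" "AE x in cubeM R. cont_rep (cube R) g x = g x"
    "x \<in> ccube R \<Longrightarrow> cont_rep (cube R) g x = f x"
proof -
  have "\<exists>f. continuous_on (closure (cube R)) f \<and> (AE x in cubeM R. f x = g x)"
    using assms by (auto simp: closure_cube[OF R])
  from someI_ex[OF this] show 1: "continuous_on (ccube R) (cont_rep (cube R) g)" and 2: "AE x in cubeM R. cont_rep (cube R) g x = g x"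
    by (simp_all add: cont_rep_def closure_cube[OF R])
  have "AE x in cubeM R. cont_rep (cube R) g x = f x"
    using 2 assms(2) by eventually_elim simp
  then show "x \<in> ccube R \<Longrightarrow> cont_rep (cube R) g x = f x"
    using cont_rep_unique[OF 1 assms(1)] by blast
qed

lemma mollseq_seminorm_limit:
  fixes u :: "real^'n \<Rightarrow> real"
  assumes u: "u \<in> sobolev (cube R) p" and p: "q \<le> p"
  shows "(\<lambda>n. \<Sum>\<gamma> | mi_order \<gamma> \<le> q. LINT y|cubeM R. (mi_deriv \<gamma> (mollseq n u) y)\<^sup>2)
    \<longlonglongrightarrow> (\<Sum>\<gamma> | mi_order \<gamma> \<le> q. LINT y|cubeM R. (weak_deriv (cube R) \<gamma> u y)\<^sup>2)"
  by (intro tendsto_sum L2conv_square mi_deriv_mollseq_L2conv sobolevD[OF u]) (use p in auto)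

lemma seminorm_le_norm:
  fixes u :: "real^'n \<Rightarrow> real"
  assumes "q \<le> p"
  shows "sqrt (\<Sum>\<gamma> | mi_order \<gamma> \<le> q. LINT y|cubeM R. (weak_deriv (cube R) \<gamma> u y)\<^sup>2) \<le> sobolev_norm (cube R) p u"
  unfolding sobolev_norm_def sobolev_inner_self
  by (intro real_sqrt_le_mono sum_mono2) (use assms in \<open>auto simp: integral_nonneg_AE\<close>)

text \<open>The smooth embedding for mollifications, passed to the limit: the derivatives converge
  in L2 and the seminorms on the right converge as well.\<close>

lemma weak_deriv_bounded:
  fixes u :: "real^'n \<Rightarrow> real"
  assumes u: "u \<in> sobolev (cube R) p" and p: "sob_order TYPE('n) \<le> p" and \<alpha>: "mi_order \<alpha> \<le> 2"
  shows "AE x in cubeM R. \<bar>weak_deriv (cube R) \<alpha> u x\<bar> \<le> embedding_const TYPE('n) R * sobolev_norm (cube R) p u"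
proof -
  let ?B = "\<lambda>n. embedding_const TYPE('n) R * sqrt (\<Sum>\<gamma> | mi_order \<gamma> \<le> sob_order TYPE('n). LINT y|cubeM R. (mi_deriv \<gamma> (mollseq n u) y)\<^sup>2)"
  let ?b = "embedding_const TYPE('n) R * sqrt (\<Sum>\<gamma> | mi_order \<gamma> \<le> sob_order TYPE('n). LINT y|cubeM R. (weak_deriv (cube R) \<gamma> u y)\<^sup>2)"
  have "mi_order \<alpha> \<le> p"
    using \<alpha> p by (simp add: sob_order_def)
  then have c: "L2conv (cubeM R) (\<lambda>n. mi_deriv \<alpha> (mollseq n u)) (weak_deriv (cube R) \<alpha> u)"
    by (intro mi_deriv_mollseq_L2conv sobolevD[OF u])
  have "?B \<longlonglongrightarrow> ?b"
    by (intro tendsto_intros mollseq_seminorm_limit[OF u p])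
  moreover have "AE x in cubeM R. \<bar>mi_deriv \<alpha> (mollseq n u) x\<bar> \<le> ?B n" for n
    by (intro AE_cubeM_ball embC smooth_mollseq sobolevD(1)[OF u] \<alpha>) (use cube_subset_ccube in auto)
  ultimately have "AE x in cubeM R. \<bar>weak_deriv (cube R) \<alpha> u x\<bar> \<le> ?b"
    by (intro L2conv_AE_le[OF finite_cubeM c, of ?B]) auto
  then show ?thesis
  proof eventually_elim
    case (elim x)
    have "?b \<le> embedding_const TYPE('n) R * sobolev_norm (cube R) p u"
    using embC_pos by (intro mult_left_mono seminorm_le_norm[OF p]) auto
    with elim show ?case
      by linarith
  qed
qed

text \<open>The smooth embedding applied to differences of mollifications, whose derivatives up to
  \<open>sob_order\<close> are Cauchy in L2.\<close>

lemma mollseq_uniform_Cauchy: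
  fixes u :: "real^'n \<Rightarrow> real"
  assumes u: "u \<in> sobolev (cube R) p" and p: "sob_order TYPE('n) \<le> p" and \<alpha>: "mi_order \<alpha> \<le> 2"
  shows "uniformly_Cauchy_on (ccube R) (\<lambda>n. mi_deriv \<alpha> (mollseq n u))"
proof (rule uniformly_Cauchy_onI)
  fix e :: real assume "e > 0"
  define D where "D \<gamma> n = sqrt (LINT y|cubeM R. (mi_deriv \<gamma> (mollseq n u) y - weak_deriv (cube R) \<gamma> u y)\<^sup>2)" for \<gamma> n
  let ?A = "{\<gamma> :: 'n \<Rightarrow> nat. mi_order \<gamma> \<le> sob_order TYPE('n)}"
  define T where "T n = embedding_const TYPE('n) R * (\<Sum>\<gamma>\<in>?A. D \<gamma> n)" for n
  have c: "L2conv (cubeM R) (\<lambda>n. mi_deriv \<gamma> (mollseq n u)) (weak_deriv (cube R) \<gamma> u)" if "\<gamma> \<in> ?A" for \<gamma>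
    using that p by (intro mi_deriv_mollseq_L2conv sobolevD[OF u]) auto
  have sm: "smooth (mollseq n u)" for n
    by (intro smooth_mollseq sobolevD(1)[OF u])
  have D0: "D \<gamma> n \<ge> 0" for \<gamma> n
    by (simp add: D_def integral_nonneg_AE)
  have "T \<longlonglongrightarrow> embedding_const TYPE('n) R * (\<Sum>\<gamma>\<in>?A. sqrt 0)"
    unfolding T_def D_def by (intro tendsto_intros L2convD(3)[OF c]) auto
  then have "T \<longlonglongrightarrow> 0" by simp
  then obtain N where N: "\<And>n. n \<ge> N \<Longrightarrow> \<bar>T n\<bar> < e / 2"
    using LIMSEQ_D[of T 0 "e/2"] \<open>e > 0\<close> by auto
  have "dist (mi_deriv \<alpha> (mollseq k u) x) (mi_deriv \<alpha> (mollseq n u) x) < e"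
    if "x \<in> ccube R" "k \<ge> N" "n \<ge> N" for x k n
  proof -
    let ?w = "\<lambda>x. mollseq k u x - mollseq n u x"
    note d = mi_deriv_diff[OF sm[of k] sm[of n]]
    have "\<bar>mi_deriv \<alpha> ?w x\<bar> \<le> embedding_const TYPE('n) R * sqrt (\<Sum>\<gamma>\<in>?A. LINT y|cubeM R. (mi_deriv \<gamma> ?w y)\<^sup>2)"
      by (rule embC[OF d(1) \<alpha> that(1)])
    also have "sqrt (\<Sum>\<gamma>\<in>?A. LINT y|cubeM R. (mi_deriv \<gamma> ?w y)\<^sup>2) \<le> (\<Sum>\<gamma>\<in>?A. D \<gamma> k + D \<gamma> n)"
    proof -
      have le: "sqrt (LINT y|cubeM R. (mi_deriv \<gamma> ?w y)\<^sup>2) \<le> D \<gamma> k + D \<gamma> n" if "\<gamma> \<in> ?A" for \<gamma>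
      proof -
        note L = L2convD(1,2)[OF c[OF that]]
        show ?thesis
          using L2_norm_triangle[OF L2fun_diff[OF L(1)[of k] L(2)] L2fun_diff[OF L(2) L(1)[of n]]]
          by (simp add: d(2) D_def power2_commute[of "weak_deriv _ _ _ _"])
      qed
      have "(\<Sum>\<gamma>\<in>?A. LINT y|cubeM R. (mi_deriv \<gamma> ?w y)\<^sup>2) = (\<Sum>\<gamma>\<in>?A. (sqrt (LINT y|cubeM R. (mi_deriv \<gamma> ?w y)\<^sup>2))\<^sup>2)"
        by (simp add: integral_nonneg_AE)
      also have "sqrt \<dots> \<le> (\<Sum>\<gamma>\<in>?A. sqrt (LINT y|cubeM R. (mi_deriv \<gamma> ?w y)\<^sup>2))"
        using L2_set_le_sum[of ?A "\<lambda>\<gamma>. sqrt (LINT y|cubeM R. (mi_deriv \<gamma> ?w y)\<^sup>2)"] by (simp add: L2_set_def integral_nonneg_AE)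
      also have "\<dots> \<le> (\<Sum>\<gamma>\<in>?A. D \<gamma> k + D \<gamma> n)"
        by (rule sum_mono) (rule le)
      finally show ?thesis .
    qed
    then have "embedding_const TYPE('n) R * sqrt (\<Sum>\<gamma>\<in>?A. LINT y|cubeM R. (mi_deriv \<gamma> ?w y)\<^sup>2) \<le> embedding_const TYPE('n) R * (\<Sum>\<gamma>\<in>?A. D \<gamma> k + D \<gamma> n)"
      using embC_pos by (intro mult_left_mono) auto
    also have "\<dots> = T k + T n"
      by (simp add: T_def sum.distrib distrib_left)
    also have "\<dots> < e"
      using N[OF that(2)] N[OF that(3)] by simp
    finally show ?thesis
      by (simp add: d(2) dist_real_def)
  qed
  then show "\<exists>M. \<forall>x\<in>ccube R. \<forall>m\<ge>M. \<forall>n\<ge>M. dist (mi_deriv \<alpha> (mollseq m u) x) (mi_deriv \<alpha> (mollseq n u) x) < e"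
    by blast
qed

text \<open>The uniform limit of the mollified derivatives is the continuous representative. A
  separate \<open>g\<close> is allowed because boundary values use \<open>cont_rep\<close> of
  \<open>u\<close> itself, and the chosen weak derivative of order zero need not be
  \<open>u\<close>.\<close>

lemma cont_rep_weak_deriv:
  fixes u :: "real^'n \<Rightarrow> real"
  assumes u: "u \<in> sobolev (cube R) p" and p: "sob_order TYPE('n) \<le> p" and \<alpha>: "mi_order \<alpha> \<le> 2"
    and g: "AE x in cubeM R. weak_deriv (cube R) \<alpha> u x = g x"
  shows "continuous_on (ccube R) (cont_rep (cube R) g)"
    "AE x in cubeM R. cont_rep (cube R) g x = g x"
    "uniform_limit (ccube R) (\<lambda>n. mi_deriv \<alpha> (mollseq n u)) (cont_rep (cube R) g) sequentially"
    "x \<in> ccube R \<Longrightarrow> \<bar>cont_rep (cube R) g x\<bar> \<le> embedding_const TYPE('n) R * sobolev_norm (cube R) p u"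
proof -
  have sm: "smooth (mollseq n u)" for n
    by (intro smooth_mollseq sobolevD(1)[OF u])
  have "mi_order \<alpha> \<le> p"
    using \<alpha> p by (simp add: sob_order_def)
  then have c: "L2conv (cubeM R) (\<lambda>n. mi_deriv \<alpha> (mollseq n u)) (weak_deriv (cube R) \<alpha> u)"
    by (intro mi_deriv_mollseq_L2conv sobolevD[OF u])
  obtain f where f: "uniform_limit (ccube R) (\<lambda>n. mi_deriv \<alpha> (mollseq n u)) f sequentially"
    using Cauchy_uniformly_convergent[OF mollseq_uniform_Cauchy[OF u p \<alpha>]] by (auto simp: uniformly_convergent_on_def)
  have fc: "continuous_on (ccube R) f"
    by (rule uniform_limit_theorem[OF _ f]) (auto intro!: always_eventually smooth_continuous smooth_mi_deriv sm)
  have lim: "(\<lambda>n. mi_deriv \<alpha> (mollseq n u) x) \<longlonglongrightarrow> f x" if "x \<in> ccube R" for x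
    by (rule tendsto_uniform_limitI[OF f that])
  have "AE x in cubeM R. f x = weak_deriv (cube R) \<alpha> u x"
    by (rule L2conv_AE_eq[OF finite_cubeM c]) (rule AE_cubeM_ball, use lim cube_subset_ccube in blast)
  then have fg: "AE x in cubeM R. f x = g x"
    using g by eventually_elim simp
  note r = cont_rep_props[OF fc fg]
  show "continuous_on (ccube R) (cont_rep (cube R) g)" "AE x in cubeM R. cont_rep (cube R) g x = g x"
    by (rule r(1), rule r(2))
  show "uniform_limit (ccube R) (\<lambda>n. mi_deriv \<alpha> (mollseq n u)) (cont_rep (cube R) g) sequentially"
    using f by (rule uniform_limit_cong'[THEN iffD1, rotated -1]) (auto simp: r(3))
  assume x: "x \<in> ccube R"
  let ?B = "\<lambda>n. embedding_const TYPE('n) R * sqrt (\<Sum>\<gamma> | mi_order \<gamma> \<le> sob_order TYPE('n). LINT y|cubeM R. (mi_deriv \<gamma> (mollseq n u) y)\<^sup>2)"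
  have "?B \<longlonglongrightarrow> embedding_const TYPE('n) R * sqrt (\<Sum>\<gamma> | mi_order \<gamma> \<le> sob_order TYPE('n). LINT y|cubeM R. (weak_deriv (cube R) \<gamma> u y)\<^sup>2)"
    by (intro tendsto_intros mollseq_seminorm_limit[OF u p])
  moreover have "\<bar>mi_deriv \<alpha> (mollseq n u) x\<bar> \<le> ?B n" for n
    by (intro embC sm x \<alpha>)
  moreover have "(\<lambda>n. \<bar>mi_deriv \<alpha> (mollseq n u) x\<bar>) \<longlonglongrightarrow> \<bar>f x\<bar>"
    by (intro tendsto_intros lim x)
  ultimately have "\<bar>f x\<bar> \<le> embedding_const TYPE('n) R * sqrt (\<Sum>\<gamma> | mi_order \<gamma> \<le> sob_order TYPE('n). LINT y|cubeM R. (weak_deriv (cube R) \<gamma> u y)\<^sup>2)"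
    by (intro LIMSEQ_le) auto
  also have "\<dots> \<le> embedding_const TYPE('n) R * sobolev_norm (cube R) p u"
    using embC_pos by (intro mult_left_mono seminorm_le_norm[OF p]) auto
  finally show "\<bar>cont_rep (cube R) g x\<bar> \<le> embedding_const TYPE('n) R * sobolev_norm (cube R) p u"
    using r(3)[OF x] by simp
qed

end

subsection \<open>The boundary integral and the divergence theorem\<close>

definition face_point :: "'n::finite \<Rightarrow> real \<Rightarrow> ('n \<Rightarrow> real) \<Rightarrow> real^'n" where
  "face_point i t y = (\<chi> j. if j = i then t else y j)"

definition face_integral :: "real \<Rightarrow> 'n::finite \<Rightarrow> real \<Rightarrow> (real^'n \<Rightarrow> real) \<Rightarrow> real" where
  "face_integral R i t f = (LINT y:(PiE (UNIV - {i}) (\<lambda>_. {- R..R}))|(PiM (UNIV - {i}) (\<lambda>_. lborel)). f (face_point i t y))"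

lemma bdry_integral_face: "bdry_integral R f = (\<Sum>i\<in>UNIV. \<Sum>t\<in>{- R, R}. face_integral R i t f)"
  by (simp add: bdry_integral_def face_integral_def face_point_def)

interpretation lborel_product: product_sigma_finite "\<lambda>_. lborel :: real measure" ..

lemma face_point_measurable [measurable]:
  "face_point i t \<in> borel_measurable (PiM (UNIV - {i}) (\<lambda>_. lborel))"
proof -
  have "(\<lambda>y. face_point i t y $ j) \<in> borel_measurable (PiM (UNIV - {i}) (\<lambda>_. lborel))" for j
    by (cases "j = i") (simp_all add: face_point_def)
  then show ?thesis
    by (auto simp: borel_measurable_euclidean_space[of "face_point i t"] Basis_vec_def inner_axis)
qed

abbreviation face_cell :: "real \<Rightarrow> 'n::finite \<Rightarrow> ('n \<Rightarrow> real) set" where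
  "face_cell R i \<equiv> PiE (UNIV - {i}) (\<lambda>_. {- R..R})"

abbreviation face_measure :: "'n::finite \<Rightarrow> ('n \<Rightarrow> real) measure" where
  "face_measure i \<equiv> PiM (UNIV - {i}) (\<lambda>_. lborel)"

lemma face_cell_sets [measurable]: "face_cell R i \<in> sets (face_measure i)"
  by (rule sets_PiM_I_finite) auto

lemma face_cell_emeasure: "emeasure (face_measure i) (face_cell R i) < \<infinity>"
  by (subst lborel_product.emeasure_PiM) (auto simp: ennreal_prod_eq_top less_top[symmetric] emeasure_lborel_Icc_eq simp del: prod_constant)

lemma face_point_in:
  "y \<in> face_cell R i \<Longrightarrow> \<bar>t\<bar> \<le> R \<Longrightarrow> face_point i t y \<in> ccube R"
  unfolding mem_ccube by (auto simp: face_point_def PiE_iff abs_le_iff minus_le_iff)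

lemma face_integrable:
  fixes f :: "real^'n::finite \<Rightarrow> real"
  assumes c: "continuous_on (ccube R) f" and t: "\<bar>t\<bar> \<le> R"
  shows "set_integrable (face_measure i) (face_cell R i) (\<lambda>y. f (face_point i t y))"
proof -
  obtain B where B: "\<And>x. x \<in> ccube R \<Longrightarrow> norm (f x) \<le> B"
    using continuous_bounded_ccube[OF c] by blast
  have m: "(\<lambda>x. indicator (ccube R) x *\<^sub>R f x) \<in> borel_measurable borel"
    by (rule borel_measurable_continuous_on_indicator[OF _ c]) simp
  have eq: "indicator (face_cell R i) y *\<^sub>R f (face_point i t y)
     = indicator (face_cell R i) y *\<^sub>R (indicator (ccube R) (face_point i t y) *\<^sub>R f (face_point i t y))" for y
    using face_point_in[of y i R t] t by (auto simp: indicator_def)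
  show ?thesis
    unfolding set_integrable_def
  proof (rule integrableI_bounded_set[where A="face_cell R i" and B=B])
    show "(\<lambda>y. indicator (face_cell R i) y *\<^sub>R f (face_point i t y)) \<in> borel_measurable (face_measure i)"
      unfolding eq
      by (rule borel_measurable_scaleR[OF borel_measurable_indicator[OF face_cell_sets] measurable_compose[OF face_point_measurable m]])
    show "AE y\<in>face_cell R i in face_measure i. norm (indicator (face_cell R i) y *\<^sub>R f (face_point i t y)) \<le> B"
      by (intro AE_I2) (auto intro: B[OF face_point_in[OF _ t], unfolded real_norm_def])
    show "AE y in face_measure i. y \<notin> face_cell R i \<longrightarrow> indicator (face_cell R i) y *\<^sub>R f (face_point i t y) = 0"
      by (intro AE_I2) simp
  qed (use face_cell_emeasure in auto)
qed

lemma face_integral_lincomb: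
  fixes f g :: "real^'n::finite \<Rightarrow> real"
  assumes "continuous_on (ccube R) f" "continuous_on (ccube R) g" "\<bar>t\<bar> \<le> R"
  shows "face_integral R i t (\<lambda>x. a * f x + b * g x) = a * face_integral R i t f + b * face_integral R i t g"
  unfolding face_integral_def
  using face_integrable[OF assms(1,3), where i=i] face_integrable[OF assms(2,3), where i=i]
  by (simp add: set_integral_add(2) set_integrable_mult_right)

lemma face_integral_mono:
  fixes f g :: "real^'n::finite \<Rightarrow> real"
  assumes "continuous_on (ccube R) f" "continuous_on (ccube R) g" "\<bar>t\<bar> \<le> R"
    "\<And>x. x \<in> ccube R \<Longrightarrow> f x \<le> g x"
  shows "face_integral R i t f \<le> face_integral R i t g"
  unfolding face_integral_def
  by (intro set_integral_mono face_integrable assms face_point_in)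

lemma face_integral_cong:
  fixes f g :: "real^'n::finite \<Rightarrow> real"
  assumes "\<bar>t\<bar> \<le> R" "\<And>x. x \<in> ccube R \<Longrightarrow> f x = g x"
  shows "face_integral R i t f = face_integral R i t g"
  unfolding face_integral_def
  by (intro set_lebesgue_integral_cong) (auto intro!: assms face_point_in)

lemma bdry_integral_lincomb:
  fixes f g :: "real^'n::finite \<Rightarrow> real"
  assumes "R > 0" "continuous_on (ccube R) f" "continuous_on (ccube R) g"
  shows "bdry_integral R (\<lambda>x. a * f x + b * g x) = a * bdry_integral R f + b * bdry_integral R g"
proof -
  have "face_integral R i t (\<lambda>x. a * f x + b * g x) = a * face_integral R i t f + b * face_integral R i t g"
    if "t \<in> {- R, R}" for i t
    by (rule face_integral_lincomb) (use assms that in auto)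
  then show ?thesis
    by (simp add: bdry_integral_face sum.distrib sum_distrib_left)
qed

lemma bdry_integral_cmult:
  fixes f :: "real^'n::finite \<Rightarrow> real"
  assumes "R > 0" "continuous_on (ccube R) f"
  shows "bdry_integral R (\<lambda>x. a * f x) = a * bdry_integral R f"
  using bdry_integral_lincomb[OF assms assms(2), of a 0] by simp

lemma bdry_integral_mono:
  fixes f g :: "real^'n::finite \<Rightarrow> real"
  assumes "R > 0" "continuous_on (ccube R) f" "continuous_on (ccube R) g" "\<And>x. x \<in> ccube R \<Longrightarrow> f x \<le> g x"
  shows "bdry_integral R f \<le> bdry_integral R g"
  unfolding bdry_integral_face
  by (intro sum_mono face_integral_mono) (use assms in auto)

lemma bdry_integral_cong:
  fixes f g :: "real^'n::finite \<Rightarrow> real"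
  assumes "R > 0" "\<And>x. x \<in> ccube R \<Longrightarrow> f x = g x"
  shows "bdry_integral R f = bdry_integral R g"
  unfolding bdry_integral_face
  by (intro sum.cong refl face_integral_cong) (use assms in auto)

lemma bdry_integral_nonneg:
  fixes f :: "real^'n::finite \<Rightarrow> real"
  assumes "R > 0" "continuous_on (ccube R) f" "\<And>x. x \<in> ccube R \<Longrightarrow> f x \<ge> 0"
  shows "bdry_integral R f \<ge> 0"
  using bdry_integral_mono[of R "\<lambda>_. 0" f] bdry_integral_cmult[of R "\<lambda>_::real^'n. 0" 0] assms by simp

lemma bdry_integral_abs_le:
  fixes f :: "real^'n::finite \<Rightarrow> real"
  assumes "R > 0" "continuous_on (ccube R) f" "\<And>x. x \<in> ccube R \<Longrightarrow> \<bar>f x\<bar> \<le> B"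
  shows "\<bar>bdry_integral R f\<bar> \<le> B * bdry_integral R (\<lambda>_::real^'n. 1)"
proof -
  have "bdry_integral R f \<le> bdry_integral R (\<lambda>_::real^'n. B * 1)"
    by (rule bdry_integral_mono) (use assms in \<open>auto simp: abs_le_iff\<close>)
  moreover have "bdry_integral R (\<lambda>_::real^'n. (- B) * 1) \<le> bdry_integral R f"
    by (rule bdry_integral_mono) (use assms in \<open>auto simp: abs_le_iff minus_le_iff\<close>)
  ultimately show ?thesis
    using bdry_integral_cmult[of R "\<lambda>_::real^'n. 1" B] bdry_integral_cmult[of R "\<lambda>_::real^'n. 1" "- B"] assms(1) by auto
qed

lemma bdry_integral_uniform_limit:
  fixes f :: "nat \<Rightarrow> real^'n::finite \<Rightarrow> real"
  assumes "R > 0" "\<And>n. continuous_on (ccube R) (f n)" "continuous_on (ccube R) g" "uniform_limit (ccube R) f g sequentially"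
  shows "(\<lambda>n. bdry_integral R (f n)) \<longlonglongrightarrow> bdry_integral R g"
proof (rule LIMSEQ_I)
  fix e :: real assume e: "e > 0"
  let ?C = "bdry_integral R (\<lambda>_::real^'n. 1)"
  have C: "?C \<ge> 0" by (rule bdry_integral_nonneg) (use assms in auto)
  define d where "d = e / (?C + 1)"
  have d: "d > 0" using e C by (simp add: d_def)
  obtain N where N: "\<And>n x. n \<ge> N \<Longrightarrow> x \<in> ccube R \<Longrightarrow> dist (f n x) (g x) < d"
    using assms(4) d unfolding uniform_limit_sequentially_iff by metis
  have "norm (bdry_integral R (f n) - bdry_integral R g) < e" if "n \<ge> N" for n
  proof -
    have "bdry_integral R (f n) - bdry_integral R g = bdry_integral R (\<lambda>x. f n x - g x)"
      using bdry_integral_lincomb[OF assms(1) assms(2)[of n] assms(3), where a=1 and b="-1"] by simp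
    also have "\<bar>bdry_integral R (\<lambda>x. f n x - g x)\<bar> \<le> d * ?C"
      using N[OF that] by (intro bdry_integral_abs_le continuous_intros assms) (auto simp: dist_real_def less_imp_le)
    moreover have "d * ?C < d * (?C + 1)" using d by simp
    moreover have "d * (?C + 1) = e" using C by (simp add: d_def)
    ultimately show ?thesis by simp
  qed
  then show "\<exists>N. \<forall>n\<ge>N. norm (bdry_integral R (f n) - bdry_integral R g) < e" by blast
qed

section \<open>Fubini and the divergence theorem on the cube\<close>

lemma vec_lambda_measurable: "(\<lambda>y. \<chi> j. y j) \<in> measurable (PiM (UNIV::'n::finite set) (\<lambda>_. lborel)) (borel :: (real^'n) measure)"
  by (auto simp: borel_measurable_euclidean_space[of "\<lambda>y. \<chi> j. y j"] Basis_vec_def inner_axis)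

text \<open>Allows one coordinate to be split off by Fubini. The measure is identified by its values
  on boxes.\<close>

lemma lborel_vec: "(lborel :: (real^'n::finite) measure) = distr (PiM UNIV (\<lambda>_. lborel)) borel (\<lambda>y. \<chi> j. y j)"
proof (rule lborel_eqI)
  fix l u :: "real^'n" assume lu: "\<And>b. b \<in> Basis \<Longrightarrow> l \<bullet> b \<le> u \<bullet> b"
  have le: "l $ j \<le> u $ j" for j
    using lu[of "axis j 1"] by (auto simp: Basis_vec_def inner_axis)
  have "emeasure (distr (PiM UNIV (\<lambda>_. lborel)) borel (\<lambda>y. \<chi> j. y j)) (box l u)
      = emeasure (PiM UNIV (\<lambda>_. lborel)) (PiE UNIV (\<lambda>j. {l $ j<..<u $ j}))"
    by (subst emeasure_distr[OF vec_lambda_measurable])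
      (auto simp: mem_box_cart space_PiM PiE_def extensional_def Pi_iff intro!: arg_cong[where f="emeasure _"])
  also have "\<dots> = (\<Prod>j\<in>UNIV. emeasure lborel {l $ j<..<u $ j})"
    by (subst lborel_product.emeasure_PiM) auto
  also have "\<dots> = (\<Prod>j\<in>UNIV. ennreal (u $ j - l $ j))"
    using le by simp
  also have "\<dots> = ennreal (\<Prod>j\<in>UNIV. u $ j - l $ j)"
    using le by (subst prod_ennreal) auto
  also have "(\<Prod>j\<in>UNIV. u $ j - l $ j) = (\<Prod>b\<in>Basis. (u - l) \<bullet> b)"
  proof -
    have B: "(Basis :: (real^'n) set) = (\<lambda>j. axis j 1) ` UNIV"
      by (auto simp: Basis_vec_def)
    have "inj (\<lambda>j::'n. axis j (1::real))"
      by (auto simp: inj_on_def axis_eq_axis)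
    then show ?thesis
      unfolding B by (subst prod.reindex) (auto simp: inner_axis)
  qed
  finally show "emeasure (distr (PiM UNIV (\<lambda>_. lborel)) borel (\<lambda>y. \<chi> j. y j)) (box l u) = (\<Prod>b\<in>Basis. (u - l) \<bullet> b)" .
qed simp

text \<open>The faces are negligible, and a function continuous on the closed cube and cut off
  outside is Borel, so the completed measure can be exchanged for \<open>lborel\<close>.\<close>

lemma integral_cubeM_ccube:
  fixes f :: "real^'n::finite \<Rightarrow> real"
  assumes c: "continuous_on (ccube R) f"
  shows "(LINT x|cubeM R. f x) = (LINT x|lborel. indicator (ccube R) x *\<^sub>R f x)"
proof -
  have m: "(\<lambda>x. indicator (ccube R) x *\<^sub>R f x) \<in> borel_measurable borel"
    by (rule borel_measurable_continuous_on_indicator[OF _ c]) simp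
  have "negligible (ccube R - cube R :: (real^'n) set)"
    unfolding cube_eq_box by (rule negligible_frontier_interval)
  then have "AE x in lebesgue. x \<notin> (ccube R - cube R :: (real^'n) set)"
    unfolding negligible_iff_null_sets by (rule AE_not_in)
  then have ae: "AE x in lebesgue. indicator (cube R) x *\<^sub>R f x = indicator (ccube R) x *\<^sub>R f x"
    by eventually_elim (use cube_subset_ccube in \<open>auto simp: indicator_def\<close>)
  have "f \<in> borel_measurable (cubeM R)"
    by (rule continuous_cubeM[OF continuous_on_subset[OF c cube_subset_ccube]])
  then have m2: "(\<lambda>x. indicator (cube R) x *\<^sub>R f x) \<in> borel_measurable lebesgue"
    by (simp add: borel_measurable_restrict_space_iff)
  have "(LINT x|cubeM R. f x) = (LINT x|lebesgue. indicator (cube R) x *\<^sub>R f x)"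
    by (rule integral_restrict_space) simp
  also have "\<dots> = (LINT x|lebesgue. indicator (ccube R) x *\<^sub>R f x)"
    by (rule integral_cong_AE[OF m2 _ ae]) (use m in \<open>auto intro: measurable_completion\<close>)
  also have "\<dots> = (LINT x|lborel. indicator (ccube R) x *\<^sub>R f x)"
    by (rule integral_completion) (use m in simp)
  finally show ?thesis .
qed

text \<open>Fubini in all coordinates but the \<open>i\<close>-th, then the fundamental theorem of
  calculus on each line across the cube. For lines that miss the closed cube both sides
  vanish.\<close>

lemma integral_partial_derivative:
  fixes f D :: "real^'n::finite \<Rightarrow> real"
  assumes R: "R > 0" and f: "continuous_on (ccube R) f" and D: "continuous_on (ccube R) D"
    and d: "\<And>x. x \<in> ccube R \<Longrightarrow> ((\<lambda>s. f (x + s *\<^sub>R axis i 1)) has_real_derivative D x) (at 0)"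
  shows "(LINT x|cubeM R. D x) = face_integral R i R f - face_integral R i (- R) f"
proof -
  let ?g = "\<lambda>x. indicator (ccube R) x *\<^sub>R D x"
  have m: "?g \<in> borel_measurable borel"
    by (rule borel_measurable_continuous_on_indicator[OF _ D]) simp
  have int: "integrable lborel ?g"
    by (rule borel_integrable_compact[OF _ D]) simp
  have U: "UNIV = insert i (UNIV - {i})" by auto
  have iP: "integrable (PiM UNIV (\<lambda>_. lborel)) (\<lambda>y. ?g (\<chi> j. y j))"
    using int unfolding lborel_vec by (subst (asm) integrable_distr_eq[OF vec_lambda_measurable]) (use m in auto)
  have "(LINT x|cubeM R. D x) = (LINT x|lborel. ?g x)"
    by (rule integral_cubeM_ccube[OF D])
  also have "\<dots> = (LINT y|PiM UNIV (\<lambda>_. lborel). ?g (\<chi> j. y j))"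
    by (subst lborel_vec, rule integral_distr[OF vec_lambda_measurable m])
  also have "\<dots> = (LINT y|face_measure i. LINT s|lborel. ?g (\<chi> j. (y(i := s)) j))"
    using lborel_product.product_integral_insert[of "UNIV - {i}" i "\<lambda>y. ?g (\<chi> j. y j)"] iP
    by (simp add: insert_absorb insert_Diff_if)
  also have "\<dots> = (LINT y|face_measure i. indicator (face_cell R i) y *\<^sub>R f (face_point i R y)
        - indicator (face_cell R i) y *\<^sub>R f (face_point i (- R) y))"
  proof (rule Bochner_Integration.integral_cong[OF refl])
    fix y :: "'n \<Rightarrow> real" assume "y \<in> space (face_measure i)"
    then have ext: "y \<in> extensional (UNIV - {i})"
      by (simp add: space_PiM PiE_def)
    have fp: "(\<chi> j. (y(i := s)) j) = face_point i s y" for s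
      by (simp add: face_point_def vec_eq_iff)
    show "(LINT s|lborel. ?g (\<chi> j. (y(i := s)) j)) = indicator (face_cell R i) y *\<^sub>R f (face_point i R y)
        - indicator (face_cell R i) y *\<^sub>R f (face_point i (- R) y)"
    proof (cases "y \<in> face_cell R i")
      case False
      then obtain j where j: "j \<noteq> i" "\<not> \<bar>y j\<bar> \<le> R"
        using ext by (auto simp: PiE_iff abs_le_iff minus_le_iff)
      then have "face_point i s y \<notin> ccube R" for s
        unfolding mem_ccube by (auto simp: face_point_def intro!: exI[of _ j])
      then show ?thesis
        using False unfolding fp by simp
    next
      case True
      have ind: "indicator (ccube R) (face_point i s y) = (indicator {- R..R} s :: real)" for s
      proof (cases "s \<in> {- R..R}")
        case sT: True
        then have "face_point i s y \<in> ccube R"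
          by (intro face_point_in True) auto
        with sT show ?thesis by simp
      next
        case sF: False
        then have "face_point i s y \<notin> ccube R"
          unfolding mem_ccube by (auto simp: face_point_def abs_le_iff intro!: exI[of _ i])
        with sF show ?thesis by simp
      qed
      have shift: "face_point i (s + \<sigma>) y = face_point i s y + \<sigma> *\<^sub>R axis i 1" for s \<sigma>
        by (auto simp: face_point_def vec_eq_iff axis_def)
      have fpc: "continuous_on S (\<lambda>s. face_point i s y)" for S
      proof -
        have "continuous_on S (\<lambda>s. face_point i 0 y + s *\<^sub>R axis i 1)"
          by (intro continuous_intros)
        moreover have "(\<lambda>s. face_point i s y) = (\<lambda>s. face_point i 0 y + s *\<^sub>R axis i 1)"
        proof
          fix s
          show "face_point i s y = face_point i 0 y + s *\<^sub>R axis i 1"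
            using shift[of 0 s] by (simp only: add_0)
        qed
        ultimately show ?thesis
          by (simp only:)
      qed
      have "(LINT s|lborel. indicator {- R..R} s *\<^sub>R D (face_point i s y)) = f (face_point i R y) - f (face_point i (- R) y)"
      proof (rule integral_FTC_Icc)
        show "- R \<le> R" using R by simp
        fix s assume s: "- R \<le> s" "s \<le> R"
        then have "face_point i s y \<in> ccube R"
          by (intro face_point_in True) auto
        note d' = d[OF this]
        have "(\<lambda>\<sigma>. f (face_point i (\<sigma> + s) y)) = (\<lambda>\<sigma>. f (face_point i s y + \<sigma> *\<^sub>R axis i 1))"
        proof
          fix \<sigma>
          show "f (face_point i (\<sigma> + s) y) = f (face_point i s y + \<sigma> *\<^sub>R axis i 1)"
            using shift[of s \<sigma>] by (simp only: add.commute)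
        qed
        with d' have "((\<lambda>\<sigma>. f (face_point i (\<sigma> + s) y)) has_real_derivative D (face_point i s y)) (at 0)"
          by simp
        then have "((\<lambda>s. f (face_point i s y)) has_real_derivative D (face_point i s y)) (at s)"
          using DERIV_shift[of "\<lambda>s. f (face_point i s y)" "D (face_point i s y)" 0 s] by simp
        then show "((\<lambda>s. f (face_point i s y)) has_vector_derivative D (face_point i s y)) (at s within {- R..R})"
          by (simp add: has_real_derivative_iff_has_vector_derivative has_vector_derivative_at_within)
      next
        show "continuous_on {- R..R} (\<lambda>s. D (face_point i s y))"
          by (rule continuous_on_compose2[OF D fpc]) (use face_point_in[OF True] in \<open>auto simp: abs_le_iff\<close>)
      qed
      then show ?thesis
        using True unfolding fp by (simp add: ind)
    qed
  qed
  also have "\<dots> = face_integral R i R f - face_integral R i (- R) f"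
    unfolding face_integral_def set_lebesgue_integral_def
    using face_integrable[OF f, where t=R and i=i] face_integrable[OF f, where t="- R" and i=i] R
    by (intro Bochner_Integration.integral_diff) (auto simp: set_integrable_def)
  finally show ?thesis .
qed

text \<open>The outer normal of a face is plus or minus a coordinate vector, so its flux involves
  one component of \<open>V\<close>. Boundary terms are only ever estimated from above, so their
  signs are given up here.\<close>

lemma divergence_bound:
  fixes V D :: "'n::finite \<Rightarrow> real^'n \<Rightarrow> real"
  assumes R: "R > 0" and V: "\<And>i. continuous_on (ccube R) (V i)" and D: "\<And>i. continuous_on (ccube R) (D i)"
    and d: "\<And>i x. x \<in> ccube R \<Longrightarrow> ((\<lambda>s. V i (x + s *\<^sub>R axis i 1)) has_real_derivative D i x) (at 0)"
    and b: "continuous_on (ccube R) b" "\<And>i x. x \<in> ccube R \<Longrightarrow> \<bar>V i x\<bar> \<le> b x"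
  shows "\<bar>LINT x|cubeM R. (\<Sum>i\<in>UNIV. D i x)\<bar> \<le> bdry_integral R b"
proof -
  have int: "integrable (cubeM R) (D i)" for i
    by (rule L1_le_L2(1)[OF finite_cubeM continuous_L2fun[OF D]])
  have "(LINT x|cubeM R. (\<Sum>i\<in>UNIV. D i x)) = (\<Sum>i\<in>UNIV. face_integral R i R (V i) - face_integral R i (- R) (V i))"
    using int by (simp add: integral_partial_derivative[OF R V D d])
  also have "\<bar>\<Sum>i\<in>UNIV. face_integral R i R (V i) - face_integral R i (- R) (V i)\<bar>
      \<le> (\<Sum>i\<in>UNIV. \<bar>face_integral R i R (V i) - face_integral R i (- R) (V i)\<bar>)"
    by (rule sum_abs)
  also have "\<dots> \<le> (\<Sum>i\<in>UNIV. face_integral R i (- R) b + face_integral R i R b)"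
  proof (rule sum_mono)
    fix i
    have le: "\<bar>face_integral R i t (V i)\<bar> \<le> face_integral R i t b" if "\<bar>t\<bar> \<le> R" for t
    proof -
      have "face_integral R i t (V i) \<le> face_integral R i t b"
        by (rule face_integral_mono[OF V b(1) that]) (use b(2) in \<open>auto simp: abs_le_iff\<close>)
      moreover have "face_integral R i t (\<lambda>x. (- 1) * V i x + 0 * V i x) \<le> face_integral R i t b"
        by (rule face_integral_mono[OF _ b(1) that]) (use b(2) V in \<open>auto simp: abs_le_iff intro!: continuous_intros\<close>)
      ultimately show ?thesis
        using face_integral_lincomb[OF V V that, where a="-1" and b=0] by simp
    qed
    show "\<bar>face_integral R i R (V i) - face_integral R i (- R) (V i)\<bar> \<le> face_integral R i (- R) b + face_integral R i R b"
      using le[of R] le[of "- R"] R by simp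
  qed
  also have "\<dots> = bdry_integral R b"
    using R by (simp add: bdry_integral_face)
  finally show ?thesis .
qed

subsection \<open>The Carleman estimate\<close>

text \<open>A relation rather than an operator: the rules below synthesize the derivative of a
  composite expression in exactly the form in which the divergence is written down later.\<close>

definition pd :: "'n::finite \<Rightarrow> (real^'n \<Rightarrow> real) \<Rightarrow> real \<Rightarrow> real^'n \<Rightarrow> bool" where
  "pd i f D x \<longleftrightarrow> ((\<lambda>s. f (x + s *\<^sub>R axis i 1)) has_real_derivative D) (at 0)"

lemma pd_eq: "pd i f D x \<Longrightarrow> D = E \<Longrightarrow> pd i f E x"
  by simp

lemma pd_add: "pd i f D x \<Longrightarrow> pd i g E x \<Longrightarrow> pd i (\<lambda>x. f x + g x) (D + E) x"
  unfolding pd_def by (rule DERIV_add)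

lemma pd_diff: "pd i f D x \<Longrightarrow> pd i g E x \<Longrightarrow> pd i (\<lambda>x. f x - g x) (D - E) x"
  unfolding pd_def by (rule DERIV_diff)

lemma pd_cmult: "pd i f D x \<Longrightarrow> pd i (\<lambda>x. c * f x) (c * D) x"
  unfolding pd_def by (rule DERIV_cmult)

lemma pd_mult: "pd i f D x \<Longrightarrow> pd i g E x \<Longrightarrow> pd i (\<lambda>x. f x * g x) (D * g x + f x * E) x"
  unfolding pd_def by (auto intro!: derivative_eq_intros)

lemma pd_sum: "(\<And>j. j \<in> J \<Longrightarrow> pd i (f j) (D j) x) \<Longrightarrow> pd i (\<lambda>x. \<Sum>j\<in>J. f j x) (\<Sum>j\<in>J. D j) x"
  unfolding pd_def by (rule DERIV_sum)

lemma pd_exp: "pd i f D x \<Longrightarrow> pd i (\<lambda>x. exp (f x)) (exp (f x) * D) x"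
  unfolding pd_def by (auto intro!: derivative_eq_intros)

lemma pd_powr: "pd i f D x \<Longrightarrow> f x > 0 \<Longrightarrow> pd i (\<lambda>x. f x powr a) (a * f x powr (a - 1) * D) x"
  unfolding pd_def by (rule DERIV_cong[OF DERIV_fun_powr]) auto

lemma pd_smooth: "smooth f \<Longrightarrow> pd i f (pderivative i f x) x"
  using smooth_axis_derivative[of f x i 0 UNIV] by (simp add: pd_def)

lemma pd_component: "pd i (\<lambda>x. (x - x0) $ j) (axis i 1 $ j) x"
  unfolding pd_def by (auto intro!: derivative_eq_intros)

definition sqdist :: "real^'n::finite \<Rightarrow> real^'n \<Rightarrow> real" where
  "sqdist x0 x = (\<Sum>j\<in>UNIV. (x - x0) $ j * (x - x0) $ j)"

lemma sqdist_norm: "sqdist x0 x = (norm (x - x0))\<^sup>2"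
  unfolding sqdist_def norm_vec_def L2_set_def by (simp add: sum_nonneg power2_eq_square)

lemma norm_powr_sqdist:
  assumes "x \<noteq> x0"
  shows "norm (x - x0) powr (- \<beta>) = sqdist x0 x powr (- \<beta> / 2)"
proof -
  have "norm (x - x0) > 0" using assms by simp
  then have "sqdist x0 x powr (- \<beta> / 2) = (norm (x - x0) powr 2) powr (- \<beta> / 2)"
    by (simp add: sqdist_norm powr_numeral)
  also have "\<dots> = norm (x - x0) powr (- \<beta>)"
    by (subst powr_powr) simp
  finally show ?thesis ..
qed

lemma pd_sqdist: "pd i (sqdist x0) (2 * (x - x0) $ i) x"
proof -
  have "pd i (\<lambda>x. \<Sum>j\<in>UNIV. (x - x0) $ j * (x - x0) $ j)
     (\<Sum>j\<in>UNIV. axis i 1 $ j * (x - x0) $ j + (x - x0) $ j * axis i 1 $ j) x"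
    by (intro pd_sum pd_mult pd_component)
  moreover have "(\<Sum>j\<in>UNIV. axis i 1 $ j * (x - x0) $ j + (x - x0) $ j * axis i 1 $ j) = 2 * (\<Sum>j\<in>UNIV. axis i 1 $ j * (x - x0) $ j)"
    unfolding sum_distrib_left by (rule sum.cong) (simp_all add: mult.commute)
  ultimately show ?thesis
    unfolding sqdist_def [abs_def] by (simp only: sum_axis)
qed

text \<open>The distance to \<open>x0\<close> raised to \<open>2 * a\<close>. Written with the
  squared distance, its partial derivatives stay in the same family up to a coordinate
  factor.\<close>

definition spow :: "real^'n::finite \<Rightarrow> real \<Rightarrow> real^'n \<Rightarrow> real" where
  "spow x0 a x = sqdist x0 x powr a"

lemma sqdist_pos: "x \<noteq> x0 \<Longrightarrow> sqdist x0 x > 0"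
  by (simp add: sqdist_norm)

lemma pd_spow:
  assumes "x \<noteq> x0"
  shows "pd i (spow x0 a) (2 * a * spow x0 (a - 1) x * (x - x0) $ i) x"
  unfolding spow_def [abs_def]
  by (rule pd_eq[OF pd_powr[OF pd_sqdist sqdist_pos[OF assms]]]) simp

lemma spow_mult_sqdist:
  assumes "x \<noteq> x0"
  shows "sqdist x0 x * spow x0 (a - 1) x = spow x0 a x"
proof -
  have "sqdist x0 x * sqdist x0 x powr (a - 1) = sqdist x0 x powr (1 + (a - 1))"
    using sqdist_pos[OF assms] by (intro powr_mult_base) simp
  then show ?thesis
    by (simp add: spow_def)
qed

lemma spow_cont:
  assumes "x0 \<notin> S"
  shows "continuous_on S (spow x0 a)"
  unfolding spow_def [abs_def] sqdist_norm using assms by (intro continuous_intros) auto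

text \<open>Compactness of the closed cube, which avoids \<open>x0\<close>. All weights of the
  Carleman estimate are controlled through this.\<close>

lemma spow_bounds:
  fixes x0 :: "real^'n::finite"
  assumes "x0 \<notin> ccube R" and "R > 0"
  shows "\<exists>m>0. \<exists>B>0. \<forall>x\<in>ccube R. m \<le> spow x0 a x \<and> spow x0 a x \<le> B"
proof -
  have c: "continuous_on (ccube R) (spow x0 a)"
    by (rule spow_cont[OF assms(1)])
  have "0 \<in> (ccube R :: (real^'n) set)"
    using assms(2) unfolding mem_ccube by simp
  then have ne: "ccube R \<noteq> ({} :: (real^'n) set)"
    by blast
  have pos: "spow x0 a x > 0" if "x \<in> ccube R" for x
    using that assms(1) sqdist_pos[of x x0] unfolding spow_def by (metis powr_gt_zero less_irrefl)
  obtain xm where xm: "xm \<in> ccube R" "\<And>x. x \<in> ccube R \<Longrightarrow> spow x0 a xm \<le> spow x0 a x"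
    using continuous_attains_inf[OF compact_cbox ne c] by blast
  obtain xM where xM: "xM \<in> ccube R" "\<And>x. x \<in> ccube R \<Longrightarrow> spow x0 a x \<le> spow x0 a xM"
    using continuous_attains_sup[OF compact_cbox ne c] by blast
  show ?thesis
    using xm xM pos by (intro exI[of _ "spow x0 a xm"] conjI exI[of _ "spow x0 a xM"]) auto
qed

text \<open>The algebra of the Carleman estimate at one point: \<open>y\<close> is
  \<open>x - x0\<close>, \<open>z\<close> and \<open>Z\<close> are gradient and Hessian of the
  conjugated function, \<open>w\<close> is its value, and the sum over \<open>i\<close> is the
  divergence of the flux \<open>V\<close> in \<open>carleman_conjugated\<close>. For a general
  multiplier and dimension \<open>n\<close> the coefficient of \<open>N\<close> is
  \<open>2 * lam * (\<beta> * (n - \<beta> - 4) - \<gamma>) * \<psi>\<close> and that of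
  \<open>w\<^sup>2\<close> is \<open>2 * lam^3 * \<beta>\<^sup>2 * (\<gamma> - \<beta> * (n - 3 *
  \<beta> - 4)) * Q\<close>. The chosen \<open>\<gamma>\<close> is the midpoint of the interval on
  which both are positive.\<close>

lemma carleman_divergence_sum:
  fixes y z :: "'n::finite \<Rightarrow> real" and Z :: "'n \<Rightarrow> 'n \<Rightarrow> real"
  assumes sym: "\<And>i j. Z i j = Z j i"
    and \<rho>: "\<rho> = (\<Sum>i\<in>UNIV. y i * y i)" and S: "S = (\<Sum>i\<in>UNIV. y i * z i)"
    and N: "N = (\<Sum>i\<in>UNIV. z i * z i)" and L: "L = (\<Sum>i\<in>UNIV. Z i i)"
    and \<psi>: "\<psi> = \<rho> * \<theta>" and \<tau>: "\<tau> = \<psi> * \<psi> * \<psi>" and Q: "Q = \<rho> * \<tau>"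
    and \<gamma>: "\<gamma> = \<beta> * (real CARD('n) - 2 * \<beta> - 4)"
  shows "2 * (L + lam\<^sup>2 * \<beta>\<^sup>2 * (\<psi> * \<psi> * \<rho>) * w) * (2 * lam * \<beta> * \<psi> * S + lam * \<gamma> * \<psi> * w)
    = (\<Sum>i\<in>UNIV.
        4 * lam * \<beta> * (- (\<beta> + 2) * \<theta> * y i * (S * z i) + \<psi> * ((z i + (\<Sum>j\<in>UNIV. y j * Z i j)) * z i + S * Z i i))
      - 2 * lam * \<beta> * (- (\<beta> + 2) * \<theta> * y i * (N * y i) + \<psi> * ((2 * (\<Sum>j\<in>UNIV. z j * Z i j)) * y i + N * 1))
      + 2 * lam * \<gamma> * (- (\<beta> + 2) * \<theta> * y i * (w * z i) + \<psi> * (z i * z i + w * Z i i))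
      + 2 * lam^3 * \<beta>^3 * (- (3 * \<beta> + 4) * \<tau> * y i * (y i * (w * w)) + Q * (1 * (w * w) + y i * (z i * w + w * z i))))
    + 2 * lam * \<beta>\<^sup>2 * \<psi> * N + 4 * lam * \<beta> * (\<beta> + 2) * \<theta> * S\<^sup>2 + 2 * lam^3 * \<beta>^4 * Q * w\<^sup>2
    + 2 * lam * \<gamma> * (\<beta> + 2) * \<theta> * w * S"
    (is "_ = (\<Sum>i\<in>UNIV. ?D i) + _ + _ + _ + _")
proof -
  \<comment> \<open>Apart from its trace the Hessian enters only through \<open>M\<close> and
    \<open>M'\<close>. Symmetry makes them equal, and they cancel because \<open>?c3\<close> and
    \<open>?c6\<close> are opposite.\<close>
  define M where "M = (\<Sum>i\<in>UNIV. (\<Sum>j\<in>UNIV. y j * Z i j) * z i)"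
  define M' where "M' = (\<Sum>i\<in>UNIV. (\<Sum>j\<in>UNIV. z j * Z i j) * y i)"
  have "M = (\<Sum>i\<in>UNIV. \<Sum>j\<in>UNIV. y j * Z i j * z i)"
    by (simp add: M_def sum_distrib_right)
  also have "\<dots> = (\<Sum>j\<in>UNIV. \<Sum>i\<in>UNIV. y j * Z i j * z i)"
    by (rule sum.swap)
  also have "\<dots> = (\<Sum>j\<in>UNIV. \<Sum>i\<in>UNIV. z i * Z j i * y j)"
    by (intro sum.cong refl) (simp add: sym mult_ac)
  also have "\<dots> = M'"
    by (simp add: M'_def sum_distrib_right)
  finally have MM: "M = M'" .
  let ?c1 = "- 4 * lam * \<beta> * (\<beta> + 2) * \<theta> * S - 2 * lam * \<gamma> * (\<beta> + 2) * \<theta> * w + 4 * lam^3 * \<beta>^3 * Q * w"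
    and ?c2 = "4 * lam * \<beta> * \<psi> + 2 * lam * \<gamma> * \<psi>"
    and ?c3 = "4 * lam * \<beta> * \<psi>"
    and ?c4 = "4 * lam * \<beta> * \<psi> * S + 2 * lam * \<gamma> * \<psi> * w"
    and ?c5 = "2 * lam * \<beta> * (\<beta> + 2) * \<theta> * N - 2 * lam^3 * \<beta>^3 * (3 * \<beta> + 4) * \<tau> * w\<^sup>2"
    and ?c6 = "- 4 * lam * \<beta> * \<psi>"
    and ?c7 = "- 2 * lam * \<beta> * \<psi> * N + 2 * lam^3 * \<beta>^3 * Q * w\<^sup>2"
  have D: "?D i = ?c1 * (y i * z i) + ?c2 * (z i * z i) + ?c3 * ((\<Sum>j\<in>UNIV. y j * Z i j) * z i) + ?c4 * Z i i
     + ?c5 * (y i * y i) + ?c6 * ((\<Sum>j\<in>UNIV. z j * Z i j) * y i) + ?c7" for i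
    by (simp add: algebra_simps power2_eq_square)
  have "(\<Sum>i\<in>UNIV. ?D i) = ?c1 * S + ?c2 * N + ?c3 * M + ?c4 * L + ?c5 * \<rho> + ?c6 * M' + real CARD('n) * ?c7"
    unfolding D sum.distrib sum_distrib_left[symmetric] S[symmetric] N[symmetric] M_def[symmetric] L[symmetric] \<rho>[symmetric] M'_def[symmetric]
    by (simp add: algebra_simps)
  then show ?thesis
    unfolding MM[symmetric] Q \<tau> \<psi> \<gamma>
    by (simp add: algebra_simps power2_eq_square power3_eq_cube power4_eq_xxxx)
qed

lemma two_mult_le_square: "2 * a * b \<le> (a + b)\<^sup>2" for a b :: real
  using sum_squares_bound[of a b] by (simp add: power2_sum)

lemma square_sum_le: "(a + b)\<^sup>2 \<le> 2 * a\<^sup>2 + 2 * (b::real)\<^sup>2"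
  using sum_squares_bound[of a b] by (simp add: power2_sum)

text \<open>\<open>X + Y\<close> differs from \<open>P\<close> by a term of order
  \<open>lam\<close>, so \<open>2 * X * Y\<close>, at most the square of the sum, is at most
  \<open>2 * P\<^sup>2\<close> plus an error of order \<open>lam\<^sup>2 * w\<^sup>2\<close>. This
  error and the mixed term \<open>w * S\<close> are paid by half of the \<open>lam^3\<close> term;
  that is the lower bound imposed on \<open>lam\<close>.\<close>

lemma carleman_pointwise:
  fixes lam \<beta> \<psi> \<theta> \<rho> Q N S w L X \<gamma> Dv m B W :: real
  assumes \<beta>: "\<beta> > 0" and m: "m > 0" "m \<le> \<psi>" "m \<le> Q" and B: "0 < \<theta>" "\<theta> \<le> B" "\<psi> \<le> B"
    and N: "N \<ge> 0"
    and lam: "lam \<ge> 1" "lam * (\<beta>^4 * m) \<ge> \<gamma>\<^sup>2 * (\<beta> + 2) / (4 * \<beta>) * B + 2 * \<beta>\<^sup>2 * (\<beta> + 2)\<^sup>2 * B\<^sup>2"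
    and id: "2 * X * Y = Dv + 2 * lam * \<beta>\<^sup>2 * \<psi> * N + 4 * lam * \<beta> * (\<beta> + 2) * \<theta> * S\<^sup>2 + 2 * lam^3 * \<beta>^4 * Q * w\<^sup>2
    + 2 * lam * \<gamma> * (\<beta> + 2) * \<theta> * w * S"
    and P: "X + Y = P - lam * \<beta> * (\<beta> + 2) * \<psi> * w"
  shows "min (2 * \<beta>\<^sup>2 * m) (\<beta>^4 * m) * (lam * N + lam^3 * w\<^sup>2) \<le> 2 * P\<^sup>2 - Dv"
proof -
  let ?c = "\<gamma>\<^sup>2 * (\<beta> + 2) / (4 * \<beta>)" and ?d = "2 * \<beta>\<^sup>2 * (\<beta> + 2)\<^sup>2"
  have c0: "?c \<ge> 0" using \<beta> by simp
  have lc: "lam * ?c \<ge> 0" using lam(1) by (intro mult_nonneg_nonneg[OF _ c0]) simp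
  \<comment> \<open>Completing the square in \<open>S\<close>; what is lost contains
    \<open>w\<^sup>2\<close> alone, and after multiplication only one power of
    \<open>lam\<close>.\<close>
  have sq: "4 * \<beta> * S\<^sup>2 + 2 * \<gamma> * w * S \<ge> - (\<gamma>\<^sup>2 / (4 * \<beta>) * w\<^sup>2)"
  proof -
    have "0 \<le> (2 * \<beta> * S + \<gamma> * w / 2)\<^sup>2 / \<beta>"
      using \<beta> by simp
    also have "\<dots> = 4 * \<beta> * S\<^sup>2 + 2 * \<gamma> * w * S + \<gamma>\<^sup>2 / (4 * \<beta>) * w\<^sup>2"
      using \<beta> by (simp add: power2_eq_square field_simps)
    finally show ?thesis by simp
  qed
  have "lam * (\<beta> + 2) * \<theta> * (4 * \<beta> * S\<^sup>2 + 2 * \<gamma> * w * S) \<ge> lam * (\<beta> + 2) * \<theta> * (- (\<gamma>\<^sup>2 / (4 * \<beta>) * w\<^sup>2))"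
    using sq \<beta> lam B by (intro mult_left_mono) auto
  then have 1: "4 * lam * \<beta> * (\<beta> + 2) * \<theta> * S\<^sup>2 + 2 * lam * \<gamma> * (\<beta> + 2) * \<theta> * w * S \<ge> - (lam * ?c * \<theta> * w\<^sup>2)"
    by (simp add: algebra_simps)
  have "lam * ?c * \<theta> * w\<^sup>2 \<le> lam * ?c * B * w\<^sup>2"
    by (rule mult_right_mono[OF mult_left_mono[OF B(2) lc]]) simp
  also have "\<dots> \<le> lam\<^sup>2 * ?c * B * w\<^sup>2"
    using B c0 lam self_le_power[of lam 2] by (intro mult_right_mono) auto
  finally have 2: "lam * ?c * \<theta> * w\<^sup>2 \<le> lam\<^sup>2 * (?c * B) * w\<^sup>2"
    by (simp only: mult.assoc)
  have "2 * X * Y \<le> (P + - (lam * \<beta> * (\<beta> + 2) * \<psi> * w))\<^sup>2"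
    using two_mult_le_square[of X Y] P by simp
  also have "\<dots> \<le> 2 * P\<^sup>2 + 2 * (- (lam * \<beta> * (\<beta> + 2) * \<psi> * w))\<^sup>2"
    by (rule square_sum_le)
  also have "2 * (- (lam * \<beta> * (\<beta> + 2) * \<psi> * w))\<^sup>2 = lam\<^sup>2 * (?d * \<psi>\<^sup>2) * w\<^sup>2"
    by (simp add: power_mult_distrib mult_ac)
  also have "lam\<^sup>2 * (?d * \<psi>\<^sup>2) * w\<^sup>2 \<le> lam\<^sup>2 * (?d * B\<^sup>2) * w\<^sup>2"
    using B m by (intro mult_right_mono mult_left_mono power_mono) auto
  finally have 3: "2 * X * Y \<le> 2 * P\<^sup>2 + lam\<^sup>2 * (?d * B\<^sup>2) * w\<^sup>2"
    by simp
  have "lam\<^sup>2 * (?c * B + ?d * B\<^sup>2) * w\<^sup>2 \<le> lam\<^sup>2 * (lam * (\<beta>^4 * m)) * w\<^sup>2"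
    using lam(2) by (intro mult_right_mono mult_left_mono) auto
  then have 4: "lam\<^sup>2 * (?c * B) * w\<^sup>2 + lam\<^sup>2 * (?d * B\<^sup>2) * w\<^sup>2 \<le> lam^3 * (\<beta>^4 * m) * w\<^sup>2"
    by (simp add: algebra_simps power2_eq_square power3_eq_cube)
  have 5: "2 * lam * \<beta>\<^sup>2 * \<psi> * N \<ge> 2 * lam * \<beta>\<^sup>2 * m * N"
    using m N lam by (intro mult_right_mono mult_left_mono) auto
  have 6: "2 * lam^3 * \<beta>^4 * Q * w\<^sup>2 \<ge> 2 * lam^3 * \<beta>^4 * m * w\<^sup>2"
    using m lam \<beta> by (intro mult_right_mono mult_left_mono) auto
  have "min (2 * \<beta>\<^sup>2 * m) (\<beta>^4 * m) * (lam * N) \<le> (2 * \<beta>\<^sup>2 * m) * (lam * N)"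
    using lam N by (intro mult_right_mono) auto
  moreover have "min (2 * \<beta>\<^sup>2 * m) (\<beta>^4 * m) * (lam^3 * w\<^sup>2) \<le> (\<beta>^4 * m) * (lam^3 * w\<^sup>2)"
    using lam by (intro mult_right_mono) auto
  ultimately have "min (2 * \<beta>\<^sup>2 * m) (\<beta>^4 * m) * (lam * N + lam^3 * w\<^sup>2) \<le> 2 * lam * \<beta>\<^sup>2 * m * N + lam^3 * (\<beta>^4 * m) * w\<^sup>2"
    by (simp add: algebra_simps)
  also have "\<dots> \<le> 2 * P\<^sup>2 - Dv"
    using 1 2 3 4 5 6 id by (simp add: mult.assoc)
  finally show ?thesis .
qed

text \<open>\<open>1 + B\<close> stands in for \<open>sqrt B\<close>, which keeps square roots out
  of the flux constant.\<close>

lemma inner_sum_bounds: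
  fixes y z :: "'n::finite \<Rightarrow> real"
  assumes "(\<Sum>i\<in>UNIV. y i * y i) \<le> B" "N = (\<Sum>i\<in>UNIV. z i * z i)" "S = (\<Sum>i\<in>UNIV. y i * z i)"
  shows "\<bar>y i\<bar> \<le> 1 + B" "\<bar>S * z i\<bar> \<le> (1 + B) * N" "z i * z i \<le> N" "N \<ge> 0"
proof -
  have y2: "y i * y i \<le> (\<Sum>i\<in>UNIV. y i * y i)" by (rule member_le_sum) auto
  have B0: "B \<ge> 0" using assms(1) y2 by (meson order_trans zero_le_square)
  have sqB: "sqrt B \<le> 1 + B"
    using B0 by (intro real_le_lsqrt) (auto simp: power2_eq_square algebra_simps)
  have "\<bar>y i\<bar> \<le> sqrt B"
    using y2 assms(1) by (intro real_le_rsqrt) (simp add: power2_eq_square)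
  then show "\<bar>y i\<bar> \<le> 1 + B" using sqB by simp
  show z2: "z i * z i \<le> N" unfolding assms by (rule member_le_sum) auto
  show N0: "N \<ge> 0" unfolding assms by (intro sum_nonneg) auto
  have "S\<^sup>2 \<le> (\<Sum>i\<in>UNIV. y i * y i) * N"
    using Cauchy_Schwarz_ineq_sum[of y z UNIV] by (simp add: assms power2_eq_square)
  also have "\<dots> \<le> B * N"
    using assms(1) N0 by (intro mult_right_mono)
  finally have S2: "S\<^sup>2 \<le> B * N" .
  have "(S * z i)\<^sup>2 = S\<^sup>2 * (z i * z i)"
    by (simp add: power2_eq_square)
  also have "\<dots> \<le> (B * N) * N"
    using S2 z2 B0 N0 by (intro mult_mono) auto
  finally have "\<bar>S * z i\<bar> \<le> sqrt (B * N\<^sup>2)"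
    by (intro real_le_rsqrt) (simp add: power2_eq_square mult.assoc)
  also have "\<dots> = sqrt B * N" using N0 by (simp add: real_sqrt_mult)
  also have "\<dots> \<le> (1 + B) * N" using sqB N0 by (rule mult_right_mono)
  finally show "\<bar>S * z i\<bar> \<le> (1 + B) * N" .
qed

lemma abs_mult_le_sum:
  fixes a b A B :: real
  assumes "a * a \<le> A" "b * b \<le> B"
  shows "\<bar>a * b\<bar> \<le> A + B"
proof -
  have "2 * \<bar>a\<bar> * \<bar>b\<bar> \<le> a * a + b * b"
    using sum_squares_bound[of "\<bar>a\<bar>" "\<bar>b\<bar>"] by (simp add: power2_eq_square)
  moreover have "0 \<le> \<bar>a\<bar> * \<bar>b\<bar>" by simp
  ultimately show ?thesis
    using assms unfolding abs_mult by linarith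
qed

text \<open>Conjugating the Laplacian with \<open>exp (lam \<phi>)\<close>, \<open>\<phi> = r powr (- \<beta>)\<close>, gives
  \<open>P z = X + Y + lower order\<close> with \<open>X = \<Delta>z + lam\<^sup>2 |\<nabla>\<phi>|\<^sup>2 z\<close> and \<open>Y = - 2 lam \<nabla>\<phi>\<cdot>\<nabla>z + lam \<gamma> \<psi> z\<close>. The
  multiplier \<open>\<gamma> \<psi>\<close> replaces \<open>- \<Delta>\<phi>\<close>; it is what makes \<open>2 X Y\<close> a divergence plus a form that is
  positive in \<open>\<nabla>z\<close> although the Hessian of \<open>\<phi>\<close> is negative in tangential directions.\<close>

lemma carleman_conjugated:
  fixes x0 :: "real^'n::finite"
  assumes R: "R > 0" and x0: "x0 \<notin> ccube R" and \<beta>: "\<beta> > 0"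
  shows "\<exists>C>0. \<exists>\<kappa>>0. \<exists>lam1\<ge>1. \<forall>lam\<ge>lam1. \<forall>z Z1 Z2.
    continuous_on (ccube R) z \<longrightarrow> (\<forall>i. continuous_on (ccube R) (Z1 i)) \<longrightarrow> (\<forall>i j. continuous_on (ccube R) (Z2 i j)) \<longrightarrow>
    (\<forall>i. \<forall>x\<in>ccube R. pd i z (Z1 i x) x) \<longrightarrow> (\<forall>i j. \<forall>x\<in>ccube R. pd i (Z1 j) (Z2 i j x) x) \<longrightarrow>
    (\<forall>i j. \<forall>x\<in>ccube R. Z2 i j x = Z2 j i x) \<longrightarrow>
    \<kappa> * (LINT x|cubeM R. lam * (\<Sum>i\<in>UNIV. Z1 i x * Z1 i x) + lam^3 * (z x)\<^sup>2)
     \<le> 2 * (LINT x|cubeM R. ((\<Sum>i\<in>UNIV. Z2 i i x) + 2 * lam * \<beta> * spow x0 (- \<beta> / 2 - 1) x * (\<Sum>i\<in>UNIV. (x - x0) $ i * Z1 i x)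
            + lam\<^sup>2 * \<beta>\<^sup>2 * (spow x0 (- \<beta> / 2 - 1) x * spow x0 (- \<beta> / 2 - 1) x * sqdist x0 x) * z x
            - lam * \<beta> * (\<beta> + 2 - real CARD('n)) * spow x0 (- \<beta> / 2 - 1) x * z x)\<^sup>2)
       + C * bdry_integral R (\<lambda>x. lam * (\<Sum>i\<in>UNIV. Z1 i x * Z1 i x) + lam^3 * (z x)\<^sup>2)"
proof -
  define \<psi> where "\<psi> = spow x0 (- \<beta> / 2 - 1)"
  define \<theta> where "\<theta> = spow x0 (- \<beta> / 2 - 2)"
  define \<tau> where "\<tau> = spow x0 (- 3 * \<beta> / 2 - 3)"
  define Q where "Q = spow x0 (- 3 * \<beta> / 2 - 2)"
  define \<rho> where "\<rho> = sqdist x0"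
  define \<gamma> where "\<gamma> = \<beta> * (real CARD('n) - 2 * \<beta> - 4)"
  have ne: "x \<noteq> x0" if "x \<in> ccube R" for x
    using that x0 by auto
  have rel: "\<psi> x = \<rho> x * \<theta> x" "\<tau> x = \<psi> x * \<psi> x * \<psi> x" "Q x = \<rho> x * \<tau> x" if "x \<in> ccube R" for x
  proof -
    have e: "- \<beta> / 2 - 2 = - \<beta> / 2 - 1 - 1" "- 3 * \<beta> / 2 - 3 = - 3 * \<beta> / 2 - 2 - 1"
      by simp_all
    show "\<psi> x = \<rho> x * \<theta> x"
      unfolding \<psi>_def \<theta>_def \<rho>_def e by (rule spow_mult_sqdist[OF ne[OF that], symmetric])
    show "Q x = \<rho> x * \<tau> x"
      unfolding Q_def \<tau>_def \<rho>_def e by (rule spow_mult_sqdist[OF ne[OF that], symmetric])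
    show "\<tau> x = \<psi> x * \<psi> x * \<psi> x"
      by (simp add: \<tau>_def \<psi>_def spow_def powr_add[symmetric])
  qed
  obtain m1 B1 where 1: "m1 > 0" "\<And>x. x \<in> ccube R \<Longrightarrow> m1 \<le> \<psi> x \<and> \<psi> x \<le> B1"
    unfolding \<psi>_def using spow_bounds[OF x0 R] by metis
  obtain m2 B2 where 2: "m2 > 0" "\<And>x. x \<in> ccube R \<Longrightarrow> m2 \<le> \<theta> x \<and> \<theta> x \<le> B2"
    unfolding \<theta>_def using spow_bounds[OF x0 R] by metis
  obtain m3 B3 where 3: "m3 > 0" "\<And>x. x \<in> ccube R \<Longrightarrow> m3 \<le> Q x \<and> Q x \<le> B3"
    unfolding Q_def using spow_bounds[OF x0 R] by metis
  obtain m4 B4 where 4: "m4 > 0" "\<And>x. x \<in> ccube R \<Longrightarrow> m4 \<le> spow x0 1 x \<and> spow x0 1 x \<le> B4"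
    using spow_bounds[OF x0 R] by metis
  define m where "m = min m1 m3"
  define B where "B = max 1 (max (max B1 B2) (max B3 B4))"
  have m: "m > 0" using 1 3 by (simp add: m_def)
  have B: "B \<ge> 1" by (simp add: B_def)
  have bd: "m \<le> \<psi> x" "m \<le> Q x" "0 < \<theta> x" "\<theta> x \<le> B" "\<psi> x \<le> B" "Q x \<le> B" "\<rho> x \<le> B" if "x \<in> ccube R" for x
  proof -
    have "spow x0 1 x = \<rho> x"
      using sqdist_pos[OF ne[OF that]] by (simp add: spow_def \<rho>_def)
    then show "m \<le> \<psi> x" "m \<le> Q x" "0 < \<theta> x" "\<theta> x \<le> B" "\<psi> x \<le> B" "Q x \<le> B" "\<rho> x \<le> B"
      using 1(2)[OF that] 2(2)[OF that] 3(2)[OF that] 4(2)[OF that] 2(1) by (auto simp: m_def B_def)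
  qed
  \<comment> \<open>\<open>W\<close> collects the coefficients of the errors in
    \<open>carleman_pointwise\<close>; from \<open>lam1\<close> on the cubic term dominates
    them.\<close>
  define W where "W = \<gamma>\<^sup>2 * (\<beta> + 2) / (4 * \<beta>) * B + 2 * \<beta>\<^sup>2 * (\<beta> + 2)\<^sup>2 * B\<^sup>2"
  define lam1 where "lam1 = max 1 (W / (\<beta>^4 * m))"
  define \<kappa> where "\<kappa> = min (2 * \<beta>\<^sup>2 * m) (\<beta>^4 * m)"
  \<comment> \<open>Ratio between the flux and the energy \<open>E\<close>: the two flux terms
    quadratic in the gradient give 4 + 2 = 6, the other summands come from the
    \<open>\<gamma>\<close> term and the cubic term.\<close>
  define CV where "CV = 6 * \<beta> * B * (1 + B) + 2 * \<bar>\<gamma>\<bar> * B + 2 * \<beta>^3 * B * (1 + B)"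
  have \<kappa>: "\<kappa> > 0" using \<beta> m by (simp add: \<kappa>_def)
  have CV: "CV > 0"
    unfolding CV_def using \<beta> B by (intro add_pos_nonneg) auto
  have cont: "continuous_on (ccube R) \<psi>" "continuous_on (ccube R) \<theta>" "continuous_on (ccube R) \<tau>" "continuous_on (ccube R) Q" "continuous_on (ccube R) \<rho>"
    unfolding \<psi>_def \<theta>_def \<tau>_def Q_def \<rho>_def sqdist_def [abs_def] by (auto intro!: spow_cont x0 continuous_intros)
  have main: "\<kappa> * (LINT x|cubeM R. lam * (\<Sum>i\<in>UNIV. Z1 i x * Z1 i x) + lam^3 * (z x)\<^sup>2)
     \<le> 2 * (LINT x|cubeM R. ((\<Sum>i\<in>UNIV. Z2 i i x) + 2 * lam * \<beta> * \<psi> x * (\<Sum>i\<in>UNIV. (x - x0) $ i * Z1 i x)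
            + lam\<^sup>2 * \<beta>\<^sup>2 * (\<psi> x * \<psi> x * \<rho> x) * z x
            - lam * \<beta> * (\<beta> + 2 - real CARD('n)) * \<psi> x * z x)\<^sup>2)
       + CV * bdry_integral R (\<lambda>x. lam * (\<Sum>i\<in>UNIV. Z1 i x * Z1 i x) + lam^3 * (z x)\<^sup>2)"
    if lam: "lam \<ge> lam1" and cz: "continuous_on (ccube R) z" and c1: "\<And>i. continuous_on (ccube R) (Z1 i)"
      and c2: "\<And>i j. continuous_on (ccube R) (Z2 i j)"
      and d1: "\<And>i x. x \<in> ccube R \<Longrightarrow> pd i z (Z1 i x) x" and d2: "\<And>i j x. x \<in> ccube R \<Longrightarrow> pd i (Z1 j) (Z2 i j x) x"
      and sym: "\<And>i j x. x \<in> ccube R \<Longrightarrow> Z2 i j x = Z2 j i x" for lam z Z1 Z2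
  proof -
    have l1: "lam \<ge> 1" and l2: "lam * (\<beta>^4 * m) \<ge> W"
      using lam \<beta> m by (auto simp: lam1_def pos_divide_le_eq)
    define S where "S x = (\<Sum>j\<in>UNIV. (x - x0) $ j * Z1 j x)" for x
    define N where "N x = (\<Sum>j\<in>UNIV. Z1 j x * Z1 j x)" for x
    \<comment> \<open>The boundary parts of the products in \<open>2 * X * Y\<close>: the first two
      terms belong to Laplacian times \<open>S\<close>, the third to Laplacian times
      \<open>z\<close>, the last to \<open>z\<close> times \<open>S\<close>. \<open>D\<close> is its
      derivative as delivered by the \<open>pd\<close> rules.\<close>
    define V where "V i x = 4 * lam * \<beta> * (\<psi> x * (S x * Z1 i x)) - 2 * lam * \<beta> * (\<psi> x * (N x * (x - x0) $ i))
      + 2 * lam * \<gamma> * (\<psi> x * (z x * Z1 i x)) + 2 * lam^3 * \<beta>^3 * (Q x * ((x - x0) $ i * (z x * z x)))" for i x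
    define D where "D i x =
        4 * lam * \<beta> * (- (\<beta> + 2) * \<theta> x * (x - x0) $ i * (S x * Z1 i x) + \<psi> x * ((Z1 i x + (\<Sum>j\<in>UNIV. (x - x0) $ j * Z2 i j x)) * Z1 i x + S x * Z2 i i x))
      - 2 * lam * \<beta> * (- (\<beta> + 2) * \<theta> x * (x - x0) $ i * (N x * (x - x0) $ i) + \<psi> x * ((2 * (\<Sum>j\<in>UNIV. Z1 j x * Z2 i j x)) * (x - x0) $ i + N x * 1))
      + 2 * lam * \<gamma> * (- (\<beta> + 2) * \<theta> x * (x - x0) $ i * (z x * Z1 i x) + \<psi> x * (Z1 i x * Z1 i x + z x * Z2 i i x))
      + 2 * lam^3 * \<beta>^3 * (- (3 * \<beta> + 4) * \<tau> x * (x - x0) $ i * ((x - x0) $ i * (z x * z x)) + Q x * (1 * (z x * z x) + (x - x0) $ i * (Z1 i x * z x + z x * Z1 i x)))" for i x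
    define P where "P x = (\<Sum>i\<in>UNIV. Z2 i i x) + 2 * lam * \<beta> * \<psi> x * S x
            + lam\<^sup>2 * \<beta>\<^sup>2 * (\<psi> x * \<psi> x * \<rho> x) * z x - lam * \<beta> * (\<beta> + 2 - real CARD('n)) * \<psi> x * z x" for x
    define E where "E x = lam * N x + lam^3 * (z x)\<^sup>2" for x
    have cS: "continuous_on (ccube R) S" and cN: "continuous_on (ccube R) N"
      unfolding S_def [abs_def] N_def [abs_def] by (intro continuous_intros c1)+
    have cV: "continuous_on (ccube R) (V i)" and cD: "continuous_on (ccube R) (D i)" for i
      unfolding V_def [abs_def] D_def [abs_def] by (intro continuous_intros cont cS cN c1 c2 cz)+
    have cP: "continuous_on (ccube R) P" and cE: "continuous_on (ccube R) E"
      unfolding P_def [abs_def] E_def [abs_def] by (intro continuous_intros cont cS cN c1 c2 cz)+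
    have dV: "pd i (V i) (D i x) x" if x: "x \<in> ccube R" for i x
    proof -
      have d\<psi>: "pd i \<psi> (- (\<beta> + 2) * \<theta> x * (x - x0) $ i) x"
        unfolding \<psi>_def by (rule pd_eq[OF pd_spow[OF ne[OF x]]]) (simp add: \<theta>_def algebra_simps)
      have dQ: "pd i Q (- (3 * \<beta> + 4) * \<tau> x * (x - x0) $ i) x"
        unfolding Q_def by (rule pd_eq[OF pd_spow[OF ne[OF x]]]) (simp add: \<tau>_def algebra_simps)
      have dy: "pd i (\<lambda>x. (x - x0) $ i) 1 x"
        by (rule pd_eq[OF pd_component]) (simp add: axis_def)
      have dS: "pd i S (Z1 i x + (\<Sum>j\<in>UNIV. (x - x0) $ j * Z2 i j x)) x"
      proof -
        have "pd i (\<lambda>x. \<Sum>j\<in>UNIV. (x - x0) $ j * Z1 j x) (\<Sum>j\<in>UNIV. axis i 1 $ j * Z1 j x + (x - x0) $ j * Z2 i j x) x"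
          by (intro pd_sum pd_mult pd_component d2 x)
        then show ?thesis
          unfolding S_def [abs_def] by (rule pd_eq) (simp add: sum.distrib sum_axis)
      qed
      have dN: "pd i N (2 * (\<Sum>j\<in>UNIV. Z1 j x * Z2 i j x)) x"
      proof -
        have "pd i (\<lambda>x. \<Sum>j\<in>UNIV. Z1 j x * Z1 j x) (\<Sum>j\<in>UNIV. Z2 i j x * Z1 j x + Z1 j x * Z2 i j x) x"
          by (intro pd_sum pd_mult d2 x)
        then show ?thesis
          unfolding N_def [abs_def] by (rule pd_eq) (simp add: sum.distrib sum_distrib_left mult.commute)
      qed
      show ?thesis
        unfolding V_def [abs_def] D_def
        by (intro pd_add pd_diff pd_cmult pd_mult d\<psi> dQ dy dS dN d1[OF x] d2[OF x])
    qed
    have pt: "\<kappa> * E x \<le> 2 * (P x)\<^sup>2 - (\<Sum>i\<in>UNIV. D i x)" if x: "x \<in> ccube R" for x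
    proof -
      note id = carleman_divergence_sum[where y="\<lambda>i. (x - x0) $ i" and z="\<lambda>i. Z1 i x" and Z="\<lambda>i j. Z2 i j x" and w="z x" and \<beta>=\<beta> and lam=lam,
          OF sym[OF x] _ refl refl refl rel[OF x] \<gamma>_def, unfolded \<rho>_def sqdist_def, OF refl, folded sqdist_def \<rho>_def]
      show ?thesis
        unfolding E_def \<kappa>_def
      proof (rule carleman_pointwise[OF \<beta> m bd(1,2,3,4,5)[OF x] _ l1 l2[unfolded W_def]])
        show "0 \<le> N x" unfolding N_def by (intro sum_nonneg) auto
        show "2 * ((\<Sum>i\<in>UNIV. Z2 i i x) + lam\<^sup>2 * \<beta>\<^sup>2 * (\<psi> x * \<psi> x * \<rho> x) * z x) * (2 * lam * \<beta> * \<psi> x * S x + lam * \<gamma> * \<psi> x * z x)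
          = (\<Sum>i\<in>UNIV. D i x) + 2 * lam * \<beta>\<^sup>2 * \<psi> x * N x + 4 * lam * \<beta> * (\<beta> + 2) * \<theta> x * (S x)\<^sup>2 + 2 * lam^3 * \<beta>^4 * Q x * (z x)\<^sup>2
            + 2 * lam * \<gamma> * (\<beta> + 2) * \<theta> x * z x * S x"
          unfolding D_def S_def N_def by (rule id)
        show "(\<Sum>i\<in>UNIV. Z2 i i x) + lam\<^sup>2 * \<beta>\<^sup>2 * (\<psi> x * \<psi> x * \<rho> x) * z x + (2 * lam * \<beta> * \<psi> x * S x + lam * \<gamma> * \<psi> x * z x)
          = P x - lam * \<beta> * (\<beta> + 2) * \<psi> x * z x"
          by (simp add: P_def \<gamma>_def algebra_simps)
      qed
    qed
    have Vb: "\<bar>V i x\<bar> \<le> CV * E x" if x: "x \<in> ccube R" for i x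
    proof -
      have "(\<Sum>i\<in>UNIV. (x - x0) $ i * (x - x0) $ i) \<le> B"
        using bd(7)[OF x] by (simp add: \<rho>_def sqdist_def)
      note ib = inner_sum_bounds(1-3)[OF this N_def[of x] S_def[of x], where i=i] inner_sum_bounds(4)[OF this N_def[of x] S_def[of x]]
      have \<psi>0: "0 < \<psi> x" "0 < Q x" using bd(1,2)[OF x] m by auto
      have E0: "0 \<le> lam * N x" "0 \<le> lam^3 * (z x)\<^sup>2" using l1 ib(4) by auto
      have lz: "lam * (z x * z x) \<le> lam^3 * (z x)\<^sup>2"
        using l1 self_le_power[of lam 3] by (auto simp: power2_eq_square intro!: mult_right_mono)
      have t1: "\<bar>4 * lam * \<beta> * (\<psi> x * (S x * Z1 i x))\<bar> \<le> 4 * lam * \<beta> * (B * ((1 + B) * N x))"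
        unfolding abs_mult[of "4 * lam * \<beta>"] abs_mult[of "\<psi> x"] using ib(2) bd(5)[OF x] \<psi>0 \<beta> l1 ib(4) B
        by (intro mult_mono) auto
      have t2: "\<bar>2 * lam * \<beta> * (\<psi> x * (N x * (x - x0) $ i))\<bar> \<le> 2 * lam * \<beta> * (B * (N x * (1 + B)))"
        unfolding abs_mult using ib(1) bd(5)[OF x] \<psi>0 \<beta> l1 ib(4) B
        by (intro mult_mono) auto
      have "\<bar>z x * Z1 i x\<bar> \<le> z x * z x + N x"
        by (rule abs_mult_le_sum[OF order_refl ib(3)])
      then have "\<bar>2 * lam * \<gamma> * (\<psi> x * (z x * Z1 i x))\<bar> \<le> 2 * lam * \<bar>\<gamma>\<bar> * (B * (z x * z x + N x))"
        unfolding abs_mult[of "2 * lam * \<gamma>"] abs_mult[of "\<psi> x"] using bd(5)[OF x] \<psi>0 l1 B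
        by (intro mult_mono) (auto simp: abs_mult)
      also have "\<dots> = 2 * \<bar>\<gamma>\<bar> * B * (lam * (z x * z x) + lam * N x)"
        by (simp add: algebra_simps)
      also have "\<dots> \<le> 2 * \<bar>\<gamma>\<bar> * B * E x"
        unfolding E_def using lz B by (intro mult_left_mono) auto
      finally have t3: "\<bar>2 * lam * \<gamma> * (\<psi> x * (z x * Z1 i x))\<bar> \<le> 2 * \<bar>\<gamma>\<bar> * B * E x" .
      have t4: "\<bar>2 * lam^3 * \<beta>^3 * (Q x * ((x - x0) $ i * (z x * z x)))\<bar> \<le> 2 * lam^3 * \<beta>^3 * (B * ((1 + B) * (z x * z x)))"
        unfolding abs_mult[of "2 * lam^3 * \<beta>^3"] abs_mult[of "Q x"] abs_mult[of "(x - x0) $ i"] using ib(1) bd(6)[OF x] \<psi>0 \<beta> l1 B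
        by (intro mult_mono) auto
      have "\<bar>V i x\<bar> \<le> 4 * lam * \<beta> * (B * ((1 + B) * N x)) + 2 * lam * \<beta> * (B * (N x * (1 + B)))
          + 2 * \<bar>\<gamma>\<bar> * B * E x + 2 * lam^3 * \<beta>^3 * (B * ((1 + B) * (z x * z x)))"
        unfolding V_def using t1 t2 t3 t4 by linarith
      also have "\<dots> = 6 * \<beta> * B * (1 + B) * (lam * N x) + 2 * \<beta>^3 * B * (1 + B) * (lam^3 * (z x)\<^sup>2) + 2 * \<bar>\<gamma>\<bar> * B * E x"
        by (simp add: algebra_simps power2_eq_square)
      also have "\<dots> \<le> 6 * \<beta> * B * (1 + B) * E x + 2 * \<beta>^3 * B * (1 + B) * E x + 2 * \<bar>\<gamma>\<bar> * B * E x"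
        using E0 \<beta> B by (intro add_mono mult_left_mono order_refl) (auto simp: E_def)
      also have "\<dots> = CV * E x"
        by (simp add: CV_def distrib_right)
      finally show ?thesis .
    qed
    have I: "integrable (cubeM R) f" if "continuous_on (ccube R) f" for f :: "real^'n \<Rightarrow> real"
      by (rule L1_le_L2(1)[OF finite_cubeM continuous_L2fun[OF that]])
    have cP2: "continuous_on (ccube R) (\<lambda>x. (P x)\<^sup>2)"
      by (intro continuous_intros cP)
    have cDs: "continuous_on (ccube R) (\<lambda>x. \<Sum>i\<in>UNIV. D i x)"
      by (intro continuous_intros cD)
    have "\<kappa> * (LINT x|cubeM R. E x) = (LINT x|cubeM R. \<kappa> * E x)"
      by simp
    also have "\<dots> \<le> (LINT x|cubeM R. 2 * (P x)\<^sup>2 - (\<Sum>i\<in>UNIV. D i x))"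
      by (rule integral_mono) (use I[OF cE] I[OF cP2] I[OF cDs] pt cube_subset_ccube in auto)
    also have "\<dots> = 2 * (LINT x|cubeM R. (P x)\<^sup>2) - (LINT x|cubeM R. (\<Sum>i\<in>UNIV. D i x))"
      using I[OF cP2] I[OF cDs] by simp
    also have "\<dots> \<le> 2 * (LINT x|cubeM R. (P x)\<^sup>2) + bdry_integral R (\<lambda>x. CV * E x)"
      using divergence_bound[of R V D "\<lambda>x. CV * E x", OF R cV cD dV[unfolded pd_def] continuous_on_mult_left[OF cE] Vb]
      by (simp add: abs_le_iff)
    also have "bdry_integral R (\<lambda>x. CV * E x) = CV * bdry_integral R E"
      by (rule bdry_integral_cmult[OF R cE])
    finally show ?thesis
      unfolding E_def P_def S_def N_def .
  qed
  have "lam1 \<ge> 1" by (simp add: lam1_def)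
  then show ?thesis
    using CV \<kappa> main[unfolded \<psi>_def \<rho>_def]
    by (intro exI[of _ CV] exI[of _ \<kappa>] exI[of _ lam1] conjI allI impI) auto
qed

text \<open>The weight is the square of the conjugating exponential, so weighted squares of
  \<open>w\<close> are plain squares of the conjugated function.\<close>

lemma cweight_eq:
  assumes "x \<noteq> x0"
  shows "cweight x0 \<beta> lam x = (exp (lam * spow x0 (- \<beta> / 2) x))\<^sup>2"
  using norm_powr_sqdist[OF assms, of \<beta>] by (simp add: cweight_def spow_def exp_double[symmetric] mult.assoc)

definition energy :: "(real^'n::finite \<Rightarrow> real) \<Rightarrow> real^'n \<Rightarrow> real" where
  "energy w x = (w x)\<^sup>2 + (\<Sum>i\<in>UNIV. (pderivative i w x)\<^sup>2)"

lemma scaled_square_le: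
  fixes a b :: real
  shows "(a - b)\<^sup>2 \<le> 2 * a\<^sup>2 + 2 * b\<^sup>2"
  using square_sum_le[of a "- b"] by simp

text \<open>\<open>carleman_conjugated\<close> for \<open>z = e * w\<close>, where \<open>e\<close>
  is the exponential of \<open>lam * \<phi>\<close>. The gradient of \<open>z\<close> contains
  \<open>lam\<close> times \<open>z\<close> times the gradient of \<open>\<phi>\<close>, so changing
  between the energies of \<open>z\<close> and \<open>w\<close> costs powers of \<open>lam\<close>:
  inside, one factor \<open>lam\<close> survives, and on the boundary \<open>lam^3\<close> is
  conceded.\<close>

lemma carleman_smooth:
  fixes x0 :: "real^'n::finite"
  assumes R: "R > 0" and x0: "x0 \<notin> ccube R" and \<beta>: "\<beta> > 0"
  shows "\<exists>K>0. \<exists>lam1\<ge>1. \<forall>lam\<ge>lam1. \<forall>w. smooth w \<longrightarrow>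
    lam * (LINT x|cubeM R. cweight x0 \<beta> lam x * energy w x)
     \<le> K * (LINT x|cubeM R. cweight x0 \<beta> lam x * (\<Sum>i\<in>UNIV. pderivative i (pderivative i w) x)\<^sup>2)
       + K * lam^3 * bdry_integral R (\<lambda>x. cweight x0 \<beta> lam x * energy w x)"
proof -
  define \<psi> where "\<psi> = spow x0 (- \<beta> / 2 - 1)"
  define \<theta> where "\<theta> = spow x0 (- \<beta> / 2 - 2)"
  define \<phi> where "\<phi> = spow x0 (- \<beta> / 2)"
  have ne: "x \<noteq> x0" if "x \<in> ccube R" for x
    using that x0 by auto
  have rel: "\<psi> x = sqdist x0 x * \<theta> x" if "x \<in> ccube R" for x
  proof -
    have e: "- \<beta> / 2 - 2 = - \<beta> / 2 - 1 - 1" by simp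
    show ?thesis
      unfolding \<psi>_def \<theta>_def e by (rule spow_mult_sqdist[OF ne[OF that], symmetric])
  qed
  have cont: "continuous_on (ccube R) \<psi>" "continuous_on (ccube R) \<theta>" "continuous_on (ccube R) \<phi>"
    unfolding \<psi>_def \<theta>_def \<phi>_def by (auto intro!: spow_cont x0)
  have d\<phi>: "pd i \<phi> (- \<beta> * \<psi> x * (x - x0) $ i) x" if "x \<in> ccube R" for i x
    unfolding \<phi>_def by (rule pd_eq[OF pd_spow[OF ne[OF that]]]) (simp add: \<psi>_def)
  have d\<psi>: "pd i \<psi> (- (\<beta> + 2) * \<theta> x * (x - x0) $ i) x" if "x \<in> ccube R" for i x
    unfolding \<psi>_def by (rule pd_eq[OF pd_spow[OF ne[OF that]]]) (simp add: \<theta>_def algebra_simps)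
  obtain B where B: "B \<ge> 0" "\<And>x. x \<in> ccube R \<Longrightarrow> norm (\<psi> x * \<psi> x * sqdist x0 x) \<le> B"
  proof -
    have "continuous_on (ccube R) (\<lambda>x. \<psi> x * \<psi> x * sqdist x0 x)"
      unfolding sqdist_def by (intro continuous_intros cont)
    then show ?thesis
      using continuous_bounded_ccube that by blast
  qed
  have B': "0 \<le> \<psi> x * \<psi> x * sqdist x0 x" "\<psi> x * \<psi> x * sqdist x0 x \<le> B" if "x \<in> ccube R" for x
    using B(2)[OF that] sqdist_pos[OF ne[OF that]] by (auto simp: abs_mult)
  from carleman_conjugated[OF R x0 \<beta>, folded \<psi>_def]
  obtain C \<kappa> lam1 where C: "C > 0" "\<kappa> > 0" "lam1 \<ge> 1" and main: "\<forall>lam\<ge>lam1. \<forall>z Z1 Z2.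
    continuous_on (ccube R) z \<longrightarrow> (\<forall>i. continuous_on (ccube R) (Z1 i)) \<longrightarrow> (\<forall>i j. continuous_on (ccube R) (Z2 i j)) \<longrightarrow>
    (\<forall>i. \<forall>x\<in>ccube R. pd i z (Z1 i x) x) \<longrightarrow> (\<forall>i j. \<forall>x\<in>ccube R. pd i (Z1 j) (Z2 i j x) x) \<longrightarrow>
    (\<forall>i j. \<forall>x\<in>ccube R. Z2 i j x = Z2 j i x) \<longrightarrow>
    \<kappa> * (LINT x|cubeM R. lam * (\<Sum>i\<in>UNIV. Z1 i x * Z1 i x) + lam^3 * (z x)\<^sup>2)
     \<le> 2 * (LINT x|cubeM R. ((\<Sum>i\<in>UNIV. Z2 i i x) + 2 * lam * \<beta> * \<psi> x * (\<Sum>i\<in>UNIV. (x - x0) $ i * Z1 i x)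
            + lam\<^sup>2 * \<beta>\<^sup>2 * (\<psi> x * \<psi> x * sqdist x0 x) * z x
            - lam * \<beta> * (\<beta> + 2 - real CARD('n)) * \<psi> x * z x)\<^sup>2)
       + C * bdry_integral R (\<lambda>x. lam * (\<Sum>i\<in>UNIV. Z1 i x * Z1 i x) + lam^3 * (z x)\<^sup>2)"
    by (elim exE conjE) (rule that)
  \<comment> \<open>\<open>\<beta>\<^sup>2 * B\<close> bounds the squared gradient of
    \<open>\<phi>\<close>; \<open>c\<close> serves in both comparisons of \<open>A\<close> with
    \<open>E\<close> below.\<close>
  define c where "c = 3 + 2 * \<beta>\<^sup>2 * B"
  have c: "c \<ge> 3" using B by (simp add: c_def)
  \<comment> \<open>The interior and the boundary constant of the final inequality, added so that
    one number dominates both. The second carries \<open>c\<close> twice, once for each comparison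
    of energies.\<close>
  define K where "K = 2 * c / \<kappa> + C * c\<^sup>2 / \<kappa>"
  have K: "2 * c / \<kappa> \<le> K" "C * c\<^sup>2 / \<kappa> \<le> K" "K > 0"
    using C c by (auto simp: K_def intro!: add_pos_nonneg)
  have "lam * (LINT x|cubeM R. cweight x0 \<beta> lam x * energy w x)
     \<le> K * (LINT x|cubeM R. cweight x0 \<beta> lam x * (\<Sum>i\<in>UNIV. pderivative i (pderivative i w) x)\<^sup>2)
       + K * lam^3 * bdry_integral R (\<lambda>x. cweight x0 \<beta> lam x * energy w x)"
    if lam: "lam \<ge> lam1" and w: "smooth w" for lam w
  proof -
    have l1: "lam \<ge> 1" using lam C by simp
    define e where "e x = exp (lam * \<phi> x)" for x
    define z where "z x = e x * w x" for x
    define Z1 where "Z1 i x = e x * (pderivative i w x - lam * \<beta> * (\<psi> x * (x - x0) $ i * w x))" for i x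
    define Z2 where "Z2 i j x = (e x * (lam * (- \<beta> * \<psi> x * (x - x0) $ i))) * (pderivative j w x - lam * \<beta> * (\<psi> x * (x - x0) $ j * w x))
      + e x * (pderivative i (pderivative j w) x - lam * \<beta> * ((- (\<beta> + 2) * \<theta> x * (x - x0) $ i * (x - x0) $ j + \<psi> x * axis i 1 $ j) * w x + \<psi> x * (x - x0) $ j * pderivative i w x))" for i j x
    have smc: "continuous_on S w" "continuous_on S (pderivative i w)" "continuous_on S (pderivative i (pderivative j w))" for S i j
      by (auto intro!: smooth_continuous smooth_pderivative w)
    have ce: "continuous_on (ccube R) e"
      unfolding e_def [abs_def] by (intro continuous_intros cont)
    have cz: "continuous_on (ccube R) z"
      unfolding z_def [abs_def] by (intro continuous_intros ce smc)
    have c1: "continuous_on (ccube R) (Z1 i)" for i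
      unfolding Z1_def [abs_def] by (intro continuous_intros ce cont smc)
    have c2: "continuous_on (ccube R) (Z2 i j)" for i j
      unfolding Z2_def [abs_def] by (intro continuous_intros ce cont smc)
    have de: "pd i e (e x * (lam * (- \<beta> * \<psi> x * (x - x0) $ i))) x" if "x \<in> ccube R" for i x
      unfolding e_def [abs_def] by (intro pd_exp pd_cmult d\<phi> that)
    have d1: "pd i z (Z1 i x) x" if "x \<in> ccube R" for i x
      unfolding z_def [abs_def] by (rule pd_eq[OF pd_mult[OF de[OF that] pd_smooth[OF w]]]) (simp add: Z1_def algebra_simps)
    have d2: "pd i (Z1 j) (Z2 i j x) x" if "x \<in> ccube R" for i j x
      unfolding Z1_def [abs_def] Z2_def
      by (intro pd_mult pd_diff pd_cmult pd_component de[OF that] d\<psi>[OF that] pd_smooth smooth_pderivative w)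
    have sym: "Z2 i j x = Z2 j i x" for i j x
      by (simp add: Z2_def pderivative_commute[OF w, of i j] axis_def algebra_simps)
    define E where "E x = lam * (\<Sum>i\<in>UNIV. Z1 i x * Z1 i x) + lam^3 * (z x)\<^sup>2" for x
    define L where "L x = (\<Sum>i\<in>UNIV. pderivative i (pderivative i w) x)" for x
    \<comment> \<open>Undoing the conjugation: the lower order terms of
      \<open>carleman_conjugated\<close> are exactly those for which only the Laplacian of
      \<open>w\<close> remains.\<close>
    have P: "(\<Sum>i\<in>UNIV. Z2 i i x) + 2 * lam * \<beta> * \<psi> x * (\<Sum>i\<in>UNIV. (x - x0) $ i * Z1 i x)
            + lam\<^sup>2 * \<beta>\<^sup>2 * (\<psi> x * \<psi> x * sqdist x0 x) * z x
            - lam * \<beta> * (\<beta> + 2 - real CARD('n)) * \<psi> x * z x = e x * L x" if x: "x \<in> ccube R" for x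
    proof -
      define \<rho> where "\<rho> = sqdist x0 x"
      have \<rho>: "\<rho> = (\<Sum>i\<in>UNIV. (x - x0) $ i * (x - x0) $ i)"
        by (simp add: \<rho>_def sqdist_def)
      define T where "T = (\<Sum>i\<in>UNIV. (x - x0) $ i * pderivative i w x)"
      have Z2i: "Z2 i i x = (- 2 * e x * lam * \<beta> * \<psi> x) * ((x - x0) $ i * pderivative i w x)
         + (e x * lam\<^sup>2 * \<beta>\<^sup>2 * \<psi> x * \<psi> x * w x + e x * lam * \<beta> * (\<beta> + 2) * \<theta> x * w x) * ((x - x0) $ i * (x - x0) $ i)
         + e x * pderivative i (pderivative i w) x + (- e x * lam * \<beta> * \<psi> x * w x)" for i
        by (simp add: Z2_def axis_def algebra_simps power2_eq_square)
      have s1: "(\<Sum>i\<in>UNIV. Z2 i i x) = (- 2 * e x * lam * \<beta> * \<psi> x) * T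
         + (e x * lam\<^sup>2 * \<beta>\<^sup>2 * \<psi> x * \<psi> x * w x + e x * lam * \<beta> * (\<beta> + 2) * \<theta> x * w x) * \<rho>
         + e x * L x + real CARD('n) * (- e x * lam * \<beta> * \<psi> x * w x)"
        unfolding Z2i sum.distrib sum_distrib_left[symmetric] T_def[symmetric] \<rho>[symmetric] L_def[symmetric] by simp
      have Z1i: "(x - x0) $ i * Z1 i x = e x * ((x - x0) $ i * pderivative i w x) + (- e x * lam * \<beta> * \<psi> x * w x) * ((x - x0) $ i * (x - x0) $ i)" for i
        by (simp add: Z1_def algebra_simps)
      have s2: "(\<Sum>i\<in>UNIV. (x - x0) $ i * Z1 i x) = e x * T + (- e x * lam * \<beta> * \<psi> x * w x) * \<rho>"
        unfolding Z1i sum.distrib sum_distrib_left[symmetric] T_def[symmetric] \<rho>[symmetric] by simp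
      have r: "\<psi> x = \<rho> * \<theta> x" using rel[OF x] by (simp add: \<rho>_def)
      show ?thesis
        unfolding s1 s2 \<rho>_def[symmetric] r z_def by (simp add: algebra_simps power2_eq_square)
    qed
    have cE: "continuous_on (ccube R) E"
      unfolding E_def [abs_def] by (intro continuous_intros c1 cz)
    have cL: "continuous_on (ccube R) (\<lambda>x. (e x * L x)\<^sup>2)"
      unfolding L_def by (intro continuous_intros ce smc)
    define A where "A x = (e x)\<^sup>2 * energy w x" for x
    have cA: "continuous_on (ccube R) A"
      unfolding A_def [abs_def] energy_def by (intro continuous_intros ce smc)
    have I: "integrable (cubeM R) f" if "continuous_on (ccube R) f" for f :: "real^'n \<Rightarrow> real"
      by (rule L1_le_L2(1)[OF finite_cubeM continuous_L2fun[OF that]])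
    have cc: "x \<in> ccube R" if "x \<in> cube R" for x :: "real^'n"
      using that cube_subset_ccube by blast
    have key: "\<kappa> * (LINT x|cubeM R. E x) \<le> 2 * (LINT x|cubeM R. (e x * L x)\<^sup>2) + C * bdry_integral R E"
    proof -
      have "\<kappa> * (LINT x|cubeM R. E x) \<le> 2 * (LINT x|cubeM R. ((\<Sum>i\<in>UNIV. Z2 i i x) + 2 * lam * \<beta> * \<psi> x * (\<Sum>i\<in>UNIV. (x - x0) $ i * Z1 i x)
            + lam\<^sup>2 * \<beta>\<^sup>2 * (\<psi> x * \<psi> x * sqdist x0 x) * z x
            - lam * \<beta> * (\<beta> + 2 - real CARD('n)) * \<psi> x * z x)\<^sup>2) + C * bdry_integral R E"
        unfolding E_def [abs_def] by (rule main[rule_format, OF lam cz c1 c2 d1 d2 sym])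
      also have "(LINT x|cubeM R. ((\<Sum>i\<in>UNIV. Z2 i i x) + 2 * lam * \<beta> * \<psi> x * (\<Sum>i\<in>UNIV. (x - x0) $ i * Z1 i x)
            + lam\<^sup>2 * \<beta>\<^sup>2 * (\<psi> x * \<psi> x * sqdist x0 x) * z x
            - lam * \<beta> * (\<beta> + 2 - real CARD('n)) * \<psi> x * z x)\<^sup>2) = (LINT x|cubeM R. (e x * L x)\<^sup>2)"
        by (rule Bochner_Integration.integral_cong) (use P cc in auto)
      finally show ?thesis .
    qed
    have sumsq: "(\<Sum>i\<in>UNIV. (\<psi> x * (x - x0) $ i * a)\<^sup>2) = \<psi> x * \<psi> x * sqdist x0 x * a\<^sup>2" for x a
      by (simp add: sqdist_def sum_distrib_left sum_distrib_right power2_eq_square mult_ac)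
    have AE: "lam * A x \<le> c * E x" and EA: "E x \<le> c * lam^3 * A x" if x: "x \<in> ccube R" for x
    proof -
      let ?N = "\<Sum>i\<in>UNIV. Z1 i x * Z1 i x" and ?g = "\<psi> x * \<psi> x * sqdist x0 x"
      let ?G = "\<Sum>i\<in>UNIV. (pderivative i w x)\<^sup>2"
      have N0: "?N \<ge> 0" and G0: "?G \<ge> 0" by (auto intro!: sum_nonneg)
      have lp: "lam \<le> lam^3" using l1 self_le_power[of lam 3] by simp
      have z2: "(z x)\<^sup>2 = (e x)\<^sup>2 * (w x)\<^sup>2" by (simp add: z_def power_mult_distrib)
      have gz: "\<beta>\<^sup>2 * ?g * (z x)\<^sup>2 \<le> \<beta>\<^sup>2 * B * (z x)\<^sup>2"
        using B'[OF x] by (intro mult_right_mono mult_left_mono) auto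
      have "(e x)\<^sup>2 * ?G = (\<Sum>i\<in>UNIV. (Z1 i x + lam * \<beta> * (\<psi> x * (x - x0) $ i * z x))\<^sup>2)"
      proof -
        have "Z1 i x + lam * \<beta> * (\<psi> x * (x - x0) $ i * z x) = e x * pderivative i w x" for i
          by (simp add: Z1_def z_def algebra_simps)
        then show ?thesis
          by (simp only: power_mult_distrib sum_distrib_left)
      qed
      also have "\<dots> \<le> (\<Sum>i\<in>UNIV. 2 * (Z1 i x)\<^sup>2 + 2 * (lam * \<beta> * (\<psi> x * (x - x0) $ i * z x))\<^sup>2)"
        by (intro sum_mono square_sum_le)
      also have "\<dots> = 2 * ?N + 2 * lam\<^sup>2 * (\<beta>\<^sup>2 * ?g * (z x)\<^sup>2)"
        unfolding power_mult_distrib[of "lam * \<beta>"] sum.distrib sum_distrib_left[symmetric] sumsq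
        by (simp add: power2_eq_square mult_ac)
      also have "\<dots> \<le> 2 * ?N + 2 * lam\<^sup>2 * (\<beta>\<^sup>2 * B * (z x)\<^sup>2)"
        using gz by (intro add_left_mono mult_left_mono) auto
      finally have "lam * ((e x)\<^sup>2 * ?G) \<le> lam * (2 * ?N + 2 * lam\<^sup>2 * (\<beta>\<^sup>2 * B * (z x)\<^sup>2))"
        using l1 by (intro mult_left_mono) auto
      also have "\<dots> = 2 * (lam * ?N) + 2 * \<beta>\<^sup>2 * B * (lam^3 * (z x)\<^sup>2)"
        by (simp add: algebra_simps power2_eq_square power3_eq_cube)
      finally have "lam * A x \<le> 2 * (lam * ?N) + 2 * \<beta>\<^sup>2 * B * (lam^3 * (z x)\<^sup>2) + lam * (z x)\<^sup>2"
        by (simp add: A_def energy_def z2 algebra_simps)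
      also have "lam * (z x)\<^sup>2 \<le> lam^3 * (z x)\<^sup>2"
        using lp by (intro mult_right_mono) auto
      also have "2 * (lam * ?N) + 2 * \<beta>\<^sup>2 * B * (lam^3 * (z x)\<^sup>2) + lam^3 * (z x)\<^sup>2 \<le> c * (lam * ?N) + c * (lam^3 * (z x)\<^sup>2)"
      proof -
        have "2 * (lam * ?N) \<le> c * (lam * ?N)"
          using c N0 l1 by (intro mult_right_mono) auto
        moreover have "(2 * \<beta>\<^sup>2 * B + 1) * (lam^3 * (z x)\<^sup>2) \<le> c * (lam^3 * (z x)\<^sup>2)"
          using l1 by (intro mult_right_mono) (auto simp: c_def)
        ultimately show ?thesis by (simp add: distrib_right)
      qed
      finally show "lam * A x \<le> c * E x"
        by (simp add: E_def distrib_left)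
      have "?N = (\<Sum>i\<in>UNIV. (e x * pderivative i w x - lam * \<beta> * (\<psi> x * (x - x0) $ i * z x))\<^sup>2)"
      proof -
        have "Z1 i x = e x * pderivative i w x - lam * \<beta> * (\<psi> x * (x - x0) $ i * z x)" for i
          by (simp add: Z1_def z_def algebra_simps)
        then show ?thesis
          by (simp only: power2_eq_square)
      qed
      also have "\<dots> \<le> (\<Sum>i\<in>UNIV. 2 * (e x * pderivative i w x)\<^sup>2 + 2 * (lam * \<beta> * (\<psi> x * (x - x0) $ i * z x))\<^sup>2)"
        by (intro sum_mono scaled_square_le)
      also have "\<dots> = 2 * ((e x)\<^sup>2 * ?G) + 2 * lam\<^sup>2 * (\<beta>\<^sup>2 * ?g * (z x)\<^sup>2)"
        unfolding power_mult_distrib[of "lam * \<beta>"] power_mult_distrib[of "e x"] sum.distrib sum_distrib_left[symmetric] sumsq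
        by (simp add: power2_eq_square mult_ac)
      also have "\<dots> \<le> 2 * ((e x)\<^sup>2 * ?G) + 2 * lam\<^sup>2 * (\<beta>\<^sup>2 * B * (z x)\<^sup>2)"
        using gz by (intro add_left_mono mult_left_mono) auto
      finally have "lam * ?N \<le> lam * (2 * ((e x)\<^sup>2 * ?G) + 2 * lam\<^sup>2 * (\<beta>\<^sup>2 * B * (z x)\<^sup>2))"
        using l1 by (intro mult_left_mono) auto
      then have "E x \<le> lam * (2 * ((e x)\<^sup>2 * ?G)) + (2 * \<beta>\<^sup>2 * B + 1) * (lam^3 * (z x)\<^sup>2)"
        by (simp add: E_def algebra_simps power2_eq_square power3_eq_cube)
      also have "lam * (2 * ((e x)\<^sup>2 * ?G)) \<le> lam^3 * (c * ((e x)\<^sup>2 * ?G))"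
        using lp c G0 l1 by (intro mult_mono mult_right_mono) auto
      also have "(2 * \<beta>\<^sup>2 * B + 1) * (lam^3 * (z x)\<^sup>2) \<le> c * (lam^3 * (z x)\<^sup>2)"
        using l1 by (intro mult_right_mono) (auto simp: c_def)
      finally show "E x \<le> c * lam^3 * A x"
        by (simp add: A_def energy_def z2 algebra_simps)
    qed
    have "\<kappa> * (lam * (LINT x|cubeM R. A x)) = \<kappa> * (LINT x|cubeM R. lam * A x)"
      by simp
    also have "\<dots> \<le> \<kappa> * (LINT x|cubeM R. c * E x)"
      using C AE cc I[OF cA] I[OF cE] by (intro mult_left_mono integral_mono) auto
    also have "\<dots> = c * (\<kappa> * (LINT x|cubeM R. E x))"
      by simp
    also have "\<dots> \<le> c * (2 * (LINT x|cubeM R. (e x * L x)\<^sup>2) + C * bdry_integral R E)"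
      using key c by (intro mult_left_mono) auto
    also have "\<dots> \<le> c * (2 * (LINT x|cubeM R. (e x * L x)\<^sup>2) + C * (c * lam^3 * bdry_integral R A))"
    proof -
      have "bdry_integral R E \<le> bdry_integral R (\<lambda>x. c * lam^3 * A x)"
        by (intro bdry_integral_mono R cE continuous_intros cA EA)
      also have "\<dots> = c * lam^3 * bdry_integral R A"
        by (rule bdry_integral_cmult[OF R cA])
      finally show ?thesis
        using c C by (intro mult_left_mono add_left_mono) auto
    qed
    finally have "lam * (LINT x|cubeM R. A x) \<le> c * (2 * (LINT x|cubeM R. (e x * L x)\<^sup>2) + C * (c * lam^3 * bdry_integral R A)) / \<kappa>"
      using C by (simp add: pos_le_divide_eq mult.commute)
    also have "\<dots> = (2 * c / \<kappa>) * (LINT x|cubeM R. (e x * L x)\<^sup>2) + (C * c\<^sup>2 / \<kappa>) * (lam^3 * bdry_integral R A)"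
      using C by (simp add: field_simps power2_eq_square)
    also have "\<dots> \<le> K * (LINT x|cubeM R. (e x * L x)\<^sup>2) + K * (lam^3 * bdry_integral R A)"
    proof (intro add_mono mult_right_mono K)
      show "0 \<le> lam^3 * bdry_integral R A"
        using l1 by (intro mult_nonneg_nonneg bdry_integral_nonneg R cA) (auto simp: A_def energy_def intro!: mult_nonneg_nonneg add_nonneg_nonneg sum_nonneg)
    qed (simp add: integral_nonneg_AE)
    finally have fin: "lam * (LINT x|cubeM R. A x) \<le> K * (LINT x|cubeM R. (e x * L x)\<^sup>2) + K * (lam^3 * bdry_integral R A)" .
    have cw: "cweight x0 \<beta> lam x = (e x)\<^sup>2" if "x \<in> ccube R" for x
      unfolding e_def \<phi>_def by (rule cweight_eq[OF ne[OF that]])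
    have 1: "(LINT x|cubeM R. cweight x0 \<beta> lam x * energy w x) = (LINT x|cubeM R. A x)"
      by (rule Bochner_Integration.integral_cong) (use cw cc in \<open>auto simp: A_def\<close>)
    have 2: "(LINT x|cubeM R. cweight x0 \<beta> lam x * (\<Sum>i\<in>UNIV. pderivative i (pderivative i w) x)\<^sup>2) = (LINT x|cubeM R. (e x * L x)\<^sup>2)"
      by (rule Bochner_Integration.integral_cong) (use cw cc in \<open>auto simp: L_def power_mult_distrib\<close>)
    have 3: "bdry_integral R (\<lambda>x. cweight x0 \<beta> lam x * energy w x) = bdry_integral R A"
      by (rule bdry_integral_cong[OF R]) (simp add: A_def cw)
    show ?thesis
      using fin unfolding 1 2 3 by (simp add: mult.assoc)
  qed
  then show ?thesis
    using K(3) C(3) by blast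
qed

section \<open>Values, gradients and Laplacians of Sobolev functions\<close>

abbreviation mi1 :: "'n \<Rightarrow> 'n \<Rightarrow> nat" where "mi1 i \<equiv> (\<lambda>j. if j = i then 1 else 0)"
abbreviation mi2 :: "'n \<Rightarrow> 'n \<Rightarrow> nat" where "mi2 i \<equiv> (\<lambda>j. if j = i then 2 else 0)"

lemma norm_square_vec: "(norm (v :: real^'n::finite))\<^sup>2 = (\<Sum>i\<in>UNIV. (v $ i)\<^sup>2)"
  unfolding norm_vec_def L2_set_def by (simp add: sum_nonneg)

lemma uniform_limit_square:
  fixes f :: "nat \<Rightarrow> real^'n::finite \<Rightarrow> real"
  assumes "uniform_limit (ccube R) f g sequentially" "continuous_on (ccube R) g"
  shows "uniform_limit (ccube R) (\<lambda>n x. (f n x)\<^sup>2) (\<lambda>x. (g x)\<^sup>2) sequentially"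
proof -
  have "bounded (g ` ccube R)"
    by (intro compact_imp_bounded compact_continuous_image assms compact_cbox)
  then show ?thesis
    unfolding power2_eq_square by (intro uniform_lim_mult assms)
qed

lemma uniform_limit_finite_sum:
  fixes f :: "'i \<Rightarrow> nat \<Rightarrow> 'a \<Rightarrow> real"
  assumes "finite I" "\<And>i. i \<in> I \<Longrightarrow> uniform_limit S (f i) (g i) sequentially"
  shows "uniform_limit S (\<lambda>n x. \<Sum>i\<in>I. f i n x) (\<lambda>x. \<Sum>i\<in>I. g i x) sequentially"
  using assms by (induction I rule: finite_induct) (auto intro!: uniform_limit_add uniform_limit_const)

text \<open>Gradient norm and Laplacian are bounded by sums of \<open>CARD('n)\<close> derivatives;
  with this factor one constant serves for value, gradient and Laplacian.\<close>

definition emb :: "'n::finite itself \<Rightarrow> real \<Rightarrow> real" where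
  "emb T R = real CARD('n) * embedding_const T R"

context smooth_bump
begin

abbreviation "wg \<equiv> weak_gradient (cube R :: (real^'n) set)"
abbreviation "wl \<equiv> weak_laplacian (cube R :: (real^'n) set)"
abbreviation "cr \<equiv> cont_rep (cube R :: (real^'n) set)"
abbreviation "cg \<equiv> cont_gradient (cube R :: (real^'n) set)"
abbreviation "H p \<equiv> sobolev (cube R :: (real^'n) set) p"
abbreviation "nrm p \<equiv> sobolev_norm (cube R :: (real^'n) set) p"
lemma emb: "emb TYPE('n) R > 0" "embedding_const TYPE('n) R \<le> emb TYPE('n) R"
  using embC_pos by (auto simp: emb_def mult_le_cancel_right1)

context
  fixes p :: nat
  assumes p: "sob_order TYPE('n) \<le> p"
begin

lemma mi_le: "mi_order \<alpha> \<le> 2 \<Longrightarrow> mi_order (\<alpha> :: 'n \<Rightarrow> nat) \<le> p"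
  using p by (simp add: sob_order_def)

lemma wg_measurable: "u \<in> H p \<Longrightarrow> wg u \<in> borel_measurable (cubeM R)"
  using L2funD(1)[OF sobolevD(3)[of u R p, OF _ mi_le]]
  by (auto simp: borel_measurable_euclidean_space[of "wg u"] Basis_vec_def inner_axis weak_gradient_def)

lemma wl_L2fun: "u \<in> H p \<Longrightarrow> L2fun (cubeM R) (wl u)"
  unfolding weak_laplacian_def [abs_def] by (intro L2fun_sum sobolevD(3)[of u R p] mi_le) auto

lemma wg_component_L2fun: "u \<in> H p \<Longrightarrow> L2fun (cubeM R) (\<lambda>x. wg u x $ i)"
  unfolding weak_gradient_def by (simp, intro sobolevD(3)[of u R p] mi_le) auto

lemma value_bounded:
  assumes "u \<in> H p"
  shows "AE x in cubeM R. \<bar>u x\<bar> \<le> emb TYPE('n) R * nrm p u"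
  using weak_deriv_zero[OF sobolevD(1)[OF assms]] weak_deriv_bounded[OF assms p, of "\<lambda>_. 0", simplified]
proof eventually_elim
  case (elim x)
  then have "\<bar>u x\<bar> \<le> embedding_const TYPE('n) R * nrm p u" by simp
  also have "\<dots> \<le> emb TYPE('n) R * nrm p u" by (intro mult_right_mono emb) simp
  finally show ?case .
qed

lemma wg_bounded:
  assumes "u \<in> H p"
  shows "AE x in cubeM R. norm (wg u x) \<le> emb TYPE('n) R * nrm p u"
proof -
  have "AE x in cubeM R. \<forall>i\<in>UNIV. \<bar>weak_deriv (cube R) (mi1 i) u x\<bar> \<le> embedding_const TYPE('n) R * nrm p u"
    by (intro AE_finite_allI weak_deriv_bounded[OF assms p]) auto
  then show ?thesis
  proof eventually_elim
    case (elim x)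
    have "norm (wg u x) \<le> (\<Sum>i\<in>UNIV. \<bar>wg u x $ i\<bar>)"
      by (rule norm_le_l1_cart)
    also have "\<dots> \<le> (\<Sum>i\<in>(UNIV::'n set). embedding_const TYPE('n) R * nrm p u)"
      using elim by (intro sum_mono) (simp add: weak_gradient_def)
    finally show ?case by (simp add: emb_def)
  qed
qed

lemma wl_bounded:
  assumes "u \<in> H p"
  shows "AE x in cubeM R. \<bar>wl u x\<bar> \<le> emb TYPE('n) R * nrm p u"
proof -
  have "AE x in cubeM R. \<forall>i\<in>UNIV. \<bar>weak_deriv (cube R) (mi2 i) u x\<bar> \<le> embedding_const TYPE('n) R * nrm p u"
    by (intro AE_finite_allI weak_deriv_bounded[OF assms p]) auto
  then show ?thesis
  proof eventually_elim
    case (elim x)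
    have "\<bar>wl u x\<bar> \<le> (\<Sum>i\<in>UNIV. \<bar>weak_deriv (cube R) (mi2 i) u x\<bar>)"
      unfolding weak_laplacian_def by (rule sum_abs)
    also have "\<dots> \<le> (\<Sum>i\<in>(UNIV::'n set). embedding_const TYPE('n) R * nrm p u)"
      using elim by (intro sum_mono) simp
    finally show ?case by (simp add: emb_def)
  qed
qed

lemma cr_facts:
  assumes u: "u \<in> H p"
  shows "continuous_on (ccube R) (cr u)" "AE x in cubeM R. cr u x = u x"
    "uniform_limit (ccube R) (\<lambda>n. mollseq n u) (cr u) sequentially"
    "x \<in> ccube R \<Longrightarrow> \<bar>cr u x\<bar> \<le> emb TYPE('n) R * nrm p u"
proof -
  note f = cont_rep_weak_deriv[OF u p _ weak_deriv_zero[OF sobolevD(1)[OF u]], simplified]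
  show "continuous_on (ccube R) (cr u)" "AE x in cubeM R. cr u x = u x"
    by (rule f(1), rule f(2))
  show "uniform_limit (ccube R) (\<lambda>n. mollseq n u) (cr u) sequentially"
    using f(3) by (simp add: mi_deriv_zero)
  assume "x \<in> ccube R"
  then have "\<bar>cr u x\<bar> \<le> embedding_const TYPE('n) R * nrm p u" by (rule f(4))
  also have "\<dots> \<le> emb TYPE('n) R * nrm p u" by (intro mult_right_mono emb) simp
  finally show "\<bar>cr u x\<bar> \<le> emb TYPE('n) R * nrm p u" .
qed

lemma cg_facts:
  assumes u: "u \<in> H p"
  shows "continuous_on (ccube R) (\<lambda>x. cg u x $ i)" "AE x in cubeM R. cg u x $ i = weak_deriv (cube R) (mi1 i) u x"
    "uniform_limit (ccube R) (\<lambda>n. pderivative i (mollseq n u)) (\<lambda>x. cg u x $ i) sequentially"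
    "x \<in> ccube R \<Longrightarrow> norm (cg u x) \<le> emb TYPE('n) R * nrm p u"
proof -
  have f: "continuous_on (ccube R) (cr (weak_deriv (cube R) (mi1 i) u))"
    "AE x in cubeM R. cr (weak_deriv (cube R) (mi1 i) u) x = weak_deriv (cube R) (mi1 i) u x"
    "uniform_limit (ccube R) (\<lambda>n. mi_deriv (mi1 i) (mollseq n u)) (cr (weak_deriv (cube R) (mi1 i) u)) sequentially"
    "\<And>x. x \<in> ccube R \<Longrightarrow> \<bar>cr (weak_deriv (cube R) (mi1 i) u) x\<bar> \<le> embedding_const TYPE('n) R * nrm p u" for i
  proof -
    have "mi_order (mi1 i) \<le> 2" "AE x in cubeM R. weak_deriv (cube R) (mi1 i) u x = weak_deriv (cube R) (mi1 i) u x"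
      by simp_all
    note g = cont_rep_weak_deriv[OF u p this]
    show "continuous_on (ccube R) (cr (weak_deriv (cube R) (mi1 i) u))"
      "AE x in cubeM R. cr (weak_deriv (cube R) (mi1 i) u) x = weak_deriv (cube R) (mi1 i) u x"
      "uniform_limit (ccube R) (\<lambda>n. mi_deriv (mi1 i) (mollseq n u)) (cr (weak_deriv (cube R) (mi1 i) u)) sequentially"
      "\<And>x. x \<in> ccube R \<Longrightarrow> \<bar>cr (weak_deriv (cube R) (mi1 i) u) x\<bar> \<le> embedding_const TYPE('n) R * nrm p u"
      by (rule g(1), rule g(2), rule g(3), rule g(4))
  qed
  have eq: "(\<lambda>x. cg u x $ i) = cr (weak_deriv (cube R) (mi1 i) u)" for i
    by (simp add: cont_gradient_def fun_eq_iff)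
  show "continuous_on (ccube R) (\<lambda>x. cg u x $ i)" unfolding eq by (rule f)
  show "AE x in cubeM R. cg u x $ i = weak_deriv (cube R) (mi1 i) u x"
    using f(2)[of i] by (simp add: cont_gradient_def)
  show "uniform_limit (ccube R) (\<lambda>n. pderivative i (mollseq n u)) (\<lambda>x. cg u x $ i) sequentially"
    unfolding eq using f(3)[of i] by (simp add: mi_deriv_one smooth_mollseq[OF sobolevD(1)[OF u]])
  assume x: "x \<in> ccube R"
  have "norm (cg u x) \<le> (\<Sum>i\<in>UNIV. \<bar>cg u x $ i\<bar>)"
    by (rule norm_le_l1_cart)
  also have "\<dots> \<le> (\<Sum>i\<in>(UNIV::'n set). embedding_const TYPE('n) R * nrm p u)"
    using f(4)[OF x] by (intro sum_mono) (simp add: cont_gradient_def)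
  finally show "norm (cg u x) \<le> emb TYPE('n) R * nrm p u" by (simp add: emb_def)
qed

lemma cg_continuous: "u \<in> H p \<Longrightarrow> continuous_on (ccube R) (cg u)"
  using cg_facts(1) by (subst continuous_on_componentwise) (auto simp: Basis_vec_def inner_axis)

lemma wg_lincomb:
  assumes "u \<in> H p" "v \<in> H p"
  shows "AE x in cubeM R. wg (\<lambda>x. a * u x + b * v x) x = a *\<^sub>R wg u x + b *\<^sub>R wg v x"
proof -
  have "AE x in cubeM R. \<forall>i\<in>UNIV. weak_deriv (cube R) (mi1 i) (\<lambda>x. a * u x + b * v x) x
      = a * weak_deriv (cube R) (mi1 i) u x + b * weak_deriv (cube R) (mi1 i) v x"
    by (intro AE_finite_allI weak_deriv_lincomb[OF assms] mi_le) auto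
  then show ?thesis
    by eventually_elim (simp add: weak_gradient_def vec_eq_iff)
qed

lemma wl_lincomb:
  assumes "u \<in> H p" "v \<in> H p"
  shows "AE x in cubeM R. wl (\<lambda>x. a * u x + b * v x) x = a * wl u x + b * wl v x"
proof -
  have "AE x in cubeM R. \<forall>i\<in>UNIV. weak_deriv (cube R) (mi2 i) (\<lambda>x. a * u x + b * v x) x
      = a * weak_deriv (cube R) (mi2 i) u x + b * weak_deriv (cube R) (mi2 i) v x"
    by (intro AE_finite_allI weak_deriv_lincomb[OF assms] mi_le) auto
  then show ?thesis
    by eventually_elim (simp add: weak_laplacian_def sum.distrib sum_distrib_left)
qed

text \<open>An equality at every point of the closed cube, in contrast to the almost everywhere
  statements for weak derivatives; boundary integrals require this, the boundary being null.\<close>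

lemma cr_lincomb:
  assumes u: "u \<in> H p" and v: "v \<in> H p" and x: "x \<in> ccube R"
  shows "cr (\<lambda>x. a * u x + b * v x) x = a * cr u x + b * cr v x"
proof (rule cont_rep_props(3)[OF _ _ x])
  show "continuous_on (ccube R) (\<lambda>x. a * cr u x + b * cr v x)"
    by (intro continuous_intros cr_facts u v)
  show "AE x in cubeM R. a * cr u x + b * cr v x = a * u x + b * v x"
    using cr_facts(2)[OF u] cr_facts(2)[OF v] by eventually_elim simp
qed

lemma cg_lincomb:
  assumes u: "u \<in> H p" and v: "v \<in> H p" and x: "x \<in> ccube R"
  shows "cg (\<lambda>x. a * u x + b * v x) x = a *\<^sub>R cg u x + b *\<^sub>R cg v x"
proof -
  have "cr (weak_deriv (cube R) (mi1 i) (\<lambda>x. a * u x + b * v x)) x = a * cg u x $ i + b * cg v x $ i" for i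
  proof (rule cont_rep_props(3)[OF _ _ x])
    show "continuous_on (ccube R) (\<lambda>x. a * cg u x $ i + b * cg v x $ i)"
      by (intro continuous_intros cg_facts u v)
    show "AE x in cubeM R. a * cg u x $ i + b * cg v x $ i = weak_deriv (cube R) (mi1 i) (\<lambda>x. a * u x + b * v x) x"
      using cg_facts(2)[OF u, of i] cg_facts(2)[OF v, of i] weak_deriv_lincomb[OF u v mi_le, of "mi1 i" a b, simplified]
      by eventually_elim simp
  qed
  then show ?thesis
    by (simp add: cont_gradient_def vec_eq_iff)
qed

text \<open>The bounded multiplier \<open>sqrt (W x)\<close> reduces the weighted integrals to
  unweighted ones.\<close>

lemma weighted_L2_limit:
  assumes c: "L2conv (cubeM R) f g" and W: "continuous_on (ccube R) W" "\<And>x. x \<in> ccube R \<Longrightarrow> W x \<ge> 0"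
  shows "(\<lambda>n. LINT x|cubeM R. W x * (f n x)\<^sup>2) \<longlonglongrightarrow> (LINT x|cubeM R. W x * (g x :: real)\<^sup>2)"
    "integrable (cubeM R) (\<lambda>x. W x * (f n x)\<^sup>2)" "integrable (cubeM R) (\<lambda>x. W x * (g x)\<^sup>2)"
proof -
  have cs: "continuous_on (ccube R) (\<lambda>x. sqrt (W x))"
    by (intro continuous_intros W)
  obtain B where B: "\<And>x. x \<in> ccube R \<Longrightarrow> norm (sqrt (W x)) \<le> B"
    using continuous_bounded_ccube[OF cs] by blast
  have m: "(\<lambda>x. sqrt (W x)) \<in> borel_measurable (cubeM R)"
    by (rule continuous_cubeM[OF continuous_on_subset[OF cs cube_subset_ccube]])
  have c': "L2conv (cubeM R) (\<lambda>n x. sqrt (W x) * f n x) (\<lambda>x. sqrt (W x) * g x)"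
    by (rule L2conv_mult_bounded[OF c m, of B]) (rule AE_cubeM_ball, use B cube_subset_ccube in force)
  have eq: "(LINT x|cubeM R. (sqrt (W x) * h x)\<^sup>2) = (LINT x|cubeM R. W x * (h x)\<^sup>2)"
    and ieq: "integrable (cubeM R) (\<lambda>x. (sqrt (W x) * h x)\<^sup>2) \<longleftrightarrow> integrable (cubeM R) (\<lambda>x. W x * (h x)\<^sup>2)" for h
    using W(2) cube_subset_ccube[of R]
    by (auto simp: power_mult_distrib intro!: Bochner_Integration.integral_cong Bochner_Integration.integrable_cong)
  show "(\<lambda>n. LINT x|cubeM R. W x * (f n x)\<^sup>2) \<longlonglongrightarrow> (LINT x|cubeM R. W x * (g x)\<^sup>2)"
    using L2conv_square[OF c'] unfolding eq .
  show "integrable (cubeM R) (\<lambda>x. W x * (f n x)\<^sup>2)" "integrable (cubeM R) (\<lambda>x. W x * (g x)\<^sup>2)"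
    using L2funD(2)[OF L2convD(1)[OF c', of n]] L2funD(2)[OF L2convD(2)[OF c']] unfolding ieq by simp_all
qed

lemma cweight_continuous:
  assumes "x0 \<notin> ccube R"
  shows "continuous_on (ccube R) (cweight x0 \<beta> lam)"
proof -
  have "continuous_on (ccube R) (\<lambda>x. norm (x - x0) powr (- \<beta>))"
    by (intro continuous_intros) (use assms in auto)
  then show ?thesis
    unfolding cweight_def [abs_def] by (rule continuous_on_exp[OF continuous_on_mult_left])
qed

text \<open>Interior terms converge because the derivatives occurring in them converge in L2; the
  boundary term converges because values and first derivatives converge uniformly on the closed
  cube.\<close>

lemma carleman_limit:
  assumes u: "u \<in> H p" and x0: "x0 \<notin> ccube R" and lam: "lam \<ge> 0"
    and le: "\<And>w. smooth w \<Longrightarrow> lam * (LINT x|cubeM R. cweight x0 \<beta> lam x * energy w x)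
     \<le> K * (LINT x|cubeM R. cweight x0 \<beta> lam x * (\<Sum>i\<in>UNIV. pderivative i (pderivative i w) x)\<^sup>2)
       + K * lam^3 * bdry_integral R (\<lambda>x. cweight x0 \<beta> lam x * energy w x)"
  shows "lam * (LINT x|cubeM R. cweight x0 \<beta> lam x * (\<bar>u x\<bar>\<^sup>2 + (norm (wg u x))\<^sup>2))
     \<le> K * (LINT x|cubeM R. cweight x0 \<beta> lam x * (wl u x)\<^sup>2)
       + K * lam^3 * bdry_integral R (\<lambda>x. cweight x0 \<beta> lam x * (\<bar>cr u x\<bar>\<^sup>2 + (norm (cg u x))\<^sup>2))"
proof -
  let ?w = "\<lambda>n. mollseq n u" and ?W = "cweight x0 \<beta> lam"
  have sm: "smooth (?w n)" for n by (rule smooth_mollseq[OF sobolevD(1)[OF u]])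
  note W = cweight_continuous[OF x0, of \<beta> lam]
  have W0: "?W x \<ge> 0" for x by (simp add: cweight_def)
  have c0: "L2conv (cubeM R) ?w u" by (rule mollseq_L2conv[OF sobolevD(1)[OF u]])
  have c1: "L2conv (cubeM R) (\<lambda>n. pderivative i (?w n)) (\<lambda>x. wg u x $ i)" for i
    using mi_deriv_mollseq_L2conv[OF sobolevD(1,2)[OF u], of "mi1 i", OF mi_le] by (simp add: mi_deriv_one[OF sm] weak_gradient_def)
  have "L2conv (cubeM R) (\<lambda>n. pderivative i (pderivative i (?w n))) (weak_deriv (cube R) (mi2 i) u)" for i
    using mi_deriv_mollseq_L2conv[OF sobolevD(1,2)[OF u], of "mi2 i", OF mi_le] by (simp add: mi_deriv_two[OF sm])
  then have c2: "L2conv (cubeM R) (\<lambda>n x. \<Sum>i\<in>UNIV. pderivative i (pderivative i (?w n)) x) (wl u)"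
    unfolding weak_laplacian_def [abs_def] by (intro L2conv_sum) auto
  note l0 = weighted_L2_limit[OF c0 W W0] and l1 = weighted_L2_limit[OF c1 W W0] and l2 = weighted_L2_limit[OF c2 W W0]
  have i1: "(LINT x|cubeM R. ?W x * energy (?w n) x)
     = (LINT x|cubeM R. ?W x * (?w n x)\<^sup>2) + (\<Sum>i\<in>UNIV. LINT x|cubeM R. ?W x * (pderivative i (?w n) x)\<^sup>2)" for n
    unfolding energy_def distrib_left sum_distrib_left using l0(2) l1(2) by simp
  have i2: "(LINT x|cubeM R. ?W x * (\<bar>u x\<bar>\<^sup>2 + (norm (wg u x))\<^sup>2))
     = (LINT x|cubeM R. ?W x * (u x)\<^sup>2) + (\<Sum>i\<in>UNIV. LINT x|cubeM R. ?W x * (wg u x $ i)\<^sup>2)"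
    unfolding norm_square_vec distrib_left sum_distrib_left power2_abs using l0(3) l1(3) by simp
  have lim1: "(\<lambda>n. LINT x|cubeM R. ?W x * energy (?w n) x) \<longlonglongrightarrow> (LINT x|cubeM R. ?W x * (\<bar>u x\<bar>\<^sup>2 + (norm (wg u x))\<^sup>2))"
    unfolding i1 i2 by (intro tendsto_intros l0(1) l1(1))
  have lim3: "(\<lambda>n. bdry_integral R (\<lambda>x. ?W x * energy (?w n) x)) \<longlonglongrightarrow> bdry_integral R (\<lambda>x. ?W x * (\<bar>cr u x\<bar>\<^sup>2 + (norm (cg u x))\<^sup>2))"
  proof (rule bdry_integral_uniform_limit[OF R])
    show "continuous_on (ccube R) (\<lambda>x. ?W x * energy (?w n) x)" for n
      unfolding energy_def by (intro continuous_intros W smooth_continuous smooth_pderivative sm)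
    have cE: "continuous_on (ccube R) (\<lambda>x. (cr u x)\<^sup>2 + (\<Sum>i\<in>UNIV. (cg u x $ i)\<^sup>2))"
      by (intro continuous_intros cr_facts[OF u] cg_facts[OF u])
    then show "continuous_on (ccube R) (\<lambda>x. ?W x * (\<bar>cr u x\<bar>\<^sup>2 + (norm (cg u x))\<^sup>2))"
      unfolding norm_square_vec power2_abs by (intro continuous_on_mult[OF W])
    have bd: "bounded (f ` ccube R)" if "continuous_on (ccube R) f" for f :: "real^'n \<Rightarrow> real"
      by (intro compact_imp_bounded compact_continuous_image that compact_cbox)
    have "uniform_limit (ccube R) (\<lambda>n x. ?W x * ((?w n x)\<^sup>2 + (\<Sum>i\<in>UNIV. (pderivative i (?w n) x)\<^sup>2)))
        (\<lambda>x. ?W x * ((cr u x)\<^sup>2 + (\<Sum>i\<in>UNIV. (cg u x $ i)\<^sup>2))) sequentially"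
      by (intro uniform_lim_mult uniform_limit_const uniform_limit_add uniform_limit_finite_sum uniform_limit_square
          cr_facts[OF u] cg_facts[OF u] bd[OF W] bd[OF cE] finite)
    then show "uniform_limit (ccube R) (\<lambda>n x. ?W x * energy (?w n) x) (\<lambda>x. ?W x * (\<bar>cr u x\<bar>\<^sup>2 + (norm (cg u x))\<^sup>2)) sequentially"
      unfolding energy_def norm_square_vec power2_abs .
  qed
  show ?thesis
  proof (rule LIMSEQ_le)
    show "(\<lambda>n. lam * (LINT x|cubeM R. ?W x * energy (?w n) x)) \<longlonglongrightarrow> lam * (LINT x|cubeM R. ?W x * (\<bar>u x\<bar>\<^sup>2 + (norm (wg u x))\<^sup>2))"
      by (intro tendsto_intros lim1)
    show "(\<lambda>n. K * (LINT x|cubeM R. ?W x * (\<Sum>i\<in>UNIV. pderivative i (pderivative i (?w n)) x)\<^sup>2)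
       + K * lam^3 * bdry_integral R (\<lambda>x. ?W x * energy (?w n) x))
      \<longlonglongrightarrow> K * (LINT x|cubeM R. ?W x * (wl u x)\<^sup>2) + K * lam^3 * bdry_integral R (\<lambda>x. ?W x * (\<bar>cr u x\<bar>\<^sup>2 + (norm (cg u x))\<^sup>2))"
      by (intro tendsto_intros l2(1) lim3)
  qed (use le[OF sm] in blast)
qed

end

text \<open>\<open>K\<close> and \<open>lam1\<close> stand before \<open>p\<close> and
  \<open>u\<close>, so that the final \<open>lam0\<close> can be chosen independently of
  \<open>p\<close>.\<close>

lemma carleman_sobolev:
  fixes x0 :: "real^'n"
  assumes x0: "x0 \<notin> ccube R" and \<beta>: "\<beta> > 0"
  shows "\<exists>K>0. \<exists>lam1\<ge>1. \<forall>lam\<ge>lam1. \<forall>p\<ge>sob_order TYPE('n). \<forall>u\<in>H p.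
    lam * (LINT x|cubeM R. cweight x0 \<beta> lam x * (\<bar>u x\<bar>\<^sup>2 + (norm (wg u x))\<^sup>2))
     \<le> K * (LINT x|cubeM R. cweight x0 \<beta> lam x * (wl u x)\<^sup>2)
       + K * lam^3 * bdry_integral R (\<lambda>x. cweight x0 \<beta> lam x * (\<bar>cr u x\<bar>\<^sup>2 + (norm (cg u x))\<^sup>2))"
proof -
  obtain K lam1 where K: "K > 0" "lam1 \<ge> 1" and le: "\<And>lam w. lam \<ge> lam1 \<Longrightarrow> smooth w \<Longrightarrow>
    lam * (LINT x|cubeM R. cweight x0 \<beta> lam x * energy w x)
     \<le> K * (LINT x|cubeM R. cweight x0 \<beta> lam x * (\<Sum>i\<in>UNIV. pderivative i (pderivative i w) x)\<^sup>2)
       + K * lam^3 * bdry_integral R (\<lambda>x. cweight x0 \<beta> lam x * energy w x)"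
    using carleman_smooth[OF R x0 \<beta>] by blast
  show ?thesis
  proof (rule exI[of _ K], rule conjI[OF K(1)], rule exI[of _ lam1], rule conjI[OF K(2)], intro allI impI ballI)
    fix lam p u assume "lam1 \<le> lam" and pu: "sob_order TYPE('n) \<le> p" "u \<in> H p"
    then have "0 \<le> lam" using K(2) by simp
    show "lam * (LINT x|cubeM R. cweight x0 \<beta> lam x * (\<bar>u x\<bar>\<^sup>2 + (norm (wg u x))\<^sup>2))
     \<le> K * (LINT x|cubeM R. cweight x0 \<beta> lam x * (wl u x)\<^sup>2)
       + K * lam^3 * bdry_integral R (\<lambda>x. cweight x0 \<beta> lam x * (\<bar>cr u x\<bar>\<^sup>2 + (norm (cg u x))\<^sup>2))"
      by (rule carleman_limit[OF pu x0 \<open>0 \<le> lam\<close> le[OF \<open>lam1 \<le> lam\<close>]])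
  qed
qed

end

subsection \<open>Taylor expansion of the nonlinearity\<close>

lemma Ck_2D:
  fixes f :: "'a::euclidean_space \<Rightarrow> real"
  assumes "Ck 2 f"
  shows "f differentiable (at x)"
    "b \<in> Basis \<Longrightarrow> (\<lambda>x. frechet_derivative f (at x) b) differentiable (at x)"
    "b \<in> Basis \<Longrightarrow> c \<in> Basis \<Longrightarrow> continuous_on S (\<lambda>x. frechet_derivative (\<lambda>x. frechet_derivative f (at x) b) (at x) c)"
proof -
  show "f differentiable (at x)" "b \<in> Basis \<Longrightarrow> (\<lambda>x. frechet_derivative f (at x) b) differentiable (at x)"
    using assms by (auto simp: numeral_2_eq_2)
  assume "b \<in> Basis" "c \<in> Basis"
  then have "continuous_on UNIV (\<lambda>x. frechet_derivative (\<lambda>x. frechet_derivative f (at x) b) (at x) c)"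
    using assms by (auto simp: numeral_2_eq_2)
  then show "continuous_on S (\<lambda>x. frechet_derivative (\<lambda>x. frechet_derivative f (at x) b) (at x) c)"
    by (rule continuous_on_subset) simp
qed

lemma frechet_derivative_basis_expansion:
  fixes f :: "'a::euclidean_space \<Rightarrow> real"
  assumes "f differentiable (at x)"
  shows "frechet_derivative f (at x) h = (\<Sum>b\<in>Basis. (h \<bullet> b) * frechet_derivative f (at x) b)"
proof -
  have lin: "linear (frechet_derivative f (at x))"
    using assms frechet_derivative_works has_derivative_linear by blast
  have "frechet_derivative f (at x) h = frechet_derivative f (at x) (\<Sum>b\<in>Basis. (h \<bullet> b) *\<^sub>R b)"
    by (simp add: euclidean_representation)
  also have "\<dots> = (\<Sum>b\<in>Basis. (h \<bullet> b) * frechet_derivative f (at x) b)"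
    by (simp add: linear_sum[OF lin] linear_cmul[OF lin])
  finally show ?thesis .
qed

lemma frechet_line_derivative:
  fixes f :: "'a::euclidean_space \<Rightarrow> real"
  assumes "\<And>x. f differentiable (at x)"
  shows "((\<lambda>t. f (a + t *\<^sub>R v)) has_real_derivative frechet_derivative f (at (a + t *\<^sub>R v)) v) (at t)"
proof -
  have D: "(f has_derivative frechet_derivative f (at (a + t *\<^sub>R v))) (at (a + t *\<^sub>R v))"
    using assms frechet_derivative_works by blast
  have "((\<lambda>t. a + t *\<^sub>R v) has_derivative (\<lambda>s. s *\<^sub>R v)) (at t)"
    by (auto intro!: derivative_eq_intros)
  from diff_chain_at[OF this D]
  have "((\<lambda>t. f (a + t *\<^sub>R v)) has_derivative (\<lambda>s. frechet_derivative f (at (a + t *\<^sub>R v)) (s *\<^sub>R v))) (at t)"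
    by (simp only: o_def)
  also have "(\<lambda>s. frechet_derivative f (at (a + t *\<^sub>R v)) (s *\<^sub>R v)) = (*) (frechet_derivative f (at (a + t *\<^sub>R v)) v)"
    using linear_cmul[OF has_derivative_linear[OF D]] by (auto simp: fun_eq_iff)
  finally show ?thesis
    unfolding has_field_derivative_def .
qed

text \<open>As in \<open>csupp_taylor\<close>, with second derivatives bounded on \<open>S\<close>
  only; convexity keeps the intermediate point of the mean value theorem in
  \<open>S\<close>.\<close>

lemma Ck_2_taylor:
  fixes f :: "'a::euclidean_space \<Rightarrow> real"
  assumes f: "Ck 2 f" and S: "compact S" "convex S"
  shows "\<exists>K\<ge>0. \<forall>z h. z \<in> S \<longrightarrow> z + h \<in> S \<longrightarrow> \<bar>f (z + h) - f z - frechet_derivative f (at z) h\<bar> \<le> K * (norm h)\<^sup>2"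
proof -
  define G where "G b x = frechet_derivative f (at x) b" for b x
  define GG where "GG b c x = frechet_derivative (G b) (at x) c" for b c x
  note D1 = Ck_2D(1)[OF f]
  have D2: "G b differentiable (at x)" if "b \<in> Basis" for b x
    using Ck_2D(2)[OF f that] by (simp add: G_def [abs_def])
  have "\<exists>B\<ge>0. \<forall>x\<in>S. \<bar>GG b c x\<bar> \<le> B" if "b \<in> Basis" "c \<in> Basis" for b c
  proof -
    have "bounded (GG b c ` S)"
      using Ck_2D(3)[OF f that, of S] S
      by (intro compact_imp_bounded compact_continuous_image) (simp_all add: GG_def [abs_def] G_def [abs_def])
    then obtain B where "\<forall>y\<in>GG b c ` S. norm y \<le> B"
      unfolding bounded_iff by blast
    then have "\<forall>x\<in>S. \<bar>GG b c x\<bar> \<le> max B 0"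
      by (auto simp: le_max_iff_disj)
    then show ?thesis
      by (intro exI[of _ "max B 0"]) auto
  qed
  then obtain B where B: "\<And>b c. b \<in> Basis \<Longrightarrow> c \<in> Basis \<Longrightarrow> 0 \<le> B b c \<and> (\<forall>x\<in>S. \<bar>GG b c x\<bar> \<le> B b c)"
    by metis
  define K where "K = (\<Sum>b\<in>Basis. \<Sum>c\<in>Basis. B b c)"
  have "K \<ge> 0" unfolding K_def using B by (intro sum_nonneg) auto
  moreover have "\<bar>f (z + h) - f z - frechet_derivative f (at z) h\<bar> \<le> K * (norm h)\<^sup>2" if z: "z \<in> S" "z + h \<in> S" for z h
  proof -
    have seg: "z + t *\<^sub>R h \<in> S" if "0 \<le> t" "t \<le> 1" for t
    proof -
      have "z + t *\<^sub>R h = (1 - t) *\<^sub>R z + t *\<^sub>R (z + h)"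
        by (simp add: algebra_simps)
      then show ?thesis
        using convexD_alt[OF S(2) z that] by simp
    qed
    define P where "P t = (\<Sum>b\<in>Basis. (h \<bullet> b) * G b (z + t *\<^sub>R h))" for t
    define Q where "Q t = (\<Sum>b\<in>Basis. (h \<bullet> b) * (\<Sum>c\<in>Basis. (h \<bullet> c) * GG b c (z + t *\<^sub>R h)))" for t
    have 1: "((\<lambda>t. f (z + t *\<^sub>R h)) has_real_derivative P t) (at t)" for t
      using frechet_line_derivative[OF D1, of z h t] frechet_derivative_basis_expansion[OF D1[of "z + t *\<^sub>R h"], of h]
      by (simp add: P_def G_def)
    have 2: "(P has_real_derivative Q t) (at t)" for t
      unfolding P_def Q_def
    proof (intro DERIV_sum DERIV_cmult)
      fix b :: 'a assume b: "b \<in> Basis"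
      show "((\<lambda>t. G b (z + t *\<^sub>R h)) has_real_derivative (\<Sum>c\<in>Basis. (h \<bullet> c) * GG b c (z + t *\<^sub>R h))) (at t)"
        using frechet_line_derivative[OF D2[OF b], of z h t] frechet_derivative_basis_expansion[OF D2[OF b, of "z + t *\<^sub>R h"], of h]
        by (simp add: GG_def)
    qed
    obtain s where s: "0 < s" "s < 1" "f (z + h) - f z = P s"
      using MVT2[OF zero_less_one 1] by auto
    obtain s' where s': "0 < s'" "s' < s" "P s - P 0 = s * Q s'"
      using MVT2[OF s(1) 2] by auto
    have s'S: "z + s' *\<^sub>R h \<in> S" using s s' by (intro seg) auto
    have "\<bar>Q s'\<bar> \<le> (\<Sum>b\<in>Basis. norm h * (\<Sum>c\<in>Basis. norm h * B b c))"
      unfolding Q_def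
    proof (rule order_trans[OF sum_abs], rule sum_mono)
      fix b :: 'a assume b: "b \<in> Basis"
      have "\<bar>\<Sum>c\<in>Basis. (h \<bullet> c) * GG b c (z + s' *\<^sub>R h)\<bar> \<le> (\<Sum>c\<in>Basis. norm h * B b c)"
        by (rule order_trans[OF sum_abs], rule sum_mono, unfold abs_mult, rule mult_mono)
          (use B b s'S Basis_le_norm in auto)
      then show "\<bar>(h \<bullet> b) * (\<Sum>c\<in>Basis. (h \<bullet> c) * GG b c (z + s' *\<^sub>R h))\<bar> \<le> norm h * (\<Sum>c\<in>Basis. norm h * B b c)"
        unfolding abs_mult using Basis_le_norm[OF b] by (intro mult_mono) auto
    qed
    also have "\<dots> = K * (norm h)\<^sup>2"
      by (simp add: K_def sum_distrib_left sum_distrib_right power2_eq_square mult_ac)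
    finally have Q: "\<bar>Q s'\<bar> \<le> K * (norm h)\<^sup>2" .
    have "\<bar>s * Q s'\<bar> \<le> 1 * \<bar>Q s'\<bar>"
      unfolding abs_mult using s by (intro mult_right_mono) auto
    then have "\<bar>P s - P 0\<bar> \<le> K * (norm h)\<^sup>2"
      using s' Q by simp
    moreover have "P 0 = frechet_derivative f (at z) h"
      using frechet_derivative_basis_expansion[OF D1[of z], of h] by (simp add: P_def G_def)
    ultimately show ?thesis
      using s(3) by simp
  qed
  ultimately show ?thesis by blast
qed

locale C2_nonlinearity =
  fixes F :: "real^'n::finite \<Rightarrow> real \<Rightarrow> real^'n \<Rightarrow> real"
  assumes C2: "Ck 2 (\<lambda>(x, s, q). F x s q)"
begin

abbreviation dF :: "(real^'n) \<times> real \<times> (real^'n) \<Rightarrow> (real^'n) \<times> real \<times> (real^'n) \<Rightarrow> real" where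
  "dF z \<equiv> frechet_derivative (\<lambda>(x, s, q). F x s q) (at z)"

text \<open>The partial derivatives as they occur in \<open>carlemanDJ\<close>. They are identified
  below with values of the Frechet derivative, which carries continuity and the Taylor
  bound.\<close>

definition Fs :: "real^'n \<Rightarrow> real \<Rightarrow> real^'n \<Rightarrow> real" where
  "Fs x s q = deriv (\<lambda>s. F x s q) s"

definition Fp :: "real^'n \<Rightarrow> real \<Rightarrow> real^'n \<Rightarrow> real^'n" where
  "Fp x s q = gradient (\<lambda>q. F x s q) q"

lemma dF_works: "((\<lambda>(x, s, q). F x s q) has_derivative dF z) (at z)"
  using Ck_2D(1)[OF C2] frechet_derivative_works by blast

lemma dF_linear: "linear (dF z)"
  using dF_works has_derivative_linear by blast

lemma dF_continuous: "continuous_on S (\<lambda>z. dF z h)"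
proof -
  have "continuous_on S (\<lambda>z. \<Sum>b\<in>Basis. (h \<bullet> b) * dF z b)"
  proof (intro continuous_intros)
    fix b :: "(real^'n) \<times> real \<times> (real^'n)" assume "b \<in> Basis"
    then show "continuous_on S (\<lambda>z. dF z b)"
      using Ck_2D(2)[OF C2] by (meson continuous_at_imp_continuous_on differentiable_imp_continuous_within)
  qed
  then show ?thesis
    using frechet_derivative_basis_expansion[OF Ck_2D(1)[OF C2], of _ h] by simp
qed

lemma F_continuous: "continuous_on S (\<lambda>(x, s, q). F x s q)"
  using Ck_2D(1)[OF C2] by (meson continuous_at_imp_continuous_on differentiable_imp_continuous_within)

lemma Fs_eq: "Fs x s q = dF (x, s, q) (0, 1, 0)"
proof -
  have "((\<lambda>s. (x, s, q)) has_derivative (\<lambda>h. (0, h, 0))) (at s)"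
    by (auto intro!: derivative_eq_intros)
  from diff_chain_at[OF this dF_works]
  have "((\<lambda>s. F x s q) has_derivative (\<lambda>h. dF (x, s, q) (0, h, 0))) (at s)"
    by (simp add: o_def)
  also have "(\<lambda>h. dF (x, s, q) (0, h, 0)) = (*) (dF (x, s, q) (0, 1, 0))"
  proof
    fix h
    have "dF (x, s, q) (h *\<^sub>R (0, 1, 0)) = h *\<^sub>R dF (x, s, q) (0, 1, 0)"
      by (rule linear_cmul[OF dF_linear])
    then show "dF (x, s, q) (0, h, 0) = dF (x, s, q) (0, 1, 0) * h"
      by simp
  qed
  finally have "((\<lambda>s. F x s q) has_real_derivative dF (x, s, q) (0, 1, 0)) (at s)"
    by (simp only: has_field_derivative_def)
  then show ?thesis
    unfolding Fs_def by (rule DERIV_imp_deriv)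
qed

text \<open>\<open>gradient\<close> is a definite description, so existence and uniqueness both have
  to be supplied; the vector is assembled from the Frechet derivative on the basis.\<close>

lemma Fp_inner: "Fp x s q \<bullet> b = dF (x, s, q) (0, 0, b)"
proof -
  let ?D = "\<Sum>b\<in>Basis. dF (x, s, q) (0, 0, b) *\<^sub>R b"
  have "((\<lambda>q. (x, s, q)) has_derivative (\<lambda>h. (0, 0, h))) (at q)"
    by (auto intro!: derivative_eq_intros)
  from diff_chain_at[OF this dF_works]
  have D: "((\<lambda>q. F x s q) has_derivative (\<lambda>h. dF (x, s, q) (0, 0, h))) (at q)"
    by (simp add: o_def)
  have inner: "h \<bullet> ?D = dF (x, s, q) (0, 0, h)" for h
  proof -
    have lin: "linear (\<lambda>h. dF (x, s, q) (0, 0, h))"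
      using D has_derivative_linear by blast
    have "dF (x, s, q) (0, 0, h) = dF (x, s, q) (0, 0, \<Sum>b\<in>Basis. (h \<bullet> b) *\<^sub>R b)"
      by (simp add: euclidean_representation)
    also have "\<dots> = (\<Sum>b\<in>Basis. (h \<bullet> b) * dF (x, s, q) (0, 0, b))"
      by (simp add: linear_sum[OF lin] linear_cmul[OF lin])
    finally show ?thesis
      by (simp add: inner_sum_right mult.commute)
  qed
  have "GDERIV (\<lambda>q. F x s q) q :> ?D"
    unfolding gderiv_def inner using D .
  then have "Fp x s q = ?D"
    unfolding Fp_def gradient_def
  proof (intro the_equality)
    fix D' assume "GDERIV (\<lambda>q. F x s q) q :> D'"
    then have "(\<lambda>h. h \<bullet> D') = (\<lambda>h. h \<bullet> ?D)"
      using \<open>GDERIV (\<lambda>q. F x s q) q :> ?D\<close> unfolding gderiv_def by (rule has_derivative_unique)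
    then have "h \<bullet> D' = h \<bullet> ?D" for h
      by (rule fun_cong)
    then show "D' = ?D"
      by (rule iffD1[OF vector_eq_ldot, OF allI])
  qed
  then show ?thesis
    using inner[of b] by (simp add: inner_commute)
qed

lemma dF_split: "dF (x, s, q) (0, a, b) = Fs x s q * a + Fp x s q \<bullet> b"
proof -
  have "dF (x, s, q) (0, a, b) = dF (x, s, q) (a *\<^sub>R (0, 1, 0) + (0, 0, b))"
    by simp
  also have "\<dots> = a * dF (x, s, q) (0, 1, 0) + dF (x, s, q) (0, 0, b)"
    by (simp add: linear_add[OF dF_linear] linear_cmul[OF dF_linear] del: scaleR_Pair add_Pair)
  finally show ?thesis
    by (simp add: Fs_eq Fp_inner)
qed

lemma compose_measurable:
  fixes f :: "(real^'n) \<times> real \<times> (real^'n) \<Rightarrow> real"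
  assumes f: "continuous_on UNIV f" and u: "u \<in> borel_measurable (cubeM R)" and g: "g \<in> borel_measurable (cubeM R)"
  shows "(\<lambda>x. f (x, u x, g x)) \<in> borel_measurable (cubeM R)"
proof -
  have "(\<lambda>x. (x, u x, g x)) \<in> measurable (cubeM R) (borel \<Otimes>\<^sub>M (borel \<Otimes>\<^sub>M borel))"
    by (intro measurable_Pair id_cubeM u g)
  then have "(\<lambda>x. (x, u x, g x)) \<in> borel_measurable (cubeM R)"
    by (simp only: borel_prod)
  then show ?thesis
    by (rule measurable_compose[OF _ borel_measurable_continuous_onI[OF f]])
qed

lemma F_measurable:
  assumes "u \<in> borel_measurable (cubeM R)" "g \<in> borel_measurable (cubeM R)"
  shows "(\<lambda>x. F x (u x) (g x)) \<in> borel_measurable (cubeM R)" "(\<lambda>x. Fs x (u x) (g x)) \<in> borel_measurable (cubeM R)"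
    "h \<in> borel_measurable (cubeM R) \<Longrightarrow> (\<lambda>x. Fp x (u x) (g x) \<bullet> h x) \<in> borel_measurable (cubeM R)"
proof -
  show "(\<lambda>x. F x (u x) (g x)) \<in> borel_measurable (cubeM R)"
    using compose_measurable[OF F_continuous assms] by simp
  show "(\<lambda>x. Fs x (u x) (g x)) \<in> borel_measurable (cubeM R)"
    unfolding Fs_eq by (rule compose_measurable[OF dF_continuous assms])
  have "(\<lambda>x. Fp x (u x) (g x) \<bullet> b) \<in> borel_measurable (cubeM R)" for b
    unfolding Fp_inner by (rule compose_measurable[OF dF_continuous assms])
  then have "(\<lambda>x. Fp x (u x) (g x)) \<in> borel_measurable (cubeM R)"
    by (simp add: borel_measurable_euclidean_space[of "\<lambda>x. Fp x (u x) (g x)"])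
  then show "h \<in> borel_measurable (cubeM R) \<Longrightarrow> (\<lambda>x. Fp x (u x) (g x) \<bullet> h x) \<in> borel_measurable (cubeM R)"
    by (rule borel_measurable_inner)
qed

text \<open>One constant for all bounds, by compactness of closed cube times interval times ball.
  The Taylor remainder is taken at fixed \<open>x\<close>, with increments in \<open>s\<close> and
  \<open>q\<close> only.\<close>

lemma F_bounds:
  assumes "N \<ge> 0"
  shows "\<exists>K\<ge>0. \<forall>x s q. x \<in> ccube R \<longrightarrow> \<bar>s\<bar> \<le> N \<longrightarrow> norm q \<le> N \<longrightarrow>
    \<bar>F x s q\<bar> \<le> K \<and> \<bar>Fs x s q\<bar> \<le> K \<and> norm (Fp x s q) \<le> K \<and>
    (\<forall>a b. \<bar>s + a\<bar> \<le> N \<longrightarrow> norm (q + b) \<le> N \<longrightarrow>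
      \<bar>F x (s + a) (q + b) - F x s q - (Fs x s q * a + Fp x s q \<bullet> b)\<bar> \<le> K * (a\<^sup>2 + (norm b)\<^sup>2))"
proof -
  let ?S = "(ccube R :: (real^'n) set) \<times> {-N..N} \<times> (cball 0 N :: (real^'n) set)"
  have S: "compact ?S" "convex ?S"
    by (auto intro!: compact_Times convex_Times convex_box)
  have bdd: "\<exists>B\<ge>0. \<forall>z\<in>?S. \<bar>f z\<bar> \<le> B" if "continuous_on ?S f" for f :: "_ \<Rightarrow> real"
  proof -
    have "bounded (f ` ?S)"
      by (intro compact_imp_bounded compact_continuous_image that S)
    then obtain B where "\<forall>y\<in>f ` ?S. norm y \<le> B"
      unfolding bounded_iff by blast
    then have "\<forall>z\<in>?S. \<bar>f z\<bar> \<le> max B 0"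
      by (auto simp: le_max_iff_disj)
    then show ?thesis
      by (intro exI[of _ "max B 0"]) auto
  qed
  obtain B1 where B1: "B1 \<ge> 0" "\<And>x s q. (x, s, q) \<in> ?S \<Longrightarrow> \<bar>F x s q\<bar> \<le> B1"
    using bdd[OF F_continuous] by fastforce
  obtain B2 where B2: "B2 \<ge> 0" "\<And>x s q. (x, s, q) \<in> ?S \<Longrightarrow> \<bar>Fs x s q\<bar> \<le> B2"
    using bdd[OF dF_continuous, of "(0, 1, 0)"] unfolding Fs_eq by fastforce
  have "\<forall>b. \<exists>B\<ge>0. \<forall>x s q. (x, s, q) \<in> ?S \<longrightarrow> \<bar>Fp x s q \<bullet> b\<bar> \<le> B"
    using bdd[OF dF_continuous] unfolding Fp_inner by blast
  then obtain B3 where B3: "\<And>b. B3 b \<ge> 0" "\<And>b x s q. (x, s, q) \<in> ?S \<Longrightarrow> \<bar>Fp x s q \<bullet> b\<bar> \<le> B3 b"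
    by metis
  define B4 where "B4 = (\<Sum>b\<in>Basis. B3 b)"
  have B4: "B4 \<ge> 0" "\<And>x s q. (x, s, q) \<in> ?S \<Longrightarrow> norm (Fp x s q) \<le> B4"
    unfolding B4_def using B3 by (auto intro!: sum_nonneg order_trans[OF norm_le_l1] sum_mono)
  obtain B5 where B5: "B5 \<ge> 0" "\<And>z h. z \<in> ?S \<Longrightarrow> z + h \<in> ?S \<Longrightarrow>
      \<bar>(\<lambda>(x, s, q). F x s q) (z + h) - (\<lambda>(x, s, q). F x s q) z - dF z h\<bar> \<le> B5 * (norm h)\<^sup>2"
    using Ck_2_taylor[OF C2 S] by blast
  define K where "K = B1 + B2 + B4 + B5"
  show ?thesis
  proof (intro exI[of _ K] conjI allI impI)
    show "K \<ge> 0" using B1 B2 B4 B5 by (simp add: K_def)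
    fix x s and q :: "real^'n" assume x: "x \<in> (ccube R :: (real^'n) set)" and s: "\<bar>s\<bar> \<le> N" and q: "norm q \<le> N"
    then have z: "(x, s, q) \<in> ?S" by auto
    show "\<bar>F x s q\<bar> \<le> K" "\<bar>Fs x s q\<bar> \<le> K" "norm (Fp x s q) \<le> K"
      using B1(2)[OF z] B2(2)[OF z] B4(2)[OF z] B1(1) B2(1) B4(1) B5(1) by (auto simp: K_def)
    fix a b assume "\<bar>s + a\<bar> \<le> N" "norm (q + b) \<le> N"
    then have zh: "(x, s, q) + (0, a, b) \<in> ?S" using x by auto
    have "\<bar>F x (s + a) (q + b) - F x s q - (Fs x s q * a + Fp x s q \<bullet> b)\<bar> \<le> B5 * (norm (0 :: real^'n, a, b))\<^sup>2"
      using B5(2)[OF z zh] by (simp add: dF_split)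
    also have "(norm (0 :: real^'n, a, b))\<^sup>2 = a\<^sup>2 + (norm b)\<^sup>2"
      by (simp add: norm_Pair)
    also have "B5 * (a\<^sup>2 + (norm b)\<^sup>2) \<le> K * (a\<^sup>2 + (norm b)\<^sup>2)"
      using B1 B2 B4 by (intro mult_right_mono) (auto simp: K_def)
    finally show "\<bar>F x (s + a) (q + b) - F x s q - (Fs x s q * a + Fp x s q \<bullet> b)\<bar> \<le> K * (a\<^sup>2 + (norm b)\<^sup>2)" .
  qed
qed

end

text \<open>Free of measurability conditions, because a function that is not integrable has integral
  0 by convention.\<close>

lemma integral_cubeM_abs_le:
  fixes f :: "real^'n::finite \<Rightarrow> real"
  assumes b: "AE x in cubeM R. \<bar>f x\<bar> \<le> c" and c: "c \<ge> 0"
  shows "\<bar>LINT x|cubeM R. f x\<bar> \<le> c * measure (cubeM R) (cube R :: (real^'n) set)"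
proof (cases "integrable (cubeM R) f")
  case True
  interpret finite_measure "cubeM R :: (real^'n) measure" by simp
  have "\<bar>LINT x|cubeM R. f x\<bar> \<le> (LINT x|cubeM R. \<bar>f x\<bar>)"
    by (rule integral_abs_bound)
  also have "\<dots> \<le> integral\<^sup>L (cubeM R :: (real^'n) measure) (\<lambda>_. c)"
    by (rule integral_mono_AE) (use True b in auto)
  finally show ?thesis by (simp add: mult.commute)
next
  case False
  then show ?thesis
    using c by (simp add: not_integrable_integral_eq)
qed

subsection \<open>The functional and its derivative\<close>

locale carleman_functional = smooth_bump \<eta> R + C2_nonlinearity F
  for \<eta> :: "real^'n::finite \<Rightarrow> real" and R :: real and F :: "real^'n \<Rightarrow> real \<Rightarrow> real^'n \<Rightarrow> real" +
  fixes x0 :: "real^'n" and \<epsilon>0 \<beta> :: real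
  assumes x0: "x0 \<notin> ccube R" and \<epsilon>0: "\<epsilon>0 > 0" and \<beta>: "\<beta> > 0"
begin

abbreviation "J p lam et \<equiv> carlemanJ R x0 \<epsilon>0 \<beta> F p lam et"
abbreviation "DJ p lam et \<equiv> carlemanDJ R x0 \<epsilon>0 \<beta> F p lam et"
abbreviation "W lam \<equiv> cweight x0 \<beta> lam"

definition res :: "(real^'n \<Rightarrow> real) \<Rightarrow> real^'n \<Rightarrow> real" where
  "res v x = - \<epsilon>0 * wl v x + F x (v x) (wg v x)"

definition lin :: "(real^'n \<Rightarrow> real) \<Rightarrow> (real^'n \<Rightarrow> real) \<Rightarrow> real^'n \<Rightarrow> real" where
  "lin v h x = - \<epsilon>0 * wl h x + Fs x (v x) (wg v x) * h x + Fp x (v x) (wg v x) \<bullet> wg h x"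

definition rem :: "(real^'n \<Rightarrow> real) \<Rightarrow> (real^'n \<Rightarrow> real) \<Rightarrow> real^'n \<Rightarrow> real" where
  "rem v h x = F x (v x + h x) (wg v x + wg h x) - F x (v x) (wg v x)
     - (Fs x (v x) (wg v x) * h x + Fp x (v x) (wg v x) \<bullet> wg h x)"

definition bval :: "(real^'n \<Rightarrow> real) \<Rightarrow> real^'n \<Rightarrow> real" where
  "bval v x = \<bar>cr v x\<bar>\<^sup>2 + (norm (cg v x))\<^sup>2"

text \<open>The conclusion of \<open>F_bounds\<close> as a predicate, so that one \<open>K\<close>
  can be fixed for a whole ball of functions before any of them is chosen.\<close>

definition F_bound :: "real \<Rightarrow> real \<Rightarrow> bool" where
  "F_bound N K \<longleftrightarrow> K \<ge> 0 \<and> (\<forall>x s q. x \<in> ccube R \<longrightarrow> \<bar>s\<bar> \<le> N \<longrightarrow> norm q \<le> N \<longrightarrow>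
    \<bar>F x s q\<bar> \<le> K \<and> \<bar>Fs x s q\<bar> \<le> K \<and> norm (Fp x s q) \<le> K \<and>
    (\<forall>a b. \<bar>s + a\<bar> \<le> N \<longrightarrow> norm (q + b) \<le> N \<longrightarrow>
      \<bar>F x (s + a) (q + b) - F x s q - (Fs x s q * a + Fp x s q \<bullet> b)\<bar> \<le> K * (a\<^sup>2 + (norm b)\<^sup>2)))"

lemma F_bound_ex: "N \<ge> 0 \<Longrightarrow> \<exists>K. F_bound N K"
  using F_bounds[of N R] unfolding F_bound_def by metis

lemma W_pos: "W lam x > 0"
  by (simp add: cweight_def)

lemma W_cont: "continuous_on (ccube R) (W lam)"
  by (rule cweight_continuous[OF order_refl x0])

lemma W_bounded: "\<exists>B\<ge>0. \<forall>x\<in>ccube R. W lam x \<le> B"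
proof -
  obtain B where "B \<ge> 0" "\<forall>x\<in>ccube R. norm (W lam x) \<le> B"
    using continuous_bounded_ccube[OF W_cont] by blast
  then show ?thesis
    by (intro exI[of _ B]) (auto intro: order_trans[OF abs_ge_self])
qed

lemma W_mult_L2fun:
  assumes "L2fun (cubeM R) f"
  shows "L2fun (cubeM R) (\<lambda>x. W lam x * f x)"
proof -
  obtain B where B: "\<forall>x\<in>ccube R. W lam x \<le> B"
    using W_bounded by blast
  show ?thesis
  proof (rule L2fun_mult_bounded[OF assms])
    show "W lam \<in> borel_measurable (cubeM R)"
      by (rule continuous_cubeM[OF continuous_on_subset[OF W_cont cube_subset_ccube]])
    show "AE x in cubeM R. \<bar>W lam x\<bar> \<le> B"
      by (rule AE_cubeM_ball) (use B cube_subset_ccube W_pos in \<open>force simp: abs_of_pos\<close>)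
  qed
qed

lemma W_mult_integrable:
  assumes "L2fun (cubeM R) f" "L2fun (cubeM R) g"
  shows "integrable (cubeM R) (\<lambda>x. W lam x * f x * g x)"
  by (rule L2fun_mult_integrable[OF W_mult_L2fun[OF assms(1)] assms(2)])

lemma carlemanJ_eq:
  "J p lam et v = (LINT x|cubeM R. W lam x * (res v x)\<^sup>2) + lam ^ 4 * bdry_integral R (\<lambda>x. W lam x * bval v x) + et * (nrm p v)\<^sup>2"
  by (simp add: carlemanJ_def res_def bval_def)

lemma carlemanDJ_eq:
  "DJ p lam et v h = 2 * (LINT x|cubeM R. W lam x * res v x * lin v h x)
     + 2 * lam ^ 4 * bdry_integral R (\<lambda>x. W lam x * (cr v x * cr h x + cg v x \<bullet> cg h x))
     + 2 * et * sobolev_inner (cube R) p v h"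
  by (simp add: carlemanDJ_def res_def lin_def Fs_def Fp_def)

context
  fixes p :: nat
  assumes p: "sob_order TYPE('n) \<le> p"
begin

lemma measurable_facts:
  assumes "v \<in> H p"
  shows "v \<in> borel_measurable (cubeM R)" "wg v \<in> borel_measurable (cubeM R)" "wl v \<in> borel_measurable (cubeM R)"
  using L2funD(1)[OF sobolevD(1)[OF assms]] wg_measurable[OF p assms] L2funD(1)[OF wl_L2fun[OF p assms]] by simp_all

lemma wg_add:
  assumes "v \<in> H p" "h \<in> H p"
  shows "AE x in cubeM R. wg (\<lambda>x. v x + h x) x = wg v x + wg h x"
  using wg_lincomb[OF p assms, of 1 1] by simp

text \<open>By the embedding, values and gradients of \<open>v\<close> and of \<open>v + h\<close>
  lie almost everywhere in the range where \<open>K\<close> is valid. Adding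
  \<open>\<epsilon>0 * wl h x\<close> removes the second order part of \<open>lin\<close>, the one
  part that \<open>K\<close> does not control.\<close>

lemma AE_bounds:
  assumes v: "v \<in> H p" and h: "h \<in> H p" and K: "F_bound N K"
    and Nv: "emb TYPE('n) R * nrm p v \<le> N" and Nh: "emb TYPE('n) R * nrm p (\<lambda>x. v x + h x) \<le> N"
  shows "AE x in cubeM R. \<bar>res v x\<bar> \<le> \<epsilon>0 * N + K \<and> \<bar>rem v h x\<bar> \<le> K * ((h x)\<^sup>2 + (norm (wg h x))\<^sup>2)
    \<and> \<bar>lin v h x + \<epsilon>0 * wl h x\<bar> \<le> K * (\<bar>h x\<bar> + norm (wg h x))"
proof -
  note vh = sobolev_add[OF v h]
  have "AE x in cubeM R. x \<in> ccube R"
    by (rule AE_cubeM_ball) (use cube_subset_ccube in auto)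
  then show ?thesis
    using value_bounded[OF p v] value_bounded[OF p vh] wg_bounded[OF p v] wg_bounded[OF p vh] wl_bounded[OF p v] wg_add[OF v h]
  proof eventually_elim
    case (elim x)
    have s: "\<bar>v x\<bar> \<le> N" and q: "norm (wg v x) \<le> N" and s': "\<bar>v x + h x\<bar> \<le> N" and q': "norm (wg v x + wg h x) \<le> N"
      and l: "\<bar>wl v x\<bar> \<le> N"
      using elim Nv Nh by auto
    have F: "\<bar>F x (v x) (wg v x)\<bar> \<le> K" "\<bar>Fs x (v x) (wg v x)\<bar> \<le> K" "norm (Fp x (v x) (wg v x)) \<le> K"
      and T: "\<bar>rem v h x\<bar> \<le> K * ((h x)\<^sup>2 + (norm (wg h x))\<^sup>2)"
      using K[unfolded F_bound_def] elim(1) s q s' q' unfolding rem_def by blast+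
    have "\<bar>\<epsilon>0 * wl v x\<bar> \<le> \<epsilon>0 * N"
      unfolding abs_mult using \<epsilon>0 l by (intro mult_mono) auto
    then have "\<bar>res v x\<bar> \<le> \<epsilon>0 * N + K"
      using F(1) unfolding res_def by linarith
    moreover have "\<bar>lin v h x + \<epsilon>0 * wl h x\<bar> \<le> K * (\<bar>h x\<bar> + norm (wg h x))"
    proof -
      have "\<bar>Fs x (v x) (wg v x) * h x\<bar> \<le> K * \<bar>h x\<bar>"
        unfolding abs_mult using F(2) by (rule mult_right_mono) simp
      moreover have "\<bar>Fp x (v x) (wg v x) \<bullet> wg h x\<bar> \<le> K * norm (wg h x)"
        by (rule order_trans[OF Cauchy_Schwarz_ineq2 mult_right_mono[OF F(3)]]) simp
      moreover have "lin v h x + \<epsilon>0 * wl h x = Fs x (v x) (wg v x) * h x + Fp x (v x) (wg v x) \<bullet> wg h x"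
        by (simp add: lin_def)
      ultimately show ?thesis
        unfolding distrib_left by linarith
    qed
    ultimately show ?case
      using T by blast
  qed
qed

text \<open>The embedding makes all three bounded almost everywhere, which suffices on the finite
  measure of the cube.\<close>

lemma residual_L2fun:
  assumes v: "v \<in> H p" and h: "h \<in> H p"
  shows "L2fun (cubeM R) (res v)" "L2fun (cubeM R) (lin v h)" "L2fun (cubeM R) (rem v h)"
proof -
  note mv = measurable_facts[OF v] and mh = measurable_facts[OF h]
  note vh = sobolev_add[OF v h]
  define N where "N = emb TYPE('n) R * (nrm p v + nrm p h)"
  have Nn: "emb TYPE('n) R * nrm p v \<le> N" "emb TYPE('n) R * nrm p (\<lambda>x. v x + h x) \<le> N"
    using emb(1) sobolev_norm_triangle[OF v h] by (auto simp: N_def mult_left_mono intro!: mult_left_mono)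
  have "N \<ge> 0" using emb(1) by (simp add: N_def)
  then obtain K where K: "F_bound N K" using F_bound_ex by blast
  then have K0: "K \<ge> 0" by (simp add: F_bound_def)
  note B = AE_bounds[OF v h K Nn]
  have mres: "res v \<in> borel_measurable (cubeM R)"
    unfolding res_def [abs_def] using F_measurable(1)[OF mv(1,2)] mv(3) by auto
  have mlin: "lin v h \<in> borel_measurable (cubeM R)"
    unfolding lin_def [abs_def] using F_measurable(2)[OF mv(1,2)] F_measurable(3)[OF mv(1,2) mh(2)] mh by auto
  have "(\<lambda>x. F x (v x + h x) (wg v x + wg h x)) \<in> borel_measurable (cubeM R)"
    using mv mh by (intro F_measurable(1)) auto
  then have mrem: "rem v h \<in> borel_measurable (cubeM R)"
    unfolding rem_def [abs_def] using F_measurable(1,2)[OF mv(1,2)] F_measurable(3)[OF mv(1,2) mh(2)] mh by auto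
  show "L2fun (cubeM R) (res v)"
    by (rule L2fun_bounded[OF finite_cubeM mres]) (use B in eventually_elim, blast)
  let ?n = "emb TYPE('n) R * nrm p h"
  have n0: "?n \<ge> 0" using emb(1) by simp
  show "L2fun (cubeM R) (lin v h)"
  proof (rule L2fun_bounded[OF finite_cubeM mlin])
    show "AE x in cubeM R. \<bar>lin v h x\<bar> \<le> K * (?n + ?n) + \<epsilon>0 * ?n"
      using B value_bounded[OF p h] wg_bounded[OF p h] wl_bounded[OF p h]
    proof eventually_elim
      case (elim x)
      have "K * (\<bar>h x\<bar> + norm (wg h x)) \<le> K * (?n + ?n)"
        using elim K0 by (intro mult_left_mono add_mono) auto
      moreover have "\<bar>\<epsilon>0 * wl h x\<bar> \<le> \<epsilon>0 * ?n"
        unfolding abs_mult using \<epsilon>0 elim by (intro mult_mono) auto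
      ultimately show ?case using elim by linarith
    qed
  qed
  show "L2fun (cubeM R) (rem v h)"
  proof (rule L2fun_bounded[OF finite_cubeM mrem])
    show "AE x in cubeM R. \<bar>rem v h x\<bar> \<le> K * (?n\<^sup>2 + ?n\<^sup>2)"
      using B value_bounded[OF p h] wg_bounded[OF p h]
    proof eventually_elim
      case (elim x)
      have "(h x)\<^sup>2 \<le> ?n\<^sup>2"
        using elim n0 by (simp add: abs_le_square_iff[symmetric])
      moreover have "(norm (wg h x))\<^sup>2 \<le> ?n\<^sup>2"
        using elim by (intro power_mono) auto
      ultimately have "K * ((h x)\<^sup>2 + (norm (wg h x))\<^sup>2) \<le> K * (?n\<^sup>2 + ?n\<^sup>2)"
        using K0 by (intro mult_left_mono add_mono)
      then show ?case using elim by linarith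
    qed
  qed
qed

lemma residual_add:
  assumes v: "v \<in> H p" and h: "h \<in> H p"
  shows "AE x in cubeM R. res (\<lambda>x. v x + h x) x = res v x + lin v h x + rem v h x"
  using wg_add[OF v h] wl_lincomb[OF p v h, of 1 1, simplified]
  by eventually_elim (simp add: res_def lin_def rem_def algebra_simps)

lemma bval_cont: "v \<in> H p \<Longrightarrow> continuous_on (ccube R) (bval v)"
  unfolding bval_def [abs_def] by (intro continuous_intros cr_facts[OF p] cg_continuous[OF p])

lemma bval_nonneg: "bval v x \<ge> 0"
  by (simp add: bval_def)

lemma bprod_cont: "v \<in> H p \<Longrightarrow> h \<in> H p \<Longrightarrow> continuous_on (ccube R) (\<lambda>x. cr v x * cr h x + cg v x \<bullet> cg h x)"
  by (intro continuous_intros cr_facts[OF p] cg_continuous[OF p])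

text \<open>The residual at \<open>v + h\<close> is the sum of \<open>res\<close>,
  \<open>lin\<close> and \<open>rem\<close>; removing from its square the square of
  \<open>res\<close> and the product \<open>2 * res * lin\<close> leaves the integrand. Boundary and
  penalty terms are quadratic forms, so their remainder is their value at \<open>h\<close>.\<close>

lemma carlemanJ_expansion:
  assumes v: "v \<in> H p" and h: "h \<in> H p"
  shows "J p lam et (\<lambda>x. v x + h x) - J p lam et v - DJ p lam et v h
    = (LINT x|cubeM R. W lam x * ((lin v h x + rem v h x)\<^sup>2 + 2 * (res v x * rem v h x)))
      + lam ^ 4 * bdry_integral R (\<lambda>x. W lam x * bval h x) + et * (nrm p h)\<^sup>2"
proof -
  note vh = sobolev_add[OF v h]
  note L = residual_L2fun[OF v h] and Lvh = residual_L2fun(1)[OF vh h]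
  let ?q = "\<lambda>x. W lam x * ((lin v h x + rem v h x)\<^sup>2 + 2 * (res v x * rem v h x))"
  have q: "?q x = W lam x * (lin v h x + rem v h x) * (lin v h x + rem v h x) + 2 * (W lam x * res v x * rem v h x)" for x
    by (simp add: power2_eq_square algebra_simps)
  have iq: "integrable (cubeM R) ?q"
    unfolding q by (intro Bochner_Integration.integrable_add integrable_mult_right W_mult_integrable L2fun_add L)
  have i1: "integrable (cubeM R) (\<lambda>x. W lam x * (res v x)\<^sup>2)"
    using W_mult_integrable[OF L(1) L(1), of lam] by (simp add: power2_eq_square mult.assoc)
  have i2: "integrable (cubeM R) (\<lambda>x. W lam x * res v x * lin v h x)"
    by (rule W_mult_integrable[OF L(1,2)])
  have Wm: "W lam \<in> borel_measurable (cubeM R)"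
    by (rule continuous_cubeM[OF continuous_on_subset[OF W_cont cube_subset_ccube]])
  have "(LINT x|cubeM R. W lam x * (res (\<lambda>x. v x + h x) x)\<^sup>2)
      = (LINT x|cubeM R. W lam x * (res v x)\<^sup>2 + 2 * (W lam x * res v x * lin v h x) + ?q x)"
  proof (rule integral_cong_AE)
    show "AE x in cubeM R. W lam x * (res (\<lambda>x. v x + h x) x)\<^sup>2
        = W lam x * (res v x)\<^sup>2 + 2 * (W lam x * res v x * lin v h x) + ?q x"
      using residual_add[OF v h] by eventually_elim (simp add: power2_eq_square algebra_simps)
    show "(\<lambda>x. W lam x * (res (\<lambda>x. v x + h x) x)\<^sup>2) \<in> borel_measurable (cubeM R)"
      using Wm L2funD(1)[OF Lvh] by simp
    show "(\<lambda>x. W lam x * (res v x)\<^sup>2 + 2 * (W lam x * res v x * lin v h x) + ?q x) \<in> borel_measurable (cubeM R)"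
      using i1 i2 iq by simp
  qed
  also have "\<dots> = (LINT x|cubeM R. W lam x * (res v x)\<^sup>2) + 2 * (LINT x|cubeM R. W lam x * res v x * lin v h x) + (LINT x|cubeM R. ?q x)"
    using i1 i2 iq by simp
  finally have vol: "(LINT x|cubeM R. W lam x * (res (\<lambda>x. v x + h x) x)\<^sup>2)
      = (LINT x|cubeM R. W lam x * (res v x)\<^sup>2) + 2 * (LINT x|cubeM R. W lam x * res v x * lin v h x) + (LINT x|cubeM R. ?q x)" .
  let ?b = "\<lambda>x. W lam x * (cr v x * cr h x + cg v x \<bullet> cg h x)"
  have c1: "continuous_on (ccube R) (\<lambda>x. W lam x * bval v x)" and c2: "continuous_on (ccube R) (\<lambda>x. W lam x * bval h x)"
    and c3: "continuous_on (ccube R) ?b"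
    by (intro continuous_on_mult W_cont bval_cont bprod_cont v h)+
  have "bdry_integral R (\<lambda>x. W lam x * bval (\<lambda>x. v x + h x) x) = bdry_integral R (\<lambda>x. 1 * (1 * (W lam x * bval v x) + 2 * ?b x) + 1 * (W lam x * bval h x))"
  proof (rule bdry_integral_cong[OF R])
    fix x :: "real^'n" assume x: "x \<in> ccube R"
    have "cr (\<lambda>x. v x + h x) x = cr v x + cr h x" "cg (\<lambda>x. v x + h x) x = cg v x + cg h x"
      using cr_lincomb[OF p v h x, of 1 1] cg_lincomb[OF p v h x, of 1 1] by simp_all
    moreover have "(norm (cg v x + cg h x))\<^sup>2 = (norm (cg v x))\<^sup>2 + 2 * (cg v x \<bullet> cg h x) + (norm (cg h x))\<^sup>2"
      by (simp add: power2_norm_eq_inner inner_add_left inner_add_right inner_commute[of "cg h x" "cg v x"])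
    ultimately show "W lam x * bval (\<lambda>x. v x + h x) x = 1 * (1 * (W lam x * bval v x) + 2 * ?b x) + 1 * (W lam x * bval h x)"
      by (simp add: bval_def power2_sum algebra_simps)
  qed
  also have "\<dots> = bdry_integral R (\<lambda>x. W lam x * bval v x) + 2 * bdry_integral R ?b + bdry_integral R (\<lambda>x. W lam x * bval h x)"
    by (subst bdry_integral_lincomb[OF R _ c2], intro continuous_intros c1 c3, subst bdry_integral_lincomb[OF R c1 c3]) simp
  finally have bdry: "bdry_integral R (\<lambda>x. W lam x * bval (\<lambda>x. v x + h x) x)
     = bdry_integral R (\<lambda>x. W lam x * bval v x) + 2 * bdry_integral R ?b + bdry_integral R (\<lambda>x. W lam x * bval h x)" .
  show ?thesis
    unfolding carlemanJ_eq carlemanDJ_eq vol bdry sobolev_norm_add_square[OF v h] by (simp add: algebra_simps)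
qed

lemma bval_le:
  assumes h: "h \<in> H p" and x: "x \<in> ccube R"
  shows "bval h x \<le> 2 * (emb TYPE('n) R)\<^sup>2 * (nrm p h)\<^sup>2"
proof -
  have "\<bar>cr h x\<bar>\<^sup>2 \<le> (emb TYPE('n) R * nrm p h)\<^sup>2" "(norm (cg h x))\<^sup>2 \<le> (emb TYPE('n) R * nrm p h)\<^sup>2"
    using cr_facts(4)[OF p h x] cg_facts(4)[OF p h x] by (intro power_mono; simp)+
  then show ?thesis
    by (simp add: bval_def power_mult_distrib)
qed

text \<open>Restricting to \<open>nrm p h \<le> 1\<close> lets one \<open>N\<close>, hence one
  \<open>K\<close>, serve for every \<open>v + h\<close>, and makes the square of the quadratic
  \<open>rem\<close> again at most quadratic.\<close>

lemma remainder_quadratic: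
  assumes v: "v \<in> H p"
  shows "\<exists>K. \<forall>h\<in>H p. nrm p h \<le> 1 \<longrightarrow>
    \<bar>J p lam et (\<lambda>x. v x + h x) - J p lam et v - DJ p lam et v h\<bar> \<le> K * (nrm p h)\<^sup>2"
proof -
  let ?e = "emb TYPE('n) R"
  define N where "N = ?e * (nrm p v + 1)"
  have N0: "N \<ge> 0" using emb(1) by (simp add: N_def)
  then obtain K where K: "F_bound N K" using F_bound_ex by blast
  then have K0: "K \<ge> 0" by (simp add: F_bound_def)
  obtain B where B: "B \<ge> 0" "\<And>x. x \<in> ccube R \<Longrightarrow> W lam x \<le> B" using W_bounded by blast
  define k1 where "k1 = 2 * K * ?e + \<epsilon>0 * ?e"
  define k2 where "k2 = 2 * K * ?e\<^sup>2"
  define C1 where "C1 = B * (2 * k1\<^sup>2 + 2 * k2\<^sup>2 + 2 * ((\<epsilon>0 * N + K) * k2))"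
  define C2 where "C2 = \<bar>lam ^ 4\<bar> * ((B * (2 * ?e\<^sup>2)) * bdry_integral R (\<lambda>_::real^'n. 1))"
  define C where "C = C1 * measure (cubeM R) (cube R :: (real^'n) set) + C2 + \<bar>et\<bar>"
  have k0: "k1 \<ge> 0" "k2 \<ge> 0" using K0 emb(1) \<epsilon>0 by (auto simp: k1_def k2_def)
  have "\<bar>J p lam et (\<lambda>x. v x + h x) - J p lam et v - DJ p lam et v h\<bar> \<le> C * (nrm p h)\<^sup>2"
    if h: "h \<in> H p" and h1: "nrm p h \<le> 1" for h
  proof -
    let ?n = "nrm p h"
    have n0: "?n \<ge> 0" by simp
    have "nrm p (\<lambda>x. v x + h x) \<le> nrm p v + 1"
      using sobolev_norm_triangle[OF v h] h1 by simp
    then have Nn: "?e * nrm p v \<le> N" "?e * nrm p (\<lambda>x. v x + h x) \<le> N"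
      using emb(1) unfolding N_def by (intro mult_left_mono; simp)+
    let ?q = "\<lambda>x. W lam x * ((lin v h x + rem v h x)\<^sup>2 + 2 * (res v x * rem v h x))"
    have n21: "?n\<^sup>2 \<le> ?n" using h1 n0 by (simp add: power2_eq_square mult_left_le)
    have "AE x in cubeM R. x \<in> ccube R"
      by (rule AE_cubeM_ball) (use cube_subset_ccube in auto)
    then have q: "AE x in cubeM R. \<bar>?q x\<bar> \<le> C1 * ?n\<^sup>2"
      using AE_bounds[OF v h K Nn] value_bounded[OF p h] wg_bounded[OF p h] wl_bounded[OF p h]
    proof eventually_elim
      case (elim x)
      note x = elim(1)
      have 1: "\<bar>lin v h x\<bar> \<le> k1 * ?n"
      proof -
        have "K * (\<bar>h x\<bar> + norm (wg h x)) \<le> K * (?e * ?n + ?e * ?n)"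
          using elim K0 by (intro mult_left_mono add_mono) auto
        moreover have "\<bar>\<epsilon>0 * wl h x\<bar> \<le> \<epsilon>0 * (?e * ?n)"
          unfolding abs_mult using \<epsilon>0 elim by (intro mult_mono) auto
        moreover have "k1 * ?n = K * (?e * ?n + ?e * ?n) + \<epsilon>0 * (?e * ?n)"
          by (simp add: k1_def algebra_simps)
        ultimately show ?thesis using elim by linarith
      qed
      have 2: "\<bar>rem v h x\<bar> \<le> k2 * ?n\<^sup>2"
      proof -
        have "(h x)\<^sup>2 \<le> (?e * ?n)\<^sup>2"
          using elim emb(1) by (simp add: abs_le_square_iff[symmetric] abs_mult)
        moreover have "(norm (wg h x))\<^sup>2 \<le> (?e * ?n)\<^sup>2"
          using elim by (intro power_mono) auto
        ultimately have "K * ((h x)\<^sup>2 + (norm (wg h x))\<^sup>2) \<le> K * ((?e * ?n)\<^sup>2 + (?e * ?n)\<^sup>2)"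
          using K0 by (intro mult_left_mono add_mono)
        moreover have "K * ((?e * ?n)\<^sup>2 + (?e * ?n)\<^sup>2) = k2 * ?n\<^sup>2"
          by (simp add: k2_def power_mult_distrib)
        ultimately show ?thesis using elim by linarith
      qed
      have "k2 * ?n\<^sup>2 \<le> k2 * ?n" using k0 n21 by (intro mult_left_mono)
      then have r2: "\<bar>rem v h x\<bar> \<le> k2 * ?n" using 2 by simp
      have "(lin v h x + rem v h x)\<^sup>2 \<le> 2 * (lin v h x)\<^sup>2 + 2 * (rem v h x)\<^sup>2"
        by (rule square_sum_le)
      also have "\<dots> \<le> 2 * (k1 * ?n)\<^sup>2 + 2 * (k2 * ?n)\<^sup>2"
        using 1 r2 k0 by (intro add_mono mult_left_mono) (auto simp: abs_le_square_iff[symmetric] abs_mult)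
      finally have a: "(lin v h x + rem v h x)\<^sup>2 \<le> (2 * k1\<^sup>2 + 2 * k2\<^sup>2) * ?n\<^sup>2"
        by (simp add: power_mult_distrib algebra_simps)
      have b: "\<bar>res v x * rem v h x\<bar> \<le> (\<epsilon>0 * N + K) * (k2 * ?n\<^sup>2)"
        unfolding abs_mult using elim 2 \<epsilon>0 N0 K0 by (intro mult_mono) auto
      have c: "\<bar>(lin v h x + rem v h x)\<^sup>2 + 2 * (res v x * rem v h x)\<bar> \<le> (2 * k1\<^sup>2 + 2 * k2\<^sup>2) * ?n\<^sup>2 + 2 * ((\<epsilon>0 * N + K) * (k2 * ?n\<^sup>2))"
        using a b zero_le_power2[of "lin v h x + rem v h x"] by linarith
      have "\<bar>?q x\<bar> \<le> B * ((2 * k1\<^sup>2 + 2 * k2\<^sup>2) * ?n\<^sup>2 + 2 * ((\<epsilon>0 * N + K) * (k2 * ?n\<^sup>2)))"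
        unfolding abs_mult using c B(2)[OF x] W_pos[of lam x] B(1) by (intro mult_mono) auto
      then show ?case
        by (simp add: C1_def algebra_simps)
    qed
    have C10: "C1 \<ge> 0" unfolding C1_def using B k0 \<epsilon>0 N0 K0 by (intro mult_nonneg_nonneg add_nonneg_nonneg) auto
    have "\<bar>LINT x|cubeM R. ?q x\<bar> \<le> C1 * ?n\<^sup>2 * measure (cubeM R) (cube R :: (real^'n) set)"
      by (rule integral_cubeM_abs_le[OF q]) (use C10 in simp)
    moreover have "\<bar>lam ^ 4 * bdry_integral R (\<lambda>x. W lam x * bval h x)\<bar> \<le> C2 * ?n\<^sup>2"
    proof -
      have "\<bar>bdry_integral R (\<lambda>x. W lam x * bval h x)\<bar> \<le> (B * (2 * ?e\<^sup>2 * ?n\<^sup>2)) * bdry_integral R (\<lambda>_::real^'n. 1)"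
      proof (rule bdry_integral_abs_le[OF R])
        show "continuous_on (ccube R) (\<lambda>x. W lam x * bval h x)"
          by (intro continuous_on_mult W_cont bval_cont h)
        fix x :: "real^'n" assume x: "x \<in> ccube R"
        show "\<bar>W lam x * bval h x\<bar> \<le> B * (2 * ?e\<^sup>2 * ?n\<^sup>2)"
          unfolding abs_mult using B(2)[OF x] B(1) W_pos[of lam x] bval_le[OF h x] bval_nonneg[of h x]
          by (intro mult_mono) auto
      qed
      then have "\<bar>lam ^ 4\<bar> * \<bar>bdry_integral R (\<lambda>x. W lam x * bval h x)\<bar> \<le> \<bar>lam ^ 4\<bar> * ((B * (2 * ?e\<^sup>2 * ?n\<^sup>2)) * bdry_integral R (\<lambda>_::real^'n. 1))"
        by (rule mult_left_mono) simp
      then show ?thesis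
        by (simp add: C2_def abs_mult mult_ac)
    qed
    moreover have "\<bar>et * ?n\<^sup>2\<bar> \<le> \<bar>et\<bar> * ?n\<^sup>2"
      by (simp add: abs_mult)
    ultimately have "\<bar>(LINT x|cubeM R. ?q x) + lam ^ 4 * bdry_integral R (\<lambda>x. W lam x * bval h x) + et * ?n\<^sup>2\<bar>
       \<le> C1 * ?n\<^sup>2 * measure (cubeM R) (cube R :: (real^'n) set) + C2 * ?n\<^sup>2 + \<bar>et\<bar> * ?n\<^sup>2"
      by linarith
    also have "\<dots> = C * ?n\<^sup>2"
      by (simp add: C_def algebra_simps)
    finally show ?thesis
      unfolding carlemanJ_expansion[OF v h] .
  qed
  then show ?thesis by blast
qed

end

end

context carleman_functional
begin

context
  fixes p :: nat
  assumes p: "sob_order TYPE('n) \<le> p"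
begin

lemma DJ_lincomb:
  assumes v: "v \<in> H p" and h: "h \<in> H p" and k: "k \<in> H p"
  shows "DJ p lam et v (\<lambda>x. a * h x + b * k x) = a * DJ p lam et v h + b * DJ p lam et v k"
proof -
  note hk = sobolev_lincomb[OF h k, of a b]
  note Lh = residual_L2fun[OF p v h] and Lk = residual_L2fun[OF p v k] and L = residual_L2fun[OF p v hk]
  have i: "integrable (cubeM R) (\<lambda>x. W lam x * res v x * lin v h x)" "integrable (cubeM R) (\<lambda>x. W lam x * res v x * lin v k x)"
    "integrable (cubeM R) (\<lambda>x. W lam x * res v x * lin v (\<lambda>x. a * h x + b * k x) x)"
    by (intro W_mult_integrable Lh Lk L)+
  have "(LINT x|cubeM R. W lam x * res v x * lin v (\<lambda>x. a * h x + b * k x) x)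
     = (LINT x|cubeM R. a * (W lam x * res v x * lin v h x) + b * (W lam x * res v x * lin v k x))"
  proof (rule integral_cong_AE)
    show "AE x in cubeM R. W lam x * res v x * lin v (\<lambda>x. a * h x + b * k x) x
        = a * (W lam x * res v x * lin v h x) + b * (W lam x * res v x * lin v k x)"
      using wl_lincomb[OF p h k, of a b] wg_lincomb[OF p h k, of a b]
      by eventually_elim (simp add: lin_def inner_add_right algebra_simps)
  qed (use i in auto)
  also have "\<dots> = a * (LINT x|cubeM R. W lam x * res v x * lin v h x) + b * (LINT x|cubeM R. W lam x * res v x * lin v k x)"
    using i by simp
  finally have 1: "(LINT x|cubeM R. W lam x * res v x * lin v (\<lambda>x. a * h x + b * k x) x)
     = a * (LINT x|cubeM R. W lam x * res v x * lin v h x) + b * (LINT x|cubeM R. W lam x * res v x * lin v k x)" .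
  let ?b = "\<lambda>h x. W lam x * (cr v x * cr h x + cg v x \<bullet> cg h x)"
  have c: "continuous_on (ccube R) (?b h)" "continuous_on (ccube R) (?b k)"
    by (intro continuous_on_mult W_cont bprod_cont[OF p] v h k)+
  have "bdry_integral R (?b (\<lambda>x. a * h x + b * k x)) = bdry_integral R (\<lambda>x. a * ?b h x + b * ?b k x)"
    by (rule bdry_integral_cong[OF R]) (simp add: cr_lincomb[OF p h k] cg_lincomb[OF p h k] inner_add_right algebra_simps)
  then have 2: "bdry_integral R (?b (\<lambda>x. a * h x + b * k x)) = a * bdry_integral R (?b h) + b * bdry_integral R (?b k)"
    using bdry_integral_lincomb[OF R c] by simp
  show ?thesis
    unfolding carlemanDJ_eq 1 2 sobolev_inner_lincomb_right[OF h k v] by (simp add: algebra_simps)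
qed

text \<open>\<open>AE_bounds\<close> also asks for a bound on \<open>v + h\<close>, so the estimate
  is first confined to the unit ball; \<open>DJ_bounded\<close> removes this by homogeneity.\<close>

lemma DJ_bounded_unit:
  assumes v: "v \<in> H p"
  shows "\<exists>C. \<forall>h\<in>H p. nrm p h \<le> 1 \<longrightarrow> \<bar>DJ p lam et v h\<bar> \<le> C"
proof -
  let ?e = "emb TYPE('n) R"
  define N where "N = ?e * (nrm p v + 1)"
  have N0: "N \<ge> 0" using emb(1) by (simp add: N_def)
  then obtain K where K: "F_bound N K" using F_bound_ex by blast
  then have K0: "K \<ge> 0" by (simp add: F_bound_def)
  obtain B where B: "B \<ge> 0" "\<And>x. x \<in> ccube R \<Longrightarrow> W lam x \<le> B" using W_bounded by blast
  define C1 where "C1 = B * (\<epsilon>0 * N + K) * (K * (?e + ?e) + \<epsilon>0 * ?e)"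
  define C2 where "C2 = B * (2 * ((?e * nrm p v) * ?e))"
  define C where "C = 2 * (C1 * measure (cubeM R) (cube R :: (real^'n) set)) + 2 * lam ^ 4 * (C2 * bdry_integral R (\<lambda>_::real^'n. 1)) + 2 * \<bar>et\<bar> * nrm p v"
  have "\<bar>DJ p lam et v h\<bar> \<le> C" if h: "h \<in> H p" and h1: "nrm p h \<le> 1" for h
  proof -
    have "nrm p (\<lambda>x. v x + h x) \<le> nrm p v + 1"
      using sobolev_norm_triangle[OF v h] h1 by simp
    then have Nn: "?e * nrm p v \<le> N" "?e * nrm p (\<lambda>x. v x + h x) \<le> N"
      using emb(1) unfolding N_def by (intro mult_left_mono; simp)+
    have eh: "?e * nrm p h \<le> ?e"
      using emb(1) h1 by (simp add: mult_left_le)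
    have "AE x in cubeM R. x \<in> ccube R"
      by (rule AE_cubeM_ball) (use cube_subset_ccube in auto)
    then have q: "AE x in cubeM R. \<bar>W lam x * res v x * lin v h x\<bar> \<le> C1"
      using AE_bounds[OF p v h K Nn] value_bounded[OF p h] wg_bounded[OF p h] wl_bounded[OF p h]
    proof eventually_elim
      case (elim x)
      have "K * (\<bar>h x\<bar> + norm (wg h x)) \<le> K * (?e + ?e)"
        using elim eh K0 by (intro mult_left_mono add_mono) auto
      moreover have "\<bar>\<epsilon>0 * wl h x\<bar> \<le> \<epsilon>0 * ?e"
        unfolding abs_mult using \<epsilon>0 elim eh by (intro mult_mono) auto
      ultimately have "\<bar>lin v h x\<bar> \<le> K * (?e + ?e) + \<epsilon>0 * ?e"
        using elim by linarith
      then show ?case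
        unfolding abs_mult C1_def using elim B(2)[OF elim(1)] B(1) W_pos[of lam x] \<epsilon>0 N0 K0 by (intro mult_mono) auto
    qed
    have "C1 \<ge> 0" unfolding C1_def using B \<epsilon>0 N0 K0 emb(1) by (intro mult_nonneg_nonneg add_nonneg_nonneg) auto
    note 1 = integral_cubeM_abs_le[OF q this]
    have 2: "\<bar>bdry_integral R (\<lambda>x. W lam x * (cr v x * cr h x + cg v x \<bullet> cg h x))\<bar> \<le> C2 * bdry_integral R (\<lambda>_::real^'n. 1)"
    proof (rule bdry_integral_abs_le[OF R])
      show "continuous_on (ccube R) (\<lambda>x. W lam x * (cr v x * cr h x + cg v x \<bullet> cg h x))"
        by (intro continuous_on_mult W_cont bprod_cont[OF p] v h)
      fix x :: "real^'n" assume x: "x \<in> ccube R"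
      have ch: "\<bar>cr h x\<bar> \<le> ?e" "norm (cg h x) \<le> ?e"
        using cr_facts(4)[OF p h x] cg_facts(4)[OF p h x] eh by linarith+
      have "\<bar>cr v x * cr h x\<bar> \<le> (?e * nrm p v) * ?e"
        unfolding abs_mult using cr_facts(4)[OF p v x] ch emb(1) by (intro mult_mono) auto
      moreover have "\<bar>cg v x \<bullet> cg h x\<bar> \<le> (?e * nrm p v) * ?e"
        by (rule order_trans[OF Cauchy_Schwarz_ineq2])
          (use cg_facts(4)[OF p v x] ch emb(1) in \<open>intro mult_mono; simp\<close>)
      ultimately have "\<bar>cr v x * cr h x + cg v x \<bullet> cg h x\<bar> \<le> 2 * ((?e * nrm p v) * ?e)"
        by linarith
      then show "\<bar>W lam x * (cr v x * cr h x + cg v x \<bullet> cg h x)\<bar> \<le> C2"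
        unfolding abs_mult[of "W lam x"] C2_def using B(2)[OF x] B(1) W_pos[of lam x] by (intro mult_mono) auto
    qed
    have 3: "\<bar>sobolev_inner (cube R) p v h\<bar> \<le> nrm p v"
      using sobolev_Cauchy_Schwarz[OF v h] h1 mult_left_le[of "nrm p h" "nrm p v"] by simp
    have "\<bar>2 * lam ^ 4 * bdry_integral R (\<lambda>x. W lam x * (cr v x * cr h x + cg v x \<bullet> cg h x))\<bar> \<le> 2 * lam ^ 4 * (C2 * bdry_integral R (\<lambda>_::real^'n. 1))"
      unfolding abs_mult using 2 by (intro mult_mono) auto
    moreover have "\<bar>2 * et * sobolev_inner (cube R) p v h\<bar> \<le> 2 * \<bar>et\<bar> * nrm p v"
      unfolding abs_mult using 3 by (intro mult_mono) auto
    ultimately show ?thesis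
      unfolding carlemanDJ_eq C_def using 1 by linarith
  qed
  then show ?thesis by blast
qed

lemma DJ_bounded:
  assumes v: "v \<in> H p"
  shows "\<exists>C\<ge>0. \<forall>h\<in>H p. \<bar>DJ p lam et v h\<bar> \<le> C * nrm p h"
proof -
  obtain C where C: "\<And>h. h \<in> H p \<Longrightarrow> nrm p h \<le> 1 \<Longrightarrow> \<bar>DJ p lam et v h\<bar> \<le> C"
    using DJ_bounded_unit[OF v] by blast
  have "\<bar>DJ p lam et v h\<bar> \<le> max C 0 * nrm p h" if h: "h \<in> H p" for h
  proof (rule field_le_epsilon)
    fix e :: real assume e: "e > 0"
    \<comment> \<open>A positive slack instead of division by \<open>nrm p h\<close>, which may be
      0; \<open>field_le_epsilon\<close> removes it in the end.\<close>
    define t where "t = nrm p h + e / (max C 0 + 1)"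
    have d: "e / (max C 0 + 1) > 0" using e by simp
    have t: "t > 0" "nrm p h \<le> t" unfolding t_def using d by (auto intro: add_nonneg_pos)
    have "nrm p (\<lambda>x. (1 / t) * h x) = (1 / t) * nrm p h"
      using sobolev_norm_cmult[OF h, of "1 / t"] t by simp
    also have "\<dots> \<le> 1" using t by simp
    finally have "\<bar>DJ p lam et v (\<lambda>x. (1 / t) * h x)\<bar> \<le> C"
      by (rule C[OF sobolev_cmult[OF h]])
    moreover have "DJ p lam et v (\<lambda>x. (1 / t) * h x) = (1 / t) * DJ p lam et v h"
      using DJ_lincomb[OF v h h, of lam et "1 / t" 0] by simp
    ultimately have "\<bar>(1 / t) * DJ p lam et v h\<bar> \<le> C"
      by (simp only:)
    then have "\<bar>DJ p lam et v h\<bar> \<le> C * t"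
      using t by (simp add: abs_mult pos_divide_le_eq)
    also have "\<dots> \<le> max C 0 * t" using t by (intro mult_right_mono) auto
    also have "\<dots> = max C 0 * nrm p h + max C 0 * (e / (max C 0 + 1))"
      by (simp add: t_def distrib_left)
    also have "max C 0 * (e / (max C 0 + 1)) \<le> (max C 0 + 1) * (e / (max C 0 + 1))"
      using d by (intro mult_right_mono) auto
    also have "\<dots> = e" by simp
    finally show "\<bar>DJ p lam et v h\<bar> \<le> max C 0 * nrm p h + e" by simp
  qed
  then show ?thesis by (intro exI[of _ "max C 0"]) auto
qed

lemma J_has_derivative:
  assumes v: "v \<in> H p"
  shows "sobolev_has_derivative (cube R) p (J p lam et) (DJ p lam et v) v"
  unfolding sobolev_has_derivative_def
proof (intro conjI ballI allI impI)
  show "DJ p lam et v (\<lambda>x. a * h x + b * k x) = a * DJ p lam et v h + b * DJ p lam et v k"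
    if "h \<in> H p" "k \<in> H p" for h k a b
    by (rule DJ_lincomb[OF v that])
  show "\<exists>K. \<forall>h\<in>H p. \<bar>DJ p lam et v h\<bar> \<le> K * nrm p h"
    using DJ_bounded[OF v] by blast
  fix e :: real assume e: "e > 0"
  obtain K where K: "\<And>h. h \<in> H p \<Longrightarrow> nrm p h \<le> 1 \<Longrightarrow>
      \<bar>J p lam et (\<lambda>x. v x + h x) - J p lam et v - DJ p lam et v h\<bar> \<le> K * (nrm p h)\<^sup>2"
    using remainder_quadratic[OF p v] by blast
  define d where "d = min 1 (e / (\<bar>K\<bar> + 1))"
  have d: "d > 0" using e by (simp add: d_def)
  have "\<bar>J p lam et (\<lambda>x. v x + h x) - J p lam et v - DJ p lam et v h\<bar> \<le> e * nrm p h"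
    if h: "h \<in> H p" "nrm p h < d" for h
  proof -
    have "\<bar>J p lam et (\<lambda>x. v x + h x) - J p lam et v - DJ p lam et v h\<bar> \<le> K * (nrm p h)\<^sup>2"
      using h by (intro K) (auto simp: d_def)
    also have "\<dots> \<le> ((\<bar>K\<bar> + 1) * nrm p h) * nrm p h"
      unfolding power2_eq_square mult.assoc by (intro mult_right_mono) auto
    also have "\<dots> \<le> e * nrm p h"
    proof (intro mult_right_mono)
      have "nrm p h \<le> e / (\<bar>K\<bar> + 1)" using h by (simp add: d_def)
      then show "(\<bar>K\<bar> + 1) * nrm p h \<le> e"
        by (simp add: pos_le_divide_eq mult.commute)
    qed simp
    finally show ?thesis .
  qed
  then show "\<exists>d>0. \<forall>h\<in>H p. nrm p h < d \<longrightarrow> \<bar>J p lam et (\<lambda>x. v x + h x) - J p lam et v - DJ p lam et v h\<bar> \<le> e * nrm p h"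
    using d by blast
qed

text \<open>Follows from the quadratic expansion and the bounded derivative. It identifies the value
  of \<open>J\<close> at the limit of a minimizing sequence.\<close>

lemma J_sequentially_continuous:
  assumes v: "v \<in> H p" and u: "\<And>n. u n \<in> H p" and lim: "(\<lambda>n. nrm p (\<lambda>x. u n x - v x)) \<longlonglongrightarrow> 0"
  shows "(\<lambda>n. J p lam et (u n)) \<longlonglongrightarrow> J p lam et v"
proof -
  obtain K where K: "\<And>h. h \<in> H p \<Longrightarrow> nrm p h \<le> 1 \<Longrightarrow>
      \<bar>J p lam et (\<lambda>x. v x + h x) - J p lam et v - DJ p lam et v h\<bar> \<le> K * (nrm p h)\<^sup>2"
    using remainder_quadratic[OF p v] by blast
  obtain C where C: "\<And>h. h \<in> H p \<Longrightarrow> \<bar>DJ p lam et v h\<bar> \<le> C * nrm p h"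
    using DJ_bounded[OF v] by blast
  let ?n = "\<lambda>n. nrm p (\<lambda>x. u n x - v x)"
  have "(\<lambda>n. J p lam et (u n) - J p lam et v) \<longlonglongrightarrow> 0"
  proof (rule Lim_null_comparison)
    have "\<forall>\<^sub>F n in sequentially. ?n n < 1"
      using order_tendstoD(2)[OF lim, of 1] by simp
    then show "\<forall>\<^sub>F n in sequentially. norm (J p lam et (u n) - J p lam et v) \<le> K * (?n n)\<^sup>2 + C * ?n n"
    proof eventually_elim
      case (elim n)
      have "(\<lambda>x. v x + (u n x - v x)) = u n" by simp
      then show ?case
        using K[OF sobolev_diff[OF u[of n] v]] C[OF sobolev_diff[OF u[of n] v]] elim by simp
    qed
    have "(\<lambda>n. K * (?n n)\<^sup>2 + C * ?n n) \<longlonglongrightarrow> K * 0\<^sup>2 + C * 0"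
      by (intro tendsto_intros lim)
    then show "(\<lambda>n. K * (?n n)\<^sup>2 + C * ?n n) \<longlonglongrightarrow> 0" by simp
  qed
  then show ?thesis using Lim_null by blast
qed

lemma J_nonneg:
  assumes v: "v \<in> H p" and "et > 0"
  shows "J p lam et v \<ge> 0"
  unfolding carlemanJ_eq using assms(2)
  by (intro add_nonneg_nonneg mult_nonneg_nonneg integral_nonneg_AE bdry_integral_nonneg[OF R] continuous_on_mult W_cont bval_cont[OF p v])
    (auto intro!: mult_nonneg_nonneg less_imp_le[OF W_pos] bval_nonneg)

subsection \<open>Strong convexity and the minimizer\<close>

text \<open>\<open>\<epsilon>0 * wl h\<close> equals \<open>t - (lin + rem)\<close> with a
  \<open>t\<close> that is bounded by \<open>h\<close> and its gradient alone, so the Laplacian is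
  recovered from the square at the price of \<open>t\<^sup>2\<close>. The value and gradient norm of
  \<open>h\<close> are at most \<open>2 * N\<close>, which makes the quadratic \<open>rem\<close>
  linear in them.\<close>

lemma remainder_lower:
  assumes v: "v \<in> H p" and h: "h \<in> H p" and K: "F_bound N K"
    and Nv: "emb TYPE('n) R * nrm p v \<le> N" and Nvh: "emb TYPE('n) R * nrm p (\<lambda>x. v x + h x) \<le> N"
    and Nh: "emb TYPE('n) R * nrm p h \<le> 2 * N"
  shows "\<epsilon>0\<^sup>2 / 2 * (LINT x|cubeM R. W lam x * (wl h x)\<^sup>2)
      - (2 * K\<^sup>2 * (1 + 2 * N)\<^sup>2 + 2 * ((\<epsilon>0 * N + K) * K)) * (LINT x|cubeM R. W lam x * (\<bar>h x\<bar>\<^sup>2 + (norm (wg h x))\<^sup>2))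
      \<le> (LINT x|cubeM R. W lam x * ((lin v h x + rem v h x)\<^sup>2 + 2 * (res v x * rem v h x)))"
    (is "?a * ?Il - ?K4 * ?Ie \<le> ?Iq")
proof -
  have K0: "K \<ge> 0" using K by (simp add: F_bound_def)
  have "0 \<le> emb TYPE('n) R * nrm p v" using emb(1) by simp
  then have N0: "N \<ge> 0" using Nv by linarith
  note L = residual_L2fun[OF p v h]
  let ?q = "\<lambda>x. W lam x * ((lin v h x + rem v h x)\<^sup>2 + 2 * (res v x * rem v h x))"
  let ?l = "\<lambda>x. W lam x * (wl h x)\<^sup>2" and ?en = "\<lambda>x. W lam x * (\<bar>h x\<bar>\<^sup>2 + (norm (wg h x))\<^sup>2)"
  have q: "?q x = W lam x * (lin v h x + rem v h x) * (lin v h x + rem v h x) + 2 * (W lam x * res v x * rem v h x)" for x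
    by (simp add: power2_eq_square algebra_simps)
  have iq: "integrable (cubeM R) ?q"
    unfolding q by (intro Bochner_Integration.integrable_add integrable_mult_right W_mult_integrable L2fun_add L)
  have il: "integrable (cubeM R) ?l"
    using W_mult_integrable[OF wl_L2fun[OF p h] wl_L2fun[OF p h], of lam] by (simp add: power2_eq_square mult.assoc)
  have en: "?en x = W lam x * h x * h x + (\<Sum>i\<in>UNIV. W lam x * (wg h x $ i) * (wg h x $ i))" for x
    unfolding norm_square_vec power2_abs by (simp add: power2_eq_square distrib_left sum_distrib_left mult.assoc)
  have ie: "integrable (cubeM R) ?en"
    unfolding en by (intro Bochner_Integration.integrable_add Bochner_Integration.integrable_sum W_mult_integrable sobolevD(1)[OF h] wg_component_L2fun[OF p h])
  have "?a * ?Il - ?K4 * ?Ie = (LINT x|cubeM R. ?a * ?l x - ?K4 * ?en x)"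
    using il ie by simp
  also have "\<dots> \<le> ?Iq"
  proof (rule integral_mono_AE)
    show "AE x in cubeM R. ?a * ?l x - ?K4 * ?en x \<le> ?q x"
      using AE_bounds[OF p v h K Nv Nvh] value_bounded[OF p h] wg_bounded[OF p h]
    proof eventually_elim
      case (elim x)
      let ?h = "\<bar>h x\<bar>" and ?g = "norm (wg h x)"
      define t where "t = (lin v h x + \<epsilon>0 * wl h x) + rem v h x"
      have hb: "?h \<le> 2 * N" "?g \<le> 2 * N" using elim Nh by auto
      have r: "\<bar>rem v h x\<bar> \<le> K * (?h\<^sup>2 + ?g\<^sup>2)" using elim by simp
      have "?h\<^sup>2 + ?g\<^sup>2 \<le> 2 * N * ?h + 2 * N * ?g"
        unfolding power2_eq_square using hb by (intro add_mono mult_right_mono) auto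
      then have "K * (?h\<^sup>2 + ?g\<^sup>2) \<le> K * (2 * N * ?h + 2 * N * ?g)"
        using K0 by (intro mult_left_mono)
      then have "\<bar>t\<bar> \<le> K * (?h + ?g) + K * (2 * N * ?h + 2 * N * ?g)"
        using r elim unfolding t_def by linarith
      also have "\<dots> = K * (1 + 2 * N) * (?h + ?g)"
        by (simp add: algebra_simps)
      finally have "\<bar>t\<bar>\<^sup>2 \<le> (K * (1 + 2 * N) * (?h + ?g))\<^sup>2"
        by (intro power_mono) auto
      also have "\<dots> = K\<^sup>2 * (1 + 2 * N)\<^sup>2 * (?h + ?g)\<^sup>2"
        by (simp add: power_mult_distrib)
      also have "\<dots> \<le> K\<^sup>2 * (1 + 2 * N)\<^sup>2 * (2 * ?h\<^sup>2 + 2 * ?g\<^sup>2)"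
        by (intro mult_left_mono square_sum_le) auto
      finally have t2: "t\<^sup>2 \<le> 2 * K\<^sup>2 * (1 + 2 * N)\<^sup>2 * (?h\<^sup>2 + ?g\<^sup>2)"
        by (simp add: algebra_simps)
      have "(\<epsilon>0 * wl h x)\<^sup>2 = (t - (lin v h x + rem v h x))\<^sup>2"
        by (simp add: t_def)
      also have "\<dots> \<le> 2 * t\<^sup>2 + 2 * (lin v h x + rem v h x)\<^sup>2"
        by (rule scaled_square_le)
      finally have s: "?a * (wl h x)\<^sup>2 \<le> t\<^sup>2 + (lin v h x + rem v h x)\<^sup>2"
        by (simp add: power_mult_distrib)
      have "\<bar>res v x * rem v h x\<bar> \<le> (\<epsilon>0 * N + K) * (K * (?h\<^sup>2 + ?g\<^sup>2))"
        unfolding abs_mult using elim r \<epsilon>0 N0 K0 by (intro mult_mono) auto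
      then have rr: "2 * (res v x * rem v h x) \<ge> - (2 * ((\<epsilon>0 * N + K) * K) * (?h\<^sup>2 + ?g\<^sup>2))"
        by (simp add: abs_le_iff algebra_simps)
      have "?a * (wl h x)\<^sup>2 - ?K4 * (?h\<^sup>2 + ?g\<^sup>2) \<le> (lin v h x + rem v h x)\<^sup>2 + 2 * (res v x * rem v h x)"
        using s rr t2 unfolding distrib_right by linarith
      then have "W lam x * (?a * (wl h x)\<^sup>2 - ?K4 * (?h\<^sup>2 + ?g\<^sup>2)) \<le> ?q x"
        by (rule mult_left_mono) (rule less_imp_le[OF W_pos])
      then show ?case
        by (simp add: right_diff_distrib mult.left_commute)
    qed
  qed (use il ie iq in auto)
  finally show ?thesis .
qed

end

text \<open>The Carleman estimate turns the Laplacian term of \<open>remainder_lower\<close> into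
  \<open>K4 + 1\<close> copies of the weighted energy: \<open>K4\<close> cancel the negative part
  and one survives. Half of the boundary term of the functional is spent on this, so 1/2 is a valid
  constant for every \<open>lam\<close>.\<close>

lemma strong_convexity:
  assumes M: "M > 0"
  shows "\<exists>lam0>1. \<forall>lam>lam0. \<forall>p\<ge>sob_order TYPE('n). \<forall>et. \<forall>u\<in>H p. \<forall>v\<in>H p. nrm p u \<le> M \<longrightarrow> nrm p v \<le> M \<longrightarrow>
    J p lam et u - J p lam et v - DJ p lam et v (\<lambda>x. u x - v x)
     \<ge> 1/2 * (LINT x|cubeM R. W lam x * (\<bar>u x - v x\<bar>\<^sup>2 + (norm (wg (\<lambda>x. u x - v x) x))\<^sup>2))
       + 1/2 * bdry_integral R (\<lambda>x. lam ^ 4 * W lam x * (\<bar>cr (\<lambda>x. u x - v x) x\<bar>\<^sup>2 + (norm (cg (\<lambda>x. u x - v x) x))\<^sup>2))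
       + et * (nrm p (\<lambda>x. u x - v x))\<^sup>2"
proof -
  let ?e = "emb TYPE('n) R"
  define N where "N = ?e * M"
  have N0: "N \<ge> 0" using emb(1) M by (simp add: N_def)
  then obtain K where K: "F_bound N K" using F_bound_ex by blast
  then have K0: "K \<ge> 0" by (simp add: F_bound_def)
  define K4 where "K4 = 2 * K\<^sup>2 * (1 + 2 * N)\<^sup>2 + 2 * ((\<epsilon>0 * N + K) * K)"
  obtain Kc lam1 where Kc: "Kc > 0" "lam1 \<ge> 1" and carl: "\<And>lam p u. lam \<ge> lam1 \<Longrightarrow> sob_order TYPE('n) \<le> p \<Longrightarrow> u \<in> H p \<Longrightarrow>
    lam * (LINT x|cubeM R. W lam x * (\<bar>u x\<bar>\<^sup>2 + (norm (wg u x))\<^sup>2))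
     \<le> Kc * (LINT x|cubeM R. W lam x * (wl u x)\<^sup>2)
       + Kc * lam^3 * bdry_integral R (\<lambda>x. W lam x * (\<bar>cr u x\<bar>\<^sup>2 + (norm (cg u x))\<^sup>2))"
    using carleman_sobolev[OF x0 \<beta>] by blast
  \<comment> \<open>\<open>lam1\<close> admits the Carleman estimate, 2 forces
    \<open>lam0 > 1\<close>, \<open>\<epsilon>0\<^sup>2\<close> lets one factor \<open>lam\<close>
    turn the boundary loss at \<open>lam^3\<close> into part of the \<open>lam^4\<close> term, and
    the last entry makes the interior gain exceed \<open>K4 + 1\<close>.\<close>
  define lam0 where "lam0 = Max {lam1, 2, \<epsilon>0\<^sup>2, 2 * Kc * (K4 + 1) / \<epsilon>0\<^sup>2}"
  have l0: "lam1 \<le> lam0" "2 \<le> lam0" "\<epsilon>0\<^sup>2 \<le> lam0" "2 * Kc * (K4 + 1) / \<epsilon>0\<^sup>2 \<le> lam0"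
    unfolding lam0_def by (rule Max_ge; simp)+
  have main: "J p lam et u - J p lam et v - DJ p lam et v (\<lambda>x. u x - v x)
     \<ge> 1/2 * (LINT x|cubeM R. W lam x * (\<bar>u x - v x\<bar>\<^sup>2 + (norm (wg (\<lambda>x. u x - v x) x))\<^sup>2))
       + 1/2 * bdry_integral R (\<lambda>x. lam ^ 4 * W lam x * (\<bar>cr (\<lambda>x. u x - v x) x\<bar>\<^sup>2 + (norm (cg (\<lambda>x. u x - v x) x))\<^sup>2))
       + et * (nrm p (\<lambda>x. u x - v x))\<^sup>2"
    if lam: "lam > lam0" and p: "sob_order TYPE('n) \<le> p" and u: "u \<in> H p" and v: "v \<in> H p"
      and un: "nrm p u \<le> M" and vn: "nrm p v \<le> M" for lam p et u v
  proof -
    define h where "h = (\<lambda>x. u x - v x)"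
    have h: "h \<in> H p" unfolding h_def by (rule sobolev_diff[OF u v])
    have vh: "(\<lambda>x. v x + h x) = u" by (simp add: h_def)
    have "nrm p h = nrm p (\<lambda>x. u x + (- 1) * v x)" by (simp add: h_def)
    also have "\<dots> \<le> nrm p u + nrm p (\<lambda>x. (- 1) * v x)"
      by (rule sobolev_norm_triangle[OF u sobolev_cmult[OF v]])
    also have "\<dots> \<le> 2 * M"
      using un vn sobolev_norm_cmult[OF v, of "-1"] by simp
    finally have hn: "nrm p h \<le> 2 * M" .
    have Nb: "?e * nrm p v \<le> N" "?e * nrm p (\<lambda>x. v x + h x) \<le> N"
      unfolding vh N_def using emb(1) un vn by (intro mult_left_mono; simp)+
    have "?e * nrm p h \<le> ?e * (2 * M)"
      using emb(1) hn by (intro mult_left_mono) auto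
    then have Nh: "?e * nrm p h \<le> 2 * N" by (simp add: N_def)
    let ?Il = "LINT x|cubeM R. W lam x * (wl h x)\<^sup>2" and ?Ie = "LINT x|cubeM R. W lam x * (\<bar>h x\<bar>\<^sup>2 + (norm (wg h x))\<^sup>2)"
    let ?B = "bdry_integral R (\<lambda>x. W lam x * bval h x)"
    have cB: "continuous_on (ccube R) (\<lambda>x. W lam x * bval h x)"
      by (intro continuous_on_mult W_cont bval_cont[OF p h])
    have B0: "?B \<ge> 0"
      by (rule bdry_integral_nonneg[OF R cB]) (intro mult_nonneg_nonneg less_imp_le[OF W_pos] bval_nonneg[OF p])
    have E0: "?Ie \<ge> 0"
      by (intro integral_nonneg_AE AE_I2 mult_nonneg_nonneg less_imp_le[OF W_pos]) simp
    have l1: "lam \<ge> 1" "lam \<ge> lam1" "lam \<ge> \<epsilon>0\<^sup>2" using lam l0 by auto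
    have lK: "2 * Kc * (K4 + 1) \<le> \<epsilon>0\<^sup>2 * lam"
    proof -
      have "2 * Kc * (K4 + 1) / \<epsilon>0\<^sup>2 \<le> lam"
        using l0(4) lam by linarith
      then show ?thesis
        using \<epsilon>0 by (simp add: pos_divide_le_eq mult.commute)
    qed
    have "lam * ?Ie \<le> Kc * (?Il + lam^3 * ?B)"
      using carl[OF l1(2) p h] by (simp add: bval_def algebra_simps)
    then have "(\<epsilon>0\<^sup>2 / 2) * (lam * ?Ie) \<le> (\<epsilon>0\<^sup>2 / 2) * (Kc * (?Il + lam^3 * ?B))"
      by (intro mult_left_mono) auto
    moreover have "(2 * Kc * (K4 + 1)) * ?Ie / 2 \<le> (\<epsilon>0\<^sup>2 * lam) * ?Ie / 2"
      using lK E0 by (intro divide_right_mono mult_right_mono) auto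
    ultimately have "Kc * ((K4 + 1) * ?Ie) \<le> Kc * ((\<epsilon>0\<^sup>2 / 2) * (?Il + lam^3 * ?B))"
      by (simp add: algebra_simps)
    then have c: "(K4 + 1) * ?Ie \<le> (\<epsilon>0\<^sup>2 / 2) * (?Il + lam^3 * ?B)"
      using Kc by simp
    have "\<epsilon>0\<^sup>2 * (lam^3 * ?B) \<le> lam * (lam^3 * ?B)"
      using l1 B0 by (intro mult_right_mono) auto
    also have "\<dots> = lam^4 * ?B"
      by (simp add: power_numeral_reduce mult.assoc)
    finally have b: "(\<epsilon>0\<^sup>2 / 2) * (lam^3 * ?B) \<le> lam^4 * ?B / 2" by simp
    have low: "\<epsilon>0\<^sup>2 / 2 * ?Il - K4 * ?Ie \<le> (LINT x|cubeM R. W lam x * ((lin v h x + rem v h x)\<^sup>2 + 2 * (res v x * rem v h x)))"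
      unfolding K4_def by (rule remainder_lower[OF p v h K Nb Nh])
    have "J p lam et u - J p lam et v - DJ p lam et v h
      = (LINT x|cubeM R. W lam x * ((lin v h x + rem v h x)\<^sup>2 + 2 * (res v x * rem v h x)))
      + lam ^ 4 * ?B + et * (nrm p h)\<^sup>2"
      using carlemanJ_expansion[OF p v h, of lam et] unfolding vh .
    moreover have "\<epsilon>0\<^sup>2 / 2 * ?Il - K4 * ?Ie \<ge> ?Ie - lam^4 * ?B / 2"
      using c b unfolding distrib_left distrib_right by linarith
    moreover have "bdry_integral R (\<lambda>x. lam ^ 4 * W lam x * (\<bar>cr h x\<bar>\<^sup>2 + (norm (cg h x))\<^sup>2)) = lam^4 * ?B"
      using bdry_integral_cmult[OF R cB, of "lam^4"] by (simp add: bval_def mult.assoc)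
    ultimately have "J p lam et u - J p lam et v - DJ p lam et v h \<ge> 1/2 * ?Ie
       + 1/2 * bdry_integral R (\<lambda>x. lam ^ 4 * W lam x * (\<bar>cr h x\<bar>\<^sup>2 + (norm (cg h x))\<^sup>2)) + et * (nrm p h)\<^sup>2"
      using low E0 by linarith
    then show ?thesis unfolding h_def .
  qed
  have "lam0 > 1" using l0 by simp
  then show ?thesis
    using main by (intro exI[of _ lam0] conjI allI impI ballI) 
qed

end

section \<open>Closed balls and existence of the minimizer\<close>

context smooth_bump
begin

text \<open>Multiplying by \<open>1 - d\<close> moves a function of norm \<open>M\<close> into the
  open ball; the converse is the triangle inequality with arbitrarily small error.\<close>

lemma sobolev_closure_ball:
  fixes u :: "real^'n \<Rightarrow> real"
  assumes M: "M > 0"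
  shows "u \<in> sobolev_closure (cube R) p (sobolev_ball (cube R) p M) \<longleftrightarrow> u \<in> H p \<and> nrm p u \<le> M"
proof
  assume u: "u \<in> sobolev_closure (cube R) p (sobolev_ball (cube R) p M)"
  then have uH: "u \<in> H p" by (simp add: sobolev_closure_def)
  have "nrm p u \<le> M + e" if "e > 0" for e
  proof -
    from u that have "\<exists>w\<in>sobolev_ball (cube R) p M. nrm p (\<lambda>x. u x - w x) < e"
      by (simp add: sobolev_closure_def)
    then obtain w where "w \<in> sobolev_ball (cube R) p M" and "nrm p (\<lambda>x. u x - w x) < e" ..
    then have w: "w \<in> H p" "nrm p w < M" "nrm p (\<lambda>x. u x - w x) < e"
      by (simp_all add: sobolev_ball_def)
    have "nrm p (\<lambda>x. (u x - w x) + w x) \<le> nrm p (\<lambda>x. u x - w x) + nrm p w"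
      by (rule sobolev_norm_triangle[OF sobolev_diff[OF uH w(1)] w(1)])
    then show ?thesis using w by simp
  qed
  then have "nrm p u \<le> M" by (rule field_le_epsilon)
  with uH show "u \<in> H p \<and> nrm p u \<le> M" ..
next
  assume u: "u \<in> H p \<and> nrm p u \<le> M"
  have "\<exists>w\<in>sobolev_ball (cube R) p M. nrm p (\<lambda>x. u x - w x) < e" if e: "e > 0" for e
  proof -
    \<comment> \<open>\<open>d \<le> 1/2\<close> keeps the factor \<open>1 - d\<close> nonnegative,
      and \<open>d * M \<le> e / 2\<close> keeps the distance below \<open>e\<close>.\<close>
    define d where "d = min (1/2) (e / (2 * M))"
    have d: "0 < d" "d \<le> 1/2" "d \<le> e / (2 * M)" using e M by (auto simp: d_def)
    have "d * M \<le> e / 2" using d(3) M by (simp add: pos_le_divide_eq mult_ac)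
    have "nrm p (\<lambda>x. (1 - d) * u x) = (1 - d) * nrm p u"
      using sobolev_norm_cmult[of u p "1 - d"] u d by simp
    also have "\<dots> \<le> (1 - d) * M" using u d by (intro mult_left_mono) auto
    also have "\<dots> < M" using d M by (simp add: algebra_simps)
    finally have 1: "(\<lambda>x. (1 - d) * u x) \<in> sobolev_ball (cube R) p M"
      using u by (simp add: sobolev_ball_def sobolev_cmult)
    have "(\<lambda>x. u x - (1 - d) * u x) = (\<lambda>x. d * u x)"
      by (simp add: algebra_simps)
    then have "nrm p (\<lambda>x. u x - (1 - d) * u x) = d * nrm p u"
      using sobolev_norm_cmult[of u p d] u d by simp
    also have "\<dots> \<le> d * M" using u d by (intro mult_left_mono) auto
    also have "\<dots> < e" using \<open>d * M \<le> e / 2\<close> e by simp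
    finally show ?thesis by (rule bexI[OF _ 1])
  qed
  then show "u \<in> sobolev_closure (cube R) p (sobolev_ball (cube R) p M)"
    using u by (simp add: sobolev_closure_def)
qed

lemma sobolev_norm_limit:
  fixes u :: "nat \<Rightarrow> real^'n \<Rightarrow> real"
  assumes u: "\<And>n. u n \<in> H p" "\<And>n. nrm p (u n) \<le> M" and v: "v \<in> H p"
    and lim: "(\<lambda>n. nrm p (\<lambda>x. u n x - v x)) \<longlonglongrightarrow> 0"
  shows "nrm p v \<le> M"
proof (rule LIMSEQ_le_const)
  show "(\<lambda>n. nrm p (\<lambda>x. u n x - v x) + M) \<longlonglongrightarrow> M"
    using tendsto_add[OF lim tendsto_const, of M] by simp
  have "nrm p v \<le> nrm p (\<lambda>x. u n x - v x) + M" for n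
  proof -
    have "nrm p (\<lambda>x. (v x - u n x) + u n x) \<le> nrm p (\<lambda>x. v x - u n x) + nrm p (u n)"
      by (rule sobolev_norm_triangle[OF sobolev_diff[OF v u(1)] u(1)])
    then show ?thesis
      using u(2)[of n] sobolev_norm_diff_commute[OF v u(1)[of n]] by simp
  qed
  then show "\<exists>N. \<forall>n\<ge>N. nrm p v \<le> nrm p (\<lambda>x. u n x - v x) + M" by blast
qed

end

context carleman_functional
begin

text \<open>The convexity inequality is used twice with the midpoint as base. The increments are
  opposite, so the derivative terms cancel in the sum, and each increment has half the length, which
  leaves twice a quarter of \<open>et\<close> times the squared distance.\<close>

lemma midpoint_gap:
  assumes p: "sob_order TYPE('n) \<le> p" and u: "u \<in> H p" "nrm p u \<le> M" and v: "v \<in> H p" "nrm p v \<le> M"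
    and sc: "\<And>u v. u \<in> H p \<Longrightarrow> v \<in> H p \<Longrightarrow> nrm p u \<le> M \<Longrightarrow> nrm p v \<le> M \<Longrightarrow>
      J p lam et u - J p lam et v - DJ p lam et v (\<lambda>x. u x - v x) \<ge> et * (nrm p (\<lambda>x. u x - v x))\<^sup>2"
  shows "(\<lambda>x. 1/2 * u x + 1/2 * v x) \<in> H p" "nrm p (\<lambda>x. 1/2 * u x + 1/2 * v x) \<le> M"
    "et / 2 * (nrm p (\<lambda>x. u x - v x))\<^sup>2 \<le> J p lam et u + J p lam et v - 2 * J p lam et (\<lambda>x. 1/2 * u x + 1/2 * v x)"
proof -
  let ?m = "\<lambda>x. 1/2 * u x + 1/2 * v x" and ?d = "\<lambda>x. u x - v x"
  show m: "?m \<in> H p" by (rule sobolev_lincomb[OF u(1) v(1)])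
  have "nrm p ?m \<le> nrm p (\<lambda>x. 1/2 * u x) + nrm p (\<lambda>x. 1/2 * v x)"
    by (rule sobolev_norm_triangle[OF sobolev_cmult[OF u(1)] sobolev_cmult[OF v(1)]])
  then show mn: "nrm p ?m \<le> M"
    using u(2) v(2) unfolding sobolev_norm_cmult[OF u(1)] sobolev_norm_cmult[OF v(1)] by simp
  note d = sobolev_diff[OF u(1) v(1)]
  have e: "(\<lambda>x. u x - ?m x) = (\<lambda>x. 1/2 * ?d x)" "(\<lambda>x. v x - ?m x) = (\<lambda>x. - 1/2 * ?d x)"
    by (auto simp: fun_eq_iff field_simps)
  have D: "DJ p lam et ?m (\<lambda>x. a * ?d x) = a * DJ p lam et ?m ?d" for a
    using DJ_lincomb[OF p m d d, of lam et a 0] by simp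
  have n: "(nrm p (\<lambda>x. a * ?d x))\<^sup>2 = a\<^sup>2 * (nrm p ?d)\<^sup>2" for a
    by (simp add: sobolev_norm_cmult[OF d] power_mult_distrib)
  have 1: "J p lam et u - J p lam et ?m - 1/2 * DJ p lam et ?m ?d \<ge> et * ((1/2)\<^sup>2 * (nrm p ?d)\<^sup>2)"
    using sc[OF u(1) m u(2) mn] unfolding e D n .
  have 2: "J p lam et v - J p lam et ?m - (- 1/2) * DJ p lam et ?m ?d \<ge> et * ((- 1/2)\<^sup>2 * (nrm p ?d)\<^sup>2)"
    using sc[OF v(1) m v(2) mn] unfolding e D n .
  have s: "et / 2 * (nrm p ?d)\<^sup>2 = et * ((1/2)\<^sup>2 * (nrm p ?d)\<^sup>2) + et * ((- 1/2)\<^sup>2 * (nrm p ?d)\<^sup>2)"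
    by (simp add: power2_eq_square)
  show "et / 2 * (nrm p ?d)\<^sup>2 \<le> J p lam et u + J p lam et v - 2 * J p lam et ?m"
    unfolding s using 1 2 by linarith
qed

text \<open>The midpoint of two functions stays in the ball, where \<open>J\<close> is at least
  \<open>I\<close>, so \<open>midpoint_gap\<close> bounds their squared distance by the excess of
  the two values over \<open>I\<close>. Small excess gives the Cauchy property and, by completeness
  and continuity, a minimizer; zero excess gives uniqueness.\<close>

lemma unique_minimizer:
  assumes p: "sob_order TYPE('n) \<le> p" and M: "M > 0" and et: "et > 0"
    and sc: "\<And>u v. u \<in> H p \<Longrightarrow> v \<in> H p \<Longrightarrow> nrm p u \<le> M \<Longrightarrow> nrm p v \<le> M \<Longrightarrow>
      J p lam et u - J p lam et v - DJ p lam et v (\<lambda>x. u x - v x) \<ge> et * (nrm p (\<lambda>x. u x - v x))\<^sup>2"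
  defines "S \<equiv> {u \<in> H p. nrm p u \<le> M}"
  shows "\<exists>v\<in>S. (\<forall>w\<in>S. J p lam et v \<le> J p lam et w) \<and>
    (\<forall>v'\<in>S. (\<forall>w\<in>S. J p lam et v' \<le> J p lam et w) \<longrightarrow> (AE x in cubeM R. v' x = v x))"
proof -
  let ?J = "J p lam et"
  define I where "I = (INF u\<in>S. ?J u)"
  \<comment> \<open>Nonemptiness of \<open>S\<close>, without which the infimum \<open>I\<close>
    would be an unspecified value.\<close>
  have zero: "(\<lambda>_. 0) \<in> S"
  proof -
    have L: "L2fun (cubeM R) (\<lambda>_::real^'n. 0)" by (rule L2fun_zero)
    have "has_weak_deriv_L2 (cube R) \<alpha> (\<lambda>_::real^'n. 0) (\<lambda>_. 0)" for \<alpha>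
      by (simp add: has_weak_deriv_L2_def L2_space_iff L)
    then have z: "(\<lambda>_::real^'n. 0) \<in> H p"
      using L by (auto simp: sobolev_def L2_space_iff)
    have "nrm p (\<lambda>x::real^'n. 0 * 0) = \<bar>0\<bar> * nrm p (\<lambda>_::real^'n. 0)"
      by (rule sobolev_norm_cmult[OF z])
    then have "nrm p (\<lambda>_::real^'n. 0) \<le> M" using M by simp
    with z show ?thesis unfolding S_def by (intro CollectI conjI)
  qed
  have bdd: "bdd_below (?J ` S)"
    by (rule bdd_belowI[of _ 0]) (auto simp: S_def intro!: J_nonneg[OF p _ et])
  have I_le: "I \<le> ?J u" if "u \<in> S" for u
    unfolding I_def by (rule cINF_lower[OF bdd that])
  have gap: "et / 2 * (nrm p (\<lambda>x. u x - v x))\<^sup>2 \<le> (?J u - I) + (?J v - I)" if "u \<in> S" "v \<in> S" for u v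
  proof -
    from that have u: "u \<in> H p" "nrm p u \<le> M" and v: "v \<in> H p" "nrm p v \<le> M" by (auto simp: S_def)
    have "(\<lambda>x. 1/2 * u x + 1/2 * v x) \<in> H p"
      by (rule midpoint_gap(1)[OF p u v]; rule sc)
    moreover have "nrm p (\<lambda>x. 1/2 * u x + 1/2 * v x) \<le> M"
      by (rule midpoint_gap(2)[OF p u v]; rule sc)
    ultimately have "(\<lambda>x. 1/2 * u x + 1/2 * v x) \<in> S" unfolding S_def by (intro CollectI conjI)
    note I_le[OF this]
    moreover have "et / 2 * (nrm p (\<lambda>x. u x - v x))\<^sup>2 \<le> ?J u + ?J v - 2 * ?J (\<lambda>x. 1/2 * u x + 1/2 * v x)"
      by (rule midpoint_gap(3)[OF p u v]; rule sc)
    ultimately show ?thesis by linarith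
  qed
  have "\<exists>u\<in>S. ?J u < I + 1 / real (Suc n)" for n
  proof -
    have "Inf (?J ` S) < I + 1 / real (Suc n)" by (simp add: I_def)
    then show ?thesis
      using cInf_lessD[of "?J ` S"] zero by blast
  qed
  then obtain u where u: "\<And>n. u n \<in> S" "\<And>n. ?J (u n) < I + 1 / real (Suc n)" by metis
  have uH: "u n \<in> H p" "nrm p (u n) \<le> M" for n using u(1)[of n] by (auto simp: S_def)
  have "\<exists>N. \<forall>i\<ge>N. \<forall>j\<ge>N. nrm p (\<lambda>x. u i x - u j x) < e" if e: "e > 0" for e
  proof -
    \<comment> \<open>Two excesses below this number sum to less than
      \<open>et / 2 * e\<^sup>2\<close>, the left side of \<open>gap\<close> at distance
      \<open>e\<close>.\<close>
    have "et * e\<^sup>2 / 4 > 0" using et e by simp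
    then obtain N where N: "1 / real (Suc N) < et * e\<^sup>2 / 4"
      using nat_approx_posE by blast
    have "nrm p (\<lambda>x. u i x - u j x) < e" if "i \<ge> N" "j \<ge> N" for i j
    proof -
      have "1 / real (Suc k) \<le> 1 / real (Suc N)" if "k \<ge> N" for k
        using that by (simp add: frac_le)
      then have "?J (u i) - I < et * e\<^sup>2 / 4" "?J (u j) - I < et * e\<^sup>2 / 4"
        using u(2)[of i] u(2)[of j] N that by (smt (verit))+
      then have "et / 2 * (nrm p (\<lambda>x. u i x - u j x))\<^sup>2 < et / 2 * e\<^sup>2"
        using gap[OF u(1)[of i] u(1)[of j]] by simp
      then have "(nrm p (\<lambda>x. u i x - u j x))\<^sup>2 < e\<^sup>2"
        using et by simp
      then show ?thesis
        using e by (simp add: power_less_imp_less_base)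
    qed
    then show ?thesis by blast
  qed
  from sobolev_complete[OF uH(1) this]
  obtain v where v: "v \<in> H p" "(\<lambda>n. nrm p (\<lambda>x. u n x - v x)) \<longlonglongrightarrow> 0" by blast
  have vS: "v \<in> S"
    using sobolev_norm_limit[OF uH v] v(1) by (simp add: S_def)
  have "?J v \<le> I"
  proof (rule LIMSEQ_le)
    show "(\<lambda>n. ?J (u n)) \<longlonglongrightarrow> ?J v"
      by (rule J_sequentially_continuous[OF p v(1) uH(1) v(2)])
    show "(\<lambda>n. I + 1 / real (Suc n)) \<longlonglongrightarrow> I"
      using tendsto_add[OF tendsto_const LIMSEQ_inverse_real_of_nat, of I] by (simp add: inverse_eq_divide)
    show "\<exists>N. \<forall>n\<ge>N. ?J (u n) \<le> I + 1 / real (Suc n)"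
      using u(2) less_imp_le by blast
  qed
  then have min: "\<forall>w\<in>S. ?J v \<le> ?J w"
    using I_le order_trans by blast
  have uniq: "AE x in cubeM R. v' x = v x" if v': "v' \<in> S" "\<forall>w\<in>S. ?J v' \<le> ?J w" for v'
  proof -
    have "?J v' \<le> I" using v'(2) vS \<open>?J v \<le> I\<close> order_trans by blast
    then have "et / 2 * (nrm p (\<lambda>x. v' x - v x))\<^sup>2 \<le> 0"
      using gap[OF v'(1) vS] \<open>?J v \<le> I\<close> by linarith
    then have "(nrm p (\<lambda>x. v' x - v x))\<^sup>2 \<le> 0"
      using et by (simp add: mult_le_0_iff)
    then have "nrm p (\<lambda>x. v' x - v x) = 0" by simp
    moreover have "(\<lambda>x. v' x - v x) \<in> H p"
      using v'(1) v(1) by (intro sobolev_diff) (auto simp: S_def)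
    ultimately have "AE x in cubeM R. v' x - v x = 0"
      by (intro sobolev_norm_AE_zero)
    then show ?thesis by eventually_elim simp
  qed
  show ?thesis
    using vS min uniq by blast
qed

text \<open>The order of quantifiers expresses what the constants depend on: \<open>lam0\<close>
  follows \<open>M\<close>, \<open>C\<close> follows \<open>lam\<close>, and both precede
  \<open>p\<close> and \<open>\<eta>\<close>. Uniqueness holds almost everywhere because functions
  stand for their classes.\<close>

lemma carleman_convexity:
  shows
    "(\<forall>p. int p > \<lceil>real CARD('n) / 2\<rceil> + 2 \<longrightarrow>
       (\<forall>lam>1. \<forall>\<eta>>0. \<forall>v\<in>sobolev (cube R) p.
          sobolev_has_derivative (cube R) p (carlemanJ R x0 \<epsilon>0 \<beta> F p lam \<eta>)
            (carlemanDJ R x0 \<epsilon>0 \<beta> F p lam \<eta> v) v)) \<and>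
     (\<forall>M>0. \<exists>lam0>1. \<forall>lam>lam0.
       (\<exists>C>0. \<forall>p. int p > \<lceil>real CARD('n) / 2\<rceil> + 2 \<longrightarrow>
          (\<forall>\<eta>>0. \<forall>u\<in>sobolev_closure (cube R) p (sobolev_ball (cube R) p M).
             \<forall>v\<in>sobolev_closure (cube R) p (sobolev_ball (cube R) p M).
             carlemanJ R x0 \<epsilon>0 \<beta> F p lam \<eta> u - carlemanJ R x0 \<epsilon>0 \<beta> F p lam \<eta> v
               - carlemanDJ R x0 \<epsilon>0 \<beta> F p lam \<eta> v (\<lambda>x. u x - v x)
             \<ge> C * (LINT x|lebesgue_on (cube R). cweight x0 \<beta> lam x *
                    (\<bar>u x - v x\<bar>\<^sup>2 + (norm (weak_gradient (cube R) (\<lambda>x. u x - v x) x))\<^sup>2))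
               + C * bdry_integral R (\<lambda>x. lam ^ 4 * cweight x0 \<beta> lam x *
                    (\<bar>cont_rep (cube R) (\<lambda>x. u x - v x) x\<bar>\<^sup>2
                     + (norm (cont_gradient (cube R) (\<lambda>x. u x - v x) x))\<^sup>2))
               + \<eta> * (sobolev_norm (cube R) p (\<lambda>x. u x - v x))\<^sup>2)) \<and>
       (\<forall>p. int p > \<lceil>real CARD('n) / 2\<rceil> + 2 \<longrightarrow>
          (\<forall>\<eta>>0. \<exists>v\<in>sobolev_closure (cube R) p (sobolev_ball (cube R) p M).
             (\<forall>w\<in>sobolev_closure (cube R) p (sobolev_ball (cube R) p M).
                carlemanJ R x0 \<epsilon>0 \<beta> F p lam \<eta> v \<le> carlemanJ R x0 \<epsilon>0 \<beta> F p lam \<eta> w) \<and>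
             (\<forall>v'\<in>sobolev_closure (cube R) p (sobolev_ball (cube R) p M).
                (\<forall>w\<in>sobolev_closure (cube R) p (sobolev_ball (cube R) p M).
                   carlemanJ R x0 \<epsilon>0 \<beta> F p lam \<eta> v' \<le> carlemanJ R x0 \<epsilon>0 \<beta> F p lam \<eta> w)
                \<longrightarrow> (AE x in lebesgue_on (cube R). v' x = v x)))))"
proof -
  let ?S = "\<lambda>p M. sobolev_closure (cube R) p (sobolev_ball (cube R :: (real^'n) set) p M)"
  note ord = sob_order_le[where 'n='n]
  show ?thesis
  proof (intro conjI allI impI ballI)
    fix p lam et v assume "int p > \<lceil>real CARD('n) / 2\<rceil> + 2" and "v \<in> H p"
    then show "sobolev_has_derivative (cube R) p (J p lam et) (DJ p lam et v) v"
      by (intro J_has_derivative ord)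
  next
    fix M :: real assume M: "M > 0"
    obtain lam0 where lam0: "lam0 > 1" and sc: "\<And>lam p et u v. lam > lam0 \<Longrightarrow> sob_order TYPE('n) \<le> p \<Longrightarrow> u \<in> H p \<Longrightarrow> v \<in> H p \<Longrightarrow>
      nrm p u \<le> M \<Longrightarrow> nrm p v \<le> M \<Longrightarrow>
      J p lam et u - J p lam et v - DJ p lam et v (\<lambda>x. u x - v x)
     \<ge> 1/2 * (LINT x|cubeM R. W lam x * (\<bar>u x - v x\<bar>\<^sup>2 + (norm (wg (\<lambda>x. u x - v x) x))\<^sup>2))
       + 1/2 * bdry_integral R (\<lambda>x. lam ^ 4 * W lam x * (\<bar>cr (\<lambda>x. u x - v x) x\<bar>\<^sup>2 + (norm (cg (\<lambda>x. u x - v x) x))\<^sup>2))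
       + et * (nrm p (\<lambda>x. u x - v x))\<^sup>2"
      using strong_convexity[OF M] by blast
    show "\<exists>lam0>1. \<forall>lam>lam0.
       (\<exists>C>0. \<forall>p. int p > \<lceil>real CARD('n) / 2\<rceil> + 2 \<longrightarrow>
          (\<forall>\<eta>>0. \<forall>u\<in>?S p M. \<forall>v\<in>?S p M.
             J p lam \<eta> u - J p lam \<eta> v - DJ p lam \<eta> v (\<lambda>x. u x - v x)
             \<ge> C * (LINT x|cubeM R. W lam x * (\<bar>u x - v x\<bar>\<^sup>2 + (norm (wg (\<lambda>x. u x - v x) x))\<^sup>2))
               + C * bdry_integral R (\<lambda>x. lam ^ 4 * W lam x * (\<bar>cr (\<lambda>x. u x - v x) x\<bar>\<^sup>2 + (norm (cg (\<lambda>x. u x - v x) x))\<^sup>2))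
               + \<eta> * (nrm p (\<lambda>x. u x - v x))\<^sup>2)) \<and>
       (\<forall>p. int p > \<lceil>real CARD('n) / 2\<rceil> + 2 \<longrightarrow>
          (\<forall>\<eta>>0. \<exists>v\<in>?S p M. (\<forall>w\<in>?S p M. J p lam \<eta> v \<le> J p lam \<eta> w) \<and>
             (\<forall>v'\<in>?S p M. (\<forall>w\<in>?S p M. J p lam \<eta> v' \<le> J p lam \<eta> w) \<longrightarrow> (AE x in cubeM R. v' x = v x))))"
    proof (rule exI[of _ lam0], rule conjI[OF lam0], intro allI impI conjI)
      fix lam assume lam: "lam > lam0"
      show "\<exists>C>0. \<forall>p. int p > \<lceil>real CARD('n) / 2\<rceil> + 2 \<longrightarrow>
          (\<forall>\<eta>>0. \<forall>u\<in>?S p M. \<forall>v\<in>?S p M.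
             J p lam \<eta> u - J p lam \<eta> v - DJ p lam \<eta> v (\<lambda>x. u x - v x)
             \<ge> C * (LINT x|cubeM R. W lam x * (\<bar>u x - v x\<bar>\<^sup>2 + (norm (wg (\<lambda>x. u x - v x) x))\<^sup>2))
               + C * bdry_integral R (\<lambda>x. lam ^ 4 * W lam x * (\<bar>cr (\<lambda>x. u x - v x) x\<bar>\<^sup>2 + (norm (cg (\<lambda>x. u x - v x) x))\<^sup>2))
               + \<eta> * (nrm p (\<lambda>x. u x - v x))\<^sup>2)"
      proof (rule exI[of _ "1/2"], intro conjI allI impI ballI)
        fix p and et :: real and u v
        assume p: "int p > \<lceil>real CARD('n) / 2\<rceil> + 2" and "u \<in> ?S p M" "v \<in> ?S p M"
        then have "u \<in> H p" "nrm p u \<le> M" "v \<in> H p" "nrm p v \<le> M"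
          by (simp_all add: sobolev_closure_ball[OF M])
        then show "J p lam et u - J p lam et v - DJ p lam et v (\<lambda>x. u x - v x)
           \<ge> 1/2 * (LINT x|cubeM R. W lam x * (\<bar>u x - v x\<bar>\<^sup>2 + (norm (wg (\<lambda>x. u x - v x) x))\<^sup>2))
             + 1/2 * bdry_integral R (\<lambda>x. lam ^ 4 * W lam x * (\<bar>cr (\<lambda>x. u x - v x) x\<bar>\<^sup>2 + (norm (cg (\<lambda>x. u x - v x) x))\<^sup>2))
             + et * (nrm p (\<lambda>x. u x - v x))\<^sup>2"
          by (intro sc[OF lam ord[OF p]])
      qed simp
      fix p and et :: real assume p: "int p > \<lceil>real CARD('n) / 2\<rceil> + 2" and et: "et > 0"
      have S: "?S p M = {u \<in> H p. nrm p u \<le> M}"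
        using sobolev_closure_ball[OF M] by blast
      show "\<exists>v\<in>?S p M. (\<forall>w\<in>?S p M. J p lam et v \<le> J p lam et w) \<and>
             (\<forall>v'\<in>?S p M. (\<forall>w\<in>?S p M. J p lam et v' \<le> J p lam et w) \<longrightarrow> (AE x in cubeM R. v' x = v x))"
        unfolding S
      proof (rule unique_minimizer[OF ord[OF p] M et])
        fix u v assume u: "u \<in> H p" and v: "v \<in> H p" and un: "nrm p u \<le> M" and vn: "nrm p v \<le> M"
        let ?E = "LINT x|cubeM R. W lam x * (\<bar>u x - v x\<bar>\<^sup>2 + (norm (wg (\<lambda>x. u x - v x) x))\<^sup>2)"
        let ?B = "bdry_integral R (\<lambda>x. lam ^ 4 * W lam x * (\<bar>cr (\<lambda>x. u x - v x) x\<bar>\<^sup>2 + (norm (cg (\<lambda>x. u x - v x) x))\<^sup>2))"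
        have "?E \<ge> 0"
          by (intro integral_nonneg_AE AE_I2 mult_nonneg_nonneg less_imp_le[OF W_pos]) simp
        moreover have "?B \<ge> 0"
        proof (rule bdry_integral_nonneg[OF R])
          have "continuous_on (ccube R) (\<lambda>x. lam ^ 4 * W lam x * bval (\<lambda>x. u x - v x) x)"
            by (intro continuous_on_mult continuous_on_const W_cont bval_cont[OF ord[OF p]] sobolev_diff u v)
          then show "continuous_on (ccube R) (\<lambda>x. lam ^ 4 * W lam x * (\<bar>cr (\<lambda>x. u x - v x) x\<bar>\<^sup>2 + (norm (cg (\<lambda>x. u x - v x) x))\<^sup>2))"
            by (simp add: bval_def)
        qed (intro mult_nonneg_nonneg less_imp_le[OF W_pos]; simp)
        ultimately show "J p lam et u - J p lam et v - DJ p lam et v (\<lambda>x. u x - v x) \<ge> et * (nrm p (\<lambda>x. u x - v x))\<^sup>2"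
          using sc[OF lam ord[OF p] u v un vn, of et] by linarith
      qed
    qed
  qed
qed

end

theorem theorem4p1:
  fixes R \<delta> c Ch k \<mu> \<epsilon>0 \<beta> :: real
    and G :: "(real^'n::finite) set"
    and chi :: "real^'n \<Rightarrow> real"
    and H :: "real^'n \<Rightarrow> real^'n \<Rightarrow> real"
    and F :: "real^'n \<Rightarrow> real \<Rightarrow> real^'n \<Rightarrow> real"
    and x0 :: "real^'n"
  assumes "R > 0"
    and "open G" and "connected G" and "G \<noteq> {}" and "bounded G" and "closure G \<subseteq> cube R"
    and "0 < \<delta>" and "\<delta> < 1" and "c > 0"
    and "smooth chi"
    and "\<forall>x\<in>G. chi x > c"
    and "\<forall>x\<in>cube R - G. \<delta> < chi x \<and> chi x \<le> c"
    and "\<forall>x. x \<notin> cube R \<longrightarrow> chi x = \<delta>"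
    and "Ch > 0" and "k > 0"
    and "\<forall>x q. \<bar>H x q\<bar> \<le> Ch * norm q powr k"
    and "\<mu> > 0"
    and "F = hjF \<mu> k chi H"
    and "Ck 2 (\<lambda>(x, s, q). F x s q)"
    and "x0 \<notin> closure (cube R)"
    and "\<epsilon>0 > 0" and "\<beta> > 1"
  shows
    "(\<forall>p. int p > \<lceil>real CARD('n) / 2\<rceil> + 2 \<longrightarrow>
       (\<forall>lam>1. \<forall>\<eta>>0. \<forall>v\<in>sobolev (cube R) p.
          sobolev_has_derivative (cube R) p (carlemanJ R x0 \<epsilon>0 \<beta> F p lam \<eta>)
            (carlemanDJ R x0 \<epsilon>0 \<beta> F p lam \<eta> v) v)) \<and>
     (\<forall>M>0. \<exists>lam0>1. \<forall>lam>lam0.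
       (\<exists>C>0. \<forall>p. int p > \<lceil>real CARD('n) / 2\<rceil> + 2 \<longrightarrow>
          (\<forall>\<eta>>0. \<forall>u\<in>sobolev_closure (cube R) p (sobolev_ball (cube R) p M).
             \<forall>v\<in>sobolev_closure (cube R) p (sobolev_ball (cube R) p M).
             carlemanJ R x0 \<epsilon>0 \<beta> F p lam \<eta> u - carlemanJ R x0 \<epsilon>0 \<beta> F p lam \<eta> v
               - carlemanDJ R x0 \<epsilon>0 \<beta> F p lam \<eta> v (\<lambda>x. u x - v x)
             \<ge> C * (LINT x|lebesgue_on (cube R). cweight x0 \<beta> lam x *
                    (\<bar>u x - v x\<bar>\<^sup>2 + (norm (weak_gradient (cube R) (\<lambda>x. u x - v x) x))\<^sup>2))
               + C * bdry_integral R (\<lambda>x. lam ^ 4 * cweight x0 \<beta> lam x *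
                    (\<bar>cont_rep (cube R) (\<lambda>x. u x - v x) x\<bar>\<^sup>2
                     + (norm (cont_gradient (cube R) (\<lambda>x. u x - v x) x))\<^sup>2))
               + \<eta> * (sobolev_norm (cube R) p (\<lambda>x. u x - v x))\<^sup>2)) \<and>
       (\<forall>p. int p > \<lceil>real CARD('n) / 2\<rceil> + 2 \<longrightarrow>
          (\<forall>\<eta>>0. \<exists>v\<in>sobolev_closure (cube R) p (sobolev_ball (cube R) p M).
             (\<forall>w\<in>sobolev_closure (cube R) p (sobolev_ball (cube R) p M).
                carlemanJ R x0 \<epsilon>0 \<beta> F p lam \<eta> v \<le> carlemanJ R x0 \<epsilon>0 \<beta> F p lam \<eta> w) \<and>
             (\<forall>v'\<in>sobolev_closure (cube R) p (sobolev_ball (cube R) p M).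
                (\<forall>w\<in>sobolev_closure (cube R) p (sobolev_ball (cube R) p M).
                   carlemanJ R x0 \<epsilon>0 \<beta> F p lam \<eta> v' \<le> carlemanJ R x0 \<epsilon>0 \<beta> F p lam \<eta> w)
                \<longrightarrow> (AE x in lebesgue_on (cube R). v' x = v x)))))"
proof -
  have R: "R > 0" by fact
  have cl: "closure (cube R) = (ccube R :: (real^'n) set)" by (rule closure_cube[OF R])
  have Gsub: "G \<subseteq> cube R" using assms(6) closure_subset by blast
  \<comment> \<open>This corner lies in the closure of the cube but not in the cube, whereas the
    closure of \<open>G\<close> stays inside; hence \<open>G\<close> does not fill the cube.\<close>
  have "(\<chi> i. R) \<in> (ccube R :: (real^'n) set)" "(\<chi> i. R) \<notin> (cube R :: (real^'n) set)"
    using R by (auto simp: mem_ccube mem_cube)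
  then have "\<not> cube R \<subseteq> G"
    using assms(6) closure_mono[of "cube R" G] cl by blast
  \<comment> \<open>A point of the cube outside \<open>G\<close> satisfies
    \<open>\<delta> < chi x \<le> c\<close>. Only this orders the two constants, so that
    \<open>chi > c\<close> on \<open>G\<close> yields \<open>chi > \<delta>\<close> there
    too.\<close>
  then have "\<delta> < c" using assms(12) by fastforce
  have "smooth (\<lambda>x. chi x - \<delta>)"
    using mi_deriv_diff(1)[OF assms(10) smooth_const] .
  moreover have "chi x - \<delta> > 0" if "x \<in> cube R" for x
    using that assms(11,12) \<open>\<delta> < c\<close> by (cases "x \<in> G") fastforce+
  moreover have "chi x - \<delta> = 0" if "x \<notin> cube R" for x
    using that assms(13) by simp
  ultimately interpret carleman_functional "\<lambda>x. chi x - \<delta>" R F x0 \<epsilon>0 \<beta>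
    by unfold_locales (use assms cl in auto)
  show ?thesis by (rule carleman_convexity)
qed

end
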